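(* Let $\Lambda$ be a Nakayama algebra. Suppose there exists an indecomposable object $X$ in $\mathsf D^{\mathsf b}(\Lambda)$ with $\tau^n X\cong X[m]$ for some integers $n,m\ge 1$. Then $\Lambda$ is not piecewise hereditary.
   Context: $k$ is a field. A Nakayama algebra means a linear Nakayama algebra $k\mathbb A_n/J$, where $\mathbb A_n$ is the linearly oriented quiver $1\to 2\to\cdots\to n$ and $J$ is an admissible ideal. $\mathsf D^{\mathsf b}(\Lambda)$ is the bounded derived category of finitely generated $\Lambda$-modules; it has almost split triangles, and $\tau X$ denotes the Auslander--Reiten translate of $X$, i.e. for indecomposable $X$ there is an almost split triangle $\tau X\to Z\to X\to \tau X[1]$. An algebra $\Lambda$ is piecewise hereditary if there are a hereditary abelian category $\mathcal H$ (i.e. $\operatorname{Ext}^2_{\mathcal H}=0$) and an equivalence of triangulated categories $\mathsf D^{\mathsf b}(\Lambda)\simeq \mathsf D^{\mathsf b}(\mathcal H)$. *)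

theory Defs
  imports "HOL-Algebra.QuotRing" "HOL-Algebra.Ideal_Product" "HOL-Algebra.Module"
begin

section \<open>Abelian categories\<close>

text \<open>
  Categories carry addition and zero morphisms as part of the data. Morphisms know their domain and
  codomain. \<open>Comp C g f\<close> is "g after f"; it is meaningful only if \<open>Cod C f = Dom C g\<close>, and
  \<open>Plus C f g\<close> only for parallel \<open>f\<close>, \<open>g\<close>.
\<close>

record ('o, 'm) cat =
  Obj :: "'o set"
  Arr :: "'m set"
  Dom :: "'m \<Rightarrow> 'o"
  Cod :: "'m \<Rightarrow> 'o"
  Id :: "'o \<Rightarrow> 'm"
  Comp :: "'m \<Rightarrow> 'm \<Rightarrow> 'm"
  Plus :: "'m \<Rightarrow> 'm \<Rightarrow> 'm"
  Zero :: "'o \<Rightarrow> 'o \<Rightarrow> 'm"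

definition Hom :: "('o, 'm, 'z) cat_scheme \<Rightarrow> 'o \<Rightarrow> 'o \<Rightarrow> 'm set" where
  "Hom C X Y = {f \<in> Arr C. Dom C f = X \<and> Cod C f = Y}"

locale category =
  fixes C :: "('o, 'm, 'z) cat_scheme"
  assumes Dom_Obj: "f \<in> Arr C \<Longrightarrow> Dom C f \<in> Obj C"
    and Cod_Obj: "f \<in> Arr C \<Longrightarrow> Cod C f \<in> Obj C"
    and Id_Hom: "X \<in> Obj C \<Longrightarrow> Id C X \<in> Hom C X X"
    and Comp_Hom: "f \<in> Hom C X Y \<Longrightarrow> g \<in> Hom C Y Z \<Longrightarrow> Comp C g f \<in> Hom C X Z"
    and Comp_Id: "f \<in> Hom C X Y \<Longrightarrow> Comp C f (Id C X) = f"
    and Id_Comp: "f \<in> Hom C X Y \<Longrightarrow> Comp C (Id C Y) f = f"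
    and Comp_assoc: "f \<in> Hom C W X \<Longrightarrow> g \<in> Hom C X Y \<Longrightarrow> h \<in> Hom C Y Z \<Longrightarrow>
      Comp C h (Comp C g f) = Comp C (Comp C h g) f"

locale preadditive_category = category +
  assumes Plus_Hom: "f \<in> Hom C X Y \<Longrightarrow> g \<in> Hom C X Y \<Longrightarrow> Plus C f g \<in> Hom C X Y"
    and Plus_assoc: "f \<in> Hom C X Y \<Longrightarrow> g \<in> Hom C X Y \<Longrightarrow> h \<in> Hom C X Y \<Longrightarrow>
      Plus C (Plus C f g) h = Plus C f (Plus C g h)"
    and Plus_commute: "f \<in> Hom C X Y \<Longrightarrow> g \<in> Hom C X Y \<Longrightarrow> Plus C f g = Plus C g f"
    and Zero_Hom: "X \<in> Obj C \<Longrightarrow> Y \<in> Obj C \<Longrightarrow> Zero C X Y \<in> Hom C X Y"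
    and Plus_Zero: "f \<in> Hom C X Y \<Longrightarrow> Plus C f (Zero C X Y) = f"
    and Plus_inverse: "f \<in> Hom C X Y \<Longrightarrow> \<exists>g \<in> Hom C X Y. Plus C f g = Zero C X Y"
    and Comp_Plus: "f \<in> Hom C X Y \<Longrightarrow> f' \<in> Hom C X Y \<Longrightarrow> g \<in> Hom C Y Z \<Longrightarrow>
      Comp C g (Plus C f f') = Plus C (Comp C g f) (Comp C g f')"
    and Plus_Comp: "f \<in> Hom C X Y \<Longrightarrow> g \<in> Hom C Y Z \<Longrightarrow> g' \<in> Hom C Y Z \<Longrightarrow>
      Comp C (Plus C g g') f = Plus C (Comp C g f) (Comp C g' f)"

definition Neg :: "('o, 'm, 'z) cat_scheme \<Rightarrow> 'm \<Rightarrow> 'm" where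
  "Neg C f = (THE g. g \<in> Hom C (Dom C f) (Cod C f) \<and> Plus C f g = Zero C (Dom C f) (Cod C f))"

definition iso_arr :: "('o, 'm, 'z) cat_scheme \<Rightarrow> 'm \<Rightarrow> bool" where
  "iso_arr C f \<longleftrightarrow> f \<in> Arr C \<and> (\<exists>g \<in> Hom C (Cod C f) (Dom C f).
     Comp C g f = Id C (Dom C f) \<and> Comp C f g = Id C (Cod C f))"

definition isomorphic :: "('o, 'm, 'z) cat_scheme \<Rightarrow> 'o \<Rightarrow> 'o \<Rightarrow> bool" where
  "isomorphic C X Y \<longleftrightarrow> (\<exists>f \<in> Hom C X Y. iso_arr C f)"

definition mono_arr :: "('o, 'm, 'z) cat_scheme \<Rightarrow> 'm \<Rightarrow> bool" where
  "mono_arr C f \<longleftrightarrow> f \<in> Arr C \<and> (\<forall>W. \<forall>g \<in> Hom C W (Dom C f). \<forall>h \<in> Hom C W (Dom C f).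
     Comp C f g = Comp C f h \<longrightarrow> g = h)"

definition epi_arr :: "('o, 'm, 'z) cat_scheme \<Rightarrow> 'm \<Rightarrow> bool" where
  "epi_arr C f \<longleftrightarrow> f \<in> Arr C \<and> (\<forall>W. \<forall>g \<in> Hom C (Cod C f) W. \<forall>h \<in> Hom C (Cod C f) W.
     Comp C g f = Comp C h f \<longrightarrow> g = h)"

definition split_epi :: "('o, 'm, 'z) cat_scheme \<Rightarrow> 'm \<Rightarrow> bool" where
  "split_epi C f \<longleftrightarrow> (\<exists>g \<in> Hom C (Cod C f) (Dom C f). Comp C f g = Id C (Cod C f))"

definition zero_obj :: "('o, 'm, 'z) cat_scheme \<Rightarrow> 'o \<Rightarrow> bool" where
  "zero_obj C X \<longleftrightarrow> X \<in> Obj C \<and>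
     (\<forall>Y \<in> Obj C. (\<exists>!f. f \<in> Hom C X Y) \<and> (\<exists>!f. f \<in> Hom C Y X))"

definition is_biproduct ::
  "('o, 'm, 'z) cat_scheme \<Rightarrow> 'o \<Rightarrow> 'o \<Rightarrow> 'o \<Rightarrow> 'm \<Rightarrow> 'm \<Rightarrow> 'm \<Rightarrow> 'm \<Rightarrow> bool" where
  "is_biproduct C X Y P i1 i2 p1 p2 \<longleftrightarrow>
     i1 \<in> Hom C X P \<and> i2 \<in> Hom C Y P \<and> p1 \<in> Hom C P X \<and> p2 \<in> Hom C P Y \<and>
     Comp C p1 i1 = Id C X \<and> Comp C p2 i2 = Id C Y \<and>
     Comp C p1 i2 = Zero C Y X \<and> Comp C p2 i1 = Zero C X Y \<and>
     Plus C (Comp C i1 p1) (Comp C i2 p2) = Id C P"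

definition is_kernel :: "('o, 'm, 'z) cat_scheme \<Rightarrow> 'm \<Rightarrow> 'm \<Rightarrow> bool" where
  "is_kernel C f k \<longleftrightarrow> f \<in> Arr C \<and> k \<in> Arr C \<and> Cod C k = Dom C f \<and>
     Comp C f k = Zero C (Dom C k) (Cod C f) \<and>
     (\<forall>W. \<forall>g \<in> Hom C W (Dom C f). Comp C f g = Zero C W (Cod C f) \<longrightarrow>
        (\<exists>!h. h \<in> Hom C W (Dom C k) \<and> Comp C k h = g))"

definition is_cokernel :: "('o, 'm, 'z) cat_scheme \<Rightarrow> 'm \<Rightarrow> 'm \<Rightarrow> bool" where
  "is_cokernel C f c \<longleftrightarrow> f \<in> Arr C \<and> c \<in> Arr C \<and> Dom C c = Cod C f \<and>
     Comp C c f = Zero C (Dom C f) (Cod C c) \<and>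
     (\<forall>W. \<forall>g \<in> Hom C (Cod C f) W. Comp C g f = Zero C (Dom C f) W \<longrightarrow>
        (\<exists>!h. h \<in> Hom C (Cod C c) W \<and> Comp C h c = g))"

locale abelian_category = preadditive_category +
  assumes ex_zero: "\<exists>X. zero_obj C X"
    and ex_biproduct: "X \<in> Obj C \<Longrightarrow> Y \<in> Obj C \<Longrightarrow>
      \<exists>P i1 i2 p1 p2. is_biproduct C X Y P i1 i2 p1 p2"
    and ex_kernel: "f \<in> Arr C \<Longrightarrow> \<exists>k. is_kernel C f k"
    and ex_cokernel: "f \<in> Arr C \<Longrightarrow> \<exists>c. is_cokernel C f c"
    and mono_is_kernel: "mono_arr C f \<Longrightarrow> \<exists>g. is_kernel C g f"
    and epi_is_cokernel: "epi_arr C f \<Longrightarrow> \<exists>g. is_cokernel C g f"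

definition indecomposable :: "('o, 'm, 'z) cat_scheme \<Rightarrow> 'o \<Rightarrow> bool" where
  "indecomposable C X \<longleftrightarrow> X \<in> Obj C \<and> \<not> zero_obj C X \<and>
     (\<forall>Y \<in> Obj C. \<forall>Z \<in> Obj C. \<forall>i1 i2 p1 p2.
        is_biproduct C Y Z X i1 i2 p1 p2 \<longrightarrow> zero_obj C Y \<or> zero_obj C Z)"


section \<open>Localisation\<close>

text \<open>
  The localisation of \<open>C\<close> at a class \<open>S\<close> of morphisms admitting a calculus of (right) fractions.
  A roof \<open>(s, f)\<close> is a diagram \<open>X \<leftarrow> X' \<rightarrow> Y\<close> with the leg \<open>s : X' \<rightarrow> X\<close> in \<open>S\<close>, standing for the
  fraction \<open>f s\<inverse>\<close>. A morphism of the localisation is an equivalence class of roofs, together with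
  its domain and codomain. The composite of two classes is the class of the roofs obtained by
  completing \<open>f\<close>, \<open>t\<close> to an Ore square; the sum is formed on a common denominator.
\<close>

type_synonym ('o, 'm) loc_arr = "'o \<times> 'o \<times> ('m \<times> 'm) set"

definition roofs :: "('o, 'm) cat \<Rightarrow> 'm set \<Rightarrow> 'o \<Rightarrow> 'o \<Rightarrow> ('m \<times> 'm) set" where
  "roofs C S X Y = {(s, f). s \<in> S \<and> s \<in> Arr C \<and> f \<in> Arr C \<and> Dom C s = Dom C f \<and>
     Cod C s = X \<and> Cod C f = Y}"

definition roof_eq :: "('o, 'm) cat \<Rightarrow> 'm set \<Rightarrow> 'm \<times> 'm \<Rightarrow> 'm \<times> 'm \<Rightarrow> bool" where
  "roof_eq C S = (\<lambda>(s, f) (t, g). \<exists>W. \<exists>u \<in> Hom C W (Dom C s). \<exists>v \<in> Hom C W (Dom C t).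
     Comp C s u = Comp C t v \<and> Comp C s u \<in> S \<and> Comp C f u = Comp C g v)"

definition roof_class :: "('o, 'm) cat \<Rightarrow> 'm set \<Rightarrow> 'o \<Rightarrow> 'o \<Rightarrow> 'm \<times> 'm \<Rightarrow> ('o, 'm) loc_arr" where
  "roof_class C S X Y r = (X, Y, {r' \<in> roofs C S X Y. roof_eq C S r r'})"

definition localisation :: "('o, 'm) cat \<Rightarrow> 'm set \<Rightarrow> ('o, ('o, 'm) loc_arr) cat" where
  "localisation C S = \<lparr>
     Obj = Obj C,
     Arr = {roof_class C S X Y r | X Y r. X \<in> Obj C \<and> Y \<in> Obj C \<and> r \<in> roofs C S X Y},
     Dom = (\<lambda>(X, Y, P). X),
     Cod = (\<lambda>(X, Y, P). Y),
     Id = (\<lambda>X. roof_class C S X X (Id C X, Id C X)),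
     Comp = (\<lambda>(Y, Z, Q) (X, Y', P). (X, Z, {r \<in> roofs C S X Z.
       \<exists>s f t g t' f'. (s, f) \<in> P \<and> (t, g) \<in> Q \<and>
         t' \<in> S \<and> t' \<in> Hom C (Dom C f') (Dom C f) \<and> f' \<in> Hom C (Dom C t') (Dom C t) \<and>
         Comp C f t' = Comp C t f' \<and> roof_eq C S (Comp C s t', Comp C g f') r})),
     Plus = (\<lambda>(X, Y, P) (X', Y', Q). (X, Y, {r \<in> roofs C S X Y.
       \<exists>s f g. (s, f) \<in> P \<and> (s, g) \<in> Q \<and> roof_eq C S (s, Plus C f g) r})),
     Zero = (\<lambda>X Y. roof_class C S X Y (Id C X, Zero C X Y)) \<rparr>"


section \<open>Triangulated categories\<close>

text \<open>
  Only the data: shift functor and class of distinguished triangles. A triangle is a tuple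
  \<open>(X, Y, Z, u, v, w)\<close> standing for \<open>X \<rightarrow>\<^sup>u Y \<rightarrow>\<^sup>v Z \<rightarrow>\<^sup>w X[1]\<close>.
\<close>

type_synonym ('o, 'm) triangle = "'o \<times> 'o \<times> 'o \<times> 'm \<times> 'm \<times> 'm"

record ('o, 'm) tricat = "('o, 'm) cat" +
  ShObj :: "'o \<Rightarrow> 'o"
  ShArr :: "'m \<Rightarrow> 'm"
  Tri :: "('o, 'm) triangle set"

definition almost_split :: "('o, 'm) tricat \<Rightarrow> ('o, 'm) triangle \<Rightarrow> bool" where
  "almost_split T = (\<lambda>(X, Y, Z, u, v, w).
     (X, Y, Z, u, v, w) \<in> Tri T \<and> indecomposable T X \<and> indecomposable T Z \<and>
     w \<noteq> Zero T Z (ShObj T X) \<and>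
     (\<forall>W. \<forall>f \<in> Hom T W Z. \<not> split_epi T f \<longrightarrow> (\<exists>g \<in> Hom T W Y. Comp T v g = f)))"

text \<open>
  \<open>ar_translate T X Y\<close> says that \<open>Y\<close> is (a representative of the isomorphism class of) \<open>\<tau> X\<close>.
  Hence \<open>(ar_translate T ^^ n) X Y\<close> expresses \<open>Y \<cong> \<tau>\<^sup>n X\<close> for \<open>n \<ge> 1\<close>.
\<close>

definition ar_translate :: "('o, 'm) tricat \<Rightarrow> 'o \<Rightarrow> 'o \<Rightarrow> bool" where
  "ar_translate T X Y \<longleftrightarrow> (\<exists>Z u v w. almost_split T (Y, Z, X, u, v, w))"

locale additive_functor =
  fixes C :: "('o, 'm, 'z) cat_scheme" and D :: "('p, 'n, 'y) cat_scheme"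
    and Fo :: "'o \<Rightarrow> 'p" and Fm :: "'m \<Rightarrow> 'n"
  assumes F_Obj: "X \<in> Obj C \<Longrightarrow> Fo X \<in> Obj D"
    and F_Hom: "f \<in> Hom C X Y \<Longrightarrow> Fm f \<in> Hom D (Fo X) (Fo Y)"
    and F_Id: "X \<in> Obj C \<Longrightarrow> Fm (Id C X) = Id D (Fo X)"
    and F_Comp: "f \<in> Hom C X Y \<Longrightarrow> g \<in> Hom C Y Z \<Longrightarrow> Fm (Comp C g f) = Comp D (Fm g) (Fm f)"
    and F_Plus: "f \<in> Hom C X Y \<Longrightarrow> g \<in> Hom C X Y \<Longrightarrow> Fm (Plus C f g) = Plus D (Fm f) (Fm g)"

locale triangle_equivalence = additive_functor S T Fo Fm
  for S :: "('o, 'm) tricat" and T :: "('p, 'n) tricat" and Fo Fm +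
  assumes full_faithful: "X \<in> Obj S \<Longrightarrow> Y \<in> Obj S \<Longrightarrow>
      bij_betw Fm (Hom S X Y) (Hom T (Fo X) (Fo Y))"
    and ess_surj: "Z \<in> Obj T \<Longrightarrow> \<exists>X \<in> Obj S. isomorphic T (Fo X) Z"
    and triangulated: "\<exists>\<xi>.
      (\<forall>X \<in> Obj S. \<xi> X \<in> Hom T (Fo (ShObj S X)) (ShObj T (Fo X)) \<and> iso_arr T (\<xi> X)) \<and>
      (\<forall>X Y. \<forall>f \<in> Hom S X Y.
         Comp T (\<xi> Y) (Fm (ShArr S f)) = Comp T (ShArr T (Fm f)) (\<xi> X)) \<and>
      (\<forall>X Y Z u v w. (X, Y, Z, u, v, w) \<in> Tri S \<longrightarrow>
         (Fo X, Fo Y, Fo Z, Fm u, Fm v, Comp T (\<xi> X) (Fm w)) \<in> Tri T)"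

definition triangle_equivalent :: "('o, 'm) tricat \<Rightarrow> ('p, 'n) tricat \<Rightarrow> bool" where
  "triangle_equivalent S T \<longleftrightarrow> (\<exists>Fo Fm. triangle_equivalence S T Fo Fm)"


section \<open>The bounded derived category\<close>

record ('o, 'm) complex =
  cobj :: "int \<Rightarrow> 'o"
  cdiff :: "int \<Rightarrow> 'm"

definition bounded_complex :: "('o, 'm) cat \<Rightarrow> ('o, 'm) complex \<Rightarrow> bool" where
  "bounded_complex A X \<longleftrightarrow>
     (\<forall>i. cobj X i \<in> Obj A) \<and>
     (\<forall>i. cdiff X i \<in> Hom A (cobj X i) (cobj X (i + 1))) \<and>
     (\<forall>i. Comp A (cdiff X (i + 1)) (cdiff X i) = Zero A (cobj X i) (cobj X (i + 2))) \<and>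
     (\<exists>N. \<forall>i. \<bar>i\<bar> > N \<longrightarrow> zero_obj A (cobj X i))"

definition chain_map ::
  "('o, 'm) cat \<Rightarrow> ('o, 'm) complex \<Rightarrow> ('o, 'm) complex \<Rightarrow> (int \<Rightarrow> 'm) \<Rightarrow> bool" where
  "chain_map A X Y f \<longleftrightarrow> (\<forall>i. f i \<in> Hom A (cobj X i) (cobj Y i)) \<and>
     (\<forall>i. Comp A (f (i + 1)) (cdiff X i) = Comp A (cdiff Y i) (f i))"

definition homotopic :: "('o, 'm) cat \<Rightarrow> ('o, 'm) complex \<Rightarrow> ('o, 'm) complex \<Rightarrow>
    (int \<Rightarrow> 'm) \<Rightarrow> (int \<Rightarrow> 'm) \<Rightarrow> bool" where
  "homotopic A X Y f g \<longleftrightarrow> (\<exists>s. (\<forall>i. s i \<in> Hom A (cobj X i) (cobj Y (i - 1))) \<and>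
     (\<forall>i. f i = Plus A (g i)
        (Plus A (Comp A (cdiff Y (i - 1)) (s i)) (Comp A (s (i + 1)) (cdiff X i)))))"

type_synonym ('o, 'm) htpy_arr =
  "('o, 'm) complex \<times> ('o, 'm) complex \<times> (int \<Rightarrow> 'm) set"

definition htpy_class :: "('o, 'm) cat \<Rightarrow> ('o, 'm) complex \<Rightarrow> ('o, 'm) complex \<Rightarrow>
    (int \<Rightarrow> 'm) \<Rightarrow> ('o, 'm) htpy_arr" where
  "htpy_class A X Y f = (X, Y, {g. chain_map A X Y g \<and> homotopic A X Y f g})"

definition Kb :: "('o, 'm) cat \<Rightarrow> (('o, 'm) complex, ('o, 'm) htpy_arr) cat" where
  "Kb A = \<lparr>
     Obj = {X. bounded_complex A X},
     Arr = {htpy_class A X Y f | X Y f.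
       bounded_complex A X \<and> bounded_complex A Y \<and> chain_map A X Y f},
     Dom = (\<lambda>(X, Y, c). X),
     Cod = (\<lambda>(X, Y, c). Y),
     Id = (\<lambda>X. htpy_class A X X (\<lambda>i. Id A (cobj X i))),
     Comp = (\<lambda>(Y, Z, d) (X, Y', c). (X, Z, {h. chain_map A X Z h \<and>
       (\<exists>g \<in> d. \<exists>f \<in> c. homotopic A X Z (\<lambda>i. Comp A (g i) (f i)) h)})),
     Plus = (\<lambda>(X, Y, c) (X', Y', d). (X, Y, {h. chain_map A X Y h \<and>
       (\<exists>f \<in> c. \<exists>g \<in> d. homotopic A X Y (\<lambda>i. Plus A (f i) (g i)) h)})),
     Zero = (\<lambda>X Y. htpy_class A X Y (\<lambda>i. Zero A (cobj X i) (cobj Y i))) \<rparr>"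

text \<open>
  \<open>is_cohomology A X i z p\<close>: \<open>z : Z \<rightarrow> X\<^sup>i\<close> is the inclusion of the cocycles and \<open>p : Z \<rightarrow> H\<close> is the
  projection onto the cohomology object \<open>H\<close>, i.e. the cokernel of the map \<open>X\<^bsup>i-1\<^esup> \<rightarrow> Z\<close> induced by
  the differential.
\<close>

definition is_cohomology :: "('o, 'm) cat \<Rightarrow> ('o, 'm) complex \<Rightarrow> int \<Rightarrow> 'm \<Rightarrow> 'm \<Rightarrow> bool" where
  "is_cohomology A X i z p \<longleftrightarrow> is_kernel A (cdiff X i) z \<and>
     (\<exists>b \<in> Hom A (cobj X (i - 1)) (Dom A z).
        Comp A z b = cdiff X (i - 1) \<and> is_cokernel A b p)"

text \<open>In the next definition \<open>h\<close> is the map \<open>H\<^sup>i(X) \<rightarrow> H\<^sup>i(Y)\<close> induced by \<open>f\<close>.\<close>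

definition quasi_iso :: "('o, 'm) cat \<Rightarrow> ('o, 'm) complex \<Rightarrow> ('o, 'm) complex \<Rightarrow>
    (int \<Rightarrow> 'm) \<Rightarrow> bool" where
  "quasi_iso A X Y f \<longleftrightarrow> chain_map A X Y f \<and> (\<forall>i z p z' p' a h.
     is_cohomology A X i z p \<and> is_cohomology A Y i z' p' \<and>
     a \<in> Hom A (Dom A z) (Dom A z') \<and> Comp A z' a = Comp A (f i) z \<and>
     h \<in> Hom A (Cod A p) (Cod A p') \<and> Comp A h p = Comp A p' a \<longrightarrow> iso_arr A h)"

definition qis :: "('o, 'm) cat \<Rightarrow> ('o, 'm) htpy_arr set" where
  "qis A = {htpy_class A X Y f | X Y f.
     bounded_complex A X \<and> bounded_complex A Y \<and> quasi_iso A X Y f}"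

type_synonym ('o, 'm) der_arr = "(('o, 'm) complex, ('o, 'm) htpy_arr) loc_arr"

abbreviation Db_cat :: "('o, 'm) cat \<Rightarrow> (('o, 'm) complex, ('o, 'm) der_arr) cat" where
  "Db_cat A \<equiv> localisation (Kb A) (qis A)"

definition der_class :: "('o, 'm) cat \<Rightarrow> ('o, 'm) complex \<Rightarrow> ('o, 'm) complex \<Rightarrow>
    (int \<Rightarrow> 'm) \<Rightarrow> ('o, 'm) der_arr" where
  "der_class A X Y f =
     roof_class (Kb A) (qis A) X Y (Id (Kb A) X, htpy_class A X Y f)"

definition shift_complex :: "('o, 'm) cat \<Rightarrow> ('o, 'm) complex \<Rightarrow> ('o, 'm) complex" where
  "shift_complex A X = \<lparr>cobj = (\<lambda>i. cobj X (i + 1)), cdiff = (\<lambda>i. Neg A (cdiff X (i + 1)))\<rparr>"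

definition shift_htpy :: "('o, 'm) cat \<Rightarrow> ('o, 'm) htpy_arr \<Rightarrow> ('o, 'm) htpy_arr" where
  "shift_htpy A = (\<lambda>(X, Y, c). (shift_complex A X, shift_complex A Y, (\<lambda>f i. f (i + 1)) ` c))"

definition shift_der :: "('o, 'm) cat \<Rightarrow> ('o, 'm) der_arr \<Rightarrow> ('o, 'm) der_arr" where
  "shift_der A = (\<lambda>(X, Y, P).
     (shift_complex A X, shift_complex A Y, map_prod (shift_htpy A) (shift_htpy A) ` P))"

text \<open>
  The mapping cone of \<open>f : X \<rightarrow> Y\<close> has \<open>X\<^bsup>i+1\<^esup> \<oplus> Y\<^sup>i\<close> in degree \<open>i\<close>, with differential
  \<open>(x, y) \<mapsto> (- d x, f x + d y)\<close>. The biproducts are arbitrary, with injections \<open>i1\<close>, \<open>i2\<close> and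
  projections \<open>p1\<close>, \<open>p2\<close>.
\<close>

definition is_cone :: "('o, 'm) cat \<Rightarrow> ('o, 'm) complex \<Rightarrow> ('o, 'm) complex \<Rightarrow> (int \<Rightarrow> 'm) \<Rightarrow>
    ('o, 'm) complex \<Rightarrow> (int \<Rightarrow> 'm) \<Rightarrow> (int \<Rightarrow> 'm) \<Rightarrow> bool" where
  "is_cone A X Y f C i2 p1 \<longleftrightarrow> bounded_complex A C \<and> (\<exists>i1 p2. \<forall>i.
     is_biproduct A (cobj X (i + 1)) (cobj Y i) (cobj C i) (i1 i) (i2 i) (p1 i) (p2 i) \<and>
     cdiff C i = Plus A
       (Comp A (i1 (i + 1)) (Comp A (Neg A (cdiff X (i + 1))) (p1 i)))
       (Plus A (Comp A (i2 (i + 1)) (Comp A (f (i + 1)) (p1 i)))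
               (Comp A (i2 (i + 1)) (Comp A (cdiff Y i) (p2 i)))))"

definition Db_triangles ::
  "('o, 'm) cat \<Rightarrow> (('o, 'm) complex, ('o, 'm) der_arr) triangle set" where
  "Db_triangles A = {(X, Y, Z, u, v, w).
     u \<in> Hom (Db_cat A) X Y \<and> v \<in> Hom (Db_cat A) Y Z \<and>
     w \<in> Hom (Db_cat A) Z (shift_complex A X) \<and>
     (\<exists>X' Y' C f i2 p1 a b c.
        bounded_complex A X' \<and> bounded_complex A Y' \<and> chain_map A X' Y' f \<and>
        is_cone A X' Y' f C i2 p1 \<and>
        a \<in> Hom (Db_cat A) X X' \<and> iso_arr (Db_cat A) a \<and>
        b \<in> Hom (Db_cat A) Y Y' \<and> iso_arr (Db_cat A) b \<and>
        c \<in> Hom (Db_cat A) Z C \<and> iso_arr (Db_cat A) c \<and>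
        Comp (Db_cat A) b u = Comp (Db_cat A) (der_class A X' Y' f) a \<and>
        Comp (Db_cat A) c v = Comp (Db_cat A) (der_class A Y' C i2) b \<and>
        Comp (Db_cat A) (shift_der A a) w =
          Comp (Db_cat A) (der_class A C (shift_complex A X') p1) c)}"

definition Db :: "('o, 'm) cat \<Rightarrow> (('o, 'm) complex, ('o, 'm) der_arr) tricat" where
  "Db A = cat.extend (Db_cat A)
     \<lparr>ShObj = shift_complex A, ShArr = shift_der A, Tri = Db_triangles A\<rparr>"


section \<open>Hereditary categories\<close>

definition stalk_complex :: "('o, 'm) cat \<Rightarrow> 'o \<Rightarrow> ('o, 'm) complex" where
  "stalk_complex A X = (let E = (\<lambda>i::int. if i = 0 then X else (SOME Z. zero_obj A Z)) in
     \<lparr>cobj = E, cdiff = (\<lambda>i. Zero A (E i) (E (i + 1)))\<rparr>)"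

definition Ext :: "nat \<Rightarrow> ('o, 'm) cat \<Rightarrow> 'o \<Rightarrow> 'o \<Rightarrow> ('o, 'm) der_arr set" where
  "Ext n A X Y =
     Hom (Db A) (stalk_complex A X) ((ShObj (Db A) ^^ n) (stalk_complex A Y))"

definition hereditary :: "('o, 'm) cat \<Rightarrow> bool" where
  "hereditary A \<longleftrightarrow> (\<forall>X \<in> Obj A. \<forall>Y \<in> Obj A. Ext 2 A X Y =
     {Zero (Db A) (stalk_complex A X) ((ShObj (Db A) ^^ 2) (stalk_complex A Y))})"


section \<open>Finitely generated modules\<close>

text \<open>
  Left modules over a not necessarily commutative ring. As in \<^locale>\<open>module\<close>, the fields \<open>mult\<close> and
  \<open>one\<close> of the module record carry no meaning.
\<close>

locale left_module = R: ring R + M: abelian_group M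
  for R :: "'r ring" and M :: "('r, 'v) module" +
  assumes smult_closed: "r \<in> carrier R \<Longrightarrow> x \<in> carrier M \<Longrightarrow> r \<odot>\<^bsub>M\<^esub> x \<in> carrier M"
    and smult_l_distr: "r \<in> carrier R \<Longrightarrow> s \<in> carrier R \<Longrightarrow> x \<in> carrier M \<Longrightarrow>
      (r \<oplus>\<^bsub>R\<^esub> s) \<odot>\<^bsub>M\<^esub> x = (r \<odot>\<^bsub>M\<^esub> x) \<oplus>\<^bsub>M\<^esub> (s \<odot>\<^bsub>M\<^esub> x)"
    and smult_r_distr: "r \<in> carrier R \<Longrightarrow> x \<in> carrier M \<Longrightarrow> y \<in> carrier M \<Longrightarrow>
      r \<odot>\<^bsub>M\<^esub> (x \<oplus>\<^bsub>M\<^esub> y) = (r \<odot>\<^bsub>M\<^esub> x) \<oplus>\<^bsub>M\<^esub> (r \<odot>\<^bsub>M\<^esub> y)"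
    and smult_assoc: "r \<in> carrier R \<Longrightarrow> s \<in> carrier R \<Longrightarrow> x \<in> carrier M \<Longrightarrow>
      (r \<otimes>\<^bsub>R\<^esub> s) \<odot>\<^bsub>M\<^esub> x = r \<odot>\<^bsub>M\<^esub> (s \<odot>\<^bsub>M\<^esub> x)"
    and smult_one: "x \<in> carrier M \<Longrightarrow> \<one>\<^bsub>R\<^esub> \<odot>\<^bsub>M\<^esub> x = x"

definition fg_module :: "'r ring \<Rightarrow> ('r, 'v) module \<Rightarrow> bool" where
  "fg_module R M \<longleftrightarrow> left_module R M \<and> (\<exists>G. finite G \<and> G \<subseteq> carrier M \<and>
     (\<forall>x \<in> carrier M. \<exists>c \<in> G \<rightarrow> carrier R. x = (\<Oplus>\<^bsub>M\<^esub>g\<in>G. c g \<odot>\<^bsub>M\<^esub> g)))"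

definition module_hom :: "'r ring \<Rightarrow> ('r, 'v) module \<Rightarrow> ('r, 'v) module \<Rightarrow> ('v \<Rightarrow> 'v) set" where
  "module_hom R M N = {f \<in> carrier M \<rightarrow>\<^sub>E carrier N.
     (\<forall>x \<in> carrier M. \<forall>y \<in> carrier M. f (x \<oplus>\<^bsub>M\<^esub> y) = f x \<oplus>\<^bsub>N\<^esub> f y) \<and>
     (\<forall>r \<in> carrier R. \<forall>x \<in> carrier M. f (r \<odot>\<^bsub>M\<^esub> x) = r \<odot>\<^bsub>N\<^esub> f x)}"

text \<open>
  The category of finitely generated modules over \<open>R\<close>. The modules are those whose underlying set
  consists of lists over the type of \<open>R\<close>. This is only a universe: a finitely generated module is a
  quotient of some \<open>R\<^sup>n\<close>, hence isomorphic to a module on a set of representatives, i.e. a set of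
  lists of length \<open>n\<close>.
\<close>

type_synonym 'r mod_obj = "('r, 'r list) module"
type_synonym 'r mod_arr = "'r mod_obj \<times> 'r mod_obj \<times> ('r list \<Rightarrow> 'r list)"

definition mod_cat :: "'r ring \<Rightarrow> ('r mod_obj, 'r mod_arr) cat" where
  "mod_cat R = \<lparr>
     Obj = {M. fg_module R M},
     Arr = {(M, N, f). fg_module R M \<and> fg_module R N \<and> f \<in> module_hom R M N},
     Dom = (\<lambda>(M, N, f). M),
     Cod = (\<lambda>(M, N, f). N),
     Id = (\<lambda>M. (M, M, \<lambda>x\<in>carrier M. x)),
     Comp = (\<lambda>(N, K, g) (M, N', f). (M, K, compose (carrier M) g f)),
     Plus = (\<lambda>(M, N, f) (M', N', g). (M, N, \<lambda>x\<in>carrier M. f x \<oplus>\<^bsub>N\<^esub> g x)),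
     Zero = (\<lambda>M N. (M, N, \<lambda>x\<in>carrier M. \<zero>\<^bsub>N\<^esub>)) \<rparr>"


section \<open>Nakayama algebras\<close>

record ('v, 'e) quiver =
  verts :: "'v set"
  arrows :: "'e set"
  src :: "'e \<Rightarrow> 'v"
  tgt :: "'e \<Rightarrow> 'v"

text \<open>A path is its start vertex together with the list of its arrows, in the order of traversal.\<close>

type_synonym ('v, 'e) path = "'v \<times> 'e list"

fun is_path :: "('v, 'e) quiver \<Rightarrow> 'v \<Rightarrow> 'e list \<Rightarrow> bool" where
  "is_path Q v [] \<longleftrightarrow> v \<in> verts Q"
| "is_path Q v (e # es) \<longleftrightarrow> v \<in> verts Q \<and> e \<in> arrows Q \<and> src Q e = v \<and> is_path Q (tgt Q e) es"

fun path_end :: "('v, 'e) quiver \<Rightarrow> 'v \<Rightarrow> 'e list \<Rightarrow> 'v" where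
  "path_end Q v [] = v"
| "path_end Q v (e # es) = path_end Q (tgt Q e) es"

text \<open>
  The path algebra of a quiver with finitely many vertices. Elements are the finitely supported
  coefficient functions on paths. The product \<open>p q\<close> of two paths is "first \<open>q\<close>, then \<open>p\<close>" (zero if
  not composable), extended bilinearly; so the coefficient of \<open>x y\<close> at a path \<open>r\<close> is a sum over the
  ways to cut \<open>r\<close> in two. With this convention left modules are representations of the quiver.
\<close>

definition path_algebra :: "('v, 'e) quiver \<Rightarrow> (('v, 'e) path \<Rightarrow> 'k::field) ring" where
  "path_algebra Q = \<lparr>
     carrier = {x. finite {p. x p \<noteq> 0} \<and> (\<forall>v es. x (v, es) \<noteq> 0 \<longrightarrow> is_path Q v es)},
     mult = (\<lambda>x y (v, es). \<Sum>i\<le>length es.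
       x (path_end Q v (take i es), drop i es) * y (v, take i es)),
     one = (\<lambda>(v, es). if v \<in> verts Q \<and> es = [] then 1 else 0),
     zero = (\<lambda>p. 0),
     add = (\<lambda>x y p. x p + y p) \<rparr>"

definition path_elem :: "('v, 'e) path \<Rightarrow> ('v, 'e) path \<Rightarrow> 'k::field" where
  "path_elem p = (\<lambda>q. if q = p then 1 else 0)"

definition arrow_ideal :: "('v, 'e) quiver \<Rightarrow> (('v, 'e) path \<Rightarrow> 'k::field) set" where
  "arrow_ideal Q = Idl\<^bsub>path_algebra Q\<^esub> {path_elem (src Q e, [e]) | e. e \<in> arrows Q}"

fun ideal_pow :: "'r ring \<Rightarrow> 'r set \<Rightarrow> nat \<Rightarrow> 'r set" where
  "ideal_pow R I 0 = carrier R"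
| "ideal_pow R I (Suc m) = ideal_prod R (ideal_pow R I m) I"

definition admissible_ideal :: "('v, 'e) quiver \<Rightarrow> (('v, 'e) path \<Rightarrow> 'k::field) set \<Rightarrow> bool" where
  "admissible_ideal Q J \<longleftrightarrow> ideal J (path_algebra Q) \<and>
     (\<exists>m\<ge>2. ideal_pow (path_algebra Q) (arrow_ideal Q) m \<subseteq> J) \<and>
     J \<subseteq> ideal_pow (path_algebra Q) (arrow_ideal Q) 2"

text \<open>The quiver \<open>1 \<rightarrow> 2 \<rightarrow> \<dots> \<rightarrow> n\<close>; the arrow \<open>i \<rightarrow> i + 1\<close> is named \<open>i\<close>.\<close>

definition linear_quiver :: "nat \<Rightarrow> (nat, nat) quiver" where
  "linear_quiver n = \<lparr>verts = {1..n}, arrows = {1..<n}, src = (\<lambda>i. i), tgt = Suc\<rparr>"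

definition nakayama_algebra :: "((nat, nat) path \<Rightarrow> 'k::field) set ring \<Rightarrow> bool" where
  "nakayama_algebra \<Lambda> \<longleftrightarrow> (\<exists>n\<ge>1. \<exists>J. admissible_ideal (linear_quiver n) J \<and>
     \<Lambda> = path_algebra (linear_quiver n) Quot J)"


section \<open>Piecewise hereditary algebras\<close>

text \<open>
  HOL cannot quantify over types inside a formula, so the types of objects and morphisms of the
  hereditary category are parameters. A statement that holds for all instances of these
  parameters covers all hereditary categories.
\<close>

definition piecewise_hereditary :: "'o itself \<Rightarrow> 'm itself \<Rightarrow> 'r ring \<Rightarrow> bool" where
  "piecewise_hereditary _ _ \<Lambda> \<longleftrightarrow> (\<exists>H :: ('o, 'm) cat.
     abelian_category H \<and> hereditary H \<and> triangle_equivalent (Db (mod_cat \<Lambda>)) (Db H))"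

end

theory Submission
  imports Defs
begin

text \<open>
  Over a hereditary abelian category an indecomposable object of the bounded derived category has
  cohomology in exactly one degree, say \<open>c(X)\<close>, and a nonzero morphism from \<open>X\<close> to \<open>Y[1]\<close> between
  two such objects forces \<open>c(X) \<le> c(Y)\<close>.  An almost split triangle over \<open>X\<close> has a nonzero
  connecting morphism from \<open>X\<close> to \<open>\<tau>X[1]\<close>, so after transport along an equivalence the degree
  never drops from \<open>X\<close> to \<open>\<tau>X\<close>, and therefore not from \<open>X\<close> to \<open>\<tau>\<^sup>n X\<close> either.  But
  \<open>c(X[m]) = c(X) - m\<close> is smaller than \<open>c(X)\<close> for positive \<open>m\<close>, so \<open>\<tau>\<^sup>n X\<close> cannot be
  isomorphic to \<open>X[m]\<close> (\<open>no_periodic_object\<close>).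

  Both facts about degrees come from one vanishing statement (\<open>vanishing\<close>): a chain map into a
  complex concentrated in degrees \<open>\<le> b\<close>, from a complex exact in degrees \<open>\<le> b + 1\<close>, is zero in
  the derived category.  It factors through a map between brutal truncations of its source that are
  resolutions of single objects two degrees apart, that is, through a class in \<open>Ext\<^sup>2\<close>.  Applied to the
  homotopy fibre of the inclusion of a truncation it shows that every complex is the direct sum, in the
  derived category, of its two truncations (\<open>truncation_splits\<close>), whence
  \<open>indecomposable_concentrated\<close>.  Applied to a morphism of complexes concentrated in one degree it
  gives \<open>nonzero_Hom_degrees\<close>.

  The derived category is the formal localisation of the homotopy category, so its morphisms are
  classes of roofs.  They can be computed with because quasi-isomorphisms admit a calculus of right
  fractions (\<open>Kb_fractions\<close>).  The construction uses homotopy fibres, which are obtained by twisting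
  the differential of a direct sum.  Exactness is checked by diagram chases with generalised elements:
  arbitrary morphisms into an object, which may be replaced by their composites with an epimorphism.
  This is sound since epimorphisms of an abelian category are stable under pullback.

  A Nakayama algebra is finite-dimensional and hence noetherian, so its finitely generated modules form
  an abelian category (\<open>nakayama_abelian\<close>), to whose derived category the above applies.
\<close>

section \<open>Calculating in preadditive categories\<close>

text \<open>
  Linear identities between morphisms are decided by rewriting.  Applying \<open>sg C \<cdot> True\<close> to both sides
  and pushing \<open>sg\<close> to the monomials turns every sum into an AC-sorted sum of terms
  \<open>sg C x True\<close> and \<open>sg C x False\<close>, the latter standing for the negative of \<open>x\<close>.  The term order
  puts opposite monomials next to each other, where they cancel; with \<open>Neg C x\<close> and \<open>x\<close> in place
  of the two marked terms they would be sorted apart.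
\<close>

definition sg :: "('o, 'm, 'z) cat_scheme \<Rightarrow> 'm \<Rightarrow> bool \<Rightarrow> 'm" where
  "sg C x b = (if b then x else Neg C x)"

lemma HomI: "f \<in> Arr C \<Longrightarrow> Dom C f = X \<Longrightarrow> Cod C f = Y \<Longrightarrow> f \<in> Hom C X Y"
  by (simp add: Hom_def)

lemma HomD: assumes "f \<in> Hom C X Y" shows "f \<in> Arr C" "Dom C f = X" "Cod C f = Y"
  using assms by (simp_all add: Hom_def)

context category
begin

lemma Hom_Obj: assumes "f \<in> Hom C X Y" shows "X \<in> Obj C" "Y \<in> Obj C"
  using assms Dom_Obj Cod_Obj by (auto simp: Hom_def)

lemma comp_arr:
  assumes "f \<in> Arr C" "g \<in> Arr C" "Dom C g = Cod C f"
  shows "Comp C g f \<in> Arr C" "Dom C (Comp C g f) = Dom C f" "Cod C (Comp C g f) = Cod C g"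
  using Comp_Hom[of f "Dom C f" "Cod C f" g "Cod C g"] assms by (auto simp: Hom_def)

lemma comp_assoc:
  assumes "f \<in> Arr C" "g \<in> Arr C" "h \<in> Arr C" "Dom C g = Cod C f" "Dom C h = Cod C g"
  shows "Comp C (Comp C h g) f = Comp C h (Comp C g f)"
  using Comp_assoc[of f "Dom C f" "Cod C f" g "Cod C g" h "Cod C h"] assms by (auto simp: Hom_def)

lemma id_arr:
  assumes "X \<in> Obj C" shows "Id C X \<in> Arr C" "Dom C (Id C X) = X" "Cod C (Id C X) = X"
  using Id_Hom[OF assms] by (auto simp: Hom_def)

lemma comp_id: "f \<in> Arr C \<Longrightarrow> Dom C f = X \<Longrightarrow> Comp C f (Id C X) = f"
  using Comp_Id[of f X "Cod C f"] by (auto simp: Hom_def)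

lemma id_comp: "f \<in> Arr C \<Longrightarrow> Cod C f = Y \<Longrightarrow> Comp C (Id C Y) f = f"
  using Id_Comp[of f "Dom C f" Y] by (auto simp: Hom_def)

lemmas cat_simps = comp_arr comp_assoc id_arr comp_id id_comp Dom_Obj Cod_Obj

end

context preadditive_category
begin

lemma eq_sgI: "sg C f True = sg C g True \<Longrightarrow> f = g"
  by (simp add: sg_def)

lemma plus_arr:
  assumes "f \<in> Arr C" "g \<in> Arr C" "Dom C f = Dom C g" "Cod C f = Cod C g"
  shows "Plus C f g \<in> Arr C" "Dom C (Plus C f g) = Dom C g" "Cod C (Plus C f g) = Cod C g"
  using Plus_Hom[of f "Dom C f" "Cod C f" g] assms by (auto simp: Hom_def)

lemma plus_assoc:
  assumes "f \<in> Arr C" "g \<in> Arr C" "h \<in> Arr C"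
    "Dom C f = Dom C g" "Cod C f = Cod C g" "Dom C h = Dom C g" "Cod C h = Cod C g"
  shows "Plus C (Plus C f g) h = Plus C f (Plus C g h)"
  using Plus_assoc[of f "Dom C f" "Cod C f" g h] assms by (auto simp: Hom_def)

lemma plus_commute:
  assumes "f \<in> Arr C" "g \<in> Arr C" "Dom C f = Dom C g" "Cod C f = Cod C g"
  shows "Plus C f g = Plus C g f"
  using Plus_commute[of f "Dom C f" "Cod C f" g] assms by (auto simp: Hom_def)

lemma plus_left_commute:
  assumes "f \<in> Arr C" "g \<in> Arr C" "h \<in> Arr C"
    "Dom C f = Dom C g" "Cod C f = Cod C g" "Dom C h = Dom C g" "Cod C h = Cod C g"
  shows "Plus C f (Plus C g h) = Plus C g (Plus C f h)"
  using plus_assoc[of f g h] plus_assoc[of g f h] plus_commute[of f g] assms by simp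

lemma zero_arr:
  assumes "X \<in> Obj C" "Y \<in> Obj C"
  shows "Zero C X Y \<in> Arr C" "Dom C (Zero C X Y) = X" "Cod C (Zero C X Y) = Y"
  using Zero_Hom[OF assms] by (auto simp: Hom_def)

lemma plus_zero: "f \<in> Arr C \<Longrightarrow> Dom C f = X \<Longrightarrow> Cod C f = Y \<Longrightarrow> Plus C f (Zero C X Y) = f"
  using Plus_Zero[of f X Y] by (auto simp: Hom_def)

lemma zero_plus: "f \<in> Arr C \<Longrightarrow> Dom C f = X \<Longrightarrow> Cod C f = Y \<Longrightarrow> Plus C (Zero C X Y) f = f"
  using plus_zero[of f X Y] plus_commute[of "Zero C X Y" f] zero_arr[of X Y] Dom_Obj Cod_Obj by auto

lemma plus_left_cancel:
  assumes "f \<in> Arr C" "g \<in> Arr C" "h \<in> Arr C"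
    "Dom C f = Dom C g" "Cod C f = Cod C g" "Dom C h = Dom C g" "Cod C h = Cod C g"
    and eq: "Plus C f g = Plus C f h"
  shows "g = h"
proof -
  have F: "f \<in> Hom C (Dom C g) (Cod C g)" "g \<in> Hom C (Dom C g) (Cod C g)"
    "h \<in> Hom C (Dom C g) (Cod C g)"
    using assms(1-7) by (simp_all add: Hom_def)
  obtain k where k: "k \<in> Hom C (Dom C g) (Cod C g)" "Plus C f k = Zero C (Dom C g) (Cod C g)"
    using Plus_inverse[OF F(1)] by blast
  have z: "Plus C k f = Zero C (Dom C g) (Cod C g)"
    using Plus_commute[OF F(1) k(1)] k(2) by simp
  have "Plus C (Plus C k f) g = Plus C (Plus C k f) h"
    by (simp only: Plus_assoc[OF k(1) F(1) F(2)] Plus_assoc[OF k(1) F(1) F(3)] eq)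
  then have "Plus C (Zero C (Dom C g) (Cod C g)) g = Plus C (Zero C (Dom C g) (Cod C g)) h"
    by (simp only: z)
  moreover have "Plus C (Zero C (Dom C g) (Cod C g)) g = g"
    by (rule zero_plus) (use assms in auto)
  moreover have "Plus C (Zero C (Dom C g) (Cod C g)) h = h"
    by (rule zero_plus) (use assms in auto)
  ultimately show ?thesis by (simp only:)
qed

lemma neg_ex1: assumes "f \<in> Arr C"
  shows "\<exists>!g. g \<in> Hom C (Dom C f) (Cod C f) \<and> Plus C f g = Zero C (Dom C f) (Cod C f)"
proof -
  obtain k where k: "k \<in> Hom C (Dom C f) (Cod C f)" "Plus C f k = Zero C (Dom C f) (Cod C f)"
    using Plus_inverse[of f "Dom C f" "Cod C f"] assms by (auto simp: Hom_def)
  show ?thesis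
  proof (rule ex1I[of _ k])
    fix g assume g: "g \<in> Hom C (Dom C f) (Cod C f) \<and> Plus C f g = Zero C (Dom C f) (Cod C f)"
    show "g = k" by (rule plus_left_cancel[of f g k]) (use assms k g in \<open>auto simp: Hom_def\<close>)
  qed (use k in auto)
qed

lemma neg_arr: assumes "f \<in> Arr C"
  shows "Neg C f \<in> Arr C" "Dom C (Neg C f) = Dom C f" "Cod C (Neg C f) = Cod C f"
    and plus_neg: "Plus C f (Neg C f) = Zero C (Dom C f) (Cod C f)"
  using theI'[OF neg_ex1[OF assms]] unfolding Neg_def[symmetric] by (auto simp: Hom_def)

lemma neg_plus_self: "f \<in> Arr C \<Longrightarrow> Plus C (Neg C f) f = Zero C (Dom C f) (Cod C f)"
  using plus_neg plus_commute[of "Neg C f" f] neg_arr by simp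

lemma neg_eqI:
  assumes "f \<in> Arr C" "g \<in> Arr C" "Dom C f = Dom C g" "Cod C f = Cod C g"
    "Plus C f g = Zero C (Dom C f) (Cod C f)"
  shows "Neg C f = g"
  by (rule plus_left_cancel[of f]) (use assms in \<open>simp_all add: neg_arr plus_neg\<close>)

lemma neg_neg: "f \<in> Arr C \<Longrightarrow> Neg C (Neg C f) = f"
  by (rule neg_eqI) (simp_all add: neg_arr neg_plus_self)

lemma neg_zero: "X \<in> Obj C \<Longrightarrow> Y \<in> Obj C \<Longrightarrow> Neg C (Zero C X Y) = Zero C X Y"
  by (rule neg_eqI) (simp_all add: zero_arr plus_zero)

lemma comp_plus:
  assumes "f \<in> Arr C" "f' \<in> Arr C" "g \<in> Arr C" "Dom C f = Dom C f'" "Cod C f = Cod C f'"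
    "Dom C g = Cod C f'"
  shows "Comp C g (Plus C f f') = Plus C (Comp C g f) (Comp C g f')"
  using Comp_Plus[of f "Dom C f" "Cod C f" f' g "Cod C g"] assms by (auto simp: Hom_def)

lemma plus_comp:
  assumes "f \<in> Arr C" "g \<in> Arr C" "g' \<in> Arr C" "Dom C g = Dom C g'" "Cod C g = Cod C g'"
    "Dom C g' = Cod C f"
  shows "Comp C (Plus C g g') f = Plus C (Comp C g f) (Comp C g' f)"
  using Plus_Comp[of f "Dom C f" "Cod C f" g "Cod C g" g'] assms by (auto simp: Hom_def)

lemma plus_idem_zero:
  assumes "f \<in> Arr C" "Plus C f f = f" shows "f = Zero C (Dom C f) (Cod C f)"
  using plus_left_cancel[of f f "Zero C (Dom C f) (Cod C f)"] assms
  by (simp add: zero_arr plus_zero Dom_Obj Cod_Obj)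

lemma comp_zero:
  assumes "f \<in> Arr C" "X \<in> Obj C" "Dom C f = Y"
  shows "Comp C f (Zero C X Y) = Zero C X (Cod C f)"
proof -
  have "Y \<in> Obj C" using assms Dom_Obj by auto
  then have "Plus C (Comp C f (Zero C X Y)) (Comp C f (Zero C X Y)) = Comp C f (Zero C X Y)"
    using assms by (simp add: comp_plus[symmetric] zero_arr plus_zero)
  from plus_idem_zero[OF _ this] show ?thesis using assms \<open>Y \<in> Obj C\<close> by (simp add: comp_arr zero_arr)
qed

lemma zero_comp:
  assumes "f \<in> Arr C" "Z \<in> Obj C" "Cod C f = Y"
  shows "Comp C (Zero C Y Z) f = Zero C (Dom C f) Z"
proof -
  have "Y \<in> Obj C" using assms Cod_Obj by auto
  then have "Plus C (Comp C (Zero C Y Z) f) (Comp C (Zero C Y Z) f) = Comp C (Zero C Y Z) f"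
    using assms by (simp add: plus_comp[symmetric] zero_arr plus_zero)
  from plus_idem_zero[OF _ this] show ?thesis using assms \<open>Y \<in> Obj C\<close> by (simp add: comp_arr zero_arr)
qed

lemma comp_neg:
  assumes "f \<in> Arr C" "g \<in> Arr C" "Dom C g = Cod C f"
  shows "Comp C g (Neg C f) = Neg C (Comp C g f)" "Comp C (Neg C g) f = Neg C (Comp C g f)"
  by (rule neg_eqI[symmetric]; use assms in \<open>simp add: comp_arr neg_arr comp_plus[symmetric]
    plus_comp[symmetric] plus_neg comp_zero zero_comp Dom_Obj Cod_Obj\<close>)+

lemma sg_arr:
  assumes "f \<in> Arr C" shows "sg C f b \<in> Arr C" "Dom C (sg C f b) = Dom C f" "Cod C (sg C f b) = Cod C f"
  using assms by (auto simp: sg_def neg_arr)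

lemma neg_plus:
  assumes "f \<in> Arr C" "g \<in> Arr C" "Dom C f = Dom C g" "Cod C f = Cod C g"
  shows "Neg C (Plus C f g) = Plus C (Neg C f) (Neg C g)"
  by (rule neg_eqI) (use assms in \<open>simp_all add: plus_arr neg_arr plus_assoc Dom_Obj Cod_Obj plus_zero
    plus_left_commute[of g "Neg C f"] plus_neg\<close>)

lemma sg_plus:
  assumes "f \<in> Arr C" "g \<in> Arr C" "Dom C f = Dom C g" "Cod C f = Cod C g"
  shows "sg C (Plus C f g) b = Plus C (sg C f b) (sg C g b)"
  using assms by (simp add: sg_def neg_plus)

lemma sg_neg: "f \<in> Arr C \<Longrightarrow> sg C (Neg C f) b = sg C f (\<not> b)"
  by (simp add: sg_def neg_neg)

lemma sg_zero: "X \<in> Obj C \<Longrightarrow> Y \<in> Obj C \<Longrightarrow> sg C (Zero C X Y) b = Zero C X Y"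
  by (simp add: sg_def neg_zero)

lemma sg_cancel:
  assumes "f \<in> Arr C"
  shows "Plus C (sg C f True) (sg C f False) = Zero C (Dom C f) (Cod C f)"
    "Plus C (sg C f False) (sg C f True) = Zero C (Dom C f) (Cod C f)"
  using assms by (simp_all add: sg_def plus_neg neg_plus_self)

lemma sg_cancel_left:
  assumes "f \<in> Arr C" "g \<in> Arr C" "Dom C g = Dom C f" "Cod C g = Cod C f"
  shows "Plus C (sg C f True) (Plus C (sg C f False) g) = g"
    "Plus C (sg C f False) (Plus C (sg C f True) g) = g"
  using assms by (simp_all add: plus_assoc[symmetric] sg_arr sg_cancel zero_plus)

lemmas lin_simps = cat_simps plus_arr plus_assoc plus_commute plus_left_commute zero_arr plus_zero
  zero_plus neg_arr comp_plus plus_comp comp_zero zero_comp comp_neg sg_arr sg_plus sg_neg sg_zero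
  sg_cancel sg_cancel_left

lemmas arr_simps = cat_simps plus_arr zero_arr neg_arr comp_zero zero_comp plus_zero zero_plus

lemma plus_neg_eq_zero_iff:
  assumes "f \<in> Arr C" "g \<in> Arr C" "Dom C f = Dom C g" "Cod C f = Cod C g"
  shows "Plus C f (Neg C g) = Zero C (Dom C g) (Cod C g) \<longleftrightarrow> f = g"
proof
  assume h: "Plus C f (Neg C g) = Zero C (Dom C g) (Cod C g)"
  have "f = Plus C (Plus C f (Neg C g)) g"
    by (rule eq_sgI) (use assms in \<open>simp add: lin_simps\<close>)
  then show "f = g" using assms h by (simp add: zero_plus)
qed (use assms in \<open>simp add: plus_neg\<close>)

end

section \<open>Generalised elements of abelian categories\<close>

text \<open>
  Diagram chases use the following language.  A generalised element of an object is any morphism into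
  it, and a statement about it holds locally if it holds after composition with some epimorphism.
\<close>

locale ab_cat = abelian_category A for A :: "('o, 'm) cat"
begin

abbreviation comp (infixr "oo" 75) where "g oo f \<equiv> Comp A g f"
abbreviation add (infixl "\<boxplus>" 65) where "f \<boxplus> g \<equiv> Plus A f g"
abbreviation neg ("\<boxminus> _" [80] 80) where "\<boxminus> f \<equiv> Neg A f"

lemma kernelD:
  assumes "is_kernel A f k"
  shows "f \<in> Arr A" "k \<in> Arr A" "Cod A k = Dom A f" "f oo k = Zero A (Dom A k) (Cod A f)"
  using assms by (auto simp: is_kernel_def)

lemma kernel_lift:
  assumes "is_kernel A f k" "g \<in> Hom A W (Dom A f)" "f oo g = Zero A W (Cod A f)"
  obtains h where "h \<in> Hom A W (Dom A k)" "k oo h = g"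
  using assms unfolding is_kernel_def by blast

lemma kernel_mono:
  assumes "is_kernel A f k" "g \<in> Hom A W (Dom A k)" "h \<in> Hom A W (Dom A k)" "k oo g = k oo h"
  shows "g = h"
proof -
  note k = kernelD[OF assms(1)]
  have a: "k oo g \<in> Hom A W (Dom A f)" "f oo (k oo g) = Zero A W (Cod A f)"
    using k assms(2) by (auto simp: Hom_def arr_simps comp_assoc[symmetric])
  then have "\<exists>!u. u \<in> Hom A W (Dom A k) \<and> k oo u = k oo g"
    using assms(1) unfolding is_kernel_def by blast
  then show ?thesis using assms(2-4) by metis
qed

lemma cokernelD:
  assumes "is_cokernel A f c"
  shows "f \<in> Arr A" "c \<in> Arr A" "Dom A c = Cod A f" "c oo f = Zero A (Dom A f) (Cod A c)"
  using assms by (auto simp: is_cokernel_def)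

lemma cokernel_lift:
  assumes "is_cokernel A f c" "g \<in> Hom A (Cod A f) W" "g oo f = Zero A (Dom A f) W"
  obtains h where "h \<in> Hom A (Cod A c) W" "h oo c = g"
  using assms unfolding is_cokernel_def by blast

lemma epi_arrow: "epi_arr A e \<Longrightarrow> e \<in> Arr A"
  by (simp add: epi_arr_def)

lemma epi_cancel:
  assumes "epi_arr A e" "g oo e = h oo e" "g \<in> Arr A" "h \<in> Arr A" "Dom A g = Cod A e"
    "Dom A h = Cod A e" "Cod A g = Cod A h"
  shows "g = h"
  using assms unfolding epi_arr_def Hom_def by blast

lemma epi_cancel_zero:
  assumes "epi_arr A e" "g oo e = Zero A (Dom A e) (Cod A g)" "g \<in> Arr A" "Dom A g = Cod A e"
  shows "g = Zero A (Cod A e) (Cod A g)"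
  by (rule epi_cancel[OF assms(1)])
    (use assms epi_arrow[OF assms(1)] in \<open>simp_all add: arr_simps\<close>)

lemma epiI_zero:
  assumes "f \<in> Arr A"
    "\<And>W g. g \<in> Hom A (Cod A f) W \<Longrightarrow> g oo f = Zero A (Dom A f) W \<Longrightarrow> g = Zero A (Cod A f) W"
  shows "epi_arr A f"
  unfolding epi_arr_def
proof (intro conjI assms allI ballI impI)
  fix W g h assume gh: "g \<in> Hom A (Cod A f) W" "h \<in> Hom A (Cod A f) W" "g oo f = h oo f"
  have "(g \<boxplus> \<boxminus> h) oo f = Zero A (Dom A f) W"
    by (rule eq_sgI) (use gh assms(1) in \<open>simp add: Hom_def lin_simps\<close>)
  then have "g \<boxplus> \<boxminus> h = Zero A (Cod A f) W"
    using gh by (intro assms) (auto simp: Hom_def arr_simps)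
  then show "g = h" using gh plus_neg_eq_zero_iff[of g h] by (auto simp: Hom_def)
qed

lemma monoI_zero:
  assumes "f \<in> Arr A"
    "\<And>W g. g \<in> Hom A W (Dom A f) \<Longrightarrow> f oo g = Zero A W (Cod A f) \<Longrightarrow> g = Zero A W (Dom A f)"
  shows "mono_arr A f"
  unfolding mono_arr_def
proof (intro conjI assms allI ballI impI)
  fix W g h assume gh: "g \<in> Hom A W (Dom A f)" "h \<in> Hom A W (Dom A f)" "f oo g = f oo h"
  have "f oo (g \<boxplus> \<boxminus> h) = Zero A W (Cod A f)"
    by (rule eq_sgI) (use gh assms(1) in \<open>auto simp add: Hom_def lin_simps\<close>)
  then have "g \<boxplus> \<boxminus> h = Zero A W (Dom A f)"
    using gh by (intro assms) (auto simp: Hom_def arr_simps)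
  then show "g = h" using gh plus_neg_eq_zero_iff[of g h] by (auto simp: Hom_def)
qed

lemma epi_id: "X \<in> Obj A \<Longrightarrow> epi_arr A (Id A X)"
  by (rule epiI_zero) (auto simp: Hom_def arr_simps)

lemma epi_comp:
  assumes "epi_arr A e" "epi_arr A e'" "Dom A e = Cod A e'"
  shows "epi_arr A (e oo e')"
proof (rule epiI_zero)
  have a: "e \<in> Arr A" "e' \<in> Arr A" using assms by (auto intro: epi_arrow)
  then show "e oo e' \<in> Arr A" using assms by (simp add: arr_simps)
  fix W g assume "g \<in> Hom A (Cod A (e oo e')) W" "g oo e oo e' = Zero A (Dom A (e oo e')) W"
  then have g: "g \<in> Arr A" "Dom A g = Cod A e" "Cod A g = W" "(g oo e) oo e' = Zero A (Dom A e') W"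
    using a assms by (auto simp: Hom_def arr_simps)
  have "g oo e = Zero A (Cod A e') (Cod A (g oo e))"
    using g a assms by (intro epi_cancel_zero) (auto simp: arr_simps)
  then have "g = Zero A (Cod A e) (Cod A g)"
    using g a assms by (intro epi_cancel_zero) (auto simp: arr_simps)
  then show "g = Zero A (Cod A (e oo e')) W" using g a assms by (simp add: arr_simps)
qed

lemma epi_cokernel_of_kernel:
  assumes "epi_arr A e" "is_kernel A e k" shows "is_cokernel A k e"
proof -
  obtain g where g: "is_cokernel A g e" using epi_is_cokernel[OF assms(1)] by blast
  note G = cokernelD[OF g] and K = kernelD[OF assms(2)]
  obtain g' where g': "g' \<in> Hom A (Dom A g) (Dom A k)" "k oo g' = g"
    using kernel_lift[OF assms(2), of g "Dom A g"] G by (auto simp: Hom_def)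
  show ?thesis unfolding is_cokernel_def
  proof (intro conjI allI ballI impI)
    fix W h assume h: "h \<in> Hom A (Cod A k) W" "h oo k = Zero A (Dom A k) W"
    have "h oo g = (h oo k) oo g'" using g'(2)[symmetric] g'(1) h(1) K by (simp add: Hom_def arr_simps)
    also have "\<dots> = Zero A (Dom A g) W" using h(2) g'(1) h(1) Cod_Obj by (auto simp: Hom_def arr_simps)
    finally have "h \<in> Hom A (Cod A g) W \<and> h oo g = Zero A (Dom A g) W" using h K G by auto
    then show "\<exists>!m. m \<in> Hom A (Cod A e) W \<and> m oo e = h"
      using g unfolding is_cokernel_def by blast
  qed (use K in auto)
qed

text \<open>
  The pullback, along which generalised elements lift, is the kernel of
  \<open>q = f p\<^sub>1 - e p\<^sub>2\<close> on the biproduct.  Since \<open>q\<close> restricts to \<open>- e\<close> on the second summand,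
  it is epi, hence the cokernel of its kernel; a morphism that kills the projection to \<open>X\<close> therefore
  factors through \<open>q\<close>, and the two inclusions of the biproduct show that it is zero.
\<close>

lemma pullback_epi:
  assumes e: "epi_arr A e" "e \<in> Hom A Y' Y" and f: "f \<in> Hom A X Y"
  obtains P e' f' where "e' \<in> Hom A P X" "epi_arr A e'" "f' \<in> Hom A P Y'" "f oo e' = e oo f'"
proof -
  have O: "X \<in> Obj A" "Y \<in> Obj A" "Y' \<in> Obj A" using e f Hom_Obj by auto
  obtain S i1 i2 p1 p2 where b: "is_biproduct A X Y' S i1 i2 p1 p2" using ex_biproduct[OF O(1,3)] by blast
  note B = b[unfolded is_biproduct_def Hom_def, simplified]
  have E: "e \<in> Arr A" "Dom A e = Y'" "Cod A e = Y" "f \<in> Arr A" "Dom A f = X" "Cod A f = Y"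
    using e f by (auto simp: Hom_def)
  define q where "q = f oo p1 \<boxplus> \<boxminus> (e oo p2)"
  have q: "q \<in> Arr A" "Dom A q = S" "Cod A q = Y" using B E by (auto simp: q_def arr_simps)
  have qi2: "q oo i2 = \<boxminus> e"
    unfolding q_def by (rule eq_sgI) (use B E O in \<open>simp add: lin_simps\<close>)
  have epq: "epi_arr A q"
  proof (rule epiI_zero[OF q(1)])
    fix W g assume g: "g \<in> Hom A (Cod A q) W" "g oo q = Zero A (Dom A q) W"
    then have W: "W \<in> Obj A" using Hom_Obj by blast
    have "(g oo q) oo i2 = g oo \<boxminus> e" using qi2 g(1) q B by (simp add: Hom_def arr_simps)
    then have "\<boxminus> (g oo e) = Zero A Y' W" using g q E B W by (auto simp: Hom_def lin_simps)
    then have "\<boxminus> (\<boxminus> (g oo e)) = Zero A Y' W" using O W by (simp add: neg_zero)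
    then have "g oo e = Zero A Y' W" using g q E by (auto simp: Hom_def arr_simps neg_neg)
    then show "g = Zero A (Cod A q) W" using epi_cancel_zero[OF e(1), of g] g q E
      by (auto simp: Hom_def)
  qed
  obtain k where k: "is_kernel A q k" using ex_kernel[OF q(1)] by blast
  note K = kernelD[OF k]
  have ck: "is_cokernel A k q" by (rule epi_cokernel_of_kernel[OF epq k])
  have "epi_arr A (p1 oo k)"
  proof (rule epiI_zero)
    show "p1 oo k \<in> Arr A" using K B q by (simp add: arr_simps)
    fix W h assume h: "h \<in> Hom A (Cod A (p1 oo k)) W" "h oo p1 oo k = Zero A (Dom A (p1 oo k)) W"
    then have h1: "h \<in> Arr A" "Dom A h = X" "Cod A h = W" "(h oo p1) oo k = Zero A (Dom A k) W"
      using K B q by (auto simp: Hom_def arr_simps)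
    have W: "W \<in> Obj A" using h1 Cod_Obj by auto
    obtain m where m: "m \<in> Hom A Y W" "m oo q = h oo p1"
      using cokernel_lift[OF ck, of "h oo p1" W] h1 K B q by (auto simp: Hom_def arr_simps)
    have "m oo \<boxminus> e = (m oo q) oo i2" using m(1) qi2 q B by (simp add: Hom_def arr_simps)
    also have "\<dots> = h oo (p1 oo i2)" using m(2) h1 B by (simp add: comp_assoc)
    also have "\<dots> = Zero A Y' W" using h1 B O by (simp add: arr_simps)
    finally have "m oo \<boxminus> e = Zero A Y' W" .
    then have "\<boxminus> (\<boxminus> (m oo e)) = Zero A Y' W" using m E O W by (auto simp: Hom_def neg_zero comp_neg)
    then have "m oo e = Zero A Y' W" using m E by (auto simp: Hom_def arr_simps neg_neg)
    then have "m = Zero A Y W" using epi_cancel_zero[OF e(1), of m] m E by (auto simp: Hom_def)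
    then have "(h oo p1) oo i1 = Zero A S W oo i1" using m(2) q W by (simp add: arr_simps)
    then have "h = Zero A X W" using h1 B W by (auto simp: arr_simps)
    then show "h = Zero A (Cod A (p1 oo k)) W" using K B q by (simp add: arr_simps)
  qed
  moreover have "f oo p1 oo k = e oo p2 oo k"
  proof -
    have "(f oo p1 oo k) \<boxplus> \<boxminus> (e oo p2 oo k) = q oo k"
      unfolding q_def by (rule eq_sgI) (use K B E q in \<open>simp add: lin_simps\<close>)
    then show ?thesis using K B E q plus_neg_eq_zero_iff[of "f oo p1 oo k" "e oo p2 oo k"]
      by (simp add: arr_simps)
  qed
  ultimately show ?thesis
    using that[of "p1 oo k" "Dom A k" "p2 oo k"] K B q by (simp add: Hom_def arr_simps)
qed

lemma cokernel_epi: assumes "is_cokernel A f c" shows "epi_arr A c"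
proof (rule epiI_zero)
  note K = cokernelD[OF assms]
  show "c \<in> Arr A" by fact
  fix W g assume g: "g \<in> Hom A (Cod A c) W" "g oo c = Zero A (Dom A c) W"
  have W: "W \<in> Obj A" using g Hom_Obj by blast
  have "g oo c \<in> Hom A (Cod A f) W" "(g oo c) oo f = Zero A (Dom A f) W"
    using g K W by (auto simp: Hom_def arr_simps)
  then have "\<exists>!h. h \<in> Hom A (Cod A c) W \<and> h oo c = g oo c"
    using assms unfolding is_cokernel_def by blast
  moreover have "Zero A (Cod A c) W \<in> Hom A (Cod A c) W" "Zero A (Cod A c) W oo c = g oo c"
    using g K W by (auto simp: Hom_def arr_simps)
  ultimately show "g = Zero A (Cod A c) W" using g(1) by blast
qed

text \<open>
  The morphism \<open>b\<close> is epi onto the kernel \<open>k\<close> of its cokernel, so that elements of this kernel lift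
  locally along \<open>b\<close>.  Indeed, if a morphism \<open>h\<close> on the kernel kills \<open>b\<close>, then \<open>b\<close> factors through
  the subobject \<open>k \<circ> ker h\<close>, which is the kernel of some \<open>g\<close>.  This \<open>g\<close> kills \<open>b\<close>, so it factors
  through the cokernel and kills \<open>k\<close>; hence \<open>ker h\<close> is everything and \<open>h\<close> is zero.
\<close>

lemma cokernel_exact:
  assumes p: "is_cokernel A b p" and x: "x \<in> Hom A W (Cod A b)" and px: "p oo x = Zero A W (Cod A p)"
  obtains V e x' where "e \<in> Hom A V W" "epi_arr A e" "x' \<in> Hom A V (Dom A b)" "x oo e = b oo x'"
proof -
  note P = cokernelD[OF p]
  obtain k where k: "is_kernel A p k" using ex_kernel P by blast
  note K = kernelD[OF k]
  obtain b' where b': "b' \<in> Hom A (Dom A b) (Dom A k)" "k oo b' = b"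
    using kernel_lift[OF k, of b "Dom A b"] P by (auto simp: Hom_def)
  have B: "b' \<in> Arr A" "Dom A b' = Dom A b" "Cod A b' = Dom A k" using b'(1) by (auto simp: Hom_def)
  have "epi_arr A b'"
  proof (rule epiI_zero)
    show "b' \<in> Arr A" by fact
    fix U h assume h: "h \<in> Hom A (Cod A b') U" "h oo b' = Zero A (Dom A b') U"
    have H: "h \<in> Arr A" "Dom A h = Dom A k" "Cod A h = U" using h B by (auto simp: Hom_def)
    obtain l where l: "is_kernel A h l" using ex_kernel H by blast
    note L = kernelD[OF l]
    obtain b'' where b'': "b'' \<in> Hom A (Dom A b) (Dom A l)" "l oo b'' = b'"
      using kernel_lift[OF l, of b' "Dom A b"] h B H by (auto simp: Hom_def)
    have "mono_arr A (k oo l)"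
      unfolding mono_arr_def
    proof (intro conjI allI ballI impI)
      show "k oo l \<in> Arr A" using K L H by (simp add: arr_simps)
      fix V u v assume u: "u \<in> Hom A V (Dom A (k oo l))" "v \<in> Hom A V (Dom A (k oo l))"
        "(k oo l) oo u = (k oo l) oo v"
      then have "u \<in> Hom A V (Dom A l)" "v \<in> Hom A V (Dom A l)" "k oo l oo u = k oo l oo v"
        using K L H by (auto simp: Hom_def arr_simps)
      then have "l oo u = l oo v"
        by (intro kernel_mono[OF k, of "l oo u" V "l oo v"])
          (use K L H in \<open>auto simp: Hom_def arr_simps\<close>)
      with \<open>u \<in> Hom A V (Dom A l)\<close> \<open>v \<in> Hom A V (Dom A l)\<close>
      show "u = v" by (rule kernel_mono[OF l])
    qed
    then obtain g where g: "is_kernel A g (k oo l)" using mono_is_kernel by blast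
    note G = kernelD[OF g]
    have Gd: "Dom A g = Cod A k" using G K L H by (simp add: arr_simps)
    have g0: "g oo k oo l = Zero A (Dom A l) (Cod A g)" using G K L H by (simp add: arr_simps)
    have "g oo b = g oo k oo l oo b''" by (simp only: b'(2) b''(2))
    also have "\<dots> = (g oo k oo l) oo b''"
      using b''(1) K L H G(1) Gd by (simp add: Hom_def arr_simps)
    also have "\<dots> = Zero A (Dom A b) (Cod A g)"
      unfolding g0 using b''(1) G by (simp add: Hom_def arr_simps)
    finally have gb: "g oo b = Zero A (Dom A b) (Cod A g)" .
    obtain g' where g': "g' \<in> Hom A (Cod A p) (Cod A g)" "g' oo p = g"
      using cokernel_lift[OF p _ gb] G Gd K P by (auto simp: Hom_def)
    have "g oo k = g' oo p oo k" using g' P K by (auto simp: Hom_def arr_simps)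
    then have "g oo k = Zero A (Dom A k) (Cod A g)" using g'(1) K P by (auto simp: Hom_def arr_simps)
    then obtain m where m: "m \<in> Hom A (Dom A k) (Dom A (k oo l))" "(k oo l) oo m = k"
      using kernel_lift[OF g, of k "Dom A k"] K G Gd by (auto simp: Hom_def)
    have "l oo m = Id A (Dom A k)"
      by (rule kernel_mono[OF k, of _ "Dom A k"]) (use m K L H in \<open>auto simp: Hom_def arr_simps\<close>)
    then have "h = h oo l oo m" using H by (simp add: arr_simps)
    also have "\<dots> = (h oo l) oo m" using m(1) K L(1-3) H by (simp add: Hom_def arr_simps)
    also have "\<dots> = Zero A (Dom A l) (Cod A h) oo m" by (simp only: L(4))
    also have "\<dots> = Zero A (Dom A k) U"
      using m(1) K L(1-3) H Cod_Obj[of h] by (auto simp: Hom_def arr_simps)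
    finally show "h = Zero A (Cod A b') U" using B by simp
  qed
  moreover obtain y where y: "y \<in> Hom A W (Dom A k)" "k oo y = x"
    using kernel_lift[OF k, of x W] x px P by (auto simp: Hom_def)
  ultimately obtain V e x' where V: "e \<in> Hom A V W" "epi_arr A e" "x' \<in> Hom A V (Dom A b)" "y oo e = b' oo x'"
    using pullback_epi[OF _ b'(1), of y W] by metis
  have "x oo e = (k oo y) oo e" by (simp only: y(2))
  also have "\<dots> = k oo b' oo x'"
    unfolding V(4)[symmetric] using y(1) V(1) K(2) by (simp add: Hom_def comp_assoc)
  also have "\<dots> = (k oo b') oo x'" using B V(3) K(2) by (simp add: Hom_def comp_assoc)
  also have "\<dots> = b oo x'" by (simp only: b'(2))
  finally show ?thesis using that V by blast
qed

lemma mono_epi_iso: assumes "mono_arr A f" "epi_arr A f" shows "iso_arr A f"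
proof -
  obtain g where g: "is_kernel A g f" using mono_is_kernel assms by blast
  note G = kernelD[OF g]
  have "g = Zero A (Cod A f) (Cod A g)"
    by (rule epi_cancel_zero[OF assms(2)]) (use G in auto)
  then have "g oo Id A (Cod A f) = Zero A (Cod A f) (Cod A g)" using G by (simp add: arr_simps)
  then obtain m where m: "m \<in> Hom A (Cod A f) (Dom A f)" "f oo m = Id A (Cod A f)"
    using kernel_lift[OF g, of "Id A (Cod A f)" "Cod A f"] G by (auto simp: Hom_def arr_simps)
  have "m oo f = Id A (Dom A f)"
    by (rule kernel_mono[OF g, of _ "Dom A f"])
      (use m G in \<open>auto simp: Hom_def arr_simps comp_assoc[symmetric]\<close>)
  then show ?thesis unfolding iso_arr_def using m G by blast
qed

end

section \<open>Calculus of right fractions\<close>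

text \<open>
  The class \<open>S\<close> is closed under right factors (\<open>S_cancel\<close>).  This makes both legs of every common
  refinement of two roofs members of \<open>S\<close>, which keeps the refinement arguments symmetric.
\<close>

locale fractions = preadditive_category C for C :: "('o, 'm) cat" +
  fixes S :: "'m set"
  assumes S_Arr: "s \<in> S \<Longrightarrow> s \<in> Arr C"
    and S_Id: "X \<in> Obj C \<Longrightarrow> Id C X \<in> S"
    and S_comp: "s \<in> S \<Longrightarrow> t \<in> S \<Longrightarrow> Cod C s = Dom C t \<Longrightarrow> Comp C t s \<in> S"
    and S_cancel: "s \<in> S \<Longrightarrow> u \<in> Arr C \<Longrightarrow> Cod C u = Dom C s \<Longrightarrow> Comp C s u \<in> S \<Longrightarrow> u \<in> S"
    and S_ore: "s \<in> S \<Longrightarrow> f \<in> Arr C \<Longrightarrow> Cod C f = Cod C s \<Longrightarrow>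
      \<exists>t f'. t \<in> S \<and> f' \<in> Arr C \<and> Dom C t = Dom C f' \<and> Cod C t = Dom C f \<and> Cod C f' = Dom C s \<and>
        Comp C f t = Comp C s f'"
    and S_null: "s \<in> S \<Longrightarrow> f \<in> Arr C \<Longrightarrow> Cod C f = Dom C s \<Longrightarrow>
      Comp C s f = Zero C (Dom C f) (Cod C s) \<Longrightarrow>
      \<exists>t \<in> S. Cod C t = Dom C f \<and> Comp C f t = Zero C (Dom C t) (Cod C f)"
begin

definition square :: "'m \<Rightarrow> 'm \<Rightarrow> 'm \<Rightarrow> 'm \<Rightarrow> bool" where
  "square f t a b \<longleftrightarrow> a \<in> S \<and> b \<in> Arr C \<and> Dom C a = Dom C b \<and> Cod C a = Dom C f \<and>
     Cod C b = Dom C t \<and> Comp C f a = Comp C t b"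

abbreviation L where "L \<equiv> localisation C S"

lemma ex_square: "t \<in> S \<Longrightarrow> f \<in> Arr C \<Longrightarrow> Cod C f = Cod C t \<Longrightarrow> \<exists>a b. square f t a b"
  using S_ore[of t f] unfolding square_def by metis

lemma comp_eq_comp:
  assumes "Comp C f a = Comp C t b" "f \<in> Arr C" "a \<in> Arr C" "t \<in> Arr C" "b \<in> Arr C" "c \<in> Arr C"
    "Cod C a = Dom C f" "Cod C b = Dom C t" "Cod C c = Dom C a" "Cod C c = Dom C b"
  shows "Comp C f (Comp C a c) = Comp C t (Comp C b c)"
  using assms comp_assoc[of c a f] comp_assoc[of c b t] by metis

lemma S_equal:
  assumes "s \<in> S" "f \<in> Arr C" "g \<in> Arr C" "Cod C f = Dom C s" "Cod C g = Dom C s"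
    "Dom C g = Dom C f" "Comp C s f = Comp C s g"
  shows "\<exists>t \<in> S. Cod C t = Dom C f \<and> Comp C f t = Comp C g t"
proof -
  have s: "s \<in> Arr C" using assms S_Arr by blast
  have e: "Comp C s (Plus C f (Neg C g)) = Zero C (Dom C f) (Cod C s)"
    by (rule eq_sgI) (use assms s in \<open>simp add: lin_simps\<close>)
  have "\<exists>t \<in> S. Cod C t = Dom C (Plus C f (Neg C g)) \<and>
      Comp C (Plus C f (Neg C g)) t = Zero C (Dom C t) (Cod C (Plus C f (Neg C g)))"
    by (rule S_null[OF assms(1)]) (use assms e in \<open>simp_all add: plus_arr neg_arr\<close>)
  then obtain t where t: "t \<in> S" "Cod C t = Dom C f"
      "Comp C (Plus C f (Neg C g)) t = Zero C (Dom C t) (Cod C g)"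
    using assms by (auto simp: plus_arr neg_arr)
  have "Plus C (Comp C f t) (Neg C (Comp C g t)) = Zero C (Dom C t) (Cod C g)"
    using t S_Arr[OF t(1)] assms(2-6) by (simp add: plus_comp neg_arr comp_neg)
  then have "Comp C f t = Comp C g t"
    using plus_neg_eq_zero_iff[of "Comp C f t" "Comp C g t"] t S_Arr[OF t(1)] assms(2-6)
    by (simp add: comp_arr)
  with t show ?thesis by blast
qed

lemma in_roofs:
  "(s, f) \<in> roofs C S X Y \<longleftrightarrow> s \<in> S \<and> f \<in> Arr C \<and> Dom C s = Dom C f \<and> Cod C s = X \<and> Cod C f = Y"
  using S_Arr by (auto simp: roofs_def)

lemma roofs_Obj: assumes "r \<in> roofs C S X Y" shows "X \<in> Obj C" "Y \<in> Obj C"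
  using assms by (auto simp: roofs_def Cod_Obj)

lemma roof_eqI:
  assumes "u \<in> Arr C" "v \<in> Arr C" "Dom C u = Dom C v" "Cod C u = Dom C s" "Cod C v = Dom C t"
    "Comp C s u = Comp C t v" "Comp C s u \<in> S" "Comp C f u = Comp C g v"
  shows "roof_eq C S (s, f) (t, g)"
  unfolding roof_eq_def prod.case
  by (rule exI[of _ "Dom C u"], rule bexI[of _ u], rule bexI[of _ v]) (use assms in \<open>auto simp: Hom_def\<close>)

lemma roof_eqE:
  assumes "roof_eq C S (s, f) (t, g)" "(s, f) \<in> roofs C S X Y" "(t, g) \<in> roofs C S X Y"
  obtains u v where "u \<in> S" "v \<in> S" "Dom C u = Dom C v" "Cod C u = Dom C s" "Cod C v = Dom C t"
    "Comp C s u = Comp C t v" "Comp C s u \<in> S" "Comp C f u = Comp C g v"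
proof -
  obtain u v where uv: "u \<in> Arr C" "v \<in> Arr C" "Dom C u = Dom C v" "Cod C u = Dom C s"
    "Cod C v = Dom C t" "Comp C s u = Comp C t v" "Comp C s u \<in> S" "Comp C f u = Comp C g v"
    using assms(1) by (auto simp: roof_eq_def Hom_def)
  have "u \<in> S" using S_cancel[of s u] uv assms(2) by (auto simp: in_roofs)
  moreover have "v \<in> S" using S_cancel[of t v] uv assms(3) by (auto simp: in_roofs)
  ultimately show ?thesis using that uv by blast
qed

lemma roof_eq_sym: assumes "roof_eq C S r r'" shows "roof_eq C S r' r"
  using assms unfolding roof_eq_def by (cases r; cases r') (simp; metis)

lemma refine_roof:
  assumes "(s, f) \<in> roofs C S X Y" "u \<in> S" "Cod C u = Dom C s"
  shows "(Comp C s u, Comp C f u) \<in> roofs C S X Y" "roof_eq C S (s, f) (Comp C s u, Comp C f u)"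
proof -
  have a: "s \<in> S" "f \<in> Arr C" "Dom C s = Dom C f" "Cod C s = X" "Cod C f = Y" "s \<in> Arr C" "u \<in> Arr C"
    using assms S_Arr by (auto simp: in_roofs)
  then have "Comp C s u \<in> S" using assms S_comp by auto
  with a assms show "(Comp C s u, Comp C f u) \<in> roofs C S X Y"
    by (simp add: in_roofs cat_simps)
  show "roof_eq C S (s, f) (Comp C s u, Comp C f u)"
    by (rule roof_eqI[of u "Id C (Dom C u)"])
      (use a assms \<open>Comp C s u \<in> S\<close> in \<open>simp_all add: cat_simps\<close>)
qed

lemma roof_eq_refl: assumes "r \<in> roofs C S X Y" shows "roof_eq C S r r"
proof (cases r)
  case (Pair s f)
  have "roof_eq C S (s, f) (s, f)"
    by (rule roof_eqI[of "Id C (Dom C s)" "Id C (Dom C s)"])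
      (use assms[unfolded Pair in_roofs] S_Arr[of s] in \<open>simp_all add: cat_simps\<close>)
  then show ?thesis using Pair by simp
qed

text \<open>
  Completing two refinements to a square gives a common one whose legs both lie in \<open>S\<close>, the second
  because \<open>S\<close> is closed under right factors.
\<close>

lemma common_refinement:
  assumes "t \<in> S" "v \<in> S" "w \<in> S" "Cod C v = Dom C t" "Cod C w = Dom C t"
  obtains a b where "a \<in> S" "b \<in> S" "Dom C a = Dom C b" "Cod C a = Dom C v" "Cod C b = Dom C w"
    "Comp C v a = Comp C w b"
proof -
  obtain a b where ab: "square v w a b" using ex_square[of w v] assms S_Arr by auto
  note ab = ab[unfolded square_def]
  have "Comp C w b \<in> S" using S_comp[of a v] ab assms by auto
  then have "b \<in> S" using S_cancel[of w b] ab assms by auto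
  with ab that show ?thesis by auto
qed

lemma roof_eq_trans:
  assumes "roof_eq C S r r'" "roof_eq C S r' r''"
    and r: "r \<in> roofs C S X Y" "r' \<in> roofs C S X Y" "r'' \<in> roofs C S X Y"
  shows "roof_eq C S r r''"
proof -
  obtain s f t g q h where e: "r = (s, f)" "r' = (t, g)" "r'' = (q, h)" by (metis surj_pair)
  note R = r[unfolded e in_roofs]
  have sA: "s \<in> Arr C" "t \<in> Arr C" "q \<in> Arr C" using R S_Arr by auto
  obtain u v where uv: "u \<in> S" "v \<in> S" "Dom C u = Dom C v" "Cod C u = Dom C s" "Cod C v = Dom C t"
    "Comp C s u = Comp C t v" "Comp C s u \<in> S" "Comp C f u = Comp C g v"
    using roof_eqE assms(1) r unfolding e by metis
  obtain w z where wz: "w \<in> S" "z \<in> S" "Dom C w = Dom C z" "Cod C w = Dom C t" "Cod C z = Dom C q"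
    "Comp C t w = Comp C q z" "Comp C t w \<in> S" "Comp C g w = Comp C h z"
    using roof_eqE assms(2) r unfolding e by metis
  obtain a b where ab: "a \<in> S" "b \<in> S" "Dom C a = Dom C b" "Cod C a = Dom C v" "Cod C b = Dom C w"
    "Comp C v a = Comp C w b"
    using common_refinement[of t v w] R uv wz by metis
  have A: "u \<in> Arr C" "v \<in> Arr C" "w \<in> Arr C" "z \<in> Arr C" "a \<in> Arr C" "b \<in> Arr C"
    using uv(1,2) wz(1,2) ab(1,2) S_Arr by auto
  have 1: "Comp C s (Comp C u a) = Comp C q (Comp C z b)"
    using comp_eq_comp[OF uv(6), of a] comp_eq_comp[OF wz(6), of b] R uv(1-5) wz(1-5) ab A sA by simp
  have 2: "Comp C f (Comp C u a) = Comp C h (Comp C z b)"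
    using comp_eq_comp[OF uv(8), of a] comp_eq_comp[OF wz(8), of b] R uv(1-5) wz(1-5) ab A by simp
  have 3: "Comp C s (Comp C u a) \<in> S"
    using S_comp[of a "Comp C s u"] uv(1-5,7) ab(1-5) A R sA by (simp add: cat_simps)
  show ?thesis unfolding e
    by (rule roof_eqI[of "Comp C u a" "Comp C z b"])
      (use 1 2 3 uv(1-5) wz(1-5) ab(1-5) A in \<open>simp_all add: cat_simps\<close>)
qed

text \<open>
  Composition of roofs does not depend on the completion of the inner square: two completions have a
  common refinement on the side of \<open>f\<close>, and what remains on the side of \<open>t\<close> is equalised by a
  further refinement, since \<open>t\<close> lies in \<open>S\<close>.
\<close>

lemma square_indep:
  assumes sq: "square f t a b" "square f t a' b'"
    and r: "(s, f) \<in> roofs C S X Y" "(t, g) \<in> roofs C S Y Z"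
  shows "roof_eq C S (Comp C s a, Comp C g b) (Comp C s a', Comp C g b')"
proof -
  note sq = sq[unfolded square_def] and r = r[unfolded in_roofs]
  have A0: "s \<in> Arr C" "t \<in> Arr C" "a \<in> Arr C" "a' \<in> Arr C" using r sq S_Arr by auto
  obtain p q where pq: "p \<in> S" "q \<in> S" "Dom C p = Dom C q" "Cod C p = Dom C a" "Cod C q = Dom C a'"
    "Comp C a p = Comp C a' q" using common_refinement[of s a a'] sq r by metis
  have A1: "p \<in> Arr C" "q \<in> Arr C" using pq(1,2) S_Arr by auto
  have "Comp C t (Comp C b p) = Comp C f (Comp C a p)"
    using sq r A0 A1 pq(1-5) comp_eq_comp[of f a t b p] by simp
  also have "\<dots> = Comp C t (Comp C b' q)"
    using sq r A0 A1 pq comp_eq_comp[of f a' t b' q] by simp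
  finally have "\<exists>c\<in>S. Cod C c = Dom C (Comp C b p) \<and> Comp C (Comp C b p) c = Comp C (Comp C b' q) c"
    by (intro S_equal[of t]) (use r sq A0 A1 pq(1-5) in \<open>auto simp: cat_simps\<close>)
  then obtain c where c: "c \<in> S" "Cod C c = Dom C p" "Comp C b (Comp C p c) = Comp C b' (Comp C q c)"
    using r sq A0 A1 pq(1-5) S_Arr by (auto simp: cat_simps)
  have Ac: "c \<in> Arr C" using c S_Arr by auto
  have e: "Comp C a (Comp C p c) = Comp C a' (Comp C q c)"
    using comp_eq_comp[OF pq(6), of c] A0 A1 Ac pq(1-5) c(2) sq by simp
  have sa: "Comp C s (Comp C a (Comp C p c)) \<in> S"
    using c(1,2) pq(1-5) sq r A0 A1 Ac by (intro S_comp) (auto simp: cat_simps)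
  show ?thesis
    by (rule roof_eqI[of "Comp C p c" "Comp C q c"])
      (use e sa c pq(1-5) sq r A0 A1 Ac in \<open>simp_all add: cat_simps\<close>)
qed

lemma square_roof:
  assumes "square f t a b" "(s, f) \<in> roofs C S X Y" "(t, g) \<in> roofs C S Y Z"
  shows "(Comp C s a, Comp C g b) \<in> roofs C S X Z"
  using assms S_comp[of a s] S_Arr unfolding square_def in_roofs by (auto simp: cat_simps)

lemma square_refine1:
  assumes "square (Comp C f u) t a b" "u \<in> S" "Cod C u = Dom C f" "f \<in> Arr C"
  shows "square f t (Comp C u a) b"
  using assms S_comp[of a u] S_Arr unfolding square_def by (auto simp: cat_simps)

lemma square_refine2:
  assumes "square f (Comp C t u) a b" "u \<in> S" "Cod C u = Dom C t" "t \<in> Arr C"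
  shows "square f t a (Comp C u b)"
  using assms S_Arr unfolding square_def by (auto simp: cat_simps)

lemma square_eq1:
  assumes sq: "square f t a b" "square (Comp C f u) t a' b'" and u: "u \<in> S" "Cod C u = Dom C f"
    and r: "(s, f) \<in> roofs C S X Y" "(t, g) \<in> roofs C S Y Z"
  shows "roof_eq C S (Comp C s a, Comp C g b) (Comp C (Comp C s u) a', Comp C g b')"
  using square_indep[OF sq(1) square_refine1[OF sq(2) u] r] r u sq(2) S_Arr
  unfolding square_def in_roofs by (auto simp: cat_simps)

lemma square_eq2:
  assumes sq: "square f t a b" "square f (Comp C t u) a' b'" and u: "u \<in> S" "Cod C u = Dom C t"
    and r: "(s, f) \<in> roofs C S X Y" "(t, g) \<in> roofs C S Y Z"
  shows "roof_eq C S (Comp C s a, Comp C g b) (Comp C s a', Comp C (Comp C g u) b')"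
  using square_indep[OF sq(1) square_refine2[OF sq(2) u] r] r u sq(2) S_Arr
  unfolding square_def in_roofs by (auto simp: cat_simps)

lemma square_cong1:
  assumes sq: "square f t a b" "square f1 t a1 b1" and e: "roof_eq C S (s, f) (s1, f1)"
    and r: "(s, f) \<in> roofs C S X Y" "(s1, f1) \<in> roofs C S X Y" "(t, g) \<in> roofs C S Y Z"
  shows "roof_eq C S (Comp C s a, Comp C g b) (Comp C s1 a1, Comp C g b1)"
proof -
  obtain u v where uv: "u \<in> S" "v \<in> S" "Dom C u = Dom C v" "Cod C u = Dom C s" "Cod C v = Dom C s1"
    "Comp C s u = Comp C s1 v" "Comp C s u \<in> S" "Comp C f u = Comp C f1 v"
    using roof_eqE[OF e r(1,2)] by metis
  note R = r[unfolded in_roofs]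
  obtain a' b' where sq': "square (Comp C f u) t a' b'"
    using ex_square[of t "Comp C f u"] uv R S_Arr by (auto simp: cat_simps)
  have 1: "roof_eq C S (Comp C s a, Comp C g b) (Comp C (Comp C s u) a', Comp C g b')"
    by (rule square_eq1[OF sq(1) sq' _ _ r(1,3)]) (use uv R in auto)
  have 2: "roof_eq C S (Comp C s1 a1, Comp C g b1) (Comp C (Comp C s u) a', Comp C g b')"
    unfolding uv(6) by (rule square_eq1[OF sq(2) sq'[unfolded uv(8)] _ _ r(2,3)]) (use uv R in auto)
  show ?thesis
    by (rule roof_eq_trans[OF 1 roof_eq_sym[OF 2]])
      (use square_roof[OF sq(1) r(1,3)] square_roof[OF sq(2) r(2,3)]
        square_roof[OF sq' refine_roof(1)[OF r(1) uv(1)] r(3)] uv in auto)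
qed

lemma square_cong2:
  assumes sq: "square f t a b" "square f t1 a1 b1" and e: "roof_eq C S (t, g) (t1, g1)"
    and r: "(s, f) \<in> roofs C S X Y" "(t, g) \<in> roofs C S Y Z" "(t1, g1) \<in> roofs C S Y Z"
  shows "roof_eq C S (Comp C s a, Comp C g b) (Comp C s a1, Comp C g1 b1)"
proof -
  obtain u v where uv: "u \<in> S" "v \<in> S" "Dom C u = Dom C v" "Cod C u = Dom C t" "Cod C v = Dom C t1"
    "Comp C t u = Comp C t1 v" "Comp C t u \<in> S" "Comp C g u = Comp C g1 v"
    using roof_eqE[OF e r(2,3)] by metis
  note R = r[unfolded in_roofs]
  obtain a' b' where sq': "square f (Comp C t u) a' b'"
    using ex_square[of "Comp C t u" f] uv R S_Arr by (auto simp: cat_simps)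
  have 1: "roof_eq C S (Comp C s a, Comp C g b) (Comp C s a', Comp C (Comp C g u) b')"
    by (rule square_eq2[OF sq(1) sq' _ _ r(1,2)]) (use uv R in auto)
  have 2: "roof_eq C S (Comp C s a1, Comp C g1 b1) (Comp C s a', Comp C (Comp C g u) b')"
    unfolding uv(8) by (rule square_eq2[OF sq(2) sq'[unfolded uv(6)] _ _ r(1,3)]) (use uv R in auto)
  show ?thesis
    by (rule roof_eq_trans[OF 1 roof_eq_sym[OF 2]])
      (use square_roof[OF sq(1) r(1,2)] square_roof[OF sq(2) r(1,3)]
        square_roof[OF sq' r(1) refine_roof(1)[OF r(2) uv(1)]] uv in auto)
qed

abbreviation cls where "cls \<equiv> roof_class C S"

lemma cls_eq_iff:
  assumes "r \<in> roofs C S X Y" "r' \<in> roofs C S X Y"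
  shows "cls X Y r = cls X Y r' \<longleftrightarrow> roof_eq C S r r'"
proof
  assume "cls X Y r = cls X Y r'"
  then have "r' \<in> {q \<in> roofs C S X Y. roof_eq C S r q}"
    using assms roof_eq_refl[OF assms(2)] by (auto simp: roof_class_def)
  then show "roof_eq C S r r'" by auto
next
  assume "roof_eq C S r r'"
  then show "cls X Y r = cls X Y r'"
    using assms roof_eq_trans roof_eq_sym unfolding roof_class_def by blast
qed

lemma cls_Hom: "r \<in> roofs C S X Y \<Longrightarrow> cls X Y r \<in> Hom L X Y"
  using roofs_Obj[of r X Y] by (cases r) (auto simp: Hom_def localisation_def roof_class_def)

lemma HomE:
  assumes "\<phi> \<in> Hom L X Y"
  obtains s f where "(s, f) \<in> roofs C S X Y" "\<phi> = cls X Y (s, f)"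
  using assms by (auto simp: Hom_def localisation_def roof_class_def)

lemma Comp_cls:
  assumes sq: "square f t a b" and r: "(s, f) \<in> roofs C S X Y" "(t, g) \<in> roofs C S Y Z"
  shows "Comp L (cls Y Z (t, g)) (cls X Y (s, f)) = cls X Z (Comp C s a, Comp C g b)"
proof -
  have "(\<exists>s' f' t' g' a' b'. (s', f') \<in> roofs C S X Y \<and> roof_eq C S (s, f) (s', f') \<and>
      (t', g') \<in> roofs C S Y Z \<and> roof_eq C S (t, g) (t', g') \<and> a' \<in> S \<and>
      a' \<in> Hom C (Dom C b') (Dom C f') \<and> b' \<in> Hom C (Dom C a') (Dom C t') \<and>
      Comp C f' a' = Comp C t' b' \<and> roof_eq C S (Comp C s' a', Comp C g' b') q)
    \<longleftrightarrow> roof_eq C S (Comp C s a, Comp C g b) q" if q: "q \<in> roofs C S X Z" for q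
  proof
    assume "\<exists>s' f' t' g' a' b'. (s', f') \<in> roofs C S X Y \<and> roof_eq C S (s, f) (s', f') \<and>
      (t', g') \<in> roofs C S Y Z \<and> roof_eq C S (t, g) (t', g') \<and> a' \<in> S \<and>
      a' \<in> Hom C (Dom C b') (Dom C f') \<and> b' \<in> Hom C (Dom C a') (Dom C t') \<and>
      Comp C f' a' = Comp C t' b' \<and> roof_eq C S (Comp C s' a', Comp C g' b') q"
    then obtain s' f' t' g' a' b' where h: "(s', f') \<in> roofs C S X Y" "roof_eq C S (s, f) (s', f')"
      "(t', g') \<in> roofs C S Y Z" "roof_eq C S (t, g) (t', g')" "a' \<in> S"
      "a' \<in> Hom C (Dom C b') (Dom C f')" "b' \<in> Hom C (Dom C a') (Dom C t')"
      "Comp C f' a' = Comp C t' b'" and e: "roof_eq C S (Comp C s' a', Comp C g' b') q" by blast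
    then have sq': "square f' t' a' b'" by (auto simp: square_def Hom_def)
    obtain a'' b'' where sq'': "square f t' a'' b''"
      using ex_square[of t' f] h r by (auto simp: in_roofs)
    note R = square_roof[OF sq r] square_roof[OF sq'' r(1) h(3)] square_roof[OF sq' h(1,3)]
    show "roof_eq C S (Comp C s a, Comp C g b) q"
      using roof_eq_trans[OF roof_eq_trans[OF square_cong2[OF sq sq'' h(4) r(1,2) h(3)]
        square_cong1[OF sq'' sq' h(2) r(1) h(1,3)]] e] R q by blast
  next
    assume "roof_eq C S (Comp C s a, Comp C g b) q"
    with sq r roof_eq_refl[OF r(1)] roof_eq_refl[OF r(2)]
    show "\<exists>s' f' t' g' a' b'. (s', f') \<in> roofs C S X Y \<and> roof_eq C S (s, f) (s', f') \<and>
      (t', g') \<in> roofs C S Y Z \<and> roof_eq C S (t, g) (t', g') \<and> a' \<in> S \<and>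
      a' \<in> Hom C (Dom C b') (Dom C f') \<and> b' \<in> Hom C (Dom C a') (Dom C t') \<and>
      Comp C f' a' = Comp C t' b' \<and> roof_eq C S (Comp C s' a', Comp C g' b') q"
      using S_Arr unfolding square_def Hom_def by fastforce
  qed
  then show ?thesis
    unfolding localisation_def roof_class_def by (simp add: conj_assoc cong: conj_cong) 
qed

lemma Plus_cls:
  assumes r: "(s, f) \<in> roofs C S X Y" "(s, g) \<in> roofs C S X Y"
  shows "Plus L (cls X Y (s, f)) (cls X Y (s, g)) = cls X Y (s, Plus C f g)"
proof -
  have rp: "(s, Plus C f g) \<in> roofs C S X Y" using r by (auto simp: in_roofs plus_arr)
  have eq: "roof_eq C S (s, Plus C f g) (s1, Plus C f1 g1)"
    if h: "(s1, f1) \<in> roofs C S X Y" "roof_eq C S (s, f) (s1, f1)"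
      "(s1, g1) \<in> roofs C S X Y" "roof_eq C S (s, g) (s1, g1)" for s1 f1 g1
  proof -
    note R = r[unfolded in_roofs] h(1,3)[unfolded in_roofs]
    obtain u v where uv: "u \<in> S" "v \<in> S" "Dom C u = Dom C v" "Cod C u = Dom C s" "Cod C v = Dom C s1"
      "Comp C s u = Comp C s1 v" "Comp C s u \<in> S" "Comp C f u = Comp C f1 v"
      using roof_eqE[OF h(2) r(1) h(1)] by metis
    obtain w z where wz: "w \<in> S" "z \<in> S" "Dom C w = Dom C z" "Cod C w = Dom C s" "Cod C z = Dom C s1"
      "Comp C s w = Comp C s1 z" "Comp C s w \<in> S" "Comp C g w = Comp C g1 z"
      using roof_eqE[OF h(4) r(2) h(3)] by metis
    obtain a b where ab: "a \<in> S" "b \<in> S" "Dom C a = Dom C b" "Cod C a = Dom C u" "Cod C b = Dom C w"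
      "Comp C u a = Comp C w b" using common_refinement[of s u w] uv wz R by metis
    have A: "s \<in> Arr C" "s1 \<in> Arr C" "u \<in> Arr C" "v \<in> Arr C" "w \<in> Arr C" "z \<in> Arr C" "a \<in> Arr C"
      "b \<in> Arr C" using uv(1,2) wz(1,2) ab(1,2) R S_Arr by auto
    have 1: "Comp C s1 (Comp C v a) = Comp C s (Comp C u a)"
      using comp_eq_comp[OF uv(6), of a] A R uv(1-5) ab(1-5) by simp
    have 2: "Comp C s1 (Comp C z b) = Comp C s (Comp C w b)"
      using comp_eq_comp[OF wz(6), of b] A R wz(1-5) ab(1-5) by simp
    have "\<exists>c\<in>S. Cod C c = Dom C (Comp C v a) \<and> Comp C (Comp C v a) c = Comp C (Comp C z b) c"
      by (rule S_equal[of s1]) (use 1 2 ab uv(1-5) wz(1-5) R A in \<open>simp_all add: comp_arr\<close>)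
    then obtain c where c: "c \<in> S" "Cod C c = Dom C a" "Comp C v (Comp C a c) = Comp C z (Comp C b c)"
      using ab(1-5) uv(1-5) wz(1-5) A S_Arr by (auto simp: cat_simps)
    have Ac: "c \<in> Arr C" using c S_Arr by auto
    have e: "Comp C u (Comp C a c) = Comp C w (Comp C b c)"
      using comp_eq_comp[OF ab(6), of c] A Ac uv(1-5) wz(1-5) ab(1-5) c(2) by simp
    have k1: "Comp C s (Comp C u (Comp C a c)) = Comp C s1 (Comp C v (Comp C a c))"
      using comp_eq_comp[OF uv(6), of "Comp C a c"] A Ac R uv(1-5) ab(1-5) c(2) by (simp add: comp_arr)
    have k2: "Comp C f (Comp C u (Comp C a c)) = Comp C f1 (Comp C v (Comp C a c))"
      using comp_eq_comp[OF uv(8), of "Comp C a c"] A Ac R uv(1-5) ab(1-5) c(2) by (simp add: comp_arr)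
    have k3: "Comp C g (Comp C u (Comp C a c)) = Comp C g1 (Comp C v (Comp C a c))"
      unfolding e c(3)
      using comp_eq_comp[OF wz(8), of "Comp C b c"] A Ac R wz(1-5) ab(1-5) c(2) by (simp add: comp_arr)
    have k4: "Comp C (Comp C (Comp C s u) a) c \<in> S"
      using uv(1-5,7) ab(1-5) c(1,2) A Ac R by (intro S_comp) (auto simp: comp_arr)
    show ?thesis
      by (rule roof_eqI[of "Comp C u (Comp C a c)" "Comp C v (Comp C a c)"])
        (use k1 k2 k3 k4 uv(1-5) ab(1-5) c(1,2) A Ac R in \<open>simp_all add: plus_comp cat_simps\<close>)
  qed
  have "(\<exists>s1 f1 g1. (s1, f1) \<in> roofs C S X Y \<and> roof_eq C S (s, f) (s1, f1) \<and>
      (s1, g1) \<in> roofs C S X Y \<and> roof_eq C S (s, g) (s1, g1) \<and> roof_eq C S (s1, Plus C f1 g1) q)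
    \<longleftrightarrow> roof_eq C S (s, Plus C f g) q" if q: "q \<in> roofs C S X Y" for q
  proof
    assume "\<exists>s1 f1 g1. (s1, f1) \<in> roofs C S X Y \<and> roof_eq C S (s, f) (s1, f1) \<and>
      (s1, g1) \<in> roofs C S X Y \<and> roof_eq C S (s, g) (s1, g1) \<and> roof_eq C S (s1, Plus C f1 g1) q"
    then obtain s1 f1 g1 where h: "(s1, f1) \<in> roofs C S X Y" "roof_eq C S (s, f) (s1, f1)"
      "(s1, g1) \<in> roofs C S X Y" "roof_eq C S (s, g) (s1, g1)" "roof_eq C S (s1, Plus C f1 g1) q"
      by blast
    have "(s1, Plus C f1 g1) \<in> roofs C S X Y" using h by (auto simp: in_roofs plus_arr)
    then show "roof_eq C S (s, Plus C f g) q"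
      using roof_eq_trans[OF eq[OF h(1-4)] h(5)] rp q by blast
  next
    assume "roof_eq C S (s, Plus C f g) q"
    with r roof_eq_refl[OF r(1)] roof_eq_refl[OF r(2)]
    show "\<exists>s1 f1 g1. (s1, f1) \<in> roofs C S X Y \<and> roof_eq C S (s, f) (s1, f1) \<and>
      (s1, g1) \<in> roofs C S X Y \<and> roof_eq C S (s, g) (s1, g1) \<and> roof_eq C S (s1, Plus C f1 g1) q"
      by blast
  qed
  then show ?thesis
    unfolding localisation_def roof_class_def by (simp add: conj_assoc cong: conj_cong)
qed

lemma common_denominator:
  assumes "\<phi> \<in> Hom L X Y" "\<psi> \<in> Hom L X Z"
  obtains s f g where "(s, f) \<in> roofs C S X Y" "(s, g) \<in> roofs C S X Z"
    "\<phi> = cls X Y (s, f)" "\<psi> = cls X Z (s, g)"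
proof -
  obtain s f where f: "(s, f) \<in> roofs C S X Y" "\<phi> = cls X Y (s, f)" using HomE[OF assms(1)] .
  obtain t g where g: "(t, g) \<in> roofs C S X Z" "\<psi> = cls X Z (t, g)" using HomE[OF assms(2)] .
  obtain a b where ab: "square s t a b" using ex_square[of t s] f g S_Arr by (auto simp: in_roofs)
  note R = f(1)[unfolded in_roofs] g(1)[unfolded in_roofs] ab[unfolded square_def]
  have "Comp C t b \<in> S" using S_comp[of a s] R by auto
  then have b: "b \<in> S" using S_cancel[of t b] R by auto
  have 1: "(Comp C s a, Comp C f a) \<in> roofs C S X Y" "\<phi> = cls X Y (Comp C s a, Comp C f a)"
    using refine_roof[OF f(1), of a] R f(2) cls_eq_iff[OF f(1)] by auto
  have 2: "(Comp C s a, Comp C g b) \<in> roofs C S X Z" "\<psi> = cls X Z (Comp C s a, Comp C g b)"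
    using refine_roof[OF g(1), of b] R b g(2) cls_eq_iff[OF g(1)] by auto
  show ?thesis using that[OF 1(1) 2(1) 1(2) 2(2)] .
qed

lemma Id_cls: "Id L X = cls X X (Id C X, Id C X)"
  and Zero_cls: "Zero L X Y = cls X Y (Id C X, Zero C X Y)"
  and Obj_L: "Obj L = Obj C"
  by (simp_all add: localisation_def)

lemma Zero_cls':
  assumes "s \<in> S" "Cod C s = X" "Y \<in> Obj C"
  shows "(s, Zero C (Dom C s) Y) \<in> roofs C S X Y" "Zero L X Y = cls X Y (s, Zero C (Dom C s) Y)"
proof -
  have a: "s \<in> Arr C" "Dom C s \<in> Obj C" "X \<in> Obj C" using assms S_Arr Dom_Obj Cod_Obj by auto
  have r: "(Id C X, Zero C X Y) \<in> roofs C S X Y" using a assms S_Id by (simp add: in_roofs arr_simps)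
  have "Comp C (Id C X) s = s" "Comp C (Zero C X Y) s = Zero C (Dom C s) Y"
    using a assms by (auto simp: arr_simps)
  then show "(s, Zero C (Dom C s) Y) \<in> roofs C S X Y" "Zero L X Y = cls X Y (s, Zero C (Dom C s) Y)"
    using refine_roof[OF r assms(1)] a assms cls_eq_iff[OF r] by (auto simp: Zero_cls arr_simps)
qed

theorem localisation_preadditive: "preadditive_category L"
proof
  show "Dom L f \<in> Obj L" "Cod L f \<in> Obj L" if hyp: "f \<in> Arr L" for f
    using hyp by (auto simp: localisation_def roof_class_def)
  show I: "Id L X \<in> Hom L X X" if hyp: "X \<in> Obj L" for X
    unfolding Id_cls using hyp by (intro cls_Hom) (auto simp: Obj_L in_roofs S_Id id_arr)
  show CH: "Comp L g f \<in> Hom L X Z" if hyp: "f \<in> Hom L X Y" "g \<in> Hom L Y Z" for f g X Y Z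
  proof -
    obtain s f' where f: "(s, f') \<in> roofs C S X Y" "f = cls X Y (s, f')" using HomE[OF hyp(1)] .
    obtain t g' where g: "(t, g') \<in> roofs C S Y Z" "g = cls Y Z (t, g')" using HomE[OF hyp(2)] .
    obtain a b where ab: "square f' t a b" using ex_square[of t f'] f g by (auto simp: in_roofs)
    show ?thesis unfolding f g Comp_cls[OF ab f(1) g(1)] by (rule cls_Hom[OF square_roof[OF ab f(1) g(1)]])
  qed
  show "Comp L f (Id L X) = f" if hyp: "f \<in> Hom L X Y" for f X Y
  proof -
    obtain s f' where f: "(s, f') \<in> roofs C S X Y" "f = cls X Y (s, f')" using HomE[OF hyp] .
    note R = f(1)[unfolded in_roofs]
    have X: "X \<in> Obj C" using roofs_Obj f by blast
    have sq: "square (Id C X) s s (Id C (Dom C s))"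
      using R X S_Arr[of s] by (auto simp: square_def cat_simps)
    have r: "(Id C X, Id C X) \<in> roofs C S X X" using X by (auto simp: in_roofs S_Id id_arr)
    show ?thesis unfolding Id_cls f Comp_cls[OF sq r f(1)] using R S_Arr[of s] by (auto simp: cat_simps)
  qed
  show "Comp L (Id L Y) f = f" if hyp: "f \<in> Hom L X Y" for f X Y
  proof -
    obtain s f' where f: "(s, f') \<in> roofs C S X Y" "f = cls X Y (s, f')" using HomE[OF hyp] .
    note R = f(1)[unfolded in_roofs]
    have X: "Y \<in> Obj C" using roofs_Obj f by blast
    have sq: "square f' (Id C Y) (Id C (Dom C s)) f'"
      using R X S_Arr[of s] S_Id Dom_Obj[of f'] by (auto simp: square_def cat_simps)
    have r: "(Id C Y, Id C Y) \<in> roofs C S Y Y" using X by (auto simp: in_roofs S_Id id_arr)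
    show ?thesis unfolding Id_cls f Comp_cls[OF sq f(1) r] using R S_Arr[of s] by (auto simp: cat_simps)
  qed
  show "Comp L h (Comp L g f) = Comp L (Comp L h g) f"
    if hyp: "f \<in> Hom L W X" "g \<in> Hom L X Y" "h \<in> Hom L Y Z" for f g h W X Y Z
  proof -
    obtain s f' where f: "(s, f') \<in> roofs C S W X" "f = cls W X (s, f')" using HomE[OF hyp(1)] .
    obtain t g' where g: "(t, g') \<in> roofs C S X Y" "g = cls X Y (t, g')" using HomE[OF hyp(2)] .
    obtain r h' where h: "(r, h') \<in> roofs C S Y Z" "h = cls Y Z (r, h')" using HomE[OF hyp(3)] .
    note R = f(1)[unfolded in_roofs] g(1)[unfolded in_roofs] h(1)[unfolded in_roofs]
    have A: "s \<in> Arr C" "t \<in> Arr C" "r \<in> Arr C" using R S_Arr by auto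
    obtain e k where ek: "square g' r e k" using ex_square[of r g'] R by auto
    note rt = square_roof[OF ek g(1) h(1)]
    obtain l m where lm: "square f' (Comp C t e) l m"
      using ex_square[of "Comp C t e" f'] rt R by (auto simp: in_roofs)
    note E = ek[unfolded square_def] lm[unfolded square_def]
    have A': "e \<in> Arr C" "l \<in> Arr C" using E S_Arr by auto
    have sq: "square f' t l (Comp C e m)" by (rule square_refine2[OF lm]) (use E R A in auto)
    note rs = square_roof[OF sq f(1) g(1)]
    have sq2: "square (Comp C g' (Comp C e m)) r (Id C (Dom C l)) (Comp C k m)"
      using E R A A' S_Id Dom_Obj[of m] comp_eq_comp[of g' e r k m]
      by (simp add: square_def cat_simps)
    show ?thesis
      unfolding f g h Comp_cls[OF sq f(1) g(1)] Comp_cls[OF ek g(1) h(1)] Comp_cls[OF sq2 rs h(1)]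
        Comp_cls[OF lm f(1) rt]
      using E R A A' by (simp add: cat_simps)
  qed
  show PH: "Plus L f g \<in> Hom L X Y" if hyp: "f \<in> Hom L X Y" "g \<in> Hom L X Y" for f g X Y
  proof -
    obtain s f' g' where f: "(s, f') \<in> roofs C S X Y" "(s, g') \<in> roofs C S X Y"
      "f = cls X Y (s, f')" "g = cls X Y (s, g')" using common_denominator[OF hyp] .
    have "(s, Plus C f' g') \<in> roofs C S X Y" using f by (auto simp: in_roofs plus_arr)
    then show ?thesis unfolding f Plus_cls[OF f(1,2)] by (rule cls_Hom)
  qed
  show "Plus L f g = Plus L g f" if hyp: "f \<in> Hom L X Y" "g \<in> Hom L X Y" for f g X Y
  proof -
    obtain s f' g' where f: "(s, f') \<in> roofs C S X Y" "(s, g') \<in> roofs C S X Y"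
      "f = cls X Y (s, f')" "g = cls X Y (s, g')" using common_denominator[OF hyp] .
    show ?thesis unfolding f Plus_cls[OF f(1,2)] Plus_cls[OF f(2,1)]
      using f plus_commute[of f' g'] by (auto simp: in_roofs)
  qed
  show "Plus L (Plus L f g) h = Plus L f (Plus L g h)"
    if hyp: "f \<in> Hom L X Y" "g \<in> Hom L X Y" "h \<in> Hom L X Y" for f g h X Y
  proof -
    obtain s f' g' where f: "(s, f') \<in> roofs C S X Y" "(s, g') \<in> roofs C S X Y"
      "f = cls X Y (s, f')" "g = cls X Y (s, g')" using common_denominator[OF hyp(1,2)] .
    obtain t h' where h: "(t, h') \<in> roofs C S X Y" "h = cls X Y (t, h')" using HomE[OF hyp(3)] .
    obtain a b where ab: "square s t a b" using ex_square[of t s] f h S_Arr by (auto simp: in_roofs)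
    note R = f(1,2)[unfolded in_roofs] h(1)[unfolded in_roofs] ab[unfolded square_def]
    have "Comp C t b \<in> S" using S_comp[of a s] R by auto
    then have b: "b \<in> S" using S_cancel[of t b] R by auto
    define q f2 g2 h2 where "q = Comp C s a" "f2 = Comp C f' a" "g2 = Comp C g' a" "h2 = Comp C h' b"
    have r: "(q, f2) \<in> roofs C S X Y" "(q, g2) \<in> roofs C S X Y" "(q, h2) \<in> roofs C S X Y"
      using refine_roof(1)[OF f(1), of a] refine_roof(1)[OF f(2), of a] refine_roof(1)[OF h(1), of b] R b
      by (auto simp: q_f2_g2_h2_def)
    then have rp: "(q, Plus C f2 g2) \<in> roofs C S X Y" "(q, Plus C g2 h2) \<in> roofs C S X Y"
      by (auto simp: in_roofs plus_arr)
    have e: "f = cls X Y (q, f2)" "g = cls X Y (q, g2)" "h = cls X Y (q, h2)"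
      unfolding f h using refine_roof(2)[OF f(1), of a] refine_roof(2)[OF f(2), of a]
        refine_roof(2)[OF h(1), of b] R b cls_eq_iff[OF f(1) r(1)] cls_eq_iff[OF f(2) r(2)] cls_eq_iff[OF h(1) r(3)]
      by (auto simp: q_f2_g2_h2_def)
    have "Plus C (Plus C f2 g2) h2 = Plus C f2 (Plus C g2 h2)"
      by (rule plus_assoc) (use r in \<open>auto simp: in_roofs\<close>)
    then show ?thesis
      unfolding e Plus_cls[OF r(1,2)] Plus_cls[OF r(2,3)] Plus_cls[OF rp(1) r(3)] Plus_cls[OF r(1) rp(2)]
      by simp
  qed
  show ZH: "Zero L X Y \<in> Hom L X Y" if hyp: "X \<in> Obj L" "Y \<in> Obj L" for X Y
    unfolding Zero_cls using hyp by (intro cls_Hom) (auto simp: Obj_L in_roofs S_Id arr_simps)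
  show "Plus L f (Zero L X Y) = f" if hyp: "f \<in> Hom L X Y" for f X Y
  proof -
    obtain s f' where f: "(s, f') \<in> roofs C S X Y" "f = cls X Y (s, f')" using HomE[OF hyp] .
    note R = f(1)[unfolded in_roofs]
    have z: "(s, Zero C (Dom C s) Y) \<in> roofs C S X Y" "Zero L X Y = cls X Y (s, Zero C (Dom C s) Y)"
      using Zero_cls'[of s X Y] R roofs_Obj[OF f(1)] by auto
    show ?thesis unfolding z f Plus_cls[OF f(1) z(1)] using R plus_zero[of f' "Dom C s" Y] by auto
  qed
  show "\<exists>g\<in>Hom L X Y. Plus L f g = Zero L X Y" if hyp: "f \<in> Hom L X Y" for f X Y
  proof -
    obtain s f' where f: "(s, f') \<in> roofs C S X Y" "f = cls X Y (s, f')" using HomE[OF hyp] .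
    note R = f(1)[unfolded in_roofs]
    have r: "(s, Neg C f') \<in> roofs C S X Y" using R by (auto simp: in_roofs neg_arr)
    have "Plus L f (cls X Y (s, Neg C f')) = Zero L X Y"
      unfolding f Plus_cls[OF f(1) r] using Zero_cls'[of s X Y] R roofs_Obj[OF f(1)] plus_neg[of f'] by auto
    then show ?thesis using cls_Hom[OF r] by blast
  qed
  show "Comp L g (Plus L f f') = Plus L (Comp L g f) (Comp L g f')"
    if h: "f \<in> Hom L X Y" "f' \<in> Hom L X Y" "g \<in> Hom L Y Z" for f f' g X Y Z
  proof -
    obtain s a b where f: "(s, a) \<in> roofs C S X Y" "(s, b) \<in> roofs C S X Y"
      "f = cls X Y (s, a)" "f' = cls X Y (s, b)" using common_denominator[OF h(1,2)] .
    obtain t c where g: "(t, c) \<in> roofs C S Y Z" "g = cls Y Z (t, c)" using HomE[OF h(3)] .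
    note R = f(1,2)[unfolded in_roofs] g(1)[unfolded in_roofs]
    obtain p q where pq: "square a t p q" using ex_square[of t a] R by auto
    note P = pq[unfolded square_def]
    have A: "s \<in> Arr C" "t \<in> Arr C" "p \<in> Arr C" using R P S_Arr by auto
    obtain p2 q2 where pq2: "square (Comp C b p) t p2 q2"
      using ex_square[of t "Comp C b p"] R P A by (auto simp: comp_arr)
    note P2 = pq2[unfolded square_def]
    have A2: "p2 \<in> Arr C" using P2 S_Arr by auto
    have P3: "Cod C p2 = Dom C p" "Comp C b (Comp C p p2) = Comp C t q2" "q2 \<in> Arr C" "Dom C p2 = Dom C q2"
      "Cod C q2 = Dom C t" using P2 P R A A2 by (auto simp: cat_simps)
    have e1: "Comp C a (Comp C p p2) = Comp C t (Comp C q p2)"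
      by (rule comp_eq_comp) (use P P3(1) R A A2 in auto)
    have pS: "Comp C p p2 \<in> S" by (rule S_comp) (use P P2 P3 in auto)
    have sq1: "square a t (Comp C p p2) (Comp C q p2)"
      unfolding square_def using P P3(1) R A A2 pS e1 by (simp add: comp_arr)
    have sq2: "square b t (Comp C p p2) q2"
      unfolding square_def using P P3 R A A2 pS by (simp add: comp_arr)
    have r: "(s, Plus C a b) \<in> roofs C S X Y" using R by (auto simp: in_roofs plus_arr)
    have sq3: "square (Plus C a b) t (Comp C p p2) (Plus C (Comp C q p2) q2)"
      unfolding square_def using P P3 R A A2 pS e1 by (simp add: comp_plus plus_comp plus_arr comp_arr)
    show ?thesis
      unfolding f g Plus_cls[OF f(1,2)] Comp_cls[OF sq1 f(1) g(1)] Comp_cls[OF sq2 f(2) g(1)]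
        Comp_cls[OF sq3 r g(1)] Plus_cls[OF square_roof[OF sq1 f(1) g(1)] square_roof[OF sq2 f(2) g(1)]]
      using P P3 R A A2 by (simp add: comp_plus comp_arr)
  qed
  show "Comp L (Plus L g g') f = Plus L (Comp L g f) (Comp L g' f)"
    if h: "f \<in> Hom L X Y" "g \<in> Hom L Y Z" "g' \<in> Hom L Y Z" for f g g' X Y Z
  proof -
    obtain s a b where f: "(s, a) \<in> roofs C S Y Z" "(s, b) \<in> roofs C S Y Z"
      "g = cls Y Z (s, a)" "g' = cls Y Z (s, b)" using common_denominator[OF h(2,3)] .
    obtain t c where g: "(t, c) \<in> roofs C S X Y" "f = cls X Y (t, c)" using HomE[OF h(1)] .
    note R = f(1,2)[unfolded in_roofs] g(1)[unfolded in_roofs]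
    obtain p q where pq: "square c s p q" using ex_square[of s c] R by auto
    note P = pq[unfolded square_def]
    have r: "(s, Plus C a b) \<in> roofs C S Y Z" using R by (auto simp: in_roofs plus_arr)
    show ?thesis
      unfolding f g Plus_cls[OF f(1,2)] Comp_cls[OF pq g(1) f(1)] Comp_cls[OF pq g(1) f(2)]
        Comp_cls[OF pq g(1) r] Plus_cls[OF square_roof[OF pq g(1) f(1)] square_roof[OF pq g(1) f(2)]]
      using P R by (simp add: plus_comp)
  qed
qed

text \<open>
  Every later statement that a morphism of the derived category vanishes passes through this
  criterion.
\<close>

lemma cls_zero_iff:
  assumes "(s, f) \<in> roofs C S X Y"
  shows "cls X Y (s, f) = Zero L X Y \<longleftrightarrow> (\<exists>u \<in> S. Cod C u = Dom C f \<and> Comp C f u = Zero C (Dom C u) Y)"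
proof -
  note R = assms[unfolded in_roofs]
  have Y: "Y \<in> Obj C" and sA: "s \<in> Arr C" using roofs_Obj[OF assms] R S_Arr by auto
  have z: "(s, Zero C (Dom C s) Y) \<in> roofs C S X Y" "Zero L X Y = cls X Y (s, Zero C (Dom C s) Y)"
    using Zero_cls'[of s X Y] R Y by auto
  have "roof_eq C S (s, f) (s, Zero C (Dom C s) Y) \<longleftrightarrow>
     (\<exists>u \<in> S. Cod C u = Dom C f \<and> Comp C f u = Zero C (Dom C u) Y)"
  proof
    assume "roof_eq C S (s, f) (s, Zero C (Dom C s) Y)"
    then obtain u v where uv: "u \<in> S" "v \<in> S" "Dom C u = Dom C v" "Cod C u = Dom C s" "Cod C v = Dom C s"
      "Comp C f u = Comp C (Zero C (Dom C s) Y) v"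
      using roof_eqE[OF _ assms z(1)] by metis
    then have "Comp C f u = Zero C (Dom C u) Y" using S_Arr Y by (simp add: zero_comp)
    then show "\<exists>u \<in> S. Cod C u = Dom C f \<and> Comp C f u = Zero C (Dom C u) Y" using uv R by auto
  next
    assume "\<exists>u \<in> S. Cod C u = Dom C f \<and> Comp C f u = Zero C (Dom C u) Y"
    then obtain u where u: "u \<in> S" "Cod C u = Dom C f" "Comp C f u = Zero C (Dom C u) Y" by blast
    show "roof_eq C S (s, f) (s, Zero C (Dom C s) Y)"
      by (rule roof_eqI[of u u]) (use u R Y sA S_Arr S_comp in \<open>auto simp: zero_comp\<close>)
  qed
  then show ?thesis using cls_eq_iff[OF assms z(1)] z(2) by simp
qed

end

section \<open>Complexes up to homotopy\<close>

context ab_cat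
begin

lemma complexD:
  assumes "bounded_complex A X"
  shows "cobj X i \<in> Obj A" "cdiff X i \<in> Arr A" "Dom A (cdiff X i) = cobj X i"
    "Cod A (cdiff X i) = cobj X (i + 1)"
  using assms by (auto simp: bounded_complex_def Hom_def)

lemma diff_diff:
  assumes "bounded_complex A X" "j = i + 1"
  shows "cdiff X j oo cdiff X i = Zero A (cobj X i) (cobj X (j + 1))"
  using assms by (simp add: bounded_complex_def add.assoc)

lemma diff_diff_left:
  assumes "bounded_complex A X" "j = i + 1" "x \<in> Arr A" "Cod A x = cobj X i"
  shows "cdiff X j oo cdiff X i oo x = Zero A (Dom A x) (cobj X (j + 1))"
  using diff_diff[OF assms(1,2)] complexD[OF assms(1)] assms
  by (simp add: comp_assoc[symmetric] zero_comp)

lemmas complex_simps = complexD diff_diff diff_diff_left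

lemma chain_mapD:
  assumes "chain_map A X Y f"
  shows "f i \<in> Arr A" "Dom A (f i) = cobj X i" "Cod A (f i) = cobj Y i"
    "j = i + 1 \<Longrightarrow> f j oo cdiff X i = cdiff Y i oo f i"
  using assms by (auto simp: chain_map_def Hom_def)

lemma chain_map_left:
  assumes "chain_map A X Y f" "bounded_complex A X" "bounded_complex A Y"
    "j = i + 1" "x \<in> Arr A" "Cod A x = cobj X i"
  shows "f j oo cdiff X i oo x = cdiff Y i oo f i oo x"
  using chain_mapD[OF assms(1), of i] chain_mapD[OF assms(1), of j] assms complexD[OF assms(2)]
    complexD[OF assms(3)] by (simp add: comp_assoc[symmetric])

lemma chain_mapI:
  assumes "\<And>i. f i \<in> Arr A" "\<And>i. Dom A (f i) = cobj X i" "\<And>i. Cod A (f i) = cobj Y i"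
    "\<And>i. f (i + 1) oo cdiff X i = cdiff Y i oo f i"
  shows "chain_map A X Y f"
  using assms by (auto simp: chain_map_def Hom_def)

lemma chain_map_id: "bounded_complex A X \<Longrightarrow> chain_map A X X (\<lambda>i. Id A (cobj X i))"
  by (rule chain_mapI) (simp_all add: complexD cat_simps)

lemma chain_map_zero:
  "bounded_complex A X \<Longrightarrow> bounded_complex A Y \<Longrightarrow> chain_map A X Y (\<lambda>i. Zero A (cobj X i) (cobj Y i))"
  by (rule chain_mapI) (simp_all add: complexD arr_simps)

lemma chain_map_comp:
  assumes "chain_map A X Y f" "chain_map A Y Z g" "bounded_complex A X" "bounded_complex A Y"
    "bounded_complex A Z"
  shows "chain_map A X Z (\<lambda>i. g i oo f i)"
  by (rule chain_mapI) (simp_all add: chain_mapD[OF assms(1)] chain_mapD[OF assms(2)]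
    chain_map_left[OF assms(2)] complexD assms cat_simps)

lemma chain_map_plus:
  assumes "chain_map A X Y f" "chain_map A X Y g" "bounded_complex A X" "bounded_complex A Y"
  shows "chain_map A X Y (\<lambda>i. f i \<boxplus> g i)"
  by (rule chain_mapI) (simp_all add: chain_mapD[OF assms(1)] chain_mapD[OF assms(2)]
    complexD assms plus_arr plus_comp comp_plus)

lemma chain_map_neg:
  assumes "chain_map A X Y f" "bounded_complex A X" "bounded_complex A Y"
  shows "chain_map A X Y (\<lambda>i. \<boxminus> f i)"
  by (rule chain_mapI) (simp_all add: chain_mapD[OF assms(1)] complexD assms neg_arr comp_neg)

definition is_htpy :: "('o, 'm) complex \<Rightarrow> ('o, 'm) complex \<Rightarrow> (int \<Rightarrow> 'm) \<Rightarrow> bool" where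
  "is_htpy X Y s \<longleftrightarrow> (\<forall>i. s i \<in> Arr A \<and> Dom A (s i) = cobj X i \<and> Cod A (s i) = cobj Y (i - 1))"

lemma is_htpyD:
  assumes "is_htpy X Y s" shows "s i \<in> Arr A" "Dom A (s i) = cobj X i" "Cod A (s i) = cobj Y (i - 1)"
  using assms by (auto simp: is_htpy_def)

lemma homotopicI:
  assumes "is_htpy X Y s"
    "\<And>i. f i = g i \<boxplus> (cdiff Y (i - 1) oo s i \<boxplus> s (i + 1) oo cdiff X i)"
  shows "homotopic A X Y f g"
  using assms unfolding homotopic_def is_htpy_def by (intro exI[of _ s]) (simp add: Hom_def)

lemma homotopicE:
  assumes "homotopic A X Y f g"
  obtains s where "is_htpy X Y s"
    "\<And>i. f i = g i \<boxplus> (cdiff Y (i - 1) oo s i \<boxplus> s (i + 1) oo cdiff X i)"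
  using assms unfolding homotopic_def is_htpy_def by (auto simp: Hom_def)

lemma homotopic_refl:
  assumes "chain_map A X Y f" "bounded_complex A X" "bounded_complex A Y"
  shows "homotopic A X Y f f"
  by (rule homotopicI[of _ _ "\<lambda>i. Zero A (cobj X i) (cobj Y (i - 1))"])
    (simp_all add: is_htpy_def complexD assms chain_mapD[OF assms(1)] arr_simps)

lemma homotopic_sym:
  assumes "homotopic A X Y f g" "chain_map A X Y f" "chain_map A X Y g" "bounded_complex A X" "bounded_complex A Y"
  shows "homotopic A X Y g f"
proof -
  obtain s where s: "is_htpy X Y s" and e: "\<And>i. f i = g i \<boxplus> (cdiff Y (i - 1) oo s i \<boxplus> s (i + 1) oo cdiff X i)"
    using homotopicE[OF assms(1)] by metis
  show ?thesis
  proof (rule homotopicI)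
    show "is_htpy X Y (\<lambda>i. \<boxminus> s i)" using is_htpyD[OF s] by (simp add: is_htpy_def neg_arr)
    show "g i = f i \<boxplus> (cdiff Y (i - 1) oo \<boxminus> s i \<boxplus> \<boxminus> s (i + 1) oo cdiff X i)" for i
      unfolding e
      by (rule eq_sgI) (simp add: lin_simps is_htpyD[OF s] chain_mapD[OF assms(3)] complexD assms(4,5))
  qed
qed

lemma homotopic_trans:
  assumes "homotopic A X Y f g" "homotopic A X Y g h" "chain_map A X Y h" "bounded_complex A X"
    "bounded_complex A Y"
  shows "homotopic A X Y f h"
proof -
  obtain s where s: "is_htpy X Y s" and e: "\<And>i. f i = g i \<boxplus> (cdiff Y (i - 1) oo s i \<boxplus> s (i + 1) oo cdiff X i)"
    using homotopicE[OF assms(1)] by metis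
  obtain t where t: "is_htpy X Y t" and e': "\<And>i. g i = h i \<boxplus> (cdiff Y (i - 1) oo t i \<boxplus> t (i + 1) oo cdiff X i)"
    using homotopicE[OF assms(2)] by metis
  show ?thesis
  proof (rule homotopicI)
    show "is_htpy X Y (\<lambda>i. s i \<boxplus> t i)" using is_htpyD[OF s] is_htpyD[OF t] by (simp add: is_htpy_def plus_arr)
    show "f i = h i \<boxplus> (cdiff Y (i - 1) oo (s i \<boxplus> t i) \<boxplus> (s (i + 1) \<boxplus> t (i + 1)) oo cdiff X i)" for i
      unfolding e e'
      by (rule eq_sgI) (simp add: lin_simps is_htpyD[OF s] is_htpyD[OF t] chain_mapD[OF assms(3)]
        complexD assms(4,5))
  qed
qed

lemma homotopic_plus:
  assumes "homotopic A X Y f g" "homotopic A X Y f' g'" "chain_map A X Y g" "chain_map A X Y g'"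
    "bounded_complex A X" "bounded_complex A Y"
  shows "homotopic A X Y (\<lambda>i. f i \<boxplus> f' i) (\<lambda>i. g i \<boxplus> g' i)"
proof -
  obtain s where s: "is_htpy X Y s" and e: "\<And>i. f i = g i \<boxplus> (cdiff Y (i - 1) oo s i \<boxplus> s (i + 1) oo cdiff X i)"
    using homotopicE[OF assms(1)] by metis
  obtain t where t: "is_htpy X Y t" and e': "\<And>i. f' i = g' i \<boxplus> (cdiff Y (i - 1) oo t i \<boxplus> t (i + 1) oo cdiff X i)"
    using homotopicE[OF assms(2)] by metis
  show ?thesis
  proof (rule homotopicI)
    show "is_htpy X Y (\<lambda>i. s i \<boxplus> t i)" using is_htpyD[OF s] is_htpyD[OF t] by (simp add: is_htpy_def plus_arr)
    show "f i \<boxplus> f' i = g i \<boxplus> g' i \<boxplus> (cdiff Y (i - 1) oo (s i \<boxplus> t i) \<boxplus> (s (i + 1) \<boxplus> t (i + 1)) oo cdiff X i)" for i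
      unfolding e e'
      by (rule eq_sgI) (simp add: lin_simps is_htpyD[OF s] is_htpyD[OF t] chain_mapD[OF assms(3)]
        chain_mapD[OF assms(4)] complexD assms(5,6))
  qed
qed

lemma homotopic_comp_left:
  assumes "homotopic A X Y f g" "chain_map A X Y g" "chain_map A Y Z h"
    "bounded_complex A X" "bounded_complex A Y" "bounded_complex A Z"
  shows "homotopic A X Z (\<lambda>i. h i oo f i) (\<lambda>i. h i oo g i)"
proof -
  obtain s where s: "is_htpy X Y s" and e: "\<And>i. f i = g i \<boxplus> (cdiff Y (i - 1) oo s i \<boxplus> s (i + 1) oo cdiff X i)"
    using homotopicE[OF assms(1)] by metis
  show ?thesis
  proof (rule homotopicI)
    show "is_htpy X Z (\<lambda>i. h (i - 1) oo s i)"
      using is_htpyD[OF s] by (simp add: is_htpy_def comp_arr chain_mapD[OF assms(3)])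
    show "h i oo f i = h i oo g i \<boxplus> (cdiff Z (i - 1) oo h (i - 1) oo s i \<boxplus> (h (i + 1 - 1) oo s (i + 1)) oo cdiff X i)" for i
      unfolding e
      by (simp add: cat_simps plus_arr comp_plus is_htpyD[OF s] chain_mapD[OF assms(2)]
        chain_mapD[OF assms(3)] chain_map_left[OF assms(3)] complexD assms(4-6))
  qed
qed

lemma homotopic_comp_right:
  assumes "homotopic A Y Z f g" "chain_map A Y Z g" "chain_map A X Y h"
    "bounded_complex A X" "bounded_complex A Y" "bounded_complex A Z"
  shows "homotopic A X Z (\<lambda>i. f i oo h i) (\<lambda>i. g i oo h i)"
proof -
  obtain s where s: "is_htpy Y Z s" and e: "\<And>i. f i = g i \<boxplus> (cdiff Z (i - 1) oo s i \<boxplus> s (i + 1) oo cdiff Y i)"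
    using homotopicE[OF assms(1)] by metis
  show ?thesis
  proof (rule homotopicI)
    show "is_htpy X Z (\<lambda>i. s i oo h i)"
      using is_htpyD[OF s] by (simp add: is_htpy_def comp_arr chain_mapD[OF assms(3)])
    show "f i oo h i = g i oo h i \<boxplus> (cdiff Z (i - 1) oo s i oo h i \<boxplus> (s (i + 1) oo h (i + 1)) oo cdiff X i)" for i
      unfolding e
      by (simp add: cat_simps plus_arr plus_comp is_htpyD[OF s] chain_mapD[OF assms(2)]
        chain_mapD[OF assms(3)] complexD assms(4-6))
  qed
qed

abbreviation hc where "hc \<equiv> htpy_class A"

lemma hc_eq_iff:
  assumes "chain_map A X Y f" "chain_map A X Y g" "bounded_complex A X" "bounded_complex A Y"
  shows "hc X Y f = hc X Y g \<longleftrightarrow> homotopic A X Y f g"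
proof
  assume "hc X Y f = hc X Y g"
  then have "g \<in> {h. chain_map A X Y h \<and> homotopic A X Y f h}"
    using assms homotopic_refl by (auto simp: htpy_class_def)
  then show "homotopic A X Y f g" by auto
next
  assume "homotopic A X Y f g"
  then show "hc X Y f = hc X Y g" unfolding htpy_class_def
    using assms homotopic_trans homotopic_sym by blast
qed

lemma Obj_Kb: "Obj (Kb A) = {X. bounded_complex A X}"
  and Id_Kb: "Id (Kb A) X = hc X X (\<lambda>i. Id A (cobj X i))"
  and Zero_Kb: "Zero (Kb A) X Y = hc X Y (\<lambda>i. Zero A (cobj X i) (cobj Y i))"
  by (simp_all add: Kb_def)

lemma Hom_Kb_iff: "F \<in> Hom (Kb A) X Y \<longleftrightarrow>
    bounded_complex A X \<and> bounded_complex A Y \<and> (\<exists>f. chain_map A X Y f \<and> F = hc X Y f)"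
  by (auto simp: Hom_def Kb_def htpy_class_def)

lemma Hom_KbE:
  assumes "F \<in> Hom (Kb A) X Y"
  obtains f where "bounded_complex A X" "bounded_complex A Y" "chain_map A X Y f" "F = hc X Y f"
  using assms unfolding Hom_Kb_iff by blast

lemma hc_Arr:
  assumes "chain_map A X Y f" "bounded_complex A X" "bounded_complex A Y"
  shows "hc X Y f \<in> Hom (Kb A) X Y" "hc X Y f \<in> Arr (Kb A)" "Dom (Kb A) (hc X Y f) = X" "Cod (Kb A) (hc X Y f) = Y"
proof -
  show "hc X Y f \<in> Hom (Kb A) X Y" using assms Hom_Kb_iff by blast
  then show "hc X Y f \<in> Arr (Kb A)" "Dom (Kb A) (hc X Y f) = X" "Cod (Kb A) (hc X Y f) = Y"
    by (simp_all add: Hom_def)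
qed

lemma Comp_Kb:
  assumes f: "chain_map A X Y f" and g: "chain_map A Y Z g"
    and b: "bounded_complex A X" "bounded_complex A Y" "bounded_complex A Z"
  shows "Comp (Kb A) (hc Y Z g) (hc X Y f) = hc X Z (\<lambda>i. g i oo f i)"
proof -
  have "(\<exists>g'. (chain_map A Y Z g' \<and> homotopic A Y Z g g') \<and> (\<exists>f'. (chain_map A X Y f' \<and> homotopic A X Y f f') \<and>
      homotopic A X Z (\<lambda>i. g' i oo f' i) h)) \<longleftrightarrow> homotopic A X Z (\<lambda>i. g i oo f i) h"
    if h: "chain_map A X Z h" for h
  proof
    assume "\<exists>g'. (chain_map A Y Z g' \<and> homotopic A Y Z g g') \<and> (\<exists>f'. (chain_map A X Y f' \<and> homotopic A X Y f f') \<and>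
      homotopic A X Z (\<lambda>i. g' i oo f' i) h)"
    then obtain g' f' where 1: "chain_map A Y Z g'" "homotopic A Y Z g g'" "chain_map A X Y f'"
      "homotopic A X Y f f'" "homotopic A X Z (\<lambda>i. g' i oo f' i) h" by blast
    have 2: "homotopic A X Z (\<lambda>i. g i oo f i) (\<lambda>i. g i oo f' i)"
      by (rule homotopic_comp_left[OF 1(4,3) g b])
    have 3: "homotopic A X Z (\<lambda>i. g i oo f' i) (\<lambda>i. g' i oo f' i)"
      by (rule homotopic_comp_right[OF 1(2,1,3) b])
    show "homotopic A X Z (\<lambda>i. g i oo f i) h"
      using homotopic_trans[OF 2 homotopic_trans[OF 3 1(5) h b(1,3)] h b(1,3)] .
  next
    assume "homotopic A X Z (\<lambda>i. g i oo f i) h"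
    then show "\<exists>g'. (chain_map A Y Z g' \<and> homotopic A Y Z g g') \<and> (\<exists>f'. (chain_map A X Y f' \<and> homotopic A X Y f f') \<and>
      homotopic A X Z (\<lambda>i. g' i oo f' i) h)"
      using f g homotopic_refl[OF f b(1,2)] homotopic_refl[OF g b(2,3)] by blast
  qed
  then show ?thesis
    unfolding Kb_def htpy_class_def by (simp add: Bex_def cong: conj_cong)
qed

lemma Plus_Kb:
  assumes f: "chain_map A X Y f" and g: "chain_map A X Y g"
    and b: "bounded_complex A X" "bounded_complex A Y"
  shows "Plus (Kb A) (hc X Y f) (hc X Y g) = hc X Y (\<lambda>i. f i \<boxplus> g i)"
proof -
  have "(\<exists>f'. (chain_map A X Y f' \<and> homotopic A X Y f f') \<and> (\<exists>g'. (chain_map A X Y g' \<and> homotopic A X Y g g') \<and>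
      homotopic A X Y (\<lambda>i. f' i \<boxplus> g' i) h)) \<longleftrightarrow> homotopic A X Y (\<lambda>i. f i \<boxplus> g i) h"
    if h: "chain_map A X Y h" for h
  proof
    assume "\<exists>f'. (chain_map A X Y f' \<and> homotopic A X Y f f') \<and> (\<exists>g'. (chain_map A X Y g' \<and> homotopic A X Y g g') \<and>
      homotopic A X Y (\<lambda>i. f' i \<boxplus> g' i) h)"
    then obtain g' f' where 1: "chain_map A X Y g'" "homotopic A X Y g g'" "chain_map A X Y f'"
      "homotopic A X Y f f'" "homotopic A X Y (\<lambda>i. f' i \<boxplus> g' i) h" by blast
    show "homotopic A X Y (\<lambda>i. f i \<boxplus> g i) h"
      using homotopic_trans[OF homotopic_plus[OF 1(4,2,3,1) b] 1(5) h b] .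
  next
    assume "homotopic A X Y (\<lambda>i. f i \<boxplus> g i) h"
    then show "\<exists>f'. (chain_map A X Y f' \<and> homotopic A X Y f f') \<and> (\<exists>g'. (chain_map A X Y g' \<and> homotopic A X Y g g') \<and>
      homotopic A X Y (\<lambda>i. f' i \<boxplus> g' i) h)"
      using f g homotopic_refl[OF f b] homotopic_refl[OF g b] by blast
  qed
  then show ?thesis
    unfolding Kb_def htpy_class_def by (simp add: Bex_def cong: conj_cong)
qed

theorem Kb_preadditive: "preadditive_category (Kb A)"
proof
  show "Dom (Kb A) f \<in> Obj (Kb A)" "Cod (Kb A) f \<in> Obj (Kb A)" if "f \<in> Arr (Kb A)" for f
    using that by (auto simp: Kb_def htpy_class_def)
  show "Id (Kb A) X \<in> Hom (Kb A) X X" if "X \<in> Obj (Kb A)" for X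
    unfolding Id_Kb using that by (intro hc_Arr) (auto simp: Obj_Kb chain_map_id)
  show "Comp (Kb A) G F \<in> Hom (Kb A) X Z" if hyp: "F \<in> Hom (Kb A) X Y" "G \<in> Hom (Kb A) Y Z" for F G X Y Z
  proof -
    obtain f where f: "bounded_complex A X" "bounded_complex A Y" "chain_map A X Y f" "F = hc X Y f"
      using Hom_KbE[OF hyp(1)] .
    obtain g where g: "bounded_complex A Y" "bounded_complex A Z" "chain_map A Y Z g" "G = hc Y Z g"
      using Hom_KbE[OF hyp(2)] .
    show ?thesis unfolding f(4) g(4) Comp_Kb[OF f(3) g(3) f(1,2) g(2)]
      using hc_Arr chain_map_comp[OF f(3) g(3) f(1,2) g(2)] f g by blast
  qed
  show "Comp (Kb A) F (Id (Kb A) X) = F" "Comp (Kb A) (Id (Kb A) Y) F = F"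
    if hyp: "F \<in> Hom (Kb A) X Y" for F X Y
  proof -
    obtain f where f: "bounded_complex A X" "bounded_complex A Y" "chain_map A X Y f" "F = hc X Y f"
      using Hom_KbE[OF hyp] .
    show "Comp (Kb A) F (Id (Kb A) X) = F"
      unfolding f(4) Id_Kb Comp_Kb[OF chain_map_id[OF f(1)] f(3) f(1,1,2)]
      by (simp add: comp_id chain_mapD[OF f(3)])
    show "Comp (Kb A) (Id (Kb A) Y) F = F"
      unfolding f(4) Id_Kb Comp_Kb[OF f(3) chain_map_id[OF f(2)] f(1,2,2)]
      by (simp add: id_comp chain_mapD[OF f(3)])
  qed
  show "Comp (Kb A) H (Comp (Kb A) G F) = Comp (Kb A) (Comp (Kb A) H G) F"
    if hyp: "F \<in> Hom (Kb A) W X" "G \<in> Hom (Kb A) X Y" "H \<in> Hom (Kb A) Y Z" for F G H W X Y Z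
  proof -
    obtain f where f: "bounded_complex A W" "bounded_complex A X" "chain_map A W X f" "F = hc W X f"
      using Hom_KbE[OF hyp(1)] .
    obtain g where g: "bounded_complex A X" "bounded_complex A Y" "chain_map A X Y g" "G = hc X Y g"
      using Hom_KbE[OF hyp(2)] .
    obtain h where h: "bounded_complex A Y" "bounded_complex A Z" "chain_map A Y Z h" "H = hc Y Z h"
      using Hom_KbE[OF hyp(3)] .
    show ?thesis
      unfolding f(4) g(4) h(4) Comp_Kb[OF f(3) g(3) f(1,2) g(2)] Comp_Kb[OF g(3) h(3) g(1,2) h(2)]
        Comp_Kb[OF f(3) chain_map_comp[OF g(3) h(3) g(1,2) h(2)] f(1,2) h(2)]
        Comp_Kb[OF chain_map_comp[OF f(3) g(3) f(1,2) g(2)] h(3) f(1) h(1,2)]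
      by (simp add: cat_simps chain_mapD[OF f(3)] chain_mapD[OF g(3)] chain_mapD[OF h(3)])
  qed
  show "Plus (Kb A) F G \<in> Hom (Kb A) X Y" "Plus (Kb A) F G = Plus (Kb A) G F"
    if hyp: "F \<in> Hom (Kb A) X Y" "G \<in> Hom (Kb A) X Y" for F G X Y
  proof -
    obtain f where f: "bounded_complex A X" "bounded_complex A Y" "chain_map A X Y f" "F = hc X Y f"
      using Hom_KbE[OF hyp(1)] .
    obtain g where g: "chain_map A X Y g" "G = hc X Y g"
      using Hom_KbE[OF hyp(2)] .
    show "Plus (Kb A) F G \<in> Hom (Kb A) X Y"
      unfolding f(4) g(2) Plus_Kb[OF f(3) g(1) f(1,2)] using hc_Arr chain_map_plus[OF f(3) g(1) f(1,2)] f by blast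
    have "(\<lambda>i. f i \<boxplus> g i) = (\<lambda>i. g i \<boxplus> f i)"
      by (rule ext, rule plus_commute) (simp_all add: chain_mapD[OF f(3)] chain_mapD[OF g(1)])
    then show "Plus (Kb A) F G = Plus (Kb A) G F"
      unfolding f(4) g(2) Plus_Kb[OF f(3) g(1) f(1,2)] Plus_Kb[OF g(1) f(3) f(1,2)] by simp
  qed
  show "Plus (Kb A) (Plus (Kb A) F G) H = Plus (Kb A) F (Plus (Kb A) G H)"
    if hyp: "F \<in> Hom (Kb A) X Y" "G \<in> Hom (Kb A) X Y" "H \<in> Hom (Kb A) X Y" for F G H X Y
  proof -
    obtain f where f: "bounded_complex A X" "bounded_complex A Y" "chain_map A X Y f" "F = hc X Y f"
      using Hom_KbE[OF hyp(1)] .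
    obtain g where g: "chain_map A X Y g" "G = hc X Y g" using Hom_KbE[OF hyp(2)] .
    obtain h where h: "chain_map A X Y h" "H = hc X Y h" using Hom_KbE[OF hyp(3)] .
    show ?thesis
      unfolding f(4) g(2) h(2) Plus_Kb[OF f(3) g(1) f(1,2)] Plus_Kb[OF g(1) h(1) f(1,2)]
        Plus_Kb[OF f(3) chain_map_plus[OF g(1) h(1) f(1,2)] f(1,2)]
        Plus_Kb[OF chain_map_plus[OF f(3) g(1) f(1,2)] h(1) f(1,2)]
      by (simp add: plus_assoc chain_mapD[OF f(3)] chain_mapD[OF g(1)] chain_mapD[OF h(1)])
  qed
  show "Zero (Kb A) X Y \<in> Hom (Kb A) X Y" if "X \<in> Obj (Kb A)" "Y \<in> Obj (Kb A)" for X Y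
    unfolding Zero_Kb using that by (intro hc_Arr) (auto simp: Obj_Kb chain_map_zero)
  show "Plus (Kb A) F (Zero (Kb A) X Y) = F" "\<exists>G\<in>Hom (Kb A) X Y. Plus (Kb A) F G = Zero (Kb A) X Y"
    if hyp: "F \<in> Hom (Kb A) X Y" for F X Y
  proof -
    obtain f where f: "bounded_complex A X" "bounded_complex A Y" "chain_map A X Y f" "F = hc X Y f"
      using Hom_KbE[OF hyp] .
    show "Plus (Kb A) F (Zero (Kb A) X Y) = F"
      unfolding f(4) Zero_Kb Plus_Kb[OF f(3) chain_map_zero[OF f(1,2)] f(1,2)]
      by (simp add: plus_zero chain_mapD[OF f(3)])
    have "Plus (Kb A) F (hc X Y (\<lambda>i. \<boxminus> f i)) = Zero (Kb A) X Y"
      unfolding f(4) Zero_Kb Plus_Kb[OF f(3) chain_map_neg[OF f(3,1,2)] f(1,2)]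
      by (simp add: plus_neg chain_mapD[OF f(3)])
    then show "\<exists>G\<in>Hom (Kb A) X Y. Plus (Kb A) F G = Zero (Kb A) X Y"
      using hc_Arr[OF chain_map_neg[OF f(3,1,2)] f(1,2)] by blast
  qed
  show "Comp (Kb A) G (Plus (Kb A) F F') = Plus (Kb A) (Comp (Kb A) G F) (Comp (Kb A) G F')"
    if hyp: "F \<in> Hom (Kb A) X Y" "F' \<in> Hom (Kb A) X Y" "G \<in> Hom (Kb A) Y Z" for F F' G X Y Z
  proof -
    obtain f where f: "bounded_complex A X" "bounded_complex A Y" "chain_map A X Y f" "F = hc X Y f"
      using Hom_KbE[OF hyp(1)] .
    obtain f' where f': "chain_map A X Y f'" "F' = hc X Y f'" using Hom_KbE[OF hyp(2)] .
    obtain g where g: "bounded_complex A Y" "bounded_complex A Z" "chain_map A Y Z g" "G = hc Y Z g"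
      using Hom_KbE[OF hyp(3)] .
    show ?thesis
      unfolding f(4) g(4) f'(2) Plus_Kb[OF f(3) f'(1) f(1,2)] Comp_Kb[OF f(3) g(3) f(1,2) g(2)]
        Comp_Kb[OF f'(1) g(3) f(1,2) g(2)] Comp_Kb[OF chain_map_plus[OF f(3) f'(1) f(1,2)] g(3) f(1,2) g(2)]
        Plus_Kb[OF chain_map_comp[OF f(3) g(3) f(1,2) g(2)] chain_map_comp[OF f'(1) g(3) f(1,2) g(2)] f(1) g(2)]
      by (simp add: comp_plus chain_mapD[OF f(3)] chain_mapD[OF f'(1)] chain_mapD[OF g(3)])
  qed
  show "Comp (Kb A) (Plus (Kb A) G G') F = Plus (Kb A) (Comp (Kb A) G F) (Comp (Kb A) G' F)"
    if hyp: "F \<in> Hom (Kb A) X Y" "G \<in> Hom (Kb A) Y Z" "G' \<in> Hom (Kb A) Y Z" for F G G' X Y Z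
  proof -
    obtain f where f: "bounded_complex A X" "bounded_complex A Y" "chain_map A X Y f" "F = hc X Y f"
      using Hom_KbE[OF hyp(1)] .
    obtain g where g: "bounded_complex A Y" "bounded_complex A Z" "chain_map A Y Z g" "G = hc Y Z g"
      using Hom_KbE[OF hyp(2)] .
    obtain g' where g': "chain_map A Y Z g'" "G' = hc Y Z g'" using Hom_KbE[OF hyp(3)] .
    show ?thesis
      unfolding f(4) g(4) g'(2) Plus_Kb[OF g(3) g'(1) g(1,2)] Comp_Kb[OF f(3) g(3) f(1,2) g(2)]
        Comp_Kb[OF f(3) g'(1) f(1,2) g(2)] Comp_Kb[OF f(3) chain_map_plus[OF g(3) g'(1) g(1,2)] f(1,2) g(2)]
        Plus_Kb[OF chain_map_comp[OF f(3) g(3) f(1,2) g(2)] chain_map_comp[OF f(3) g'(1) f(1,2) g(2)] f(1) g(2)]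
      by (simp add: plus_comp chain_mapD[OF f(3)] chain_mapD[OF g'(1)] chain_mapD[OF g(3)])
  qed
qed

end

section \<open>Cohomology through generalised elements\<close>

context ab_cat
begin

definition cocycle :: "('o, 'm) complex \<Rightarrow> int \<Rightarrow> 'm \<Rightarrow> bool" where
  "cocycle X i z \<longleftrightarrow> z \<in> Arr A \<and> Cod A z = cobj X i \<and>
     cdiff X i oo z = Zero A (Dom A z) (cobj X (i + 1))"

text \<open>
  Locally a boundary: after composition with an epimorphism, the generalised element lifts along the
  incoming differential.
\<close>

definition loc_bd :: "('o, 'm) complex \<Rightarrow> int \<Rightarrow> 'm \<Rightarrow> bool" where
  "loc_bd X i z \<longleftrightarrow> (\<exists>e x. epi_arr A e \<and> Cod A e = Dom A z \<and> x \<in> Arr A \<and> Dom A x = Dom A e \<and>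
     Cod A x = cobj X (i - 1) \<and> z oo e = cdiff X (i - 1) oo x)"

definition exact_at :: "('o, 'm) complex \<Rightarrow> int \<Rightarrow> bool" where
  "exact_at X i \<longleftrightarrow> (\<forall>z. cocycle X i z \<longrightarrow> loc_bd X i z)"

lemma loc_bdE:
  assumes "loc_bd X i z"
  obtains e x where "epi_arr A e" "e \<in> Arr A" "Cod A e = Dom A z" "x \<in> Arr A" "Dom A x = Dom A e"
    "Cod A x = cobj X (i - 1)" "z oo e = cdiff X (i - 1) oo x"
  using assms epi_arrow unfolding loc_bd_def by blast

lemma loc_bdI:
  assumes "epi_arr A e" "Cod A e = Dom A z" "x \<in> Arr A" "Dom A x = Dom A e"
    "Cod A x = cobj X (i - 1)" "z oo e = cdiff X (i - 1) oo x"
  shows "loc_bd X i z"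
  using assms unfolding loc_bd_def by blast

lemma loc_bd_diff:
  assumes "bounded_complex A X" "x \<in> Arr A" "Cod A x = cobj X (i - 1)"
  shows "loc_bd X i (cdiff X (i - 1) oo x)"
  by (rule loc_bdI[of "Id A (Dom A x)" _ x])
    (use assms in \<open>simp_all add: epi_id cat_simps complexD\<close>)

lemma loc_bd_zero:
  assumes "bounded_complex A X" "W \<in> Obj A"
  shows "loc_bd X i (Zero A W (cobj X i))"
  using loc_bd_diff[OF assms(1), of "Zero A W (cobj X (i - 1))" i] assms
  by (simp add: arr_simps complexD)

lemma loc_bd_epi:
  assumes "loc_bd X i (z oo e)" "epi_arr A e" "z \<in> Arr A" "Cod A e = Dom A z"
  shows "loc_bd X i z"
proof -
  have e: "e \<in> Arr A" by (rule epi_arrow) fact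
  obtain e' x where h: "epi_arr A e'" "e' \<in> Arr A" "Cod A e' = Dom A (z oo e)" "x \<in> Arr A" "Dom A x = Dom A e'"
    "Cod A x = cobj X (i - 1)" "(z oo e) oo e' = cdiff X (i - 1) oo x" using loc_bdE[OF assms(1)] .
  have c: "Cod A e' = Dom A e" using h(3) assms e by (simp add: comp_arr)
  show ?thesis
    by (rule loc_bdI[of "e oo e'" _ x])
      (use h(1,2,4-7) c assms e in \<open>simp_all add: epi_comp comp_arr comp_assoc\<close>)
qed

lemma loc_bd_neg:
  assumes "loc_bd X i z" "z \<in> Arr A" "bounded_complex A X"
  shows "loc_bd X i (\<boxminus> z)"
proof -
  obtain e x where h: "epi_arr A e" "e \<in> Arr A" "Cod A e = Dom A z" "x \<in> Arr A" "Dom A x = Dom A e"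
    "Cod A x = cobj X (i - 1)" "z oo e = cdiff X (i - 1) oo x" using loc_bdE[OF assms(1)] .
  show ?thesis
    by (rule loc_bdI[of e _ "\<boxminus> x"]) (use h assms in \<open>simp_all add: neg_arr comp_neg complexD\<close>)
qed

lemma common_epi:
  assumes "epi_arr A e" "epi_arr A e'" "Cod A e = Cod A e'"
  obtains a b where "epi_arr A a" "a \<in> Arr A" "b \<in> Arr A" "Dom A a = Dom A b" "Cod A a = Dom A e"
    "Cod A b = Dom A e'" "e oo a = e' oo b"
proof -
  have E: "e \<in> Arr A" "e' \<in> Arr A" using epi_arrow assms by blast+
  obtain P a b where "a \<in> Hom A P (Dom A e)" "epi_arr A a" "b \<in> Hom A P (Dom A e')" "e oo a = e' oo b"
    by (rule pullback_epi[OF assms(2), of "Dom A e'" "Cod A e" e "Dom A e"])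
      (use E assms(3) in \<open>auto simp: Hom_def\<close>)
  then show ?thesis using that[of a b] by (simp add: Hom_def)
qed

lemma loc_bd_plus:
  assumes "loc_bd X i z" "loc_bd X i w" "z \<in> Arr A" "w \<in> Arr A" "Dom A w = Dom A z"
    "Cod A z = cobj X i" "Cod A w = cobj X i" "bounded_complex A X"
  shows "loc_bd X i (z \<boxplus> w)"
proof -
  obtain e x where h: "epi_arr A e" "e \<in> Arr A" "Cod A e = Dom A z" "x \<in> Arr A" "Dom A x = Dom A e"
    "Cod A x = cobj X (i - 1)" "z oo e = cdiff X (i - 1) oo x" using loc_bdE[OF assms(1)] .
  obtain e' y where k: "epi_arr A e'" "e' \<in> Arr A" "Cod A e' = Dom A w" "y \<in> Arr A" "Dom A y = Dom A e'"
    "Cod A y = cobj X (i - 1)" "w oo e' = cdiff X (i - 1) oo y" using loc_bdE[OF assms(2)] .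
  obtain a b where ab: "epi_arr A a" "a \<in> Arr A" "b \<in> Arr A" "Dom A a = Dom A b" "Cod A a = Dom A e"
    "Cod A b = Dom A e'" "e oo a = e' oo b" using common_epi[OF h(1) k(1)] h k assms(5) by metis
  have 1: "z oo e oo a = cdiff X (i - 1) oo x oo a"
  proof -
    have "z oo e oo a = (z oo e) oo a" using h(1-6) ab(2,5) assms by (simp add: comp_assoc)
    then show ?thesis using h ab(2,5) by (simp add: comp_assoc complexD[OF assms(8)])
  qed
  have 2: "w oo e oo a = cdiff X (i - 1) oo y oo b"
  proof -
    have "w oo e oo a = (w oo e') oo b" using k(1-6) ab(2-7) assms by (simp add: comp_assoc)
    then show ?thesis using k ab(3,6) by (simp add: comp_assoc complexD[OF assms(8)])
  qed
  show ?thesis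
    by (rule loc_bdI[of "e oo a" _ "x oo a \<boxplus> y oo b"])
      (use 1 2 h(1-6) k(1-6) ab(1-6) assms(3-8) in
        \<open>simp_all add: epi_comp comp_arr plus_arr plus_comp comp_plus complexD[OF assms(8)]\<close>)
qed

subsection \<open>Quasi-isomorphisms\<close>

text \<open>
  Injectivity and surjectivity of a chain map on cohomology, expressed for local generalised elements.
  Together they characterise quasi-isomorphisms (\<open>quasi_isoI\<close> and \<open>quasi_isoD\<close>), and after this
  characterisation no cohomology object has to be chosen.
\<close>

definition coh_inj_at :: "('o, 'm) complex \<Rightarrow> ('o, 'm) complex \<Rightarrow> (int \<Rightarrow> 'm) \<Rightarrow> int \<Rightarrow> bool" where
  "coh_inj_at X Y f i \<longleftrightarrow> (\<forall>z. cocycle X i z \<and> loc_bd Y i (f i oo z) \<longrightarrow> loc_bd X i z)"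

definition coh_inj :: "('o, 'm) complex \<Rightarrow> ('o, 'm) complex \<Rightarrow> (int \<Rightarrow> 'm) \<Rightarrow> bool" where
  "coh_inj X Y f \<longleftrightarrow> (\<forall>i. coh_inj_at X Y f i)"

definition coh_surj_at :: "('o, 'm) complex \<Rightarrow> ('o, 'm) complex \<Rightarrow> (int \<Rightarrow> 'm) \<Rightarrow> int \<Rightarrow> bool" where
  "coh_surj_at X Y f i \<longleftrightarrow> (\<forall>y. cocycle Y i y \<longrightarrow> (\<exists>e x. epi_arr A e \<and> Cod A e = Dom A y \<and>
     cocycle X i x \<and> Dom A x = Dom A e \<and> loc_bd Y i (f i oo x \<boxplus> \<boxminus> (y oo e))))"

definition coh_surj :: "('o, 'm) complex \<Rightarrow> ('o, 'm) complex \<Rightarrow> (int \<Rightarrow> 'm) \<Rightarrow> bool" where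
  "coh_surj X Y f \<longleftrightarrow> (\<forall>i. coh_surj_at X Y f i)"

lemma cocycle_comp:
  assumes "cocycle X i z" "e \<in> Arr A" "Cod A e = Dom A z" "bounded_complex A X"
  shows "cocycle X i (z oo e)"
proof -
  have "cdiff X i oo z oo e = (cdiff X i oo z) oo e"
    by (rule comp_assoc[symmetric])
      (use assms(1-3) in \<open>simp_all add: cocycle_def complexD[OF assms(4)]\<close>)
  then show ?thesis using assms by (simp add: cocycle_def comp_arr zero_comp complexD[OF assms(4)])
qed

lemma cocycle_map:
  assumes "cocycle X i z" "chain_map A X Y f" "bounded_complex A X" "bounded_complex A Y"
  shows "cocycle Y i (f i oo z)"
proof -
  have "cdiff Y i oo f i oo z = f (i + 1) oo cdiff X i oo z"
    by (rule chain_map_left[OF assms(2-4), symmetric]) (use assms(1) in \<open>simp_all add: cocycle_def\<close>)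
  then show ?thesis using assms(1)
    by (simp add: cocycle_def comp_arr comp_zero Dom_Obj chain_mapD[OF assms(2)])
qed

lemma cocycle_plus:
  assumes "cocycle X i z" "cocycle X i w" "Dom A w = Dom A z" "bounded_complex A X"
  shows "cocycle X i (z \<boxplus> w)"
  using assms by (simp add: cocycle_def plus_arr comp_plus plus_zero zero_arr Dom_Obj complexD[OF assms(4)])

lemma cocycle_neg:
  assumes "cocycle X i z" "bounded_complex A X"
  shows "cocycle X i (\<boxminus> z)"
  using assms by (simp add: cocycle_def neg_arr comp_neg neg_zero Dom_Obj complexD[OF assms(2)])

lemma loc_bd_map:
  assumes "loc_bd X i z" "z \<in> Arr A" "Cod A z = cobj X i" "chain_map A X Y f" "bounded_complex A X" "bounded_complex A Y"
  shows "loc_bd Y i (f i oo z)"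
proof -
  obtain e x where h: "epi_arr A e" "e \<in> Arr A" "Cod A e = Dom A z" "x \<in> Arr A" "Dom A x = Dom A e"
    "Cod A x = cobj X (i - 1)" "z oo e = cdiff X (i - 1) oo x" using loc_bdE[OF assms(1)] .
  have "f i oo cdiff X (i - 1) oo x = cdiff Y (i - 1) oo f (i - 1) oo x"
    by (rule chain_map_left[OF assms(4-6)]) (use h in simp_all)
  then show ?thesis
    by (intro loc_bdI[of e _ "f (i - 1) oo x"])
      (use h assms(2,3) in \<open>simp_all add: comp_arr comp_assoc chain_mapD[OF assms(4)]\<close>)
qed

lemma coh_surj_atE:
  assumes "coh_surj_at X Y f i" "cocycle Y i y" "chain_map A X Y f" "bounded_complex A X" "bounded_complex A Y"
  obtains e x u where "epi_arr A e" "e \<in> Arr A" "Cod A e = Dom A y" "cocycle X i x" "x \<in> Arr A"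
    "Cod A x = cobj X i" "Dom A x = Dom A e" "u \<in> Arr A" "Dom A u = Dom A e"
    "Cod A u = cobj Y (i - 1)" "f i oo x = y oo e \<boxplus> cdiff Y (i - 1) oo u"
proof -
  obtain e x where ex: "epi_arr A e" "Cod A e = Dom A y" "cocycle X i x" "Dom A x = Dom A e"
    "loc_bd Y i (f i oo x \<boxplus> \<boxminus> (y oo e))"
    using assms(1,2) unfolding coh_surj_at_def by blast
  have a: "e \<in> Arr A" "x \<in> Arr A" "Cod A x = cobj X i" "y \<in> Arr A" "Cod A y = cobj Y i"
    using ex assms(2) epi_arrow by (auto simp: cocycle_def)
  obtain e' u where h: "epi_arr A e'" "e' \<in> Arr A" "Cod A e' = Dom A (f i oo x \<boxplus> \<boxminus> (y oo e))" "u \<in> Arr A"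
    "Dom A u = Dom A e'" "Cod A u = cobj Y (i - 1)"
    "(f i oo x \<boxplus> \<boxminus> (y oo e)) oo e' = cdiff Y (i - 1) oo u" using loc_bdE[OF ex(5)] .
  have c: "Cod A e' = Dom A e" using h(3) a ex(2,4)
    by (simp add: comp_arr plus_arr neg_arr chain_mapD[OF assms(3)])
  have "f i oo x oo e' = y oo e oo e' \<boxplus> (f i oo x \<boxplus> \<boxminus> (y oo e)) oo e'"
    by (rule eq_sgI) (use c h(2) a ex(2,4) in \<open>simp add: lin_simps chain_mapD[OF assms(3)]\<close>)
  then have "f i oo x oo e' = y oo e oo e' \<boxplus> cdiff Y (i - 1) oo u" by (simp only: h(7))
  then show ?thesis
    using that[of "e oo e'" "x oo e'" u] cocycle_comp[OF ex(3) h(2) _ assms(4)] epi_comp[OF ex(1) h(1)] c h(2,4-6) a ex(2,4)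
    by (simp add: comp_arr)
qed

lemma coh_surjE:
  assumes "coh_surj X Y f" "cocycle Y i y" "chain_map A X Y f" "bounded_complex A X" "bounded_complex A Y"
  obtains e x u where "epi_arr A e" "e \<in> Arr A" "Cod A e = Dom A y" "cocycle X i x" "x \<in> Arr A"
    "Cod A x = cobj X i" "Dom A x = Dom A e" "u \<in> Arr A" "Dom A u = Dom A e"
    "Cod A u = cobj Y (i - 1)" "f i oo x = y oo e \<boxplus> cdiff Y (i - 1) oo u"
  using coh_surj_atE[OF _ assms(2-5)] assms(1) unfolding coh_surj_def by blast

lemma is_cohomology_ex:
  assumes "bounded_complex A X" shows "\<exists>z p. is_cohomology A X i z p"
proof -
  obtain z where z: "is_kernel A (cdiff X i) z" using ex_kernel complexD[OF assms] by blast
  obtain b where b: "b \<in> Hom A (cobj X (i - 1)) (Dom A z)" "z oo b = cdiff X (i - 1)"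
    by (rule kernel_lift[OF z, of "cdiff X (i - 1)" "cobj X (i - 1)"])
      (simp_all add: Hom_def complex_simps[OF assms])
  obtain p where "is_cokernel A b p" using ex_cokernel b(1) by (auto simp: Hom_def)
  with z b show ?thesis unfolding is_cohomology_def by blast
qed

lemma is_cohomologyD:
  assumes "is_cohomology A X i z p" "bounded_complex A X"
  shows "z \<in> Arr A" "Cod A z = cobj X i" "p \<in> Arr A" "Dom A p = Dom A z"
    "cdiff X i oo z = Zero A (Dom A z) (cobj X (i + 1))" "epi_arr A p"
proof -
  obtain b where h: "is_kernel A (cdiff X i) z" "b \<in> Hom A (cobj X (i - 1)) (Dom A z)" "is_cokernel A b p"
    using assms(1) unfolding is_cohomology_def by blast
  then show "z \<in> Arr A" "Cod A z = cobj X i" "p \<in> Arr A" "Dom A p = Dom A z"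
    "cdiff X i oo z = Zero A (Dom A z) (cobj X (i + 1))" "epi_arr A p"
    using kernelD[OF h(1)] cokernelD[OF h(3)] cokernel_epi[OF h(3)] complexD[OF assms(2)]
    by (auto simp: Hom_def)
qed

lemma cocycle_cohomology:
  assumes "is_cohomology A X i z p" "bounded_complex A X" "x \<in> Arr A" "Cod A x = Dom A z"
  shows "cocycle X i (z oo x)"
  by (rule cocycle_comp) (use is_cohomologyD[OF assms(1,2)] assms in \<open>auto simp: cocycle_def\<close>)

lemma cocycle_lift:
  assumes "is_cohomology A X i z p" "bounded_complex A X" "cocycle X i w"
  obtains x where "x \<in> Arr A" "Dom A x = Dom A w" "Cod A x = Dom A z" "w = z oo x"
proof -
  have k: "is_kernel A (cdiff X i) z" using assms(1) by (simp add: is_cohomology_def)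
  obtain x where "x \<in> Hom A (Dom A w) (Dom A z)" "z oo x = w"
    by (rule kernel_lift[OF k, of w "Dom A w"])
      (use assms(3) in \<open>auto simp: cocycle_def Hom_def complexD[OF assms(2)]\<close>)
  then show ?thesis using that by (auto simp: Hom_def)
qed

text \<open>
  The bridge between generalised elements and a chosen cohomology object, whose projection \<open>p\<close> is a
  cokernel and therefore exact on local elements.
\<close>

lemma loc_bd_cohomology:
  assumes "is_cohomology A X i z p" "bounded_complex A X" "x \<in> Arr A" "Cod A x = Dom A z"
  shows "loc_bd X i (z oo x) \<longleftrightarrow> p oo x = Zero A (Dom A x) (Cod A p)"
proof -
  note D = is_cohomologyD[OF assms(1,2)]
  obtain b where k: "is_kernel A (cdiff X i) z" and b: "b \<in> Hom A (cobj X (i - 1)) (Dom A z)"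
    "z oo b = cdiff X (i - 1)" "is_cokernel A b p"
    using assms(1) unfolding is_cohomology_def by blast
  have B: "b \<in> Arr A" "Dom A b = cobj X (i - 1)" "Cod A b = Dom A z" using b by (auto simp: Hom_def)
  have pb: "p oo b = Zero A (cobj X (i - 1)) (Cod A p)" using cokernelD[OF b(3)] B by simp
  show ?thesis
  proof
    assume "loc_bd X i (z oo x)"
    then obtain e y where h: "epi_arr A e" "e \<in> Arr A" "Cod A e = Dom A (z oo x)" "y \<in> Arr A" "Dom A y = Dom A e"
      "Cod A y = cobj X (i - 1)" "(z oo x) oo e = cdiff X (i - 1) oo y" by (rule loc_bdE)
    have c: "Cod A e = Dom A x" using h(3) D assms(3,4) by (simp add: comp_arr)
    have "z oo x oo e = (z oo b) oo y" using h(7) c h(2) assms(3,4) D by (simp add: comp_assoc b(2))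
    also have "\<dots> = z oo b oo y" using h D B by (simp add: comp_assoc)
    finally have "x oo e = b oo y"
      by (rule kernel_mono[OF k, of "x oo e" "Dom A e" "b oo y", rotated 2]) (use h(2,4-6) c B assms(3,4) in \<open>simp_all add: Hom_def comp_arr\<close>)
    then have "(p oo x) oo e = p oo b oo y" using h(2) c assms(3,4) D by (simp add: comp_assoc)
    also have "\<dots> = (p oo b) oo y" using h(4-6) B D by (simp add: comp_assoc)
    also have "\<dots> = Zero A (Dom A e) (Cod A p)" unfolding pb using h(4-6) D(3) by (simp add: zero_comp Cod_Obj)
    finally have "(p oo x) oo e = Zero A (Dom A e) (Cod A p)" .
    then show "p oo x = Zero A (Dom A x) (Cod A p)"
      using epi_cancel_zero[OF h(1), of "p oo x"] c assms(3,4) D by (simp add: comp_arr)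
  next
    assume px: "p oo x = Zero A (Dom A x) (Cod A p)"
    obtain V e y where h: "e \<in> Hom A V (Dom A x)" "epi_arr A e" "y \<in> Hom A V (Dom A b)" "x oo e = b oo y"
      by (rule cokernel_exact[OF b(3), of x "Dom A x"]) (use assms(3,4) px B in \<open>auto simp: Hom_def\<close>)
    have H: "e \<in> Arr A" "Dom A e = V" "Cod A e = Dom A x" "y \<in> Arr A" "Dom A y = V" "Cod A y = cobj X (i - 1)"
      using h B by (auto simp: Hom_def)
    have "(z oo x) oo e = z oo b oo y" using H(1-3) assms(3,4) D by (simp add: comp_assoc h(4))
    also have "\<dots> = (z oo b) oo y" using H B D by (simp add: comp_assoc)
    finally show "loc_bd X i (z oo x)"
      by (intro loc_bdI[of e _ y]) (use h(2) H assms(3,4) D in \<open>simp_all add: comp_arr b(2)\<close>)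
  qed
qed

lemma quasi_isoI:
  assumes f: "chain_map A X Y f" and b: "bounded_complex A X" "bounded_complex A Y"
    and inj: "coh_inj X Y f" and surj: "coh_surj X Y f"
  shows "quasi_iso A X Y f"
  unfolding quasi_iso_def
proof (intro conjI allI impI f)
  fix i z p z' p' a h
  assume asm: "is_cohomology A X i z p \<and> is_cohomology A Y i z' p' \<and> a \<in> Hom A (Dom A z) (Dom A z') \<and>
     z' oo a = f i oo z \<and> h \<in> Hom A (Cod A p) (Cod A p') \<and> h oo p = p' oo a"
  then have c: "is_cohomology A X i z p" "is_cohomology A Y i z' p'" and e1: "z' oo a = f i oo z" and e2: "h oo p = p' oo a"
    and H: "a \<in> Arr A" "Dom A a = Dom A z" "Cod A a = Dom A z'" "h \<in> Arr A" "Dom A h = Cod A p" "Cod A h = Cod A p'"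
    by (auto simp: Hom_def)
  note D = is_cohomologyD[OF c(1) b(1)] and D' = is_cohomologyD[OF c(2) b(2)] and F = chain_mapD(1-3)[OF f, of i]
  have e1': "z' oo a oo x = f i oo z oo x" if "x \<in> Arr A" "Cod A x = Dom A z" for x
    using that H D D' F e1 comp_assoc[of x a z'] comp_assoc[of x z "f i"] by simp
  have e2': "h oo p oo x = p' oo a oo x" if "x \<in> Arr A" "Cod A x = Dom A z" for x
    using that H D D' F e2 comp_assoc[of x a p'] comp_assoc[of x p h] by simp
  have "mono_arr A h"
  proof (rule monoI_zero)
    fix W g assume g: "g \<in> Hom A W (Dom A h)" "h oo g = Zero A W (Cod A h)"
    have G: "g \<in> Arr A" "Dom A g = W" "Cod A g = Cod A p" using g H by (auto simp: Hom_def)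
    obtain V e x where k: "e \<in> Hom A V W" "epi_arr A e" "x \<in> Hom A V (Dom A z)" "g oo e = p oo x"
      using pullback_epi[OF D(6), of "Dom A z" "Cod A p" g W] D G by (auto simp: Hom_def)
    have K: "e \<in> Arr A" "Dom A e = V" "Cod A e = W" "x \<in> Arr A" "Dom A x = V" "Cod A x = Dom A z"
      using k by (auto simp: Hom_def)
    have "p' oo a oo x = h oo g oo e" using e2' K k(4) by simp
    also have "\<dots> = (h oo g) oo e" using K G H by (simp add: comp_assoc)
    also have "\<dots> = Zero A V (Cod A p')" unfolding g(2) using K H D' by (simp add: zero_comp Cod_Obj)
    finally have "loc_bd Y i (z' oo a oo x)"
      using loc_bd_cohomology[OF c(2) b(2), of "a oo x"] K H by (simp add: comp_arr)
    then have "loc_bd Y i (f i oo z oo x)" using e1' K by simp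
    then have "loc_bd X i (z oo x)"
      using inj cocycle_cohomology[OF c(1) b(1), of x] K unfolding coh_inj_def coh_inj_at_def by blast
    then have "g oo e = Zero A V (Cod A p)"
      using loc_bd_cohomology[OF c(1) b(1), of x] K k(4) by simp
    then show "g = Zero A W (Dom A h)" using epi_cancel_zero[OF k(2), of g] G K H by simp
  qed (use H in simp)
  moreover have "epi_arr A h"
  proof (rule epiI_zero)
    fix W g assume g: "g \<in> Hom A (Cod A h) W" "g oo h = Zero A (Dom A h) W"
    have G: "g \<in> Arr A" "Dom A g = Cod A p'" "Cod A g = W" "W \<in> Obj A" using g H Cod_Obj by (auto simp: Hom_def)
    have "cocycle Y i z'" using D' by (simp add: cocycle_def)
    then obtain e x where ex: "epi_arr A e" "Cod A e = Dom A z'" "cocycle X i x" "Dom A x = Dom A e"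
      "loc_bd Y i (f i oo x \<boxplus> \<boxminus> (z' oo e))"
      using surj unfolding coh_surj_def coh_surj_at_def by blast
    obtain x' where x': "x' \<in> Arr A" "Dom A x' = Dom A x" "Cod A x' = Dom A z" "x = z oo x'"
      using cocycle_lift[OF c(1) b(1) ex(3)] .
    have E: "e \<in> Arr A" using ex epi_arrow by blast
    have X: "Dom A x' = Dom A e" using x' ex by simp
    have "f i oo x \<boxplus> \<boxminus> (z' oo e) = z' oo (a oo x' \<boxplus> \<boxminus> e)"
      unfolding x'(4) using x'(1,3) X E ex(2) H D D' F e1'[OF x'(1,3)]
      by (simp add: comp_plus comp_neg comp_arr neg_arr)
    then have "p' oo (a oo x' \<boxplus> \<boxminus> e) = Zero A (Dom A e) (Cod A p')"
      using loc_bd_cohomology[OF c(2) b(2), of "a oo x' \<boxplus> \<boxminus> e"] ex(5) x'(1,3) X E ex(2) H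
      by (simp add: comp_arr plus_arr neg_arr)
    then have "p' oo a oo x' \<boxplus> \<boxminus> (p' oo e) = Zero A (Dom A e) (Cod A p')"
      using x'(1,3) X E ex(2) H D D' by (simp add: comp_plus comp_neg comp_arr neg_arr)
    then have "p' oo a oo x' = p' oo e"
      using plus_neg_eq_zero_iff[of "p' oo a oo x'" "p' oo e"] x'(1,3) X E ex(2) H D D' by (simp add: comp_arr)
    then have "(g oo p') oo e = g oo h oo p oo x'"
      using e2'[OF x'(1,3)] E ex(2) D' G by (simp add: comp_assoc)
    also have "\<dots> = (g oo h) oo p oo x'" using x'(1,3) H D G by (simp add: comp_assoc comp_arr)
    also have "\<dots> = Zero A (Dom A e) W" unfolding g(2) using x'(1,3) X H D G by (simp add: zero_comp comp_arr)
    finally have "g oo p' = Zero A (Dom A z') W"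
      using epi_cancel_zero[OF ex(1), of "g oo p'"] E ex(2) D' G by (simp add: comp_arr)
    then show "g = Zero A (Cod A h) W" using epi_cancel_zero[OF D'(6), of g] D' G H by simp
  qed (use H in simp)
  ultimately show "iso_arr A h" by (rule mono_epi_iso)
qed

lemma quasi_isoD:
  assumes q: "quasi_iso A X Y f" and b: "bounded_complex A X" "bounded_complex A Y"
  shows "coh_inj X Y f" "coh_surj X Y f"
proof -
  have f: "chain_map A X Y f" using q by (simp add: quasi_iso_def)
  have data: "\<exists>z p z' p' a h h'. is_cohomology A X i z p \<and> is_cohomology A Y i z' p' \<and>
      a \<in> Arr A \<and> Dom A a = Dom A z \<and> Cod A a = Dom A z' \<and> h \<in> Arr A \<and> Dom A h = Cod A p \<and> Cod A h = Cod A p' \<and>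
      z' oo a = f i oo z \<and> h oo p = p' oo a \<and> h' \<in> Arr A \<and> Dom A h' = Cod A p' \<and> Cod A h' = Cod A p \<and>
      h' oo h = Id A (Cod A p) \<and> h oo h' = Id A (Cod A p')" for i
  proof -
    obtain z p where c: "is_cohomology A X i z p" using is_cohomology_ex[OF b(1)] by blast
    obtain z' p' where c': "is_cohomology A Y i z' p'" using is_cohomology_ex[OF b(2)] by blast
    note D = is_cohomologyD[OF c b(1)] and D' = is_cohomologyD[OF c' b(2)] and F = chain_mapD(1-3)[OF f, of i]
    have "cocycle X i z" using D by (simp add: cocycle_def)
    from cocycle_lift[OF c' b(2) cocycle_map[OF this f b]]
    obtain a where a: "a \<in> Arr A" "Dom A a = Dom A (f i oo z)" "Cod A a = Dom A z'" "f i oo z = z' oo a" .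
    have ad: "Dom A a = Dom A z" using a(2) D F by (simp add: comp_arr)
    obtain d where d: "d \<in> Hom A (cobj X (i - 1)) (Dom A z)" "z oo d = cdiff X (i - 1)" "is_cokernel A d p"
      using c unfolding is_cohomology_def by blast
    have Dd: "d \<in> Arr A" "Dom A d = cobj X (i - 1)" "Cod A d = Dom A z" using d by (auto simp: Hom_def)
    have "loc_bd X i (z oo d)" unfolding d(2)
      using loc_bd_diff[OF b(1), of "Id A (cobj X (i - 1))" i] by (simp add: cat_simps complexD[OF b(1)])
    from loc_bd_map[OF this _ _ f b] have "loc_bd Y i (f i oo z oo d)" using Dd D by (simp add: comp_arr)
    moreover have "f i oo z oo d = z' oo a oo d"
      using comp_assoc[of d z "f i"] comp_assoc[of d a z'] a Dd D D' F ad by simp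
    ultimately have "p' oo a oo d = Zero A (cobj X (i - 1)) (Cod A p')"
      using loc_bd_cohomology[OF c' b(2), of "a oo d"] a(1,3) ad Dd by (simp add: comp_arr)
    then have "(p' oo a) oo d = Zero A (Dom A d) (Cod A p')" using a(1,3) ad Dd D' by (simp add: comp_assoc)
    moreover have "p' oo a \<in> Hom A (Cod A d) (Cod A p')" using a(1,3) ad Dd D' by (simp add: Hom_def comp_arr)
    ultimately obtain h where h: "h \<in> Hom A (Cod A p) (Cod A p')" "h oo p = p' oo a"
      using cokernel_lift[OF d(3)] by metis
    have "iso_arr A h"
      using q c c' h a(1,3,4) ad unfolding quasi_iso_def by (metis HomI)
    have H: "h \<in> Arr A" "Dom A h = Cod A p" "Cod A h = Cod A p'" using HomD[OF h(1)] by auto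
    then obtain h' where h': "h' \<in> Hom A (Cod A p') (Cod A p)" "h' oo h = Id A (Cod A p)" "h oo h' = Id A (Cod A p')"
      using \<open>iso_arr A h\<close> unfolding iso_arr_def by metis
    note H' = HomD[OF h'(1)] and a4 = a(4)[symmetric]
    show ?thesis
      by (intro exI[of _ z] exI[of _ p] exI[of _ z'] exI[of _ p'] exI[of _ a] exI[of _ h] exI[of _ h'] conjI)
        (fact c c' a(1) ad a(3) H a4 h(2) H' h'(2,3))+
  qed
  show "coh_inj X Y f" unfolding coh_inj_def coh_inj_at_def
  proof (intro allI impI, elim conjE)
    fix i w assume w: "cocycle X i w" "loc_bd Y i (f i oo w)"
    obtain z p z' p' a h h' where c: "is_cohomology A X i z p" "is_cohomology A Y i z' p'" and
      a: "a \<in> Arr A" "Dom A a = Dom A z" "Cod A a = Dom A z'" and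
      h: "h \<in> Arr A" "Dom A h = Cod A p" "Cod A h = Cod A p'" and e: "z' oo a = f i oo z" "h oo p = p' oo a" and
      h': "h' \<in> Arr A" "Dom A h' = Cod A p'" "Cod A h' = Cod A p" "h' oo h = Id A (Cod A p)"
      using data[of i] by metis
    note D = is_cohomologyD[OF c(1) b(1)] and D' = is_cohomologyD[OF c(2) b(2)] and F = chain_mapD(1-3)[OF f, of i]
    obtain x where x: "x \<in> Arr A" "Cod A x = Dom A z" "w = z oo x" using cocycle_lift[OF c(1) b(1) w(1)] by metis
    have "f i oo w = z' oo a oo x"
      unfolding x(3) using comp_assoc[of x z "f i"] comp_assoc[of x a z'] x(1,2) D D' a F e(1) by simp
    then have 1: "p' oo a oo x = Zero A (Dom A x) (Cod A p')"
      using loc_bd_cohomology[OF c(2) b(2), of "a oo x"] w(2) a x(1,2) by (simp add: comp_arr)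
    have "p oo x = (h' oo h) oo p oo x" unfolding h'(4) using x(1,2) D by (simp add: id_comp comp_arr)
    also have "\<dots> = h' oo (h oo p) oo x" using x(1,2) D h h'(1-3) by (simp add: comp_assoc comp_arr)
    also have "\<dots> = h' oo p' oo a oo x" unfolding e(2) using x(1,2) D' a by (simp add: comp_assoc)
    also have "\<dots> = Zero A (Dom A x) (Cod A p)" unfolding 1 using h' x by (simp add: comp_zero Dom_Obj)
    finally show "loc_bd X i w" unfolding x(3) using loc_bd_cohomology[OF c(1) b(1), of x] x(1,2) by simp
  qed
  show "coh_surj X Y f" unfolding coh_surj_def coh_surj_at_def
  proof (intro allI impI)
    fix i w assume w: "cocycle Y i w"
    obtain z p z' p' a h h' where c: "is_cohomology A X i z p" "is_cohomology A Y i z' p'" and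
      a: "a \<in> Arr A" "Dom A a = Dom A z" "Cod A a = Dom A z'" and
      h: "h \<in> Arr A" "Dom A h = Cod A p" "Cod A h = Cod A p'" and e: "z' oo a = f i oo z" "h oo p = p' oo a" and
      h': "h' \<in> Arr A" "Dom A h' = Cod A p'" "Cod A h' = Cod A p" "h oo h' = Id A (Cod A p')"
      using data[of i] by metis
    note D = is_cohomologyD[OF c(1) b(1)] and D' = is_cohomologyD[OF c(2) b(2)] and F = chain_mapD(1-3)[OF f, of i]
    obtain y where y: "y \<in> Arr A" "Dom A y = Dom A w" "Cod A y = Dom A z'" "w = z' oo y"
      using cocycle_lift[OF c(2) b(2) w] .
    obtain V u x where k: "u \<in> Hom A V (Dom A y)" "epi_arr A u" "x \<in> Hom A V (Dom A z)" "(h' oo p' oo y) oo u = p oo x"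
      by (rule pullback_epi[OF D(6), of "Dom A z" "Cod A p" "h' oo p' oo y" "Dom A y"])
        (use D D' h' y(1,3) in \<open>simp_all add: Hom_def comp_arr\<close>)
    have K: "u \<in> Arr A" "Dom A u = V" "Cod A u = Dom A y" "x \<in> Arr A" "Dom A x = V" "Cod A x = Dom A z"
      using k by (auto simp: Hom_def)
    have "p' oo a oo x = (p' oo a) oo x" using K D' a by (simp add: comp_assoc)
    also have "\<dots> = h oo p oo x" unfolding e(2)[symmetric] using K D h by (simp add: comp_assoc)
    also have "\<dots> = (h oo h') oo p' oo y oo u"
      unfolding k(4)[symmetric] using K D' h h'(1-3) y(1,3) by (simp add: comp_assoc comp_arr)
    also have "\<dots> = p' oo y oo u" unfolding h'(4) using K D' y(1,3) by (simp add: id_comp comp_arr)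
    finally have pe: "p' oo a oo x = p' oo y oo u" .
    have "p' oo (a oo x \<boxplus> \<boxminus> (y oo u)) = Zero A V (Cod A p')"
      using pe K D' a y(1,3) plus_neg[of "p' oo y oo u"] by (simp add: comp_plus comp_neg comp_arr neg_arr)
    then have "loc_bd Y i (z' oo (a oo x \<boxplus> \<boxminus> (y oo u)))"
      using loc_bd_cohomology[OF c(2) b(2), of "a oo x \<boxplus> \<boxminus> (y oo u)"] K a y(1,3)
      by (simp add: comp_arr plus_arr neg_arr)
    moreover have "z' oo (a oo x \<boxplus> \<boxminus> (y oo u)) = (z' oo a) oo x \<boxplus> \<boxminus> ((z' oo y) oo u)"
      using K D' a y(1,3) by (simp add: comp_plus comp_neg comp_arr neg_arr comp_assoc)
    moreover have "(z' oo a) oo x = f i oo z oo x" unfolding e(1) using K D F by (simp add: comp_assoc)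
    ultimately have "loc_bd Y i (f i oo z oo x \<boxplus> \<boxminus> (w oo u))" by (simp only: y(4))
    then show "\<exists>e x. epi_arr A e \<and> Cod A e = Dom A w \<and> cocycle X i x \<and> Dom A x = Dom A e \<and>
      loc_bd Y i (f i oo x \<boxplus> \<boxminus> (w oo e))"
      by (intro exI[of _ u] exI[of _ "z oo x"] conjI)
        (use k(2) K y(2) D cocycle_cohomology[OF c(1) b(1), of x] in \<open>simp_all add: comp_arr\<close>)
  qed
qed

lemma htpy_on_cocycle:
  assumes "homotopic A X Y f g" "cocycle X i z" "chain_map A X Y g" "bounded_complex A X" "bounded_complex A Y"
  obtains u where "u \<in> Arr A" "Dom A u = Dom A z" "Cod A u = cobj Y (i - 1)"
    "f i oo z = g i oo z \<boxplus> cdiff Y (i - 1) oo u"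
proof -
  obtain s where s: "is_htpy X Y s" and e: "\<And>i. f i = g i \<boxplus> (cdiff Y (i - 1) oo s i \<boxplus> s (i + 1) oo cdiff X i)"
    using homotopicE[OF assms(1)] by metis
  have "f i oo z = g i oo z \<boxplus> cdiff Y (i - 1) oo s i oo z"
    unfolding e using assms(2)
    by (simp add: cocycle_def arr_simps plus_comp is_htpyD[OF s] chain_mapD[OF assms(3)]
      complexD[OF assms(4)] complexD[OF assms(5)])
  then show ?thesis using that[of "s i oo z"] assms(2)
    by (simp add: cocycle_def comp_arr is_htpyD[OF s])
qed

lemma coh_inj_htpy:
  assumes "homotopic A X Y f g" "chain_map A X Y f" "chain_map A X Y g" "bounded_complex A X" "bounded_complex A Y"
    "coh_inj X Y f"
  shows "coh_inj X Y g"
  unfolding coh_inj_def coh_inj_at_def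
proof (intro allI impI, elim conjE)
  fix i z assume z: "cocycle X i z" "loc_bd Y i (g i oo z)"
  obtain u where u: "u \<in> Arr A" "Dom A u = Dom A z" "Cod A u = cobj Y (i - 1)"
    "f i oo z = g i oo z \<boxplus> cdiff Y (i - 1) oo u"
    using htpy_on_cocycle[OF assms(1) z(1) assms(3-5)] .
  have "loc_bd Y i (f i oo z)" unfolding u(4)
    by (rule loc_bd_plus[OF z(2) loc_bd_diff[OF assms(5)]])
      (use u(1-3) z(1) in \<open>simp_all add: cocycle_def comp_arr chain_mapD[OF assms(3)] complexD assms(5)\<close>)
  then show "loc_bd X i z" using assms(6) z(1) unfolding coh_inj_def coh_inj_at_def by blast
qed

lemma coh_surj_htpy:
  assumes "homotopic A X Y f g" "chain_map A X Y f" "chain_map A X Y g" "bounded_complex A X" "bounded_complex A Y"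
    "coh_surj X Y f"
  shows "coh_surj X Y g"
  unfolding coh_surj_def coh_surj_at_def
proof (intro allI impI)
  fix i y assume y: "cocycle Y i y"
  obtain e x u where h: "epi_arr A e" "e \<in> Arr A" "Cod A e = Dom A y" "cocycle X i x" "x \<in> Arr A"
    "Cod A x = cobj X i" "Dom A x = Dom A e" "u \<in> Arr A" "Dom A u = Dom A e"
    "Cod A u = cobj Y (i - 1)" "f i oo x = y oo e \<boxplus> cdiff Y (i - 1) oo u"
    using coh_surjE[OF assms(6) y assms(2,4,5)] .
  obtain v where v: "v \<in> Arr A" "Dom A v = Dom A x" "Cod A v = cobj Y (i - 1)"
    "g i oo x = f i oo x \<boxplus> cdiff Y (i - 1) oo v"
    using htpy_on_cocycle[OF homotopic_sym[OF assms(1-5)] h(4) assms(2,4,5)] .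
  have "g i oo x \<boxplus> \<boxminus> (y oo e) = cdiff Y (i - 1) oo (u \<boxplus> v)"
    unfolding v(4) h(11)
    by (rule eq_sgI) (use h(1-10) v(1-3) y in \<open>simp add: lin_simps cocycle_def complexD[OF assms(5)]\<close>)
  then have "loc_bd Y i (g i oo x \<boxplus> \<boxminus> (y oo e))"
    using loc_bd_diff[OF assms(5), of "u \<boxplus> v" i] h(1-10) v(1-3) by (simp add: plus_arr)
  then show "\<exists>e x. epi_arr A e \<and> Cod A e = Dom A y \<and> cocycle X i x \<and> Dom A x = Dom A e \<and>
      loc_bd Y i (g i oo x \<boxplus> \<boxminus> (y oo e))" using h by blast
qed

lemma qis_iff:
  assumes "chain_map A X Y f" "bounded_complex A X" "bounded_complex A Y"
  shows "hc X Y f \<in> qis A \<longleftrightarrow> coh_inj X Y f \<and> coh_surj X Y f"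
proof
  assume "hc X Y f \<in> qis A"
  then obtain g where g: "hc X Y f = hc X Y g" "quasi_iso A X Y g" by (auto simp: qis_def htpy_class_def)
  then have c: "chain_map A X Y g" by (simp add: quasi_iso_def)
  then have "homotopic A X Y g f" using g(1) hc_eq_iff[OF c assms(1) assms(2,3)] by simp
  with quasi_isoD[OF g(2) assms(2,3)] show "coh_inj X Y f \<and> coh_surj X Y f"
    using coh_inj_htpy coh_surj_htpy c assms by blast
next
  assume "coh_inj X Y f \<and> coh_surj X Y f"
  then show "hc X Y f \<in> qis A" using quasi_isoI assms unfolding qis_def by blast
qed

end

section \<open>Twisted sums and homotopy fibres\<close>

context preadditive_category
begin

lemma zero_objD:
  assumes "zero_obj C X"
  shows "X \<in> Obj C" "Id C X = Zero C X X"
    "f \<in> Arr C \<Longrightarrow> Cod C f = X \<Longrightarrow> f = Zero C (Dom C f) X"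
    "f \<in> Arr C \<Longrightarrow> Dom C f = X \<Longrightarrow> f = Zero C X (Cod C f)"
proof -
  show X: "X \<in> Obj C" using assms by (simp add: zero_obj_def)
  have u: "g = h" if "g \<in> Hom C X Y" "h \<in> Hom C X Y" for g h Y
    using assms that Hom_Obj(2)[OF that(1)] unfolding zero_obj_def by blast
  have v: "g = h" if "g \<in> Hom C Y X" "h \<in> Hom C Y X" for g h Y
    using assms that Hom_Obj(1)[OF that(1)] unfolding zero_obj_def by blast
  show "Id C X = Zero C X X" by (rule u[OF Id_Hom[OF X] Zero_Hom[OF X X]])
  show "f = Zero C (Dom C f) X" if "f \<in> Arr C" "Cod C f = X"
    by (rule v[OF HomI[OF that(1) refl that(2)] Zero_Hom[OF Dom_Obj[OF that(1)] X]])
  show "f = Zero C X (Cod C f)" if "f \<in> Arr C" "Dom C f = X"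
    by (rule u[OF HomI[OF that(1) that(2) refl] Zero_Hom[OF X Cod_Obj[OF that(1)]]])
qed

lemma zero_objI:
  assumes "X \<in> Obj C" "Id C X = Zero C X X"
  shows "zero_obj C X"
proof -
  have "f = Zero C X Y" if "f \<in> Hom C X Y" for f Y
  proof -
    note F = HomD[OF that]
    have "f = Comp C f (Id C X)" using F by (simp add: comp_id)
    then show ?thesis unfolding assms(2) using F assms(1) by (simp add: comp_zero)
  qed
  moreover have "f = Zero C Y X" if "f \<in> Hom C Y X" for f Y
  proof -
    note F = HomD[OF that]
    have "f = Comp C (Id C X) f" using F by (simp add: id_comp)
    then show ?thesis unfolding assms(2) using F assms(1) by (simp add: zero_comp)
  qed
  ultimately show ?thesis unfolding zero_obj_def using assms(1) Zero_Hom by blast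
qed

end

context ab_cat
begin

lemma bounded_complexI:
  assumes "\<And>i. cobj X i \<in> Obj A" "\<And>i. cdiff X i \<in> Arr A" "\<And>i. Dom A (cdiff X i) = cobj X i"
    "\<And>i. Cod A (cdiff X i) = cobj X (i + 1)"
    "\<And>i. cdiff X (i + 1) oo cdiff X i = Zero A (cobj X i) (cobj X (i + 1 + 1))"
    "\<And>i. \<bar>i\<bar> > N \<Longrightarrow> zero_obj A (cobj X i)"
  shows "bounded_complex A X"
  unfolding bounded_complex_def using assms by (auto simp: Hom_def add.assoc)

lemma bounded_complexE:
  assumes "bounded_complex A X"
  obtains N where "\<And>i. \<bar>i\<bar> > N \<Longrightarrow> zero_obj A (cobj X i)"
  using assms unfolding bounded_complex_def by blast

subsection \<open>Twisted sums\<close>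

text \<open>
  A direct sum of \<open>X\<close> and \<open>Y\<close> in each degree whose differential has the off-diagonal entry \<open>g\<close>.
  For \<open>g = 0\<close> this is the direct sum of complexes, and for a chain map \<open>g\<close> into a shifted complex it
  is a homotopy fibre.  The structure maps are kept as data, so that no concrete biproduct has to be
  unfolded.
\<close>

definition is_twist where
  "is_twist X Y g T p q j k \<longleftrightarrow> bounded_complex A T \<and> (\<forall>i.
     p i \<in> Hom A (cobj T i) (cobj X i) \<and> q i \<in> Hom A (cobj T i) (cobj Y i) \<and>
     j i \<in> Hom A (cobj X i) (cobj T i) \<and> k i \<in> Hom A (cobj Y i) (cobj T i) \<and>
     p i oo j i = Id A (cobj X i) \<and> q i oo k i = Id A (cobj Y i) \<and>
     p i oo k i = Zero A (cobj Y i) (cobj X i) \<and> q i oo j i = Zero A (cobj X i) (cobj Y i) \<and>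
     j i oo p i \<boxplus> k i oo q i = Id A (cobj T i) \<and>
     p (i + 1) oo cdiff T i = cdiff X i oo p i \<and> 
     q (i + 1) oo cdiff T i = g i oo p i \<boxplus> cdiff Y i oo q i)"

lemma twistD:
  assumes "is_twist X Y g T p q j k"
  shows "bounded_complex A T"
    "p i \<in> Arr A" "Dom A (p i) = cobj T i" "Cod A (p i) = cobj X i"
    "q i \<in> Arr A" "Dom A (q i) = cobj T i" "Cod A (q i) = cobj Y i"
    "j i \<in> Arr A" "Dom A (j i) = cobj X i" "Cod A (j i) = cobj T i"
    "k i \<in> Arr A" "Dom A (k i) = cobj Y i" "Cod A (k i) = cobj T i"
    "p i oo j i = Id A (cobj X i)" "q i oo k i = Id A (cobj Y i)"
    "p i oo k i = Zero A (cobj Y i) (cobj X i)" "q i oo j i = Zero A (cobj X i) (cobj Y i)"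
    "j i oo p i \<boxplus> k i oo q i = Id A (cobj T i)"
    "i' = i + 1 \<Longrightarrow> p i' oo cdiff T i = cdiff X i oo p i"
    "i' = i + 1 \<Longrightarrow> q i' oo cdiff T i = g i oo p i \<boxplus> cdiff Y i oo q i"
  using assms unfolding is_twist_def Hom_def by auto

lemma assoc_eq:
  assumes "a oo b = c" "a \<in> Arr A" "b \<in> Arr A" "Cod A b = Dom A a" "x \<in> Arr A" "Cod A x = Dom A b"
  shows "a oo b oo x = c oo x"
  using comp_assoc[of x b a] assms by simp

lemma twist_ex:
  assumes X: "bounded_complex A X" and Y: "bounded_complex A Y"
    and g: "\<And>i. g i \<in> Arr A" "\<And>i. Dom A (g i) = cobj X i" "\<And>i. Cod A (g i) = cobj Y (i + 1)"
    and gd: "\<And>i. g (i + 1) oo cdiff X i = \<boxminus> (cdiff Y (i + 1) oo g i)"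
  obtains T p q j k where "is_twist X Y g T p q j k"
proof -
  have "\<forall>i. \<exists>P j k p q. is_biproduct A (cobj X i) (cobj Y i) P j k p q"
    using ex_biproduct complexD(1)[OF X] complexD(1)[OF Y] by blast
  then obtain P j k p q where b: "\<And>i. is_biproduct A (cobj X i) (cobj Y i) (P i) (j i) (k i) (p i) (q i)"
    by metis
  have B: "p i \<in> Arr A" "Dom A (p i) = P i" "Cod A (p i) = cobj X i"
    "q i \<in> Arr A" "Dom A (q i) = P i" "Cod A (q i) = cobj Y i"
    "j i \<in> Arr A" "Dom A (j i) = cobj X i" "Cod A (j i) = P i"
    "k i \<in> Arr A" "Dom A (k i) = cobj Y i" "Cod A (k i) = P i" for i
    using b[of i] unfolding is_biproduct_def Hom_def by auto
  have E: "p i oo j i = Id A (cobj X i)" "q i oo k i = Id A (cobj Y i)"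
    "p i oo k i = Zero A (cobj Y i) (cobj X i)" "q i oo j i = Zero A (cobj X i) (cobj Y i)"
    "j i oo p i \<boxplus> k i oo q i = Id A (P i)" for i
    using b[of i] unfolding is_biproduct_def by auto
  note XY = complexD[OF X] complexD[OF Y] diff_diff[OF X] diff_diff[OF Y] diff_diff_left[OF X] diff_diff_left[OF Y]
  have E': "p i oo j i oo x = x" "q i oo j i oo x = Zero A (Dom A x) (cobj Y i)"
    if "x \<in> Arr A" "Cod A x = cobj X i" for x i
    using that assoc_eq[OF E(1)[of i], of x] assoc_eq[OF E(4)[of i], of x] B XY by (simp_all add: id_comp zero_comp)
  have E'': "q i oo k i oo x = x" "p i oo k i oo x = Zero A (Dom A x) (cobj X i)"
    if "x \<in> Arr A" "Cod A x = cobj Y i" for x i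
    using that assoc_eq[OF E(2)[of i], of x] assoc_eq[OF E(3)[of i], of x] B XY by (simp_all add: id_comp zero_comp)
  have PO: "P i \<in> Obj A" for i using B(3)[of i] Dom_Obj[OF B(1), of i] B(2) by simp
  have gd': "g (i + 1) oo cdiff X i oo x = \<boxminus> (cdiff Y (i + 1) oo g i oo x)"
    if "x \<in> Arr A" "Cod A x = cobj X i" for x i
    using that assoc_eq[OF gd[of i], of x] g XY(1-8) by (simp add: cat_simps comp_neg)
  define T where "T = \<lparr>cobj = P, cdiff = \<lambda>i. j (i + 1) oo cdiff X i oo p i \<boxplus>
    k (i + 1) oo (g i oo p i \<boxplus> cdiff Y i oo q i)\<rparr>"
  have T: "cobj T i = P i" "cdiff T i = j (i + 1) oo cdiff X i oo p i \<boxplus>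
    k (i + 1) oo (g i oo p i \<boxplus> cdiff Y i oo q i)" for i by (simp_all add: T_def)
  have pd: "p (i + 1) oo cdiff T i = cdiff X i oo p i" "q (i + 1) oo cdiff T i = g i oo p i \<boxplus> cdiff Y i oo q i" for i
    unfolding T by (simp_all add: arr_simps comp_plus E' E'' B g XY PO)
  obtain N where N: "\<And>i. \<bar>i\<bar> > N \<Longrightarrow> zero_obj A (cobj X i)" using bounded_complexE[OF X] by metis
  obtain M where M: "\<And>i. \<bar>i\<bar> > M \<Longrightarrow> zero_obj A (cobj Y i)" using bounded_complexE[OF Y] by metis
  have Ta: "cdiff T i \<in> Arr A" "Dom A (cdiff T i) = P i" "Cod A (cdiff T i) = P (i + 1)" for i
    unfolding T by (simp_all add: comp_arr plus_arr B g XY)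
  have pd': "p (i + 1) oo cdiff T i oo x = cdiff X i oo p i oo x"
     "q (i + 1) oo cdiff T i oo x = g i oo p i oo x \<boxplus> cdiff Y i oo q i oo x"
    if "x \<in> Arr A" "Cod A x = P i" for x i
    using that assoc_eq[OF pd(1)[of i], of x] assoc_eq[OF pd(2)[of i], of x] B XY(1-8) g Ta
    by (simp_all add: comp_assoc plus_comp comp_arr)
  have "bounded_complex A T"
  proof (rule bounded_complexI[of _ "max N M"])
    fix i show "cobj T i \<in> Obj A" "cdiff T i \<in> Arr A" "Dom A (cdiff T i) = cobj T i"
      "Cod A (cdiff T i) = cobj T (i + 1)" by (simp_all add: T(1) Ta PO)
    have "cdiff T (i + 1) oo cdiff T i = j (i + 1 + 1) oo cdiff X (i + 1) oo p (i + 1) oo cdiff T i \<boxplus>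
      k (i + 1 + 1) oo (g (i + 1) oo p (i + 1) oo cdiff T i \<boxplus> cdiff Y (i + 1) oo q (i + 1) oo cdiff T i)"
      unfolding T(2)[of "i + 1"] by (simp add: comp_assoc plus_comp comp_arr plus_arr B Ta g XY(1-8))
    also have "\<dots> = Zero A (P i) (P (i + 1 + 1))"
      unfolding pd by (rule eq_sgI) (simp add: lin_simps B g XY PO gd')
    finally show "cdiff T (i + 1) oo cdiff T i = Zero A (cobj T i) (cobj T (i + 1 + 1))" by (simp add: T(1))
    assume "\<bar>i\<bar> > max N M"
    then have z: "zero_obj A (cobj X i)" "zero_obj A (cobj Y i)" using N M by auto
    have "p i = Zero A (P i) (cobj X i)" "q i = Zero A (P i) (cobj Y i)"
      using zero_objD(3)[OF z(1), of "p i"] zero_objD(3)[OF z(2), of "q i"] B[of i] by simp_all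
    then have "Id A (P i) = Zero A (P i) (P i)"
      using E(5)[of i] B[of i] PO by (simp add: comp_zero plus_zero zero_arr)
    then show "zero_obj A (cobj T i)" unfolding T(1) by (intro zero_objI PO)
  qed
  then have "is_twist X Y g T p q j k"
    unfolding is_twist_def using B E pd by (simp add: Hom_def T(1))
  then show ?thesis by (rule that)
qed

lemma twist_pair:
  assumes T: "is_twist X Y g T p q j k"
    and x: "x \<in> Arr A" "Cod A x = cobj X i" and y: "y \<in> Arr A" "Cod A y = cobj Y i" "Dom A y = Dom A x"
  obtains z where "z \<in> Arr A" "Dom A z = Dom A x" "Cod A z = cobj T i" "p i oo z = x" "q i oo z = y"
proof -
  note D = twistD[OF T]
  have O: "cobj X i \<in> Obj A" "cobj Y i \<in> Obj A" using Cod_Obj x y by metis+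
  have 1: "p i oo j i oo x = x" "q i oo j i oo x = Zero A (Dom A x) (cobj Y i)"
    using x assoc_eq[OF D(14)[of i], of x] assoc_eq[OF D(17)[of i], of x] D(2-13) O by (simp_all add: id_comp zero_comp)
  have 2: "q i oo k i oo y = y" "p i oo k i oo y = Zero A (Dom A y) (cobj X i)"
    using y assoc_eq[OF D(15)[of i], of y] assoc_eq[OF D(16)[of i], of y] D(2-13) O by (simp_all add: id_comp zero_comp)
  show ?thesis
    by (rule that[of "j i oo x \<boxplus> k i oo y"])
      (use x y 1 2 D(2-13) in \<open>simp_all add: comp_plus comp_arr plus_arr plus_zero zero_plus\<close>)
qed

lemma twist_joint:
  assumes T: "is_twist X Y g T p q j k"
    and "z \<in> Arr A" "w \<in> Arr A" "Cod A z = cobj T i" "Cod A w = cobj T i" "Dom A w = Dom A z"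
    "p i oo z = p i oo w" "q i oo z = q i oo w"
  shows "z = w"
proof -
  note D = twistD[OF T]
  have "x = j i oo p i oo x \<boxplus> k i oo q i oo x" if "x \<in> Arr A" "Cod A x = cobj T i" for x
  proof -
    have "x = (j i oo p i \<boxplus> k i oo q i) oo x" unfolding D(18) using that by (simp add: id_comp)
    then show ?thesis using that D(2-13) by (simp add: plus_comp comp_assoc comp_arr)
  qed
  from this[of z] this[of w] show ?thesis using assms(2-8) by metis
qed

subsection \<open>Homotopy fibres\<close>

definition unshift :: "('o, 'm) complex \<Rightarrow> ('o, 'm) complex" where
  "unshift Y = \<lparr>cobj = \<lambda>i. cobj Y (i - 1), cdiff = \<lambda>i. \<boxminus> cdiff Y (i - 1)\<rparr>"

lemma unshift_complex: assumes "bounded_complex A Y" shows "bounded_complex A (unshift Y)"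
proof -
  obtain N where N: "\<And>i. \<bar>i\<bar> > N \<Longrightarrow> zero_obj A (cobj Y i)" using bounded_complexE[OF assms] by metis
  show ?thesis
    by (rule bounded_complexI[of _ "N + 1"])
      (auto simp: unshift_def complexD[OF assms] diff_diff[OF assms] neg_arr comp_neg neg_neg neg_zero
        zero_arr comp_arr add.commute[of "1::int"] intro!: N)
qed

text \<open>
  The homotopy fibre of \<open>m\<close>.  A generalised element of \<open>F\<close> in degree \<open>i\<close> is a pair of one of
  \<open>X\<close> in degree \<open>i\<close> and one of \<open>Y\<close> in degree \<open>i - 1\<close>, read off by \<open>P\<close> and \<open>Q\<close>; moreover
  \<open>Q\<close> is a null-homotopy of \<open>m P\<close>.  This interface is all that the chases need.
\<close>

definition is_fibre where
  "is_fibre X Y m F P Q \<longleftrightarrow> bounded_complex A F \<and> chain_map A F X P \<and> is_htpy F Y Q \<and>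
     (\<forall>i. m i oo P i = cdiff Y (i - 1) oo Q i \<boxplus> Q (i + 1) oo cdiff F i) \<and>
     (\<forall>i x y. x \<in> Arr A \<and> y \<in> Arr A \<and> Dom A y = Dom A x \<and> Cod A x = cobj X i \<and> Cod A y = cobj Y (i - 1) \<longrightarrow>
        (\<exists>z \<in> Arr A. Dom A z = Dom A x \<and> Cod A z = cobj F i \<and> P i oo z = x \<and> Q i oo z = y)) \<and>
     (\<forall>i z w. z \<in> Arr A \<and> w \<in> Arr A \<and> Dom A w = Dom A z \<and> Cod A z = cobj F i \<and> Cod A w = cobj F i \<and>
        P i oo z = P i oo w \<and> Q i oo z = Q i oo w \<longrightarrow> z = w)"

lemma fibre_ex:
  assumes X: "bounded_complex A X" and Y: "bounded_complex A Y" and m: "chain_map A X Y m"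
  obtains F P Q where "is_fibre X Y m F P Q"
proof -
  note XY = complexD[OF X] complexD[OF Y] and M = chain_mapD[OF m]
  have U: "cobj (unshift Y) i = cobj Y (i - 1)" "cdiff (unshift Y) i = \<boxminus> cdiff Y (i - 1)" for i
    by (simp_all add: unshift_def)
  obtain F p q j k where T: "is_twist X (unshift Y) m F p q j k"
    by (rule twist_ex[OF X unshift_complex[OF Y], of m]) (simp_all add: U XY M comp_neg neg_neg comp_arr)
  note D = twistD[OF T] and FD = complexD[OF twistD(1)[OF T]]
  have "chain_map A F X p" by (rule chain_mapI) (simp_all add: D)
  moreover have "is_htpy F Y q" by (simp add: is_htpy_def D U)
  moreover have "m i oo p i = cdiff Y (i - 1) oo q i \<boxplus> q (i + 1) oo cdiff F i" for i
    unfolding D(20)[OF refl] U by (rule eq_sgI) (simp add: lin_simps D(2-13) U XY M)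
  moreover have "\<exists>z \<in> Arr A. Dom A z = Dom A x \<and> Cod A z = cobj F i \<and> p i oo z = x \<and> q i oo z = y"
    if "x \<in> Arr A \<and> y \<in> Arr A \<and> Dom A y = Dom A x \<and> Cod A x = cobj X i \<and> Cod A y = cobj Y (i - 1)" for i x y
    using twist_pair[OF T, of x i y] that U by metis
  moreover have "z = w" if "z \<in> Arr A \<and> w \<in> Arr A \<and> Dom A w = Dom A z \<and> Cod A z = cobj F i \<and> Cod A w = cobj F i \<and>
        p i oo z = p i oo w \<and> q i oo z = q i oo w" for i z w
    using twist_joint[OF T, of z w i] that by metis
  ultimately have "is_fibre X Y m F p q" unfolding is_fibre_def using D(1) by blast
  then show ?thesis by (rule that)
qed

lemma fibreD:
  assumes "is_fibre X Y m F P Q"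
  shows "bounded_complex A F" "chain_map A F X P" "is_htpy F Y Q"
    "m i oo P i = cdiff Y (i - 1) oo Q i \<boxplus> Q (i + 1) oo cdiff F i"
  using assms unfolding is_fibre_def by auto

lemma fibre_pair:
  assumes "is_fibre X Y m F P Q" "x \<in> Arr A" "y \<in> Arr A" "Dom A y = Dom A x" "Cod A x = cobj X i" "Cod A y = cobj Y (i - 1)"
  obtains z where "z \<in> Arr A" "Dom A z = Dom A x" "Cod A z = cobj F i" "P i oo z = x" "Q i oo z = y"
  using assms unfolding is_fibre_def by metis

lemma fibre_joint:
  assumes "is_fibre X Y m F P Q" "z \<in> Arr A" "w \<in> Arr A" "Dom A w = Dom A z" "Cod A z = cobj F i" "Cod A w = cobj F i"
    "P i oo z = P i oo w" "Q i oo z = Q i oo w"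
  shows "z = w"
  using assms unfolding is_fibre_def by metis

lemma fibre_diff:
  assumes F: "is_fibre X Y m F P Q" and X: "bounded_complex A X" and Y: "bounded_complex A Y" and m: "chain_map A X Y m"
    and z: "z \<in> Arr A" "Cod A z = cobj F i"
  shows "P (i + 1) oo cdiff F i oo z = cdiff X i oo P i oo z"
    "Q (i + 1) oo cdiff F i oo z = m i oo P i oo z \<boxplus> \<boxminus> (cdiff Y (i - 1) oo Q i oo z)"
    "m i oo P i oo z = cdiff Y (i - 1) oo Q i oo z \<boxplus> Q (i + 1) oo cdiff F i oo z"
proof -
  note D = fibreD[OF F] and M = chain_mapD(1-3)[OF m] chain_mapD(1-3)[OF fibreD(2)[OF F]] is_htpyD[OF fibreD(3)[OF F]]
    and XY = complexD[OF X] complexD[OF Y] complexD[OF fibreD(1)[OF F]]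
  show "P (i + 1) oo cdiff F i oo z = cdiff X i oo P i oo z"
    using chain_map_left[OF D(2,1) X refl z] .
  have "m i oo P i oo z = (m i oo P i) oo z" using z M by (simp add: comp_assoc)
  also have "\<dots> = cdiff Y (i - 1) oo Q i oo z \<boxplus> Q (i + 1) oo cdiff F i oo z"
    unfolding D(4) using z M XY by (simp add: plus_comp comp_assoc comp_arr)
  finally show e: "m i oo P i oo z = cdiff Y (i - 1) oo Q i oo z \<boxplus> Q (i + 1) oo cdiff F i oo z" .
  show "Q (i + 1) oo cdiff F i oo z = m i oo P i oo z \<boxplus> \<boxminus> (cdiff Y (i - 1) oo Q i oo z)"
    unfolding e by (rule eq_sgI) (use z M XY in \<open>simp add: lin_simps\<close>)
qed

lemma fibre_cocycleD:
  assumes F: "is_fibre X Y m F P Q" and X: "bounded_complex A X" and Y: "bounded_complex A Y" and m: "chain_map A X Y m"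
    and z: "cocycle F i z"
  shows "cocycle X i (P i oo z)" "m i oo P i oo z = cdiff Y (i - 1) oo Q i oo z"
proof -
  note M = chain_mapD(1-3)[OF m] chain_mapD(1-3)[OF fibreD(2)[OF F]] is_htpyD[OF fibreD(3)[OF F]]
    and XY = complexD[OF X] complexD[OF Y]
  show "cocycle X i (P i oo z)" by (rule cocycle_map[OF z fibreD(2,1)[OF F] X])
  have Z: "z \<in> Arr A" "Cod A z = cobj F i" "cdiff F i oo z = Zero A (Dom A z) (cobj F (i + 1))"
    using z by (auto simp: cocycle_def)
  show "m i oo P i oo z = cdiff Y (i - 1) oo Q i oo z"
    unfolding fibre_diff(3)[OF F X Y m Z(1,2)] using Z M XY
    by (simp add: comp_zero Dom_Obj plus_zero comp_arr)
qed

lemma fibre_cocycleI: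
  assumes F: "is_fibre X Y m F P Q" and X: "bounded_complex A X" and Y: "bounded_complex A Y" and m: "chain_map A X Y m"
    and z: "z \<in> Arr A" "Cod A z = cobj F i" "cocycle X i (P i oo z)" "m i oo P i oo z = cdiff Y (i - 1) oo Q i oo z"
  shows "cocycle F i z"
proof -
  note M = chain_mapD(1-3)[OF m] chain_mapD(1-3)[OF fibreD(2)[OF F]] is_htpyD[OF fibreD(3)[OF F]]
    and XY = complexD[OF X] complexD[OF Y] complexD[OF fibreD(1)[OF F]]
  have c: "cdiff X i oo P i oo z = Zero A (Dom A z) (cobj X (i + 1))"
    using z(3) z(1,2) M by (simp add: cocycle_def comp_arr)
  have "cdiff F i oo z = Zero A (Dom A z) (cobj F (i + 1))"
    by (rule fibre_joint[OF F, of _ _ "i + 1"])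
      (use z(1,2) M XY in \<open>simp_all add: fibre_diff(1,2)[OF F X Y m z(1,2)] z(4) c comp_arr zero_arr comp_zero Dom_Obj plus_neg\<close>)
  then show ?thesis using z by (simp add: cocycle_def)
qed

lemma fibre_diffI:
  assumes F: "is_fibre X Y m F P Q" and X: "bounded_complex A X" and Y: "bounded_complex A Y" and m: "chain_map A X Y m"
    and z: "z \<in> Arr A" "Cod A z = cobj F i" and w: "w \<in> Arr A" "Cod A w = cobj F (i - 1)" "Dom A w = Dom A z"
    and "P i oo z = cdiff X (i - 1) oo P (i - 1) oo w"
    "Q i oo z = m (i - 1) oo P (i - 1) oo w \<boxplus> \<boxminus> (cdiff Y (i - 1 - 1) oo Q (i - 1) oo w)"
  shows "z = cdiff F (i - 1) oo w"
  by (rule fibre_joint[OF F, of _ _ i])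
    (use assms fibre_diff(1,2)[OF F X Y m w(1,2)] in \<open>simp_all add: comp_arr complexD[OF fibreD(1)[OF F]]\<close>)

text \<open>
  The degreewise content of the long exact cohomology sequence of a fibre, with injectivity and
  surjectivity of the map required only in the two degrees that matter.
\<close>

lemma fibre_exact:
  assumes F: "is_fibre X Y m F P Q" and X: "bounded_complex A X" and Y: "bounded_complex A Y" and m: "chain_map A X Y m"
    and inj: "coh_inj_at X Y m i" and surj: "coh_surj_at X Y m (i - 1)"
  shows "exact_at F i"
  unfolding exact_at_def
proof (intro allI impI)
  fix z assume z: "cocycle F i z"
  note M = chain_mapD(1-3)[OF m] chain_mapD(1-3)[OF fibreD(2)[OF F]] is_htpyD[OF fibreD(3)[OF F]]
    and XY = complexD[OF X] complexD[OF Y] complexD[OF fibreD(1)[OF F]]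
  note ml = chain_map_left[OF m X Y]
  have Z: "z \<in> Arr A" "Cod A z = cobj F i" using z by (auto simp: cocycle_def)
  note c = fibre_cocycleD[OF F X Y m z]
  have "loc_bd Y i (m i oo P i oo z)" unfolding c(2) by (rule loc_bd_diff[OF Y]) (use Z M in \<open>simp_all add: comp_arr\<close>)
  then have "loc_bd X i (P i oo z)" using inj c(1) unfolding coh_inj_at_def by blast
  then obtain e y where e: "epi_arr A e" "e \<in> Arr A" "Cod A e = Dom A (P i oo z)" "y \<in> Arr A" "Dom A y = Dom A e"
    "Cod A y = cobj X (i - 1)" "(P i oo z) oo e = cdiff X (i - 1) oo y" by (rule loc_bdE)
  have ec: "Cod A e = Dom A z" using e(3) Z M by (simp add: comp_arr)
  have e7: "P i oo z oo e = cdiff X (i - 1) oo y" using e(2,7) ec Z M by (simp add: comp_assoc)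
  have dmy: "cdiff Y (i - 1) oo m (i - 1) oo y = m i oo cdiff X (i - 1) oo y"
    by (rule ml[symmetric]) (use e in simp_all)
  have c2: "cdiff Y (i - 1) oo Q i oo z oo e = m i oo P i oo z oo e"
    using assoc_eq[OF c(2)[symmetric], of e] e(2) ec Z M XY by (simp add: comp_assoc comp_arr)
  \<comment> \<open>Two elements of Y have the same boundary; their difference is a cocycle, which lifts to X.\<close>
  define w where "w = m (i - 1) oo y \<boxplus> \<boxminus> (Q i oo z oo e)"
  have w: "w \<in> Arr A" "Dom A w = Dom A e" "Cod A w = cobj Y (i - 1)"
    unfolding w_def using e(2,4-6) ec Z M by (simp_all add: comp_arr plus_arr neg_arr)
  have "cdiff Y (i - 1) oo w = cdiff Y (i - 1) oo m (i - 1) oo y \<boxplus> \<boxminus> (cdiff Y (i - 1) oo Q i oo z oo e)"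
    unfolding w_def using e(2,4-6) ec Z M XY by (simp add: comp_plus comp_neg comp_arr neg_arr)
  also have "\<dots> = Zero A (Dom A e) (cobj Y i)"
    unfolding c2 dmy e7 using e(2,4-6) ec Z M XY by (simp add: plus_neg comp_arr)
  finally have "cocycle Y (i - 1) w" using w by (simp add: cocycle_def)
  then obtain e' x u where s: "epi_arr A e'" "e' \<in> Arr A" "Cod A e' = Dom A w" "cocycle X (i - 1) x" "x \<in> Arr A"
    "Cod A x = cobj X (i - 1)" "Dom A x = Dom A e'" "u \<in> Arr A" "Dom A u = Dom A e'"
    "Cod A u = cobj Y (i - 1 - 1)" "m (i - 1) oo x = w oo e' \<boxplus> cdiff Y (i - 1 - 1) oo u"
    by (rule coh_surj_atE[OF surj _ m X Y])
  have s3: "Cod A e' = Dom A e" using s(3) w by simp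
  have dx: "cdiff X (i - 1) oo x = Zero A (Dom A e') (cobj X i)" using s(4,7) by (simp add: cocycle_def)
  obtain v where v: "v \<in> Arr A" "Dom A v = Dom A (y oo e' \<boxplus> \<boxminus> x)" "Cod A v = cobj F (i - 1)"
     "P (i - 1) oo v = y oo e' \<boxplus> \<boxminus> x" "Q (i - 1) oo v = \<boxminus> u"
    by (rule fibre_pair[OF F, of "y oo e' \<boxplus> \<boxminus> x" "\<boxminus> u" "i - 1"])
      (use s(2,5-10) s3 e(4-6) in \<open>simp_all add: comp_arr plus_arr neg_arr\<close>)
  have vd: "Dom A v = Dom A e'" using v(2) s(2,5-10) s3 e(4-6) by (simp add: comp_arr plus_arr neg_arr)
  have "z oo e oo e' = cdiff F (i - 1) oo v"
  proof (rule fibre_diffI[OF F X Y m])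
    have "P i oo z oo e oo e' = (cdiff X (i - 1) oo y) oo e'"
      unfolding e7[symmetric] using e(2) ec s(2) s3 Z M by (simp add: comp_assoc comp_arr)
    also have "\<dots> = cdiff X (i - 1) oo (y oo e' \<boxplus> \<boxminus> x)"
      using e(2,4-6) s(2,5-7) s3 XY dx
      by (simp add: comp_assoc comp_plus comp_neg neg_arr comp_arr neg_zero Dom_Obj plus_zero)
    finally show "P i oo z oo e oo e' = cdiff X (i - 1) oo P (i - 1) oo v" unfolding v(4) .
    have "m (i - 1) oo P (i - 1) oo v = m (i - 1) oo y oo e' \<boxplus> \<boxminus> (m (i - 1) oo x)"
      unfolding v(4) using e(2,4-6) s(2,5-7) s3 M by (simp add: comp_plus comp_neg neg_arr comp_arr)
    also have "\<dots> = m (i - 1) oo y oo e' \<boxplus> \<boxminus> (w oo e' \<boxplus> cdiff Y (i - 1 - 1) oo u)"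
      by (simp only: s(11))
    finally have mp: "m (i - 1) oo P (i - 1) oo v = m (i - 1) oo y oo e' \<boxplus> \<boxminus> (w oo e' \<boxplus> cdiff Y (i - 1 - 1) oo u)" .
    show "Q i oo z oo e oo e' = m (i - 1) oo P (i - 1) oo v \<boxplus> \<boxminus> (cdiff Y (i - 1 - 1) oo Q (i - 1) oo v)"
      unfolding mp v(5) w_def
      by (rule eq_sgI) (use e(2,4-6) ec s(2,5-10) s3 Z M XY in \<open>simp add: lin_simps\<close>)
  qed (use e(2) ec s(2) s3 Z v(1,3) vd in \<open>simp_all add: comp_arr\<close>)
  then show "loc_bd F i z"
    by (intro loc_bdI[of "e oo e'" _ v])
      (use epi_comp[OF e(1) s(1)] e(2) ec s(2) s3 v(1,3) vd in \<open>simp_all add: comp_arr\<close>)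
qed

lemma fibre_acyclic:
  assumes "is_fibre X Y m F P Q" "bounded_complex A X" "bounded_complex A Y" "chain_map A X Y m"
    "coh_inj X Y m" "coh_surj X Y m"
  shows "exact_at F i"
  using fibre_exact[OF assms(1-4)] assms(5,6) unfolding coh_inj_def coh_surj_def by blast

end

context ab_cat
begin

subsection \<open>Calculus of fractions for quasi-isomorphisms\<close>

lemma coh_inj_comp:
  assumes "coh_inj X Y f" "coh_inj Y Z g" "chain_map A X Y f" "chain_map A Y Z g"
    "bounded_complex A X" "bounded_complex A Y"
  shows "coh_inj X Z (\<lambda>i. g i oo f i)"
  unfolding coh_inj_def coh_inj_at_def
proof (intro allI impI, elim conjE)
  fix i z assume z: "cocycle X i z" "loc_bd Z i ((g i oo f i) oo z)"
  have "(g i oo f i) oo z = g i oo f i oo z"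
    using z(1) chain_mapD(1-3)[OF assms(3)] chain_mapD(1-3)[OF assms(4)] by (simp add: comp_assoc cocycle_def)
  then have "loc_bd Y i (f i oo z)"
    using assms(2) z cocycle_map[OF z(1) assms(3,5,6)] unfolding coh_inj_def coh_inj_at_def by simp
  then show "loc_bd X i z" using assms(1) z unfolding coh_inj_def coh_inj_at_def by blast
qed

lemma coh_surj_comp:
  assumes "coh_surj X Y f" "coh_surj Y Z g" "chain_map A X Y f" "chain_map A Y Z g"
    "bounded_complex A X" "bounded_complex A Y" "bounded_complex A Z"
  shows "coh_surj X Z (\<lambda>i. g i oo f i)"
  unfolding coh_surj_def coh_surj_at_def
proof (intro allI impI)
  fix i w assume w: "cocycle Z i w"
  obtain e y u where h: "epi_arr A e" "e \<in> Arr A" "Cod A e = Dom A w" "cocycle Y i y" "y \<in> Arr A"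
    "Cod A y = cobj Y i" "Dom A y = Dom A e" "u \<in> Arr A" "Dom A u = Dom A e"
    "Cod A u = cobj Z (i - 1)" "g i oo y = w oo e \<boxplus> cdiff Z (i - 1) oo u"
    using coh_surjE[OF assms(2) w assms(4,6,7)] .
  obtain e' x v where k: "epi_arr A e'" "e' \<in> Arr A" "Cod A e' = Dom A y" "cocycle X i x" "x \<in> Arr A"
    "Cod A x = cobj X i" "Dom A x = Dom A e'" "v \<in> Arr A" "Dom A v = Dom A e'"
    "Cod A v = cobj Y (i - 1)" "f i oo x = y oo e' \<boxplus> cdiff Y (i - 1) oo v"
    using coh_surjE[OF assms(1) h(4) assms(3,5,6)] .
  have k3: "Cod A e' = Dom A e" using k(3) h(7) by simp
  note M = chain_mapD(1-3)[OF assms(3)] chain_mapD(1-3)[OF assms(4)]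
    and XY = complexD[OF assms(5)] complexD[OF assms(6)] complexD[OF assms(7)]
  have W: "w \<in> Arr A" "Cod A w = cobj Z i" using w by (auto simp: cocycle_def)
  have gd: "g i oo cdiff Y (i - 1) oo v = cdiff Z (i - 1) oo g (i - 1) oo v"
    by (rule chain_map_left[OF assms(4,6,7)]) (use k in simp_all)
  have ge: "g i oo y oo e' = w oo e oo e' \<boxplus> cdiff Z (i - 1) oo u oo e'"
    using assoc_eq[OF h(11), of e'] k(2) k3 h(2,3,5-10) M XY W by (simp add: plus_comp comp_assoc comp_arr)
  have "(g i oo f i) oo x \<boxplus> \<boxminus> (w oo e oo e') = g i oo (f i oo x) \<boxplus> \<boxminus> (w oo e oo e')"
    using k(5,6) M by (simp add: comp_assoc)
  also have "\<dots> = g i oo y oo e' \<boxplus> g i oo cdiff Y (i - 1) oo v \<boxplus> \<boxminus> (w oo e oo e')"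
    unfolding k(11) using k(2,3,8-10) h(5,6) M XY by (simp add: comp_plus comp_arr)
  also have "\<dots> = cdiff Z (i - 1) oo (u oo e' \<boxplus> g (i - 1) oo v)"
    unfolding gd ge
    by (rule eq_sgI) (use k(2,8-10) k3 h(2,3,5-10) M XY W in \<open>simp add: lin_simps\<close>)
  finally have e: "(g i oo f i) oo x \<boxplus> \<boxminus> (w oo e oo e') = cdiff Z (i - 1) oo (u oo e' \<boxplus> g (i - 1) oo v)" .
  have "loc_bd Z i ((g i oo f i) oo x \<boxplus> \<boxminus> (w oo e oo e'))"
    unfolding e by (rule loc_bd_diff[OF assms(7)])
      (use k(2,8-10) k3 h(8-10) M in \<open>simp_all add: plus_arr comp_arr\<close>)
  then show "\<exists>e x. epi_arr A e \<and> Cod A e = Dom A w \<and> cocycle X i x \<and> Dom A x = Dom A e \<and>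
      loc_bd Z i ((g i oo f i) oo x \<boxplus> \<boxminus> (w oo e))"
    by (intro exI[of _ "e oo e'"] exI[of _ x])
      (use epi_comp[OF h(1) k(1)] k(2,4,7) k3 h(2,3) in \<open>simp add: comp_arr\<close>)
qed

lemma coh_inj_cancel:
  assumes "coh_inj X Z (\<lambda>i. g i oo f i)" "chain_map A X Y f" "chain_map A Y Z g"
    "bounded_complex A X" "bounded_complex A Y" "bounded_complex A Z"
  shows "coh_inj X Y f"
  unfolding coh_inj_def coh_inj_at_def
proof (intro allI impI, elim conjE)
  fix i z assume z: "cocycle X i z" "loc_bd Y i (f i oo z)"
  note M = chain_mapD(1-3)[OF assms(2)] chain_mapD(1-3)[OF assms(3)]
  have "loc_bd Z i (g i oo f i oo z)"
    by (rule loc_bd_map[OF z(2) _ _ assms(3,5,6)]) (use z(1) M in \<open>simp_all add: cocycle_def comp_arr\<close>)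
  moreover have "(g i oo f i) oo z = g i oo f i oo z" using z(1) M by (simp add: comp_assoc cocycle_def)
  ultimately show "loc_bd X i z" using assms(1) z unfolding coh_inj_def coh_inj_at_def by simp
qed

lemma coh_surj_cancel:
  assumes "coh_surj X Z (\<lambda>i. g i oo f i)" "coh_inj Y Z g" "chain_map A X Y f" "chain_map A Y Z g"
    "bounded_complex A X" "bounded_complex A Y" "bounded_complex A Z"
  shows "coh_surj X Y f"
  unfolding coh_surj_def coh_surj_at_def
proof (intro allI impI)
  fix i y assume y: "cocycle Y i y"
  note M = chain_mapD(1-3)[OF assms(3)] chain_mapD(1-3)[OF assms(4)]
  have cg: "chain_map A X Z (\<lambda>i. g i oo f i)" by (rule chain_map_comp[OF assms(3-7)])
  obtain e x u where h: "epi_arr A e" "e \<in> Arr A" "Cod A e = Dom A (g i oo y)" "cocycle X i x" "x \<in> Arr A"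
    "Cod A x = cobj X i" "Dom A x = Dom A e" "u \<in> Arr A" "Dom A u = Dom A e"
    "Cod A u = cobj Z (i - 1)" "(g i oo f i) oo x = (g i oo y) oo e \<boxplus> cdiff Z (i - 1) oo u"
    using coh_surjE[OF assms(1) cocycle_map[OF y assms(4,6,7)] cg assms(5,7)] .
  have Y: "y \<in> Arr A" "Cod A y = cobj Y i" using y by (auto simp: cocycle_def)
  have h3: "Cod A e = Dom A y" using h(3) Y M by (simp add: comp_arr)
  have "g i oo (f i oo x \<boxplus> \<boxminus> (y oo e)) = (g i oo f i) oo x \<boxplus> \<boxminus> ((g i oo y) oo e)"
    using h(2,5-7) h3 Y M by (simp add: comp_plus comp_neg comp_assoc comp_arr neg_arr)
  also have "\<dots> = cdiff Z (i - 1) oo u"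
    unfolding h(11) by (rule eq_sgI) (use h(2,8-10) h3 Y M complexD[OF assms(7)] in \<open>simp add: lin_simps\<close>)
  finally have e: "g i oo (f i oo x \<boxplus> \<boxminus> (y oo e)) = cdiff Z (i - 1) oo u" .
  have "loc_bd Z i (g i oo (f i oo x \<boxplus> \<boxminus> (y oo e)))"
    unfolding e by (rule loc_bd_diff[OF assms(7)]) (use h in simp_all)
  moreover have "cocycle Y i (f i oo x \<boxplus> \<boxminus> (y oo e))"
    by (rule cocycle_plus[OF cocycle_map[OF h(4) assms(3,5,6)] cocycle_neg[OF cocycle_comp[OF y h(2) h3 assms(6)] assms(6)] _ assms(6)])
      (use h(2,5-7) h3 Y M in \<open>simp add: comp_arr neg_arr\<close>)
  ultimately have "loc_bd Y i (f i oo x \<boxplus> \<boxminus> (y oo e))"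
    using assms(2) unfolding coh_inj_def coh_inj_at_def by blast
  then show "\<exists>e x. epi_arr A e \<and> Cod A e = Dom A y \<and> cocycle X i x \<and> Dom A x = Dom A e \<and>
      loc_bd Y i (f i oo x \<boxplus> \<boxminus> (y oo e))" using h(1,4,7) h3 by blast
qed

text \<open>
  The chase behind injectivity on cohomology in the Ore condition.  The generalised elements \<open>a\<close> and
  \<open>y\<close> are the two components of a cocycle of a homotopy pullback whose images agree up to the
  boundary of \<open>r\<close>.  If \<open>a\<close> bounds, then \<open>s y\<close> bounds, hence \<open>y\<close> bounds; the two bounding elements
  differ on \<open>Y\<close> by a cocycle, which surjectivity of \<open>s\<close> allows to absorb into \<open>y1\<close> and \<open>r1\<close>.
\<close>

lemma ore_chase:
  assumes f: "chain_map A X Y f" and s: "chain_map A Y' Y s" "coh_inj Y' Y s" "coh_surj Y' Y s"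
    and b: "bounded_complex A X" "bounded_complex A Y" "bounded_complex A Y'"
    and a: "a \<in> Arr A" "Cod A a = cobj X i" "loc_bd X i a"
    and y: "cocycle Y' i y" "Dom A y = Dom A a"
    and r: "r \<in> Arr A" "Dom A r = Dom A a" "Cod A r = cobj Y (i - 1)"
    and eq: "f i oo a \<boxplus> \<boxminus> (s i oo y) = cdiff Y (i - 1) oo r"
  obtains e x1 y1 r1 where "epi_arr A e" "e \<in> Arr A" "Cod A e = Dom A a"
    "x1 \<in> Arr A" "Dom A x1 = Dom A e" "Cod A x1 = cobj X (i - 1)" "a oo e = cdiff X (i - 1) oo x1"
    "y1 \<in> Arr A" "Dom A y1 = Dom A e" "Cod A y1 = cobj Y' (i - 1)" "y oo e = cdiff Y' (i - 1) oo y1"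
    "r1 \<in> Arr A" "Dom A r1 = Dom A e" "Cod A r1 = cobj Y (i - 1 - 1)"
    "r oo e = f (i - 1) oo x1 \<boxplus> (\<boxminus> (s (i - 1) oo y1) \<boxplus> \<boxminus> (cdiff Y (i - 1 - 1) oo r1))"
proof -
  note M = chain_mapD(1-3)[OF f] chain_mapD(1-3)[OF s(1)] and XY = complexD[OF b(1)] complexD[OF b(2)] complexD[OF b(3)]
  have Y: "y \<in> Arr A" "Cod A y = cobj Y' i" using y by (auto simp: cocycle_def)
  obtain e x where e: "epi_arr A e" "e \<in> Arr A" "Cod A e = Dom A a" "x \<in> Arr A" "Dom A x = Dom A e"
    "Cod A x = cobj X (i - 1)" "a oo e = cdiff X (i - 1) oo x" using loc_bdE[OF a(3)] .
  have fx: "f i oo cdiff X (i - 1) oo x = cdiff Y (i - 1) oo f (i - 1) oo x"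
    by (rule chain_map_left[OF f b(1,2)]) (use e in simp_all)
  have sy: "s i oo y = f i oo a \<boxplus> \<boxminus> (cdiff Y (i - 1) oo r)"
    unfolding eq[symmetric] by (rule eq_sgI) (use a(1,2) y(2) Y M in \<open>simp add: lin_simps\<close>)
  have sye: "s i oo y oo e = cdiff Y (i - 1) oo (f (i - 1) oo x \<boxplus> \<boxminus> (r oo e))"
  proof -
    have "s i oo y oo e = f i oo (a oo e) \<boxplus> \<boxminus> (cdiff Y (i - 1) oo r oo e)"
      using assoc_eq[OF sy, of e] e(2,3) a(1,2) y(2) r Y M XY
      by (simp add: plus_comp comp_neg comp_assoc comp_arr neg_arr)
    then show ?thesis unfolding e(7) fx
      using e(2-6) r M XY by (simp add: comp_plus comp_neg comp_arr neg_arr)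
  qed
  have "loc_bd Y i (s i oo y oo e)"
    unfolding sye by (rule loc_bd_diff[OF b(2)]) (use e(2-6) r M in \<open>simp_all add: comp_arr plus_arr neg_arr\<close>)
  then have "loc_bd Y' i (y oo e)"
    using s(2) cocycle_comp[OF y(1) e(2) _ b(3)] e(3) y(2) unfolding coh_inj_def coh_inj_at_def by simp
  then obtain e2 y2 where k: "epi_arr A e2" "e2 \<in> Arr A" "Cod A e2 = Dom A (y oo e)" "y2 \<in> Arr A" "Dom A y2 = Dom A e2"
    "Cod A y2 = cobj Y' (i - 1)" "(y oo e) oo e2 = cdiff Y' (i - 1) oo y2" by (rule loc_bdE)
  have k3: "Cod A e2 = Dom A e" using k(3) e(2,3) y(2) Y by (simp add: comp_arr)
  have k7: "y oo e oo e2 = cdiff Y' (i - 1) oo y2" using k(2,7) k3 e(2,3) y(2) Y by (simp add: comp_assoc)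
  have sd: "s i oo cdiff Y' (i - 1) oo y2 = cdiff Y (i - 1) oo s (i - 1) oo y2"
    by (rule chain_map_left[OF s(1) b(3,2)]) (use k in simp_all)
  have "s i oo (y oo e oo e2) = cdiff Y (i - 1) oo (f (i - 1) oo x oo e2 \<boxplus> \<boxminus> (r oo e oo e2))"
    using assoc_eq[OF sye[unfolded comp_assoc], of e2]
      comp_assoc[of e2 "y oo e" "s i"] sye k(2) k3 e(2-6) y(2) r Y M XY
    by (simp add: comp_assoc comp_arr plus_comp comp_neg plus_arr neg_arr)
  then have sy2: "cdiff Y (i - 1) oo s (i - 1) oo y2 = cdiff Y (i - 1) oo (f (i - 1) oo x oo e2 \<boxplus> \<boxminus> (r oo e oo e2))"
    unfolding k7 sd .
  define c where "c = (f (i - 1) oo x oo e2 \<boxplus> \<boxminus> (r oo e oo e2)) \<boxplus> \<boxminus> (s (i - 1) oo y2)"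
  have c: "c \<in> Arr A" "Dom A c = Dom A e2" "Cod A c = cobj Y (i - 1)"
    unfolding c_def using k(2,4-6) k3 e(2-6) r M by (simp_all add: comp_arr plus_arr neg_arr)
  have "cdiff Y (i - 1) oo c = cdiff Y (i - 1) oo (f (i - 1) oo x oo e2 \<boxplus> \<boxminus> (r oo e oo e2)) \<boxplus>
      \<boxminus> (cdiff Y (i - 1) oo s (i - 1) oo y2)"
    unfolding c_def comp_neg(1)[symmetric] using k(2,4-6) k3 e(2-6) r M XY
    by (intro trans[OF comp_plus]) (simp_all add: comp_arr plus_arr neg_arr comp_neg)
  also have "\<dots> = Zero A (Dom A e2) (cobj Y i)"
    unfolding sy2 using k(2,4-6) k3 e(2-6) r M XY by (intro trans[OF plus_neg]) (simp_all add: comp_arr plus_arr neg_arr)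
  finally have "cocycle Y (i - 1) c" using c by (simp add: cocycle_def)
  then obtain e4 y3 u where l: "epi_arr A e4" "e4 \<in> Arr A" "Cod A e4 = Dom A c" "cocycle Y' (i - 1) y3" "y3 \<in> Arr A"
    "Cod A y3 = cobj Y' (i - 1)" "Dom A y3 = Dom A e4" "u \<in> Arr A" "Dom A u = Dom A e4"
    "Cod A u = cobj Y (i - 1 - 1)" "s (i - 1) oo y3 = c oo e4 \<boxplus> cdiff Y (i - 1 - 1) oo u"
    by (rule coh_surjE[OF s(3) _ s(1) b(3,2)])
  have l3: "Cod A e4 = Dom A e2" using l(3) c by simp
  have dy3: "cdiff Y' (i - 1) oo y3 = Zero A (Dom A e4) (cobj Y' i)" using l(4,7) by (simp add: cocycle_def)
  show ?thesis
  proof (rule that[of "e oo e2 oo e4" "x oo e2 oo e4" "y2 oo e4 \<boxplus> y3" "\<boxminus> u"])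
    show "epi_arr A (e oo e2 oo e4)"
      by (intro epi_comp e(1) k(1) l(1)) (use k(2) k3 l(2) l3 in \<open>simp_all add: comp_arr\<close>)
    show "a oo e oo e2 oo e4 = cdiff X (i - 1) oo x oo e2 oo e4"
      using assoc_eq[OF e(7), of "e2 oo e4"] e(2-6) a(1,2) k(2) k3 l(2) l3 XY by (simp add: comp_assoc comp_arr)
    have "y oo e oo e2 oo e4 = (y oo e oo e2) oo e4"
      using e(2,3) y(2) Y k(2) k3 l(2) l3 by (simp add: comp_assoc comp_arr)
    also have "\<dots> = cdiff Y' (i - 1) oo (y2 oo e4 \<boxplus> y3)"
      unfolding k7 using dy3 k(2,4-6) l(2,5-7) l3 XY
      by (simp add: comp_assoc comp_plus comp_arr plus_zero)
    finally show "y oo e oo e2 oo e4 = cdiff Y' (i - 1) oo (y2 oo e4 \<boxplus> y3)" .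
    have "s (i - 1) oo (y2 oo e4 \<boxplus> y3) = s (i - 1) oo y2 oo e4 \<boxplus> s (i - 1) oo y3"
      using k(2,4-6) l(2,5-7) l3 M by (simp add: comp_plus comp_arr)
    also have "\<dots> = s (i - 1) oo y2 oo e4 \<boxplus> (c oo e4 \<boxplus> cdiff Y (i - 1 - 1) oo u)" by (simp only: l(11))
    finally have sy3: "s (i - 1) oo (y2 oo e4 \<boxplus> y3) = s (i - 1) oo y2 oo e4 \<boxplus> (c oo e4 \<boxplus> cdiff Y (i - 1 - 1) oo u)" .
    show "r oo e oo e2 oo e4 = f (i - 1) oo x oo e2 oo e4 \<boxplus> (\<boxminus> (s (i - 1) oo (y2 oo e4 \<boxplus> y3)) \<boxplus>
        \<boxminus> (cdiff Y (i - 1 - 1) oo \<boxminus> u))"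
      unfolding sy3 c_def
      by (rule eq_sgI) (use e(2-6) r k(2,4-6) k3 l(2,5-10) l3 M XY in \<open>simp add: lin_simps\<close>)
  qed (use e(2-6) k(2,4-6) k3 l(2,5-10) l3 in \<open>simp_all add: comp_arr plus_arr neg_arr\<close>)
qed

text \<open>
  The Ore condition, by the homotopy pullback of \<open>f\<close> and \<open>s\<close>: the homotopy fibre of
  \<open>f p - s q\<close> on the direct sum of \<open>X\<close> and \<open>Y'\<close>.  Its projection to \<open>X\<close> is a quasi-isomorphism
  because \<open>s\<close> is one.
\<close>

lemma ore:
  assumes f: "chain_map A X Y f" and s: "chain_map A Y' Y s" "coh_inj Y' Y s" "coh_surj Y' Y s"
    and b: "bounded_complex A X" "bounded_complex A Y" "bounded_complex A Y'"
  obtains F t f' where "bounded_complex A F" "chain_map A F X t" "chain_map A F Y' f'" "coh_inj F X t" "coh_surj F X t"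
    "homotopic A F Y (\<lambda>i. f i oo t i) (\<lambda>i. s i oo f' i)"
proof -
  note M = chain_mapD(1-3)[OF f] chain_mapD(1-3)[OF s(1)] and XY = complexD[OF b(1)] complexD[OF b(2)] complexD[OF b(3)]
  obtain D p q j k where D: "is_twist X Y' (\<lambda>i. Zero A (cobj X i) (cobj Y' (i + 1))) D p q j k"
    by (rule twist_ex[OF b(1,3), of "\<lambda>i. Zero A (cobj X i) (cobj Y' (i + 1))"])
      (simp_all add: XY zero_arr zero_comp comp_zero neg_zero)
  note DD = twistD[OF D] and DX = complexD[OF twistD(1)[OF D]]
  have cp: "chain_map A D X p" by (rule chain_mapI) (simp_all add: DD)
  have cq: "chain_map A D Y' q"
    by (rule chain_mapI) (simp_all add: DD(2-7,20) zero_comp XY zero_plus comp_arr DX(1))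
  \<comment> \<open>The fibre of the difference of the two maps to Y is the homotopy pullback.\<close>
  define m where "m i = f i oo p i \<boxplus> \<boxminus> (s i oo q i)" for i
  have cm: "chain_map A D Y m"
    unfolding m_def by (intro chain_map_plus chain_map_neg chain_map_comp[OF cp f] chain_map_comp[OF cq s(1)] b DD(1))
  obtain F P Q where F: "is_fibre D Y m F P Q" using fibre_ex[OF DD(1) b(2) cm] .
  note FD = fibreD[OF F] and FM = chain_mapD(1-3)[OF fibreD(2)[OF F]] is_htpyD[OF fibreD(3)[OF F]]
  have mz: "m i oo z = f i oo p i oo z \<boxplus> \<boxminus> (s i oo q i oo z)" if "z \<in> Arr A" "Cod A z = cobj D i" for i z
    unfolding m_def using that M DD(2-7) by (simp add: plus_comp comp_neg comp_assoc comp_arr neg_arr)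
  have t: "chain_map A F X (\<lambda>i. p i oo P i)" by (rule chain_map_comp[OF FD(2) cp FD(1) DD(1) b(1)])
  moreover have f': "chain_map A F Y' (\<lambda>i. q i oo P i)" by (rule chain_map_comp[OF FD(2) cq FD(1) DD(1) b(3)])
  moreover have "homotopic A F Y (\<lambda>i. f i oo p i oo P i) (\<lambda>i. s i oo q i oo P i)"
  proof (rule homotopicI[OF FD(3)])
    fix i
    have "f i oo p i oo P i = s i oo q i oo P i \<boxplus> m i oo P i"
      unfolding m_def by (rule eq_sgI) (simp add: lin_simps M DD(2-7) FM)
    then show "f i oo p i oo P i = s i oo q i oo P i \<boxplus> (cdiff Y (i - 1) oo Q i \<boxplus> Q (i + 1) oo cdiff F i)"
      unfolding FD(4) .
  qed
  moreover have "coh_inj F X (\<lambda>i. p i oo P i)"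
    unfolding coh_inj_def coh_inj_at_def
  proof (intro allI impI, elim conjE)
    fix i z assume z: "cocycle F i z" "loc_bd X i ((p i oo P i) oo z)"
    have Z: "z \<in> Arr A" "Cod A z = cobj F i" using z by (auto simp: cocycle_def)
    note c = fibre_cocycleD[OF F DD(1) b(2) cm z(1)]
    have PZ: "P i oo z \<in> Arr A" "Dom A (P i oo z) = Dom A z" "Cod A (P i oo z) = cobj D i"
      using Z FM by (simp_all add: comp_arr)
    have l: "loc_bd X i (p i oo P i oo z)" using z(2) Z FM DD(2-7) by (simp add: comp_assoc)
    have eq: "f i oo p i oo P i oo z \<boxplus> \<boxminus> (s i oo q i oo P i oo z) = cdiff Y (i - 1) oo Q i oo z"
      using c(2) mz[OF PZ(1,3)] by simp
    obtain e x1 y1 r1 where h: "epi_arr A e" "e \<in> Arr A" "Cod A e = Dom A (p i oo P i oo z)"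
      "x1 \<in> Arr A" "Dom A x1 = Dom A e" "Cod A x1 = cobj X (i - 1)" "(p i oo P i oo z) oo e = cdiff X (i - 1) oo x1"
      "y1 \<in> Arr A" "Dom A y1 = Dom A e" "Cod A y1 = cobj Y' (i - 1)" "(q i oo P i oo z) oo e = cdiff Y' (i - 1) oo y1"
      "r1 \<in> Arr A" "Dom A r1 = Dom A e" "Cod A r1 = cobj Y (i - 1 - 1)"
      "(Q i oo z) oo e = f (i - 1) oo x1 \<boxplus> (\<boxminus> (s (i - 1) oo y1) \<boxplus> \<boxminus> (cdiff Y (i - 1 - 1) oo r1))"
      by (rule ore_chase[OF f s b _ _ l cocycle_map[OF c(1) cq DD(1) b(3)] _ _ _ _ eq])
        (use Z FM PZ DD(2-7) in \<open>simp_all add: comp_arr\<close>)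
    have h3: "Cod A e = Dom A z" using h(3) PZ DD(2-7) by (simp add: comp_arr)
    obtain w where w: "w \<in> Arr A" "Dom A w = Dom A x1" "Cod A w = cobj D (i - 1)" "p (i - 1) oo w = x1" "q (i - 1) oo w = y1"
      by (rule twist_pair[OF D, of x1 "i - 1" y1]) (use h(4-6,8-10) in simp_all)
    obtain v where v: "v \<in> Arr A" "Dom A v = Dom A w" "Cod A v = cobj F (i - 1)" "P (i - 1) oo v = w" "Q (i - 1) oo v = r1"
      by (rule fibre_pair[OF F, of w r1 "i - 1"]) (use w(1-3) h(5,12-14) in simp_all)
    have "z oo e = cdiff F (i - 1) oo v"
    proof (rule fibre_diffI[OF F DD(1) b(2) cm])
      have pd: "p i oo cdiff D (i - 1) oo w = cdiff X (i - 1) oo x1"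
        using chain_map_left[OF cp DD(1) b(1), of i "i - 1" w] w(1,3,4) by simp
      have qd: "q i oo cdiff D (i - 1) oo w = cdiff Y' (i - 1) oo y1"
        using chain_map_left[OF cq DD(1) b(3), of i "i - 1" w] w(1,3,5) by simp
      have "P i oo z oo e = cdiff D (i - 1) oo w"
      proof (rule twist_joint[OF D])
        show "p i oo P i oo z oo e = p i oo cdiff D (i - 1) oo w"
          unfolding pd h(7)[symmetric] using h(2) h3 Z PZ FM DD(2-7) by (simp add: comp_assoc comp_arr)
        show "q i oo P i oo z oo e = q i oo cdiff D (i - 1) oo w"
          unfolding qd h(11)[symmetric] using h(2) h3 Z PZ FM DD(2-7) by (simp add: comp_assoc comp_arr)
      qed (use h(2,5) h3 Z FM w(1-3) DX in \<open>simp_all add: comp_arr\<close>)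
      then show "P i oo z oo e = cdiff D (i - 1) oo P (i - 1) oo v" unfolding v(4) .
      have "Q i oo z oo e = (Q i oo z) oo e" using h(2) h3 Z FM by (simp add: comp_assoc)
      also have "\<dots> = m (i - 1) oo w \<boxplus> \<boxminus> (cdiff Y (i - 1 - 1) oo r1)"
        unfolding h(15) mz[OF w(1,3)] w(4,5) using h(4-6,8-10,12-14) M XY by (simp add: plus_assoc comp_arr neg_arr)
      finally show "Q i oo z oo e = m (i - 1) oo P (i - 1) oo v \<boxplus> \<boxminus> (cdiff Y (i - 1 - 1) oo Q (i - 1) oo v)"
        unfolding v(4,5) .
    qed (use h(2,5) h3 Z v(1-3) w(2) in \<open>simp_all add: comp_arr\<close>)
    then show "loc_bd F i z" using h(1,5) h3 v(1-3) w(2) by (intro loc_bdI[of e _ v]) simp_all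
  qed
  moreover have "coh_surj F X (\<lambda>i. p i oo P i)"
    unfolding coh_surj_def coh_surj_at_def
  proof (intro allI impI)
    fix i x assume x: "cocycle X i x"
    have Xx: "x \<in> Arr A" "Cod A x = cobj X i" using x by (auto simp: cocycle_def)
    obtain e y u where h: "epi_arr A e" "e \<in> Arr A" "Cod A e = Dom A (f i oo x)" "cocycle Y' i y" "y \<in> Arr A"
      "Cod A y = cobj Y' i" "Dom A y = Dom A e" "u \<in> Arr A" "Dom A u = Dom A e"
      "Cod A u = cobj Y (i - 1)" "s i oo y = (f i oo x) oo e \<boxplus> cdiff Y (i - 1) oo u"
      using coh_surjE[OF s(3) cocycle_map[OF x f b(1,2)] s(1) b(3,2)] .
    have h3: "Cod A e = Dom A x" using h(3) Xx M by (simp add: comp_arr)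
    obtain w where w: "w \<in> Arr A" "Dom A w = Dom A (x oo e)" "Cod A w = cobj D i" "p i oo w = x oo e" "q i oo w = y"
      by (rule twist_pair[OF D, of "x oo e" i y]) (use h(2,5-7) h3 Xx in \<open>simp_all add: comp_arr\<close>)
    have wd: "Dom A w = Dom A e" using w(2) h(2) h3 Xx by (simp add: comp_arr)
    obtain z where z: "z \<in> Arr A" "Dom A z = Dom A w" "Cod A z = cobj F i" "P i oo z = w" "Q i oo z = \<boxminus> u"
      by (rule fibre_pair[OF F, of w "\<boxminus> u" i]) (use w(1,3) wd h(8-10) in \<open>simp_all add: neg_arr\<close>)
    have cw: "cocycle D i w"
    proof -
      have "cdiff D i oo w = Zero A (Dom A e) (cobj D (i + 1))"
      proof (rule twist_joint[OF D])
        have "p (i + 1) oo cdiff D i oo w = cdiff X i oo x oo e"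
          using chain_map_left[OF cp DD(1) b(1) refl w(1,3)] w(4) by simp
        also have "\<dots> = Zero A (Dom A e) (cobj X (i + 1))"
          using cocycle_comp[OF x h(2) h3 b(1)] h(2) h3 Xx by (simp add: cocycle_def comp_arr)
        finally show "p (i + 1) oo cdiff D i oo w = p (i + 1) oo Zero A (Dom A e) (cobj D (i + 1))"
          using DD(2-7) DX Dom_Obj h(2) by (simp add: comp_zero)
        have "q (i + 1) oo cdiff D i oo w = cdiff Y' i oo y"
          using chain_map_left[OF cq DD(1) b(3) refl w(1,3)] w(5) by simp
        also have "\<dots> = Zero A (Dom A e) (cobj Y' (i + 1))"
          using h(4,7) by (simp add: cocycle_def)
        finally show "q (i + 1) oo cdiff D i oo w = q (i + 1) oo Zero A (Dom A e) (cobj D (i + 1))"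
          using DD(2-7) DX Dom_Obj h(2) by (simp add: comp_zero)
      qed (use w(1,3) wd DX Dom_Obj h(2) in \<open>simp_all add: comp_arr zero_arr\<close>)
      then show ?thesis using w(1,3) wd by (simp add: cocycle_def)
    qed
    have "m i oo w = f i oo x oo e \<boxplus> \<boxminus> ((f i oo x) oo e \<boxplus> cdiff Y (i - 1) oo u)"
      unfolding mz[OF w(1,3)] w(4,5) h(11) ..
    also have "\<dots> = cdiff Y (i - 1) oo \<boxminus> u"
      by (rule eq_sgI) (use h(2,8-10) h3 Xx M XY in \<open>simp add: lin_simps\<close>)
    finally have mw: "m i oo P i oo z = cdiff Y (i - 1) oo Q i oo z" unfolding z(4,5) .
    have cz: "cocycle F i z"
      by (rule fibre_cocycleI[OF F DD(1) b(2) cm z(1,3) _ mw]) (simp add: z(4) cw)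
    have "(p i oo P i) oo z = p i oo (P i oo z)" using z(1,3) FM DD(2-7) by (simp add: comp_assoc)
    also have "\<dots> = x oo e" by (simp only: z(4) w(4))
    finally have "(p i oo P i) oo z \<boxplus> \<boxminus> (x oo e) = Zero A (Dom A e) (cobj X i)"
      using h(2) h3 Xx by (simp add: plus_neg comp_arr)
    then have "loc_bd X i ((p i oo P i) oo z \<boxplus> \<boxminus> (x oo e))"
      using loc_bd_zero[OF b(1)] Dom_Obj[OF h(2)] by simp
    then show "\<exists>e z. epi_arr A e \<and> Cod A e = Dom A x \<and> cocycle F i z \<and> Dom A z = Dom A e \<and>
      loc_bd X i ((p i oo P i) oo z \<boxplus> \<boxminus> (x oo e))"
      using h(1) h3 cz z(2) wd by metis
  qed
  ultimately show ?thesis using that FD(1) by blast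
qed

end

context ab_cat
begin

section \<open>The derived category as a category of fractions\<close>

definition zero_complex :: "('o, 'm) complex" where
  "zero_complex = (let Z = SOME Z. zero_obj A Z in \<lparr>cobj = \<lambda>i. Z, cdiff = \<lambda>i. Zero A Z Z\<rparr>)"

lemma some_zero_obj: "zero_obj A (SOME Z. zero_obj A Z)"
  using someI_ex[OF ex_zero] .

lemma zero_complex:
  "bounded_complex A zero_complex" "zero_obj A (cobj zero_complex i)"
proof -
  show z: "zero_obj A (cobj zero_complex i)" for i using some_zero_obj by (simp add: zero_complex_def Let_def)
  have o: "(SOME Z. zero_obj A Z) \<in> Obj A" using zero_objD(1)[OF some_zero_obj] .
  show "bounded_complex A zero_complex"
    by (rule bounded_complexI[of _ 0]) (use o in \<open>auto simp: zero_complex_def Let_def arr_simps some_zero_obj\<close>)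
qed

definition zero_map :: "('o, 'm) complex \<Rightarrow> ('o, 'm) complex \<Rightarrow> int \<Rightarrow> 'm" where
  "zero_map X Y i = Zero A (cobj X i) (cobj Y i)"

lemma chain_map_zero_map: "bounded_complex A X \<Longrightarrow> bounded_complex A Y \<Longrightarrow> chain_map A X Y (zero_map X Y)"
  unfolding zero_map_def by (rule chain_map_zero)

lemma loc_bd_into_zero:
  assumes "bounded_complex A X" "zero_obj A (cobj X i)" "z \<in> Arr A" "Cod A z = cobj X i"
  shows "loc_bd X i z"
proof -
  have "z = Zero A (Dom A z) (cobj X i)" by (rule zero_objD(3)[OF assms(2-4)])
  then show ?thesis using loc_bd_zero[OF assms(1) Dom_Obj[OF assms(3)], of i] by simp
qed

lemma zero_map_coh:
  assumes X: "bounded_complex A X" and ex: "\<And>i. exact_at X i"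
  shows "coh_inj zero_complex X (zero_map zero_complex X)" "coh_surj zero_complex X (zero_map zero_complex X)"
proof -
  show "coh_inj zero_complex X (zero_map zero_complex X)"
    unfolding coh_inj_def coh_inj_at_def using loc_bd_into_zero zero_complex by (simp add: cocycle_def)
  show "coh_surj zero_complex X (zero_map zero_complex X)"
    unfolding coh_surj_def coh_surj_at_def
  proof (intro allI impI)
    fix i y assume y: "cocycle X i y"
    have Y: "y \<in> Arr A" "Cod A y = cobj X i" "Dom A y \<in> Obj A" using y Dom_Obj by (auto simp: cocycle_def)
    note O = complexD[OF zero_complex(1)] and XO = complexD[OF X]
    let ?z = "Zero A (Dom A y) (cobj zero_complex i)"
    have "zero_map zero_complex X i oo ?z \<boxplus> \<boxminus> (y oo Id A (Dom A y)) = \<boxminus> y"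
      unfolding zero_map_def using Y O XO by (simp add: arr_simps)
    moreover have "loc_bd X i (\<boxminus> y)" using loc_bd_neg ex y Y X unfolding exact_at_def by blast
    ultimately show "\<exists>e x. epi_arr A e \<and> Cod A e = Dom A y \<and> cocycle zero_complex i x \<and> Dom A x = Dom A e \<and>
        loc_bd X i (zero_map zero_complex X i oo x \<boxplus> \<boxminus> (y oo e))"
      by (intro exI[of _ "Id A (Dom A y)"] exI[of _ ?z])
        (use Y O in \<open>simp add: epi_id arr_simps cocycle_def\<close>)
  qed
qed

text \<open>
  If \<open>s f\<close> is null-homotopic, then \<open>f\<close> factors through the homotopy fibre of \<open>s\<close>, which is acyclic
  when \<open>s\<close> is a quasi-isomorphism.  Applying the Ore condition to the quasi-isomorphism from the zero
  complex to this fibre produces a quasi-isomorphism \<open>t\<close> with \<open>f t\<close> null-homotopic.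
\<close>

lemma null_of_comp_null:
  assumes f: "chain_map A X Y f" and s: "chain_map A Y Z s" "coh_inj Y Z s" "coh_surj Y Z s"
    and b: "bounded_complex A X" "bounded_complex A Y" "bounded_complex A Z"
    and n: "homotopic A X Z (\<lambda>i. s i oo f i) (zero_map X Z)"
  obtains W t where "bounded_complex A W" "chain_map A W X t" "coh_inj W X t" "coh_surj W X t"
    "homotopic A W Y (\<lambda>i. f i oo t i) (zero_map W Y)"
proof -
  note M = chain_mapD[OF f] chain_mapD[OF s(1)] and XY = complexD[OF b(1)] complexD[OF b(2)] complexD[OF b(3)]
  obtain h where h: "is_htpy X Z h" and e: "\<And>i. s i oo f i = zero_map X Z i \<boxplus> (cdiff Z (i - 1) oo h i \<boxplus> h (i + 1) oo cdiff X i)"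
    using homotopicE[OF n] by metis
  note H = is_htpyD[OF h]
  have e: "s i oo f i = cdiff Z (i - 1) oo h i \<boxplus> h (i + 1) oo cdiff X i" for i
    unfolding e zero_map_def by (rule zero_plus) (simp_all add: H XY comp_arr plus_arr)
  obtain F P Q where F: "is_fibre Y Z s F P Q" using fibre_ex[OF b(2,3) s(1)] .
  note FD = fibreD[OF F] and FM = chain_mapD(1-3)[OF fibreD(2)[OF F]] is_htpyD[OF fibreD(3)[OF F]]
  have "\<exists>z. z \<in> Arr A \<and> Dom A z = cobj X i \<and> Cod A z = cobj F i \<and> P i oo z = f i \<and> Q i oo z = h i" for i
    using fibre_pair[OF F, of "f i" "h i" i] M(1-3) H by metis
  then obtain g where g: "\<And>i. g i \<in> Arr A" "\<And>i. Dom A (g i) = cobj X i" "\<And>i. Cod A (g i) = cobj F i"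
    "\<And>i. P i oo g i = f i" "\<And>i. Q i oo g i = h i" by metis
  have cg: "chain_map A X F g"
  proof (rule chain_mapI[OF g(1-3)])
    fix i
    show "g (i + 1) oo cdiff X i = cdiff F i oo g i"
    proof (rule fibre_joint[OF F, of _ _ "i + 1"])
      have "P (i + 1) oo g (i + 1) oo cdiff X i = f (i + 1) oo cdiff X i"
        using assoc_eq[OF g(4)[of "i + 1"], of "cdiff X i"] g(1-3) FM XY by simp
      moreover have "P (i + 1) oo cdiff F i oo g i = cdiff Y i oo f i"
        using fibre_diff(1)[OF F b(2,3) s(1) g(1,3)] g(4) by simp
      ultimately show "P (i + 1) oo g (i + 1) oo cdiff X i = P (i + 1) oo cdiff F i oo g i" using M(4) by simp
      have 1: "Q (i + 1) oo g (i + 1) oo cdiff X i = h (i + 1) oo cdiff X i"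
        using assoc_eq[OF g(5)[of "i + 1"], of "cdiff X i"] g(1-3) FM XY by simp
      have "Q (i + 1) oo cdiff F i oo g i = s i oo f i \<boxplus> \<boxminus> (cdiff Z (i - 1) oo h i)"
        using fibre_diff(2)[OF F b(2,3) s(1) g(1,3)] g(4,5) by simp
      also have "\<dots> = h (i + 1) oo cdiff X i"
        unfolding e by (rule eq_sgI) (simp add: lin_simps H XY)
      finally show "Q (i + 1) oo g (i + 1) oo cdiff X i = Q (i + 1) oo cdiff F i oo g i" using 1 by simp
    qed (simp_all add: g XY complexD[OF FD(1)] comp_arr)
  qed
  obtain W t f' where W: "bounded_complex A W" "chain_map A W X t" "chain_map A W zero_complex f'" "coh_inj W X t" "coh_surj W X t"
    "homotopic A W F (\<lambda>i. g i oo t i) (\<lambda>i. zero_map zero_complex F i oo f' i)"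
    by (rule ore[OF cg chain_map_zero_map[OF zero_complex(1) FD(1)] zero_map_coh[OF FD(1)] b(1) FD(1) zero_complex(1)])
      (use fibre_acyclic[OF F b(2,3) s] in auto)
  have eqz: "zero_map zero_complex F i oo f' i = zero_map W F i" for i
    unfolding zero_map_def using chain_mapD[OF W(3)] complexD[OF FD(1)] by (simp add: zero_comp)
  have "homotopic A W Y (\<lambda>i. P i oo g i oo t i) (\<lambda>i. P i oo zero_map W F i)"
    by (rule homotopic_comp_left[OF W(6)[unfolded eqz] chain_map_zero_map[OF W(1) FD(1)] FD(2) W(1) FD(1) b(2)])
  moreover have "P i oo g i oo t i = f i oo t i" for i
    using assoc_eq[OF g(4)[of i], of "t i"] g(1-3) FM chain_mapD[OF W(2)] by simp
  moreover have "P i oo zero_map W F i = zero_map W Y i" for i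
    unfolding zero_map_def using FM complexD[OF W(1)] by (simp add: comp_zero)
  moreover have "(\<lambda>i. zero_map W Y i) = zero_map W Y" by (rule ext) simp
  ultimately have "homotopic A W Y (\<lambda>i. f i oo t i) (zero_map W Y)" by simp
  with W that show ?thesis by blast
qed

lemma qisE:
  assumes "s \<in> qis A"
  obtains X Y f where "bounded_complex A X" "bounded_complex A Y" "chain_map A X Y f" "coh_inj X Y f"
    "coh_surj X Y f" "s = hc X Y f" "Dom (Kb A) s = X" "Cod (Kb A) s = Y"
proof -
  obtain X Y f where h: "s = hc X Y f" "bounded_complex A X" "bounded_complex A Y" "quasi_iso A X Y f"
    using assms by (auto simp: qis_def)
  then have "chain_map A X Y f" by (simp add: quasi_iso_def)
  then show ?thesis using that[of X Y f] h quasi_isoD[OF h(4,2,3)] hc_Arr by blast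
qed

lemma Arr_KbE:
  assumes "F \<in> Arr (Kb A)"
  obtains f where "bounded_complex A (Dom (Kb A) F)" "bounded_complex A (Cod (Kb A) F)"
    "chain_map A (Dom (Kb A) F) (Cod (Kb A) F) f" "F = hc (Dom (Kb A) F) (Cod (Kb A) F) f"
  using Hom_KbE[of F "Dom (Kb A) F" "Cod (Kb A) F"] assms by (auto simp: Hom_def)

lemma Zero_Kb': "Zero (Kb A) X Y = hc X Y (zero_map X Y)"
  unfolding Zero_Kb zero_map_def ..

theorem Kb_fractions: "fractions (Kb A) (qis A)"
proof (intro fractions.intro Kb_preadditive fractions_axioms.intro)
  fix s assume "s \<in> qis A"
  then show "s \<in> Arr (Kb A)" by (rule qisE) (simp add: hc_Arr)
next
  fix X assume "X \<in> Obj (Kb A)"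
  then have X: "bounded_complex A X" by (simp add: Obj_Kb)
  have i: "Id A (cobj X i) oo z = z" if "cocycle X i z" for i z using that by (simp add: id_comp cocycle_def)
  have "coh_inj X X (\<lambda>i. Id A (cobj X i))" unfolding coh_inj_def coh_inj_at_def using i by metis
  moreover have "coh_surj X X (\<lambda>i. Id A (cobj X i))" unfolding coh_surj_def coh_surj_at_def
  proof (intro allI impI)
    fix i y assume y: "cocycle X i y"
    then have Y: "y \<in> Arr A" "Cod A y = cobj X i" "Dom A y \<in> Obj A" using Dom_Obj by (auto simp: cocycle_def)
    have "Id A (cobj X i) oo y \<boxplus> \<boxminus> (y oo Id A (Dom A y)) = Zero A (Dom A y) (cobj X i)"
      using Y by (simp add: arr_simps plus_neg)
    then show "\<exists>e x. epi_arr A e \<and> Cod A e = Dom A y \<and> cocycle X i x \<and> Dom A x = Dom A e \<and>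
        loc_bd X i (Id A (cobj X i) oo x \<boxplus> \<boxminus> (y oo e))"
      by (intro exI[of _ "Id A (Dom A y)"] exI[of _ y]) (use y Y loc_bd_zero[OF X] in \<open>simp add: epi_id id_arr\<close>)
  qed
  ultimately show "Id (Kb A) X \<in> qis A" unfolding Id_Kb using qis_iff[OF chain_map_id[OF X] X X] by blast
next
  fix s t assume s: "s \<in> qis A" and t: "t \<in> qis A" and c: "Cod (Kb A) s = Dom (Kb A) t"
  from s obtain X Y f where f: "bounded_complex A X" "bounded_complex A Y" "chain_map A X Y f" "coh_inj X Y f"
    "coh_surj X Y f" "s = hc X Y f" "Dom (Kb A) s = X" "Cod (Kb A) s = Y" by (rule qisE)
  from t obtain Y' Z g where g0: "bounded_complex A Y'" "bounded_complex A Z" "chain_map A Y' Z g" "coh_inj Y' Z g"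
    "coh_surj Y' Z g" "t = hc Y' Z g" "Dom (Kb A) t = Y'" "Cod (Kb A) t = Z" by (rule qisE)
  have "Y' = Y" using c f(8) g0(7) by simp
  note g = g0[unfolded this]
  show "Comp (Kb A) t s \<in> qis A"
    unfolding f(6) g(6) Comp_Kb[OF f(3) g(3) f(1,2) g(2)]
      qis_iff[OF chain_map_comp[OF f(3) g(3) f(1,2) g(2)] f(1) g(2)]
    using coh_inj_comp[OF f(4) g(4) f(3) g(3) f(1,2)] coh_surj_comp[OF f(5) g(5) f(3) g(3) f(1,2) g(2)] by blast
next
  fix s u assume s: "s \<in> qis A" and u: "u \<in> Arr (Kb A)" "Cod (Kb A) u = Dom (Kb A) s" "Comp (Kb A) s u \<in> qis A"
  from s obtain Y Z g where g: "bounded_complex A Y" "bounded_complex A Z" "chain_map A Y Z g" "coh_inj Y Z g"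
    "coh_surj Y Z g" "s = hc Y Z g" "Dom (Kb A) s = Y" "Cod (Kb A) s = Z" by (rule qisE)
  obtain X f where f: "bounded_complex A X" "chain_map A X Y f" "u = hc X Y f"
    using Arr_KbE[OF u(1)] u(2) g(7) by metis
  have "hc X Z (\<lambda>i. g i oo f i) \<in> qis A"
    using u(3) unfolding f(3) g(6) Comp_Kb[OF f(2) g(3) f(1) g(1,2)] .
  then have c: "coh_inj X Z (\<lambda>i. g i oo f i)" "coh_surj X Z (\<lambda>i. g i oo f i)"
    using qis_iff[OF chain_map_comp[OF f(2) g(3) f(1) g(1,2)] f(1) g(2)] by auto
  show "u \<in> qis A" unfolding f(3) qis_iff[OF f(2,1) g(1)]
    using coh_inj_cancel[OF c(1) f(2) g(3) f(1) g(1,2)] coh_surj_cancel[OF c(2) g(4) f(2) g(3) f(1) g(1,2)] by blast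
next
  fix s u assume s: "s \<in> qis A" and u: "u \<in> Arr (Kb A)" "Cod (Kb A) u = Cod (Kb A) s"
  from s obtain Y' Y g where g: "bounded_complex A Y'" "bounded_complex A Y" "chain_map A Y' Y g" "coh_inj Y' Y g"
    "coh_surj Y' Y g" "s = hc Y' Y g" "Dom (Kb A) s = Y'" "Cod (Kb A) s = Y" by (rule qisE)
  obtain X f where f: "bounded_complex A X" "chain_map A X Y f" "u = hc X Y f"
    using Arr_KbE[OF u(1)] u(2) g(8) by metis
  obtain F t f' where F: "bounded_complex A F" "chain_map A F X t" "chain_map A F Y' f'" "coh_inj F X t" "coh_surj F X t"
    "homotopic A F Y (\<lambda>i. f i oo t i) (\<lambda>i. g i oo f' i)" using ore[OF f(2) g(3-5) f(1) g(2,1)] .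
  have "hc F X t \<in> qis A" using qis_iff[OF F(2,1) f(1)] F(4,5) by blast
  moreover have "Comp (Kb A) u (hc F X t) = Comp (Kb A) s (hc F Y' f')"
    unfolding f(3) g(6) Comp_Kb[OF F(2) f(2) F(1) f(1) g(2)] Comp_Kb[OF F(3) g(3) F(1) g(1,2)]
    using F(6) hc_eq_iff[OF chain_map_comp[OF F(2) f(2) F(1) f(1) g(2)] chain_map_comp[OF F(3) g(3) F(1) g(1,2)] F(1) g(2)]
    by blast
  ultimately show "\<exists>t f'. t \<in> qis A \<and> f' \<in> Arr (Kb A) \<and> Dom (Kb A) t = Dom (Kb A) f' \<and>
      Cod (Kb A) t = Dom (Kb A) u \<and> Cod (Kb A) f' = Dom (Kb A) s \<and> Comp (Kb A) u t = Comp (Kb A) s f'"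
    using hc_Arr[OF F(2,1) f(1)] hc_Arr[OF F(3,1) g(1)] hc_Arr(3)[OF f(2,1) g(2)] f(3) g(7) by metis
next
  fix s u assume s: "s \<in> qis A" and u: "u \<in> Arr (Kb A)" "Cod (Kb A) u = Dom (Kb A) s"
    "Comp (Kb A) s u = Zero (Kb A) (Dom (Kb A) u) (Cod (Kb A) s)"
  from s obtain Y Z g where g: "bounded_complex A Y" "bounded_complex A Z" "chain_map A Y Z g" "coh_inj Y Z g"
    "coh_surj Y Z g" "s = hc Y Z g" "Dom (Kb A) s = Y" "Cod (Kb A) s = Z" by (rule qisE)
  obtain X f where f: "bounded_complex A X" "chain_map A X Y f" "u = hc X Y f"
    using Arr_KbE[OF u(1)] u(2) g(7) by metis
  note fA = hc_Arr[OF f(2,1) g(1)]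
  have "hc X Z (\<lambda>i. g i oo f i) = hc X Z (zero_map X Z)"
    using u(3)[unfolded g(8)] unfolding f(3) fA(3) Zero_Kb' g(6) Comp_Kb[OF f(2) g(3) f(1) g(1,2)] .
  then have "homotopic A X Z (\<lambda>i. g i oo f i) (zero_map X Z)"
    using hc_eq_iff[OF chain_map_comp[OF f(2) g(3) f(1) g(1,2)] chain_map_zero_map[OF f(1) g(2)] f(1) g(2)] by blast
  then obtain W t where W: "bounded_complex A W" "chain_map A W X t" "coh_inj W X t" "coh_surj W X t"
    "homotopic A W Y (\<lambda>i. f i oo t i) (zero_map W Y)"
    by (rule null_of_comp_null[OF f(2) g(3-5) f(1) g(1,2)])
  have "hc W X t \<in> qis A" using qis_iff[OF W(2,1) f(1)] W(3,4) by blast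
  moreover have "Comp (Kb A) u (hc W X t) = Zero (Kb A) W Y"
    unfolding f(3) Zero_Kb' Comp_Kb[OF W(2) f(2) W(1) f(1) g(1)]
    using W(5) hc_eq_iff[OF chain_map_comp[OF W(2) f(2) W(1) f(1) g(1)] chain_map_zero_map[OF W(1) g(1)] W(1) g(1)]
    by blast
  ultimately show "\<exists>t\<in>qis A. Cod (Kb A) t = Dom (Kb A) u \<and> Comp (Kb A) u t = Zero (Kb A) (Dom (Kb A) t) (Cod (Kb A) u)"
    using hc_Arr[OF W(2,1) f(1)] fA(3,4) f(3) by metis
qed

end

sublocale ab_cat \<subseteq> Q: fractions "Kb A" "qis A"
  by (rule Kb_fractions)

sublocale ab_cat \<subseteq> D: preadditive_category "Db_cat A"
  by (rule Q.localisation_preadditive)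

context ab_cat
begin

lemma Obj_Db: "Obj (Db_cat A) = {X. bounded_complex A X}"
  by (simp add: Q.Obj_L Obj_Kb)

lemma roofE:
  assumes "(s, f) \<in> roofs (Kb A) (qis A) X Y"
  obtains X' s' f' where "bounded_complex A X" "bounded_complex A Y" "bounded_complex A X'"
    "chain_map A X' X s'" "coh_inj X' X s'" "coh_surj X' X s'" "chain_map A X' Y f'"
    "s = hc X' X s'" "f = hc X' Y f'"
proof -
  have r: "s \<in> qis A" "f \<in> Arr (Kb A)" "Dom (Kb A) s = Dom (Kb A) f" "Cod (Kb A) s = X" "Cod (Kb A) f = Y"
    using assms Q.in_roofs by auto
  from r(1) obtain X' X1 s' where s: "bounded_complex A X'" "bounded_complex A X1" "chain_map A X' X1 s'" "coh_inj X' X1 s'"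
    "coh_surj X' X1 s'" "s = hc X' X1 s'" "Dom (Kb A) s = X'" "Cod (Kb A) s = X1" by (rule qisE)
  have X1: "X1 = X" using s(8) r(4) by simp
  obtain f' where f: "bounded_complex A (Dom (Kb A) f)" "bounded_complex A (Cod (Kb A) f)"
    "chain_map A (Dom (Kb A) f) (Cod (Kb A) f) f'" "f = hc (Dom (Kb A) f) (Cod (Kb A) f) f'"
    using Arr_KbE[OF r(2)] .
  have d: "Dom (Kb A) f = X'" using r(3) s(7) by simp
  show ?thesis using that[of X' s' f'] s(1-6) f X1 d r(5) by metis
qed

lemma coh_exact:
  assumes "coh_inj X Y f" "chain_map A X Y f" "bounded_complex A X" "bounded_complex A Y" "exact_at Y i"
  shows "exact_at X i"
  using assms cocycle_map unfolding exact_at_def coh_inj_def coh_inj_at_def by blast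

text \<open>
  In an identity \<open>\<psi> \<phi> = 1\<close>, unwound through roofs, a chain map representing a
  quasi-isomorphism onto \<open>X\<close> factors through a complex quasi-isomorphic to \<open>Y\<close>, where every cocycle of
  degree \<open>i\<close> is a local boundary.
\<close>

lemma exact_retract:
  assumes \<phi>: "\<phi> \<in> Hom (Db_cat A) X Y" and \<psi>: "\<psi> \<in> Hom (Db_cat A) Y X"
    and id: "Comp (Db_cat A) \<psi> \<phi> = Id (Db_cat A) X" and ex: "exact_at Y i"
  shows "exact_at X i"
proof -
  obtain s f where sf: "(s, f) \<in> roofs (Kb A) (qis A) X Y" "\<phi> = Q.cls X Y (s, f)" using Q.HomE[OF \<phi>] .
  obtain t g where tg: "(t, g) \<in> roofs (Kb A) (qis A) Y X" "\<psi> = Q.cls Y X (t, g)" using Q.HomE[OF \<psi>] .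
  note R = sf(1)[unfolded Q.in_roofs] tg(1)[unfolded Q.in_roofs]
  obtain a b where ab: "Q.square f t a b" using Q.ex_square[of t f] R by auto
  have XO: "X \<in> Obj (Kb A)" using Q.roofs_Obj[OF sf(1)] by simp
  have r1: "(Id (Kb A) X, Id (Kb A) X) \<in> roofs (Kb A) (qis A) X X"
    using XO Q.S_Id Q.id_arr[OF XO] by (simp add: Q.in_roofs)
  have "Q.cls X X (Comp (Kb A) s a, Comp (Kb A) g b) = Q.cls X X (Id (Kb A) X, Id (Kb A) X)"
    using id unfolding sf(2) tg(2) Q.Comp_cls[OF ab sf(1) tg(1)] Q.Id_cls .
  then have "roof_eq (Kb A) (qis A) (Comp (Kb A) s a, Comp (Kb A) g b) (Id (Kb A) X, Id (Kb A) X)"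
    using Q.cls_eq_iff[OF Q.square_roof[OF ab sf(1) tg(1)] r1] by simp
  then obtain u v where uv: "u \<in> qis A" "v \<in> qis A" "Dom (Kb A) u = Dom (Kb A) v"
      "Cod (Kb A) u = Dom (Kb A) (Comp (Kb A) s a)" "Cod (Kb A) v = Dom (Kb A) (Id (Kb A) X)"
      "Comp (Kb A) (Comp (Kb A) g b) u = Comp (Kb A) (Id (Kb A) X) v"
    using Q.roof_eqE[OF _ Q.square_roof[OF ab sf(1) tg(1)] r1] by metis
  note S = ab[unfolded Q.square_def]
  have A: "s \<in> Arr (Kb A)" "t \<in> Arr (Kb A)" "a \<in> Arr (Kb A)" "u \<in> Arr (Kb A)" "v \<in> Arr (Kb A)"
    using R S uv(1,2) Q.S_Arr by auto
  have cu: "Cod (Kb A) u = Dom (Kb A) b" using uv(4) Q.comp_arr[of a s] A R S by auto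
  have cv: "Cod (Kb A) v = X" using uv(5) XO by (simp add: Q.id_arr)
  have gbu: "Comp (Kb A) g (Comp (Kb A) b u) = v"
    using uv(6) A R S cu cv by (simp add: Q.cat_simps)
  define h where "h = Comp (Kb A) b u"
  have h: "h \<in> Arr (Kb A)" "Cod (Kb A) h = Dom (Kb A) t" "Comp (Kb A) g h = v" "Dom (Kb A) h = Dom (Kb A) u"
    using gbu A R S cu by (simp_all add: h_def Q.comp_arr)
  obtain Y' t' g' where Y: "bounded_complex A Y" "bounded_complex A X" "bounded_complex A Y'"
    "chain_map A Y' Y t'" "coh_inj Y' Y t'" "coh_surj Y' Y t'" "chain_map A Y' X g'"
    "t = hc Y' Y t'" "g = hc Y' X g'" using roofE[OF tg(1)] .
  obtain h' where h': "bounded_complex A (Dom (Kb A) h)" "bounded_complex A (Cod (Kb A) h)"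
    "chain_map A (Dom (Kb A) h) (Cod (Kb A) h) h'" "h = hc (Dom (Kb A) h) (Cod (Kb A) h) h'"
    using Arr_KbE[OF h(1)] .
  have hY: "Cod (Kb A) h = Y'" using h(2) Y(8) hc_Arr(3)[OF Y(4,3,1)] by simp
  define V where "V = Dom (Kb A) h"
  have H: "bounded_complex A V" "chain_map A V Y' h'" "h = hc V Y' h'" using h' unfolding hY V_def by auto
  have cgh: "chain_map A V X (\<lambda>i. g' i oo h' i)" by (rule chain_map_comp[OF H(2) Y(7) H(1) Y(3,2)])
  have "hc V X (\<lambda>i. g' i oo h' i) \<in> qis A"
    using uv(2) unfolding h(3)[symmetric] Y(9) H(3) Comp_Kb[OF H(2) Y(7) H(1) Y(3,2)] .
  then have surj: "coh_surj V X (\<lambda>i. g' i oo h' i)" using qis_iff[OF cgh H(1) Y(2)] by blast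
  have exY': "exact_at Y' i" by (rule coh_exact[OF Y(5,4,3,1) ex])
  show ?thesis unfolding exact_at_def
  proof (intro allI impI)
    fix x assume x: "cocycle X i x"
    have Xx: "x \<in> Arr A" "Cod A x = cobj X i" using x by (auto simp: cocycle_def)
    obtain e y w where k: "epi_arr A e" "e \<in> Arr A" "Cod A e = Dom A x" "cocycle V i y" "y \<in> Arr A"
      "Cod A y = cobj V i" "Dom A y = Dom A e" "w \<in> Arr A" "Dom A w = Dom A e"
      "Cod A w = cobj X (i - 1)" "(g' i oo h' i) oo y = x oo e \<boxplus> cdiff X (i - 1) oo w"
      using coh_surjE[OF surj x cgh H(1) Y(2)] .
    note M = chain_mapD(1-3)[OF H(2)] chain_mapD(1-3)[OF Y(7)]
    have hy: "cocycle Y' i (h' i oo y)" by (rule cocycle_map[OF k(4) H(2,1) Y(3)])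
    have "loc_bd X i (g' i oo h' i oo y)"
      by (rule loc_bd_map[OF _ _ _ Y(7,3,2)])
        (use exY' hy k(5,6) M in \<open>simp_all add: exact_at_def cocycle_def comp_arr\<close>)
    then have 1: "loc_bd X i ((g' i oo h' i) oo y)" using k(5,6) M by (simp add: comp_assoc)
    have "x oo e = (g' i oo h' i) oo y \<boxplus> cdiff X (i - 1) oo \<boxminus> w"
      unfolding k(11) by (rule eq_sgI) (use k(2,3,8-10) Xx complexD[OF Y(2)] in \<open>simp add: lin_simps\<close>)
    moreover have "loc_bd X i ((g' i oo h' i) oo y \<boxplus> cdiff X (i - 1) oo \<boxminus> w)"
      by (rule loc_bd_plus[OF 1 loc_bd_diff[OF Y(2)] _ _ _ _ _ Y(2)])
        (use k(5-10) M complexD[OF Y(2)] in \<open>simp_all add: comp_arr neg_arr\<close>)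
    ultimately have "loc_bd X i (x oo e)" by simp
    then show "loc_bd X i x" by (rule loc_bd_epi[OF _ k(1) Xx(1) k(3)])
  qed
qed

lemma zero_obj_Db_iff:
  assumes X: "bounded_complex A X"
  shows "zero_obj (Db_cat A) X \<longleftrightarrow> (\<forall>i. exact_at X i)"
proof -
  have XO: "X \<in> Obj (Kb A)" using X by (simp add: Obj_Kb)
  have r1: "(Id (Kb A) X, Id (Kb A) X) \<in> roofs (Kb A) (qis A) X X"
    using XO Q.S_Id Q.id_arr[OF XO] by (simp add: Q.in_roofs)
  have iff: "Id (Db_cat A) X = Zero (Db_cat A) X X \<longleftrightarrow>
     (\<exists>u \<in> qis A. Cod (Kb A) u = X \<and> u = Zero (Kb A) (Dom (Kb A) u) X)"
    unfolding Q.Id_cls Q.cls_zero_iff[OF r1] using XO Q.S_Arr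
    by (intro bex_cong refl) (auto simp: Q.id_arr Q.id_comp)
  show ?thesis
  proof
    assume z: "zero_obj (Db_cat A) X"
    obtain u where u: "u \<in> qis A" "Cod (Kb A) u = X" "u = Zero (Kb A) (Dom (Kb A) u) X"
      using iff D.zero_objD(2)[OF z] by blast
    define W where "W = Dom (Kb A) u"
    have W: "bounded_complex A W" using Q.Dom_Obj[OF Q.S_Arr[OF u(1)]] by (simp add: Obj_Kb W_def)
    have c: "chain_map A W X (zero_map W X)" by (rule chain_map_zero_map[OF W X])
    have "hc W X (zero_map W X) \<in> qis A" using u(1) u(3)[folded W_def] unfolding Zero_Kb' by simp
    then have surj: "coh_surj W X (zero_map W X)" using qis_iff[OF c W X] by blast
    show "\<forall>i. exact_at X i" unfolding exact_at_def
    proof (intro allI impI)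
      fix i x assume x: "cocycle X i x"
      have Xx: "x \<in> Arr A" "Cod A x = cobj X i" using x by (auto simp: cocycle_def)
      obtain e y w where k: "epi_arr A e" "e \<in> Arr A" "Cod A e = Dom A x" "cocycle W i y" "y \<in> Arr A"
        "Cod A y = cobj W i" "Dom A y = Dom A e" "w \<in> Arr A" "Dom A w = Dom A e"
        "Cod A w = cobj X (i - 1)" "zero_map W X i oo y = x oo e \<boxplus> cdiff X (i - 1) oo w"
        using coh_surjE[OF surj x c W X] .
      have z: "zero_map W X i oo y = Zero A (Dom A e) (cobj X i)"
        unfolding zero_map_def using k(5-7) complexD[OF X] by (simp add: zero_comp)
      have "x oo e = zero_map W X i oo y \<boxplus> cdiff X (i - 1) oo \<boxminus> w"
        unfolding k(11) by (rule eq_sgI) (use k(2,3,8-10) Xx complexD[OF X] in \<open>simp add: lin_simps\<close>)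
      also have "\<dots> = cdiff X (i - 1) oo \<boxminus> w"
        unfolding z by (rule zero_plus) (use k(8-10) complexD[OF X] in \<open>simp_all add: comp_arr neg_arr\<close>)
      finally show "loc_bd X i x"
        by (intro loc_bdI[of e _ "\<boxminus> w"]) (use k in \<open>simp_all add: neg_arr\<close>)
    qed
  next
    assume ex: "\<forall>i. exact_at X i"
    have c: "chain_map A zero_complex X (zero_map zero_complex X)" by (rule chain_map_zero_map[OF zero_complex(1) X])
    have "hc zero_complex X (zero_map zero_complex X) \<in> qis A"
      using qis_iff[OF c zero_complex(1) X] zero_map_coh[OF X] ex by blast
    then have "Id (Db_cat A) X = Zero (Db_cat A) X X"
      unfolding iff using hc_Arr(3,4)[OF c zero_complex(1) X] unfolding Zero_Kb' by metis
    then show "zero_obj (Db_cat A) X" using X by (intro D.zero_objI) (simp add: Obj_Db)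
  qed
qed

end

section \<open>Vanishing over hereditary categories\<close>

context ab_cat
begin

subsection \<open>Reindexing\<close>

definition reindex :: "int \<Rightarrow> ('o, 'm) complex \<Rightarrow> ('o, 'm) complex" where
  "reindex n X = \<lparr>cobj = \<lambda>i. cobj X (i + n), cdiff = \<lambda>i. cdiff X (i + n)\<rparr>"

lemma reindex_simps: "cobj (reindex n X) i = cobj X (i + n)" "cdiff (reindex n X) i = cdiff X (i + n)"
  by (simp_all add: reindex_def)

lemma index_simps: "(i::int) + 1 + n = i + n + 1" "i - 1 + n = i + n - 1"
  by simp_all

lemma reindex_reindex: "reindex (- n) (reindex n X) = X"
  by (simp add: reindex_def)

lemma reindex_bounded: assumes "bounded_complex A X" shows "bounded_complex A (reindex n X)"
proof -
  obtain N where N: "\<And>i. \<bar>i\<bar> > N \<Longrightarrow> zero_obj A (cobj X i)" using bounded_complexE[OF assms] by metis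
  show ?thesis
    by (rule bounded_complexI[of _ "N + \<bar>n\<bar>"])
      (auto simp: reindex_simps complexD[OF assms] diff_diff[OF assms] ac_simps intro!: N)
qed

lemma reindex_chain_map: "chain_map A X Y f \<Longrightarrow> chain_map A (reindex n X) (reindex n Y) (\<lambda>i. f (i + n))"
  by (rule chain_mapI) (simp_all add: reindex_simps index_simps[of _ n] chain_mapD)

lemma reindex_homotopic:
  assumes "homotopic A X Y f g"
  shows "homotopic A (reindex n X) (reindex n Y) (\<lambda>i. f (i + n)) (\<lambda>i. g (i + n))"
proof -
  obtain s where s: "is_htpy X Y s" and e: "\<And>i. f i = g i \<boxplus> (cdiff Y (i - 1) oo s i \<boxplus> s (i + 1) oo cdiff X i)"
    using homotopicE[OF assms(1)] by metis
  show ?thesis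
    by (rule homotopicI[of _ _ "\<lambda>i. s (i + n)"])
      (use is_htpyD[OF s] e in \<open>simp_all add: is_htpy_def reindex_simps index_simps[of _ n]\<close>)
qed

lemma reindex_cocycle: "cocycle (reindex n X) i z \<longleftrightarrow> cocycle X (i + n) z"
  by (simp add: cocycle_def reindex_simps index_simps[of _ n])

lemma reindex_loc_bd: "loc_bd (reindex n X) i z \<longleftrightarrow> loc_bd X (i + n) z"
  by (simp add: loc_bd_def reindex_simps index_simps[of _ n])

lemma reindex_exact: "exact_at (reindex n X) i \<longleftrightarrow> exact_at X (i + n)"
  by (simp add: exact_at_def reindex_cocycle reindex_loc_bd)

lemma reindex_coh_inj: "coh_inj X Y f \<Longrightarrow> coh_inj (reindex n X) (reindex n Y) (\<lambda>i. f (i + n))"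
  by (simp add: coh_inj_def coh_inj_at_def reindex_cocycle reindex_loc_bd)

lemma reindex_coh_surj: "coh_surj X Y f \<Longrightarrow> coh_surj (reindex n X) (reindex n Y) (\<lambda>i. f (i + n))"
  by (simp add: coh_surj_def coh_surj_at_def reindex_cocycle reindex_loc_bd)

subsection \<open>Chain maps that vanish in the derived category\<close>

text \<open>The chain maps whose image in the derived category is zero, by the criterion for roofs.\<close>

definition null_map :: "('o, 'm) complex \<Rightarrow> ('o, 'm) complex \<Rightarrow> (int \<Rightarrow> 'm) \<Rightarrow> bool" where
  "null_map X Y f \<longleftrightarrow> (\<exists>W u. bounded_complex A W \<and> chain_map A W X u \<and> coh_inj W X u \<and> coh_surj W X u \<and>
     homotopic A W Y (\<lambda>i. f i oo u i) (zero_map W Y))"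

lemma null_map_iff:
  assumes f: "chain_map A X Y f" and b: "bounded_complex A X" "bounded_complex A Y"
  shows "null_map X Y f \<longleftrightarrow> (\<exists>u \<in> qis A. Cod (Kb A) u = X \<and> Comp (Kb A) (hc X Y f) u = Zero (Kb A) (Dom (Kb A) u) Y)"
proof
  assume "null_map X Y f"
  then obtain W u where W: "bounded_complex A W" "chain_map A W X u" "coh_inj W X u" "coh_surj W X u"
    "homotopic A W Y (\<lambda>i. f i oo u i) (zero_map W Y)" unfolding null_map_def by blast
  have "hc W X u \<in> qis A" using qis_iff[OF W(2,1) b(1)] W(3,4) by blast
  moreover have "Comp (Kb A) (hc X Y f) (hc W X u) = Zero (Kb A) W Y"
    unfolding Zero_Kb' Comp_Kb[OF W(2) f W(1) b]
    using W(5) hc_eq_iff[OF chain_map_comp[OF W(2) f W(1) b] chain_map_zero_map[OF W(1) b(2)] W(1) b(2)] by blast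
  ultimately show "\<exists>u \<in> qis A. Cod (Kb A) u = X \<and> Comp (Kb A) (hc X Y f) u = Zero (Kb A) (Dom (Kb A) u) Y"
    using hc_Arr[OF W(2,1) b(1)] by metis
next
  assume "\<exists>u \<in> qis A. Cod (Kb A) u = X \<and> Comp (Kb A) (hc X Y f) u = Zero (Kb A) (Dom (Kb A) u) Y"
  then obtain u where u: "u \<in> qis A" "Cod (Kb A) u = X" "Comp (Kb A) (hc X Y f) u = Zero (Kb A) (Dom (Kb A) u) Y" by blast
  from u(1) obtain W X' v where v: "bounded_complex A W" "bounded_complex A X'" "chain_map A W X' v" "coh_inj W X' v"
    "coh_surj W X' v" "u = hc W X' v" "Dom (Kb A) u = W" "Cod (Kb A) u = X'" by (rule qisE)
  have X': "X' = X" using v(8) u(2) by simp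
  note v = v[unfolded X']
  have "hc W Y (\<lambda>i. f i oo v i) = hc W Y (zero_map W Y)"
    using u(3)[unfolded v(7)] unfolding v(6) Zero_Kb' Comp_Kb[OF v(3) f v(1) b] .
  then have "homotopic A W Y (\<lambda>i. f i oo v i) (zero_map W Y)"
    using hc_eq_iff[OF chain_map_comp[OF v(3) f v(1) b] chain_map_zero_map[OF v(1) b(2)] v(1) b(2)] by blast
  then show "null_map X Y f" unfolding null_map_def using v by blast
qed

lemma homotopic_zero_comp:
  assumes "homotopic A X Y f (zero_map X Y)" "chain_map A Y Z g"
    "bounded_complex A X" "bounded_complex A Y" "bounded_complex A Z"
  shows "homotopic A X Z (\<lambda>i. g i oo f i) (zero_map X Z)"
proof -
  have "homotopic A X Z (\<lambda>i. g i oo f i) (\<lambda>i. g i oo zero_map X Y i)"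
    by (rule homotopic_comp_left[OF assms(1) chain_map_zero_map[OF assms(3,4)] assms(2-5)])
  moreover have "(\<lambda>i. g i oo zero_map X Y i) = zero_map X Z"
    using chain_mapD[OF assms(2)] complexD[OF assms(3)] by (auto simp: zero_map_def comp_zero)
  ultimately show ?thesis by simp
qed

lemma homotopic_comp_zero:
  assumes "homotopic A Y Z f (zero_map Y Z)" "chain_map A X Y g"
    "bounded_complex A X" "bounded_complex A Y" "bounded_complex A Z"
  shows "homotopic A X Z (\<lambda>i. f i oo g i) (zero_map X Z)"
proof -
  have "homotopic A X Z (\<lambda>i. f i oo g i) (\<lambda>i. zero_map Y Z i oo g i)"
    by (rule homotopic_comp_right[OF assms(1) chain_map_zero_map[OF assms(4,5)] assms(2-5)])
  moreover have "(\<lambda>i. zero_map Y Z i oo g i) = zero_map X Z"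
    using chain_mapD[OF assms(2)] complexD[OF assms(5)] by (auto simp: zero_map_def zero_comp)
  ultimately show ?thesis by simp
qed

lemma null_map_comp:
  assumes "null_map X Y f" "chain_map A X Y f" "chain_map A Y Z g"
    "bounded_complex A X" "bounded_complex A Y" "bounded_complex A Z"
  shows "null_map X Z (\<lambda>i. g i oo f i)"
proof -
  obtain W u where W: "bounded_complex A W" "chain_map A W X u" "coh_inj W X u" "coh_surj W X u"
    "homotopic A W Y (\<lambda>i. f i oo u i) (zero_map W Y)" using assms(1) unfolding null_map_def by blast
  have "homotopic A W Z (\<lambda>i. g i oo f i oo u i) (zero_map W Z)"
    by (rule homotopic_zero_comp[OF W(5) assms(3) W(1) assms(5,6)])
  moreover have "g i oo f i oo u i = (g i oo f i) oo u i" for i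
    using chain_mapD[OF assms(2)] chain_mapD[OF assms(3)] chain_mapD[OF W(2)] by (simp add: comp_assoc)
  ultimately show ?thesis unfolding null_map_def using W by auto
qed

lemma null_map_precomp:
  assumes "null_map E Z g" "chain_map A E Z g" "chain_map A X E r"
    "bounded_complex A X" "bounded_complex A E" "bounded_complex A Z"
  shows "null_map X Z (\<lambda>i. g i oo r i)"
proof -
  obtain W u where W: "bounded_complex A W" "chain_map A W E u" "coh_inj W E u" "coh_surj W E u"
    "homotopic A W Z (\<lambda>i. g i oo u i) (zero_map W Z)" using assms(1) unfolding null_map_def by blast
  obtain F t f' where F: "bounded_complex A F" "chain_map A F X t" "chain_map A F W f'" "coh_inj F X t" "coh_surj F X t"
    "homotopic A F E (\<lambda>i. r i oo t i) (\<lambda>i. u i oo f' i)" using ore[OF assms(3) W(2-4) assms(4,5) W(1)] .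
  note cs = chain_mapD(1-3)[OF assms(2)] chain_mapD(1-3)[OF assms(3)] chain_mapD(1-3)[OF W(2)] chain_mapD(1-3)[OF F(2)] chain_mapD(1-3)[OF F(3)]
  have "homotopic A F Z (\<lambda>i. g i oo r i oo t i) (\<lambda>i. g i oo u i oo f' i)"
    by (rule homotopic_comp_left[OF F(6) chain_map_comp[OF F(3) W(2) F(1) W(1) assms(5)] assms(2) F(1) assms(5,6)])
  moreover have "homotopic A F Z (\<lambda>i. (g i oo u i) oo f' i) (zero_map F Z)"
    by (rule homotopic_comp_zero[OF W(5) F(3,1) W(1) assms(6)])
  ultimately have "homotopic A F Z (\<lambda>i. (g i oo r i) oo t i) (zero_map F Z)"
    using homotopic_trans[of F Z "\<lambda>i. g i oo r i oo t i" "\<lambda>i. g i oo u i oo f' i" "zero_map F Z"]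
      chain_map_zero_map[OF F(1) assms(6)] F(1) assms(6) cs by (simp add: comp_assoc)
  then show ?thesis unfolding null_map_def using F by blast
qed

lemma null_map_cancel:
  assumes "null_map X Z (\<lambda>i. s i oo f i)" "chain_map A X Y f" "chain_map A Y Z s" "coh_inj Y Z s" "coh_surj Y Z s"
    "bounded_complex A X" "bounded_complex A Y" "bounded_complex A Z"
  shows "null_map X Y f"
proof -
  obtain W u where W: "bounded_complex A W" "chain_map A W X u" "coh_inj W X u" "coh_surj W X u"
    "homotopic A W Z (\<lambda>i. (s i oo f i) oo u i) (zero_map W Z)" using assms(1) unfolding null_map_def by blast
  note cs = chain_mapD(1-3)[OF assms(2)] chain_mapD(1-3)[OF assms(3)] chain_mapD(1-3)[OF W(2)]
  have "homotopic A W Z (\<lambda>i. s i oo f i oo u i) (zero_map W Z)" using W(5) cs by (simp add: comp_assoc)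
  then obtain V t where V: "bounded_complex A V" "chain_map A V W t" "coh_inj V W t" "coh_surj V W t"
    "homotopic A V Y (\<lambda>i. (f i oo u i) oo t i) (zero_map V Y)"
    by (rule null_of_comp_null[OF chain_map_comp[OF W(2) assms(2) W(1) assms(6,7)] assms(3-5) W(1) assms(7,8)])
  have "homotopic A V Y (\<lambda>i. f i oo u i oo t i) (zero_map V Y)"
    using V(5) cs chain_mapD(1-3)[OF V(2)] by (simp add: comp_assoc)
  then show ?thesis unfolding null_map_def
    using V(1) chain_map_comp[OF V(2) W(2) V(1) W(1) assms(6)] coh_inj_comp[OF V(3) W(3) V(2) W(2) V(1) W(1)]
      coh_surj_comp[OF V(4) W(4) V(2) W(2) V(1) W(1) assms(6)] by blast
qed

lemma null_map_reindex:
  assumes "null_map (reindex n X) (reindex n Y) (\<lambda>i. f (i + n))"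
  shows "null_map X Y f"
proof -
  obtain W u where W: "bounded_complex A W" "chain_map A W (reindex n X) u" "coh_inj W (reindex n X) u" "coh_surj W (reindex n X) u"
    "homotopic A W (reindex n Y) (\<lambda>i. f (i + n) oo u i) (zero_map W (reindex n Y))" using assms(1) unfolding null_map_def by blast
  have z: "(\<lambda>i. zero_map W (reindex n Y) (i - n)) = zero_map (reindex (- n) W) Y"
    by (rule ext) (simp add: zero_map_def reindex_simps)
  have "homotopic A (reindex (- n) W) Y (\<lambda>i. f i oo u (i - n)) (zero_map (reindex (- n) W) Y)"
    using reindex_homotopic[OF W(5), of "- n"] z by (simp add: reindex_reindex)
  then show ?thesis unfolding null_map_def
    using reindex_bounded[OF W(1), of "- n"] reindex_chain_map[OF W(2), of "- n"]
      reindex_coh_inj[OF W(3), of "- n"] reindex_coh_surj[OF W(4), of "- n"]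
    unfolding reindex_reindex by auto
qed

lemma chain_map_into_zero:
  assumes "bounded_complex A X" "f \<in> Arr A" "Cod A f = Y" "zero_obj A Y"
    "g \<in> Arr A" "Cod A g = Y" "Dom A g = Dom A f"
  shows "f = g"
  using zero_objD(3)[OF assms(4,2,3)] zero_objD(3)[OF assms(4,5,6)] assms(7) by simp

subsection \<open>Brutal truncation\<close>

text \<open>
  The brutal truncation keeps the terms of degree at most \<open>c\<close>; it is a quotient complex, through which
  every chain map into a complex vanishing above degree \<open>c\<close> factors (\<open>brutal_factor\<close>).
\<close>

definition brutal :: "int \<Rightarrow> ('o, 'm) complex \<Rightarrow> ('o, 'm) complex" where
  "brutal c X = \<lparr>cobj = \<lambda>i. if i \<le> c then cobj X i else cobj zero_complex i,
     cdiff = \<lambda>i. if i < c then cdiff X i else Zero A (if i \<le> c then cobj X i else cobj zero_complex i) (cobj zero_complex i)\<rparr>"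

lemma brutal_simps:
  "i \<le> c \<Longrightarrow> cobj (brutal c X) i = cobj X i" "i < c \<Longrightarrow> cdiff (brutal c X) i = cdiff X i"
  "i > c \<Longrightarrow> zero_obj A (cobj (brutal c X) i)"
  by (simp_all add: brutal_def zero_complex)

lemma brutal_bounded: assumes X: "bounded_complex A X" shows "bounded_complex A (brutal c X)"
proof -
  obtain N where N: "\<And>i. \<bar>i\<bar> > N \<Longrightarrow> zero_obj A (cobj X i)" using bounded_complexE[OF X] by metis
  obtain Z where Z: "\<And>i. cobj zero_complex i = Z" by (simp add: zero_complex_def Let_def)
  have O: "Z \<in> Obj A" "zero_obj A Z" using zero_complex(2)[of 0] zero_objD(1) by (auto simp: Z)
  show ?thesis
    by (rule bounded_complexI[of _ N])
      (auto simp: brutal_def Z complexD[OF X] O zero_arr comp_zero zero_comp diff_diff[OF X] N)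
qed

definition brutal_map :: "int \<Rightarrow> ('o, 'm) complex \<Rightarrow> int \<Rightarrow> 'm" where
  "brutal_map c X i = (if i \<le> c then Id A (cobj X i) else Zero A (cobj X i) (cobj (brutal c X) i))"

lemma brutal_chain_map: assumes X: "bounded_complex A X" shows "chain_map A X (brutal c X) (brutal_map c X)"
proof (rule chain_mapI)
  note XX = complexD[OF X] complexD[OF brutal_bounded[OF X]]
  fix i
  show "brutal_map c X i \<in> Arr A" "Dom A (brutal_map c X i) = cobj X i" "Cod A (brutal_map c X i) = cobj (brutal c X) i" for i
    by (simp_all add: brutal_map_def XX id_arr zero_arr brutal_simps)
  note a = this
  show "brutal_map c X (i + 1) oo cdiff X i = cdiff (brutal c X) i oo brutal_map c X i"
  proof (cases "i < c")
    case True
    then show ?thesis using XX by (simp add: brutal_map_def brutal_simps id_comp comp_id)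
  next
    case False
    then have "zero_obj A (cobj (brutal c X) (i + 1))" by (intro brutal_simps) simp
    then show ?thesis using a XX by (intro chain_map_into_zero[OF X]) (simp_all add: comp_arr)
  qed
qed

lemma brutal_factor:
  assumes f: "chain_map A X Y f" and X: "bounded_complex A X" and Y: "bounded_complex A Y"
    and z: "\<And>i. i > c \<Longrightarrow> zero_obj A (cobj Y i)"
  obtains g where "chain_map A (brutal c X) Y g" "f = (\<lambda>i. g i oo brutal_map c X i)"
proof -
  note XX = complexD[OF X] complexD[OF brutal_bounded[OF X]] complexD[OF Y] and F = chain_mapD[OF f]
  define g where "g i = (if i \<le> c then f i else Zero A (cobj (brutal c X) i) (cobj Y i))" for i
  have a: "g i \<in> Arr A" "Dom A (g i) = cobj (brutal c X) i" "Cod A (g i) = cobj Y i" for i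
    by (simp_all add: g_def F XX zero_arr brutal_simps)
  have "chain_map A (brutal c X) Y g"
  proof (rule chain_mapI[OF a])
    fix i
    show "g (i + 1) oo cdiff (brutal c X) i = cdiff Y i oo g i"
    proof (cases "i < c")
      case True
      then show ?thesis using F by (simp add: g_def brutal_simps)
    next
      case False
      then have "zero_obj A (cobj Y (i + 1))" by (intro z) simp
      then show ?thesis using a XX by (intro chain_map_into_zero[OF X]) (simp_all add: comp_arr)
    qed
  qed
  moreover have "f i = g i oo brutal_map c X i" for i
  proof (cases "i \<le> c")
    case True
    then show ?thesis using F by (simp add: g_def brutal_map_def comp_id)
  next
    case False
    then have "zero_obj A (cobj Y i)" by (intro z) simp
    then show ?thesis using a F chain_mapD(1-3)[OF brutal_chain_map[OF X]]
      by (intro chain_map_into_zero[OF X]) (simp_all add: comp_arr)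
  qed
  ultimately show ?thesis using that by blast
qed

lemma brutal_exact:
  assumes X: "bounded_complex A X" and "exact_at X i" "i < c"
  shows "exact_at (brutal c X) i"
  using assms(2,3) by (simp add: exact_at_def cocycle_def loc_bd_def brutal_simps)

subsection \<open>Comparison with stalk complexes\<close>

text \<open>
  A complex that vanishes above degree \<open>c\<close> and is exact below it is a resolution of the cokernel of
  its last differential.
\<close>

lemma to_stalk:
  assumes G: "bounded_complex A G" and T: "bounded_complex A T"
    and Tz: "\<And>i. i \<noteq> c \<Longrightarrow> zero_obj A (cobj T i)" and Gz: "\<And>i. i > c \<Longrightarrow> zero_obj A (cobj G i)"
    and ex: "\<And>i. i < c \<Longrightarrow> exact_at G i" and k: "is_cokernel A (cdiff G (c - 1)) \<kappa>" "Cod A \<kappa> = cobj T c"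
  obtains \<pi> where "chain_map A G T \<pi>" "coh_inj G T \<pi>" "coh_surj G T \<pi>"
proof -
  note XX = complexD[OF G] complexD[OF T] and K = cokernelD[OF k(1)]
  define \<pi> where "\<pi> i = (if i = c then \<kappa> else Zero A (cobj G i) (cobj T i))" for i
  have P: "\<pi> i \<in> Arr A" "Dom A (\<pi> i) = cobj G i" "Cod A (\<pi> i) = cobj T i" for i
    using K k(2) XX by (auto simp: \<pi>_def zero_arr)
  have ch: "chain_map A G T \<pi>"
  proof (rule chain_mapI[OF P])
    fix i
    show "\<pi> (i + 1) oo cdiff G i = cdiff T i oo \<pi> i"
    proof (cases "i + 1 = c")
      case False
      then have "zero_obj A (cobj T (i + 1))" by (rule Tz)
      then show ?thesis using P XX by (intro chain_map_into_zero[OF G]) (simp_all add: comp_arr)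
    next
      case True
      then have i: "i = c - 1" by simp
      have "\<pi> c oo cdiff G (c - 1) = Zero A (cobj G (c - 1)) (cobj T c)"
        using K(4) k(2) XX by (simp add: \<pi>_def)
      then show ?thesis unfolding i using XX by (simp add: \<pi>_def comp_zero)
    qed
  qed
  have "coh_inj G T \<pi>" unfolding coh_inj_def coh_inj_at_def
  proof (intro allI impI, elim conjE)
    fix i z assume z: "cocycle G i z" "loc_bd T i (\<pi> i oo z)"
    have Z: "z \<in> Arr A" "Cod A z = cobj G i" using z by (auto simp: cocycle_def)
    consider "i < c" | "i > c" | "i = c" by linarith
    then show "loc_bd G i z"
    proof cases
      case 1 then show ?thesis using ex z unfolding exact_at_def by blast
    next
      case 2 then show ?thesis using loc_bd_into_zero[OF G Gz Z] by blast
    next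
      case 3
      obtain e x where e: "epi_arr A e" "e \<in> Arr A" "Cod A e = Dom A (\<pi> i oo z)" "x \<in> Arr A" "Dom A x = Dom A e"
        "Cod A x = cobj T (i - 1)" "(\<pi> i oo z) oo e = cdiff T (i - 1) oo x" using loc_bdE[OF z(2)] .
      have ec: "Cod A e = Dom A z" using e(3) Z P by (simp add: comp_arr)
      have "x = Zero A (Dom A e) (cobj T (i - 1))" using zero_objD(3)[OF Tz[of "i - 1"] e(4,6)] e(5) 3 by simp
      then have "(\<pi> i oo z) oo e = Zero A (Dom A e) (cobj T i)"
        unfolding e(7) using XX Dom_Obj[OF e(2)] by (simp add: comp_zero)
      then have "\<pi> i oo z = Zero A (Dom A z) (cobj T i)"
        using epi_cancel_zero[OF e(1), of "\<pi> i oo z"] ec Z P by (simp add: comp_arr)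
      then have kz: "\<kappa> oo z = Zero A (Dom A z) (Cod A \<kappa>)" using 3 k(2) by (simp add: \<pi>_def)
      obtain V e' x' where h: "e' \<in> Hom A V (Dom A z)" "epi_arr A e'" "x' \<in> Hom A V (Dom A (cdiff G (c - 1)))"
        "z oo e' = cdiff G (c - 1) oo x'"
        by (rule cokernel_exact[OF k(1), of z "Dom A z"]) (use Z 3 kz XX in \<open>auto simp: Hom_def\<close>)
      show ?thesis by (rule loc_bdI[of e' _ x']) (use h 3 XX in \<open>auto simp: Hom_def\<close>)
    qed
  qed
  moreover have "coh_surj G T \<pi>" unfolding coh_surj_def coh_surj_at_def
  proof (intro allI impI)
    fix i y assume y: "cocycle T i y"
    have Y: "y \<in> Arr A" "Cod A y = cobj T i" "Dom A y \<in> Obj A" using y Dom_Obj by (auto simp: cocycle_def)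
    show "\<exists>e x. epi_arr A e \<and> Cod A e = Dom A y \<and> cocycle G i x \<and> Dom A x = Dom A e \<and>
        loc_bd T i (\<pi> i oo x \<boxplus> \<boxminus> (y oo e))"
    proof (cases "i = c")
      case False
      let ?x = "Zero A (Dom A y) (cobj G i)"
      have "loc_bd T i (\<pi> i oo ?x \<boxplus> \<boxminus> (y oo Id A (Dom A y)))"
        by (rule loc_bd_into_zero[OF T Tz[OF False]]) (use Y P XX in \<open>simp_all add: arr_simps\<close>)
      then show ?thesis
        by (intro exI[of _ "Id A (Dom A y)"] exI[of _ ?x])
          (use Y XX in \<open>simp add: epi_id arr_simps cocycle_def\<close>)
    next
      case True
      obtain V e x where h: "e \<in> Hom A V (Dom A y)" "epi_arr A e" "x \<in> Hom A V (Dom A \<kappa>)" "y oo e = \<kappa> oo x"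
        by (rule pullback_epi[OF cokernel_epi[OF k(1)], of "Dom A \<kappa>" "Cod A \<kappa>" y "Dom A y"])
          (use K(2) Y True k(2) in \<open>auto simp: Hom_def\<close>)
      have H: "e \<in> Arr A" "Dom A e = V" "Cod A e = Dom A y" "x \<in> Arr A" "Dom A x = V" "Cod A x = cobj G i" "V \<in> Obj A"
        using h K(3) XX True Dom_Obj by (auto simp: Hom_def)
      have "\<pi> i oo x \<boxplus> \<boxminus> (y oo e) = Zero A V (cobj T i)"
      proof -
        have "\<pi> i oo x = y oo e" using h(4) True by (simp add: \<pi>_def)
        then show ?thesis using H(1-3) Y by (simp add: plus_neg comp_arr)
      qed
      then have "loc_bd T i (\<pi> i oo x \<boxplus> \<boxminus> (y oo e))" using loc_bd_zero[OF T H(7)] by simp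
      moreover have "cocycle G i x"
        using zero_objD(3)[OF Gz[of "i + 1"], of "cdiff G i oo x"] H XX True by (simp add: cocycle_def comp_arr)
      ultimately show ?thesis using h(2) H by metis
    qed
  qed
  ultimately show ?thesis using ch that by blast
qed

lemma stalk_shift_twice: "Q \<in> Obj A \<Longrightarrow>
    (shift_complex A ^^ 2) (stalk_complex A Q) = reindex 2 (stalk_complex A Q)"
proof -
  assume Q: "Q \<in> Obj A"
  have O: "(SOME Z. zero_obj A Z) \<in> Obj A" using zero_objD(1)[OF some_zero_obj] .
  show ?thesis
    unfolding shift_complex_def reindex_def stalk_complex_def Let_def numeral_2_eq_2
    by (auto simp: fun_eq_iff neg_zero Q O)
qed

lemma stalk_bounded: assumes Q: "Q \<in> Obj A" shows "bounded_complex A (stalk_complex A Q)"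
proof -
  have O: "(SOME Z. zero_obj A Z) \<in> Obj A" using zero_objD(1)[OF some_zero_obj] .
  show ?thesis
    by (rule bounded_complexI[of _ 0]) (auto simp: stalk_complex_def Let_def Q O zero_arr comp_zero some_zero_obj)
qed

lemma stalk_obj: "cobj (stalk_complex A Q) 0 = Q" "i \<noteq> 0 \<Longrightarrow> zero_obj A (cobj (stalk_complex A Q) i)"
  by (simp_all add: stalk_complex_def Let_def some_zero_obj)

lemma Db_simps: "Obj (Db A) = Obj (Db_cat A)" "Arr (Db A) = Arr (Db_cat A)" "Dom (Db A) = Dom (Db_cat A)"
  "Cod (Db A) = Cod (Db_cat A)" "Id (Db A) = Id (Db_cat A)" "Comp (Db A) = Comp (Db_cat A)"
  "Plus (Db A) = Plus (Db_cat A)" "Zero (Db A) = Zero (Db_cat A)" "ShObj (Db A) = shift_complex A" "Tri (Db A) = Db_triangles A"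
  by (simp_all add: Db_def cat.extend_def)

lemma Hom_Db: "Hom (Db A) X Y = Hom (Db_cat A) X Y"
  by (simp add: Hom_def Db_simps)

text \<open>
  The map factors as
  \<open>X \<rightarrow> E \<rightarrow> G \<rightarrow> Y\<close> through the brutal truncations \<open>E\<close> of \<open>X\<close> at \<open>0\<close> and \<open>G\<close> of
  \<open>E\<close> at \<open>-2\<close>.  By exactness of \<open>X\<close> in negative degrees both are resolutions of single objects,
  placed in degrees \<open>0\<close> and \<open>-2\<close>, so the middle map is a class in \<open>Ext\<^sup>2\<close>.
\<close>

lemma vanishing_stalk_degrees:
  assumes her: "hereditary A" and f: "chain_map A X Y f" and X: "bounded_complex A X" and Y: "bounded_complex A Y"
    and ex: "\<And>i. i \<le> -1 \<Longrightarrow> exact_at X i" and z: "\<And>i. i > -2 \<Longrightarrow> zero_obj A (cobj Y i)"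
  shows "null_map X Y f"
proof -
  \<comment> \<open>E is a resolution of an object in degree 0, and G of one in degree -2.\<close>
  define E where "E = brutal 0 X"
  define G where "G = brutal (-2) E"
  have E: "bounded_complex A E" and G: "bounded_complex A G"
    using brutal_bounded X by (simp_all add: E_def G_def)
  obtain f1 where f1: "chain_map A E Y f1" "f = (\<lambda>i. f1 i oo brutal_map 0 X i)"
    by (rule brutal_factor[OF f X Y, of 0]) (use z in \<open>auto simp: E_def\<close>)
  obtain f2 where f2: "chain_map A G Y f2" "f1 = (\<lambda>i. f2 i oo brutal_map (-2) E i)"
    by (rule brutal_factor[OF f1(1) E Y, of "-2"]) (use z in \<open>auto simp: G_def\<close>)
  define q where "q = brutal_map (-2) E"
  have q: "chain_map A E G q" unfolding q_def G_def by (rule brutal_chain_map[OF E])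
  obtain c where c: "is_cokernel A (cdiff E (0 - 1)) c" using ex_cokernel complexD[OF E] by blast
  obtain c' where c': "is_cokernel A (cdiff G (-2 - 1)) c'" using ex_cokernel complexD[OF G] by blast
  define S where "S = stalk_complex A (Cod A c)"
  define T where "T = reindex 2 (stalk_complex A (Cod A c'))"
  have O: "Cod A c \<in> Obj A" "Cod A c' \<in> Obj A" using cokernelD[OF c] cokernelD[OF c'] Cod_Obj by auto
  have S: "bounded_complex A S" and T: "bounded_complex A T"
    using stalk_bounded O reindex_bounded by (simp_all add: S_def T_def)
  obtain \<pi> where \<pi>: "chain_map A E S \<pi>" "coh_inj E S \<pi>" "coh_surj E S \<pi>"
    by (rule to_stalk[OF E S, of 0 c])
      (use c brutal_simps(3)[of 0 _ X] stalk_obj brutal_exact[OF X, of _ 0] ex in \<open>auto simp: S_def E_def\<close>)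
  obtain \<pi>' where \<pi>': "chain_map A G T \<pi>'" "coh_inj G T \<pi>'" "coh_surj G T \<pi>'"
    by (rule to_stalk[OF G T, of "-2" c'])
      (use c' brutal_simps(3)[of "-2" _ E] stalk_obj brutal_exact[OF E, of _ "-2"] brutal_exact[OF X, of _ 0] ex
        in \<open>auto simp: T_def G_def E_def reindex_simps\<close>)
  have cq: "chain_map A E T (\<lambda>i. \<pi>' i oo q i)" by (rule chain_map_comp[OF q \<pi>'(1) E G T])
  have "hc E S \<pi> \<in> qis A" using qis_iff[OF \<pi>(1) E S] \<pi>(2,3) by blast
  then have r: "(hc E S \<pi>, hc E T (\<lambda>i. \<pi>' i oo q i)) \<in> roofs (Kb A) (qis A) S T"
    using hc_Arr[OF \<pi>(1) E S] hc_Arr[OF cq E T] by (simp add: Q.in_roofs)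
  have "Hom (Db_cat A) S T = {Zero (Db_cat A) S T}"
    using her O unfolding hereditary_def Ext_def Hom_Db Db_simps S_def T_def
    by (simp add: stalk_shift_twice)
  then have "Q.cls S T (hc E S \<pi>, hc E T (\<lambda>i. \<pi>' i oo q i)) = Zero (Db_cat A) S T"
    using Q.cls_Hom[OF r] by blast
  then have "null_map E T (\<lambda>i. \<pi>' i oo q i)"
    unfolding null_map_iff[OF cq E T] Q.cls_zero_iff[OF r] hc_Arr(3)[OF cq E T] by blast
  then have "null_map E G q" by (rule null_map_cancel[OF _ q \<pi>' E G T])
  then have "null_map E Y f1" unfolding f2(2) q_def[symmetric] by (rule null_map_comp[OF _ q f2(1) E G Y])
  then show ?thesis unfolding f1(2)
    by (rule null_map_precomp[OF _ f1(1) brutal_chain_map[OF X, of 0, folded E_def] X E Y])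
qed

theorem vanishing:
  assumes her: "hereditary A" and f: "chain_map A X Y f" and X: "bounded_complex A X" and Y: "bounded_complex A Y"
    and ex: "\<And>i. i \<le> b + 1 \<Longrightarrow> exact_at X i" and z: "\<And>i. i > b \<Longrightarrow> zero_obj A (cobj Y i)"
  shows "null_map X Y f"
proof (rule null_map_reindex)
  show "null_map (reindex (b + 2) X) (reindex (b + 2) Y) (\<lambda>i. f (i + (b + 2)))"
    by (rule vanishing_stalk_degrees[OF her reindex_chain_map[OF f] reindex_bounded[OF X] reindex_bounded[OF Y]])
      (simp_all add: reindex_exact reindex_simps ex z)
qed

end

section \<open>Indecomposable objects over a hereditary category\<close>

lemma (in preadditive_category) biproduct_iso:
  assumes b: "is_biproduct C X Y P i1 i2 p1 p2" and m: "m \<in> Hom C P Q" "n \<in> Hom C Q P"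
    and e: "Comp C n m = Id C P" "Comp C m n = Id C Q"
  shows "is_biproduct C X Y Q (Comp C m i1) (Comp C m i2) (Comp C p1 n) (Comp C p2 n)"
proof -
  note M = HomD[OF m(1)] HomD[OF m(2)]
  have B: "i1 \<in> Arr C" "Dom C i1 = X" "Cod C i1 = P" "i2 \<in> Arr C" "Dom C i2 = Y" "Cod C i2 = P"
    "p1 \<in> Arr C" "Dom C p1 = P" "Cod C p1 = X" "p2 \<in> Arr C" "Dom C p2 = P" "Cod C p2 = Y"
    and E: "Comp C p1 i1 = Id C X" "Comp C p2 i2 = Id C Y" "Comp C p1 i2 = Zero C Y X"
      "Comp C p2 i1 = Zero C X Y" "Plus C (Comp C i1 p1) (Comp C i2 p2) = Id C P"
    using b unfolding is_biproduct_def Hom_def by auto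
  have c: "Comp C (Comp C f n) (Comp C m g) = Comp C f g"
    if "f \<in> Arr C" "Dom C f = P" "g \<in> Arr C" "Cod C g = P" for f g
  proof -
    have "Comp C (Comp C f n) (Comp C m g) = Comp C f (Comp C (Comp C n m) g)"
      using that M by (simp add: comp_assoc comp_arr)
    then show ?thesis using that by (simp add: e(1) id_comp)
  qed
  have d: "Comp C (Comp C m f) (Comp C g n) = Comp C m (Comp C (Comp C f g) n)"
    if "f \<in> Arr C" "Cod C f = P" "g \<in> Arr C" "Dom C g = P" "Cod C g = Dom C f" for f g
    using that M by (simp add: comp_assoc comp_arr)
  have "Plus C (Comp C (Comp C m i1) (Comp C p1 n)) (Comp C (Comp C m i2) (Comp C p2 n)) =
      Comp C m (Comp C (Plus C (Comp C i1 p1) (Comp C i2 p2)) n)"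
    using M B by (simp add: d plus_comp comp_plus comp_arr)
  also have "\<dots> = Id C Q" unfolding E(5) using M e(2) by (simp add: id_comp)
  finally have 5: "Plus C (Comp C (Comp C m i1) (Comp C p1 n)) (Comp C (Comp C m i2) (Comp C p2 n)) = Id C Q" .
  show ?thesis unfolding is_biproduct_def
    using M B by (simp add: c E 5) (simp add: Hom_def comp_arr)
qed

context fractions
begin

text \<open>The localisation functor on morphisms.\<close>

definition loc :: "'m \<Rightarrow> 'o \<times> 'o \<times> ('m \<times> 'm) set" where
  "loc f = cls (Dom C f) (Cod C f) (Id C (Dom C f), f)"

lemma loc_roof: "f \<in> Arr C \<Longrightarrow> (Id C (Dom C f), f) \<in> roofs C S (Dom C f) (Cod C f)"
  by (simp add: in_roofs S_Id Dom_Obj id_arr)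

lemma loc_Hom: "f \<in> Hom C X Y \<Longrightarrow> loc f \<in> Hom L X Y"
  using cls_Hom[OF loc_roof[of f]] by (simp add: Hom_def loc_def)

lemma loc_comp:
  assumes "f \<in> Arr C" "g \<in> Arr C" "Dom C g = Cod C f"
  shows "loc (Comp C g f) = Comp L (loc g) (loc f)"
proof -
  have sq: "square f (Id C (Cod C f)) (Id C (Dom C f)) f"
    using assms by (simp add: square_def S_Id Dom_Obj Cod_Obj id_arr id_comp comp_id)
  show ?thesis
    unfolding loc_def using Comp_cls[OF sq loc_roof[OF assms(1)], of g "Cod C g"] loc_roof[OF assms(2)] assms
    by (simp add: comp_arr comp_id id_arr Dom_Obj)
qed

lemma loc_plus:
  assumes "f \<in> Arr C" "g \<in> Arr C" "Dom C g = Dom C f" "Cod C g = Cod C f"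
  shows "loc (Plus C f g) = Plus L (loc f) (loc g)"
  unfolding loc_def using Plus_cls[OF loc_roof[OF assms(1)], of g] loc_roof[OF assms(2)] assms
  by (simp add: plus_arr)

lemma loc_Id: "X \<in> Obj C \<Longrightarrow> loc (Id C X) = Id L X"
  by (simp add: loc_def Id_cls id_arr)

lemma loc_Zero: "X \<in> Obj C \<Longrightarrow> Y \<in> Obj C \<Longrightarrow> loc (Zero C X Y) = Zero L X Y"
  by (simp add: loc_def Zero_cls zero_arr)

lemma loc_inverse:
  assumes s: "s \<in> S"
  obtains n where "n \<in> Hom L (Cod C s) (Dom C s)" "Comp L n (loc s) = Id L (Dom C s)" "Comp L (loc s) n = Id L (Cod C s)"
proof -
  have a: "s \<in> Arr C" "Dom C s \<in> Obj C" "Cod C s \<in> Obj C" using s S_Arr Dom_Obj Cod_Obj by auto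
  have r: "(s, Id C (Dom C s)) \<in> roofs C S (Cod C s) (Dom C s)" using s a by (simp add: in_roofs id_arr)
  have r1: "(Id C (Cod C s), Id C (Cod C s)) \<in> roofs C S (Cod C s) (Cod C s)" using s a by (simp add: in_roofs id_arr S_Id)
  have sq1: "square s s (Id C (Dom C s)) (Id C (Dom C s))" using s a by (simp add: square_def S_Id id_arr comp_id)
  have sq2: "square (Id C (Dom C s)) (Id C (Dom C s)) (Id C (Dom C s)) (Id C (Dom C s))"
    using s a by (simp add: square_def S_Id id_arr comp_id)
  have "Comp L (cls (Cod C s) (Dom C s) (s, Id C (Dom C s))) (loc s) = Id L (Dom C s)"
    unfolding loc_def Comp_cls[OF sq1 loc_roof[OF a(1)] r] Id_cls using a by (simp add: comp_id id_arr)
  moreover have "(s, s) \<in> roofs C S (Cod C s) (Cod C s)" "roof_eq C S (Id C (Cod C s), Id C (Cod C s)) (s, s)"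
    using refine_roof[OF r1 s] a by (simp_all add: id_comp id_arr)
  then have "cls (Cod C s) (Cod C s) (s, s) = Id L (Cod C s)"
    unfolding Id_cls using cls_eq_iff[OF r1] by metis
  then have "Comp L (loc s) (cls (Cod C s) (Dom C s) (s, Id C (Dom C s))) = Id L (Cod C s)"
    unfolding loc_def Comp_cls[OF sq2 r loc_roof[OF a(1)]] using a by (simp add: comp_id)
  ultimately show ?thesis using that cls_Hom[OF r] by blast
qed

lemma loc_biproduct:
  assumes b: "is_biproduct C X Y P i1 i2 p1 p2"
  shows "is_biproduct L X Y P (loc i1) (loc i2) (loc p1) (loc p2)"
proof -
  have B: "i1 \<in> Arr C" "Dom C i1 = X" "Cod C i1 = P" "i2 \<in> Arr C" "Dom C i2 = Y" "Cod C i2 = P"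
    "p1 \<in> Arr C" "Dom C p1 = P" "Cod C p1 = X" "p2 \<in> Arr C" "Dom C p2 = P" "Cod C p2 = Y"
    and E: "Comp C p1 i1 = Id C X" "Comp C p2 i2 = Id C Y" "Comp C p1 i2 = Zero C Y X"
      "Comp C p2 i1 = Zero C X Y" "Plus C (Comp C i1 p1) (Comp C i2 p2) = Id C P"
    and H: "loc i1 \<in> Hom L X P" "loc i2 \<in> Hom L Y P" "loc p1 \<in> Hom L P X" "loc p2 \<in> Hom L P Y"
    using b loc_Hom unfolding is_biproduct_def Hom_def by auto
  have O: "X \<in> Obj C" "Y \<in> Obj C" "P \<in> Obj C" using B Dom_Obj by metis+
  have "Comp L (loc p1) (loc i1) = Id L X" "Comp L (loc p2) (loc i2) = Id L Y"
    "Comp L (loc p1) (loc i2) = Zero L Y X" "Comp L (loc p2) (loc i1) = Zero L X Y"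
    using B O by (simp_all add: loc_comp[symmetric] E loc_Id loc_Zero)
  moreover have "Plus L (Comp L (loc i1) (loc p1)) (Comp L (loc i2) (loc p2)) = Id L P"
    using B O by (simp add: loc_comp[symmetric] loc_plus[symmetric] comp_arr E loc_Id)
  ultimately show ?thesis unfolding is_biproduct_def using H by blast
qed

end

context ab_cat
begin

text \<open>
  The soft truncation: \<open>X\<close> below degree \<open>a\<close>, the cocycles in degree \<open>a\<close>, and zero above.
\<close>

lemma truncation_ex:
  assumes X: "bounded_complex A X"
  obtains T \<iota> where "bounded_complex A T" "chain_map A T X \<iota>" "\<And>i. i > a \<Longrightarrow> zero_obj A (cobj T i)" "coh_inj T X \<iota>"
    "\<And>i x. i \<le> a \<Longrightarrow> cocycle X i x \<Longrightarrow> \<exists>y. cocycle T i y \<and> Dom A y = Dom A x \<and> \<iota> i oo y = x"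
proof -
  obtain k where k: "is_kernel A (cdiff X a) k" using ex_kernel complexD[OF X] by blast
  note XX = complexD[OF X] and K = kernelD[OF k]
  have K': "k \<in> Arr A" "Cod A k = cobj X a" "cdiff X a oo k = Zero A (Dom A k) (cobj X (a + 1))" "Dom A k \<in> Obj A"
    using K XX Dom_Obj by auto
  obtain l where l: "l \<in> Hom A (cobj X (a - 1)) (Dom A k)" "k oo l = cdiff X (a - 1)"
    by (rule kernel_lift[OF k, of "cdiff X (a - 1)" "cobj X (a - 1)"]) (simp_all add: Hom_def XX diff_diff[OF X])
  note L = HomD[OF l(1)]
  obtain Z where Z: "zero_obj A Z" using ex_zero by blast
  have ZO: "Z \<in> Obj A" using zero_objD(1)[OF Z] .
  obtain N where N: "\<And>i. \<bar>i\<bar> > N \<Longrightarrow> zero_obj A (cobj X i)" using bounded_complexE[OF X] by metis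
  define ob where "ob i = (if i < a then cobj X i else if i = a then Dom A k else Z)" for i
  define df where "df i = (if i < a - 1 then cdiff X i else if i = a - 1 then l else Zero A (ob i) (ob (i + 1)))" for i
  define T where "T = \<lparr>cobj = ob, cdiff = df\<rparr>"
  define \<iota> where "\<iota> i = (if i < a then Id A (cobj X i) else if i = a then k else Zero A (ob i) (cobj X i))" for i
  have T: "cobj T i = ob i" "cdiff T i = df i" for i by (simp_all add: T_def)
  have ob: "i < a \<Longrightarrow> ob i = cobj X i" "ob a = Dom A k" "i > a \<Longrightarrow> ob i = Z" for i by (auto simp: ob_def)
  have obO: "ob i \<in> Obj A" for i by (auto simp: ob_def XX K' ZO)
  have df: "df i \<in> Arr A" "Dom A (df i) = ob i" "Cod A (df i) = ob (i + 1)" for i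
    by (auto simp: df_def zero_arr obO ob XX L ZO)
  have io: "\<iota> i \<in> Arr A" "Dom A (\<iota> i) = ob i" "Cod A (\<iota> i) = cobj X i" for i
    by (auto simp: \<iota>_def zero_arr obO ob XX K' id_arr ZO)
  have km: "x = y" if "k oo x = k oo y" "x \<in> Arr A" "y \<in> Arr A" "Dom A y = Dom A x" "Cod A x = Dom A k" "Cod A y = Dom A k" for x y
    by (rule kernel_mono[OF k, of x "Dom A x" y]) (use that in \<open>simp_all add: Hom_def\<close>)
  have kl: "k oo l oo x = cdiff X (a - 1) oo x" if "x \<in> Arr A" "Cod A x = cobj X (a - 1)" for x
    using assoc_eq[OF l(2), of x] that L K' by simp
  have bT: "bounded_complex A T"
  proof (rule bounded_complexI[of _ "max N \<bar>a\<bar>"], unfold T)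
    fix i
    show "ob i \<in> Obj A" "df i \<in> Arr A" "Dom A (df i) = ob i" "Cod A (df i) = ob (i + 1)" by (fact obO df)+
    consider "i + 1 < a - 1" | "i + 1 = a - 1" | "i + 1 > a - 1" by linarith
    then show "df (i + 1) oo df i = Zero A (ob i) (ob (i + 1 + 1))"
    proof cases
      case 1 then show ?thesis by (simp add: df_def ob diff_diff[OF X])
    next
      case 2
      then have i: "i = a - 1 - 1" by simp
      have "l oo cdiff X i = Zero A (cobj X i) (Dom A k)"
        by (rule km) (use i kl[of "cdiff X i"] L XX K' in \<open>simp_all add: comp_arr zero_arr comp_zero diff_diff[OF X]\<close>)
      then show ?thesis using i ob by (simp add: df_def)
    next
      case 3
      then have "df (i + 1) = Zero A (ob (i + 1)) (ob (i + 1 + 1))" by (simp add: df_def)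
      then show ?thesis using df obO by (simp add: zero_comp)
    qed
    assume i: "\<bar>i\<bar> > max N \<bar>a\<bar>"
    then show "zero_obj A (ob i)" using N[of i] Z by (auto simp: ob_def)
  qed
  have c\<iota>: "chain_map A T X \<iota>"
  proof (rule chain_mapI, unfold T)
    fix i
    show "\<iota> i \<in> Arr A" "Dom A (\<iota> i) = ob i" "Cod A (\<iota> i) = cobj X i" by (fact io)+
    consider "i < a - 1" | "i = a - 1" | "i = a" | "i > a" by linarith
    then show "\<iota> (i + 1) oo df i = cdiff X i oo \<iota> i"
    proof cases
      case 1 then show ?thesis using XX by (simp add: \<iota>_def df_def comp_id id_comp)
    next
      case 2 then show ?thesis using XX by (simp add: \<iota>_def df_def comp_id l(2))
    next
      case 3
      have "df i = Zero A (ob i) (ob (i + 1))" using 3 by (simp add: df_def)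
      then show ?thesis using 3 io[of "i + 1"] obO K' ob by (simp add: comp_zero \<iota>_def)
    next
      case 4
      have "df i = Zero A (ob i) (ob (i + 1))" "\<iota> i = Zero A (ob i) (cobj X i)" using 4 by (simp_all add: df_def \<iota>_def)
      then show ?thesis using io[of "i + 1"] obO XX by (simp add: comp_zero)
    qed
  qed
  have inj: "coh_inj T X \<iota>"
    unfolding coh_inj_def coh_inj_at_def
  proof (intro allI impI, elim conjE)
    fix i z assume z: "cocycle T i z" "loc_bd X i (\<iota> i oo z)"
    have Zz: "z \<in> Arr A" "Cod A z = ob i" using z by (auto simp: cocycle_def T)
    obtain e x where e: "epi_arr A e" "e \<in> Arr A" "Cod A e = Dom A (\<iota> i oo z)" "x \<in> Arr A" "Dom A x = Dom A e"
        "Cod A x = cobj X (i - 1)" "(\<iota> i oo z) oo e = cdiff X (i - 1) oo x" using loc_bdE[OF z(2)] .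
    have ec: "Cod A e = Dom A z" using e(3) Zz io by (simp add: comp_arr)
    consider "i < a" | "i = a" | "i > a" by linarith
    then show "loc_bd T i z"
    proof cases
      case 1
      then have "z oo e = cdiff T (i - 1) oo x" using e(7) Zz ob by (simp add: \<iota>_def id_comp T df_def)
      then show ?thesis by (intro loc_bdI[of e _ x]) (use e ec 1 ob in \<open>simp_all add: T\<close>)
    next
      case 2
      have "z oo e = l oo x"
        by (rule km) (use e(2,4-7) ec 2 Zz ob kl[of x] L K' in \<open>simp_all add: \<iota>_def comp_arr comp_assoc\<close>)
      then show ?thesis by (intro loc_bdI[of e _ x]) (use e ec 2 ob in \<open>simp_all add: T df_def\<close>)
    next
      case 3
      then show ?thesis using loc_bd_into_zero[OF bT _ Zz(1)] Zz Z ob by (simp add: T)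
    qed
  qed
  have lift: "\<exists>y. cocycle T i y \<and> Dom A y = Dom A x \<and> \<iota> i oo y = x" if i: "i \<le> a" and x: "cocycle X i x" for i x
  proof -
    have Xx: "x \<in> Arr A" "Cod A x = cobj X i" "cdiff X i oo x = Zero A (Dom A x) (cobj X (i + 1))" "Dom A x \<in> Obj A"
      using x Dom_Obj by (auto simp: cocycle_def)
    consider "i < a - 1" | "i = a - 1" | "i = a" using i by linarith
    then show ?thesis
    proof cases
      case 1
      then show ?thesis using Xx ob by (intro exI[of _ x]) (simp add: cocycle_def T df_def \<iota>_def id_comp)
    next
      case 2
      have "l oo x = Zero A (Dom A x) (Dom A k)"
        by (rule km) (use Xx 2 kl[of x] L K' in \<open>simp_all add: comp_arr zero_arr comp_zero\<close>)
      then show ?thesis using Xx ob 2 by (intro exI[of _ x]) (simp add: cocycle_def T df_def \<iota>_def id_comp)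
    next
      case 3
      obtain y where y: "y \<in> Hom A (Dom A x) (Dom A k)" "k oo y = x"
        by (rule kernel_lift[OF k, of x "Dom A x"]) (use Xx 3 XX in \<open>auto simp: Hom_def\<close>)
      have "df i = Zero A (Dom A k) (ob (i + 1))" using 3 ob by (simp add: df_def)
      then show ?thesis using HomD[OF y(1)] y(2) 3 obO ob ZO
        by (intro exI[of _ y]) (simp add: cocycle_def T \<iota>_def zero_comp)
    qed
  qed
  show ?thesis by (rule that[OF bT c\<iota> _ inj lift]) (use ob Z in \<open>simp_all add: T\<close>)
qed

lemma Kb_biproduct:
  assumes X: "bounded_complex A X" and Y: "bounded_complex A Y"
  obtains D p q j k where "is_twist X Y (\<lambda>i. Zero A (cobj X i) (cobj Y (i + 1))) D p q j k"
    "chain_map A D X p" "chain_map A D Y q" "chain_map A X D j" "chain_map A Y D k"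
    "is_biproduct (Kb A) X Y D (hc X D j) (hc Y D k) (hc D X p) (hc D Y q)"
proof -
  note XY = complexD[OF X] complexD[OF Y]
  obtain D p q j k where D: "is_twist X Y (\<lambda>i. Zero A (cobj X i) (cobj Y (i + 1))) D p q j k"
    by (rule twist_ex[OF X Y, of "\<lambda>i. Zero A (cobj X i) (cobj Y (i + 1))"])
      (simp_all add: XY zero_arr zero_comp comp_zero neg_zero)
  note DD = twistD[OF D] and DX = complexD[OF twistD(1)[OF D]]
  have cp: "chain_map A D X p" by (rule chain_mapI) (simp_all add: DD)
  have cq: "chain_map A D Y q"
    by (rule chain_mapI) (simp_all add: DD(2-7,20) zero_comp XY zero_plus comp_arr DX(1))
  have ids: "p i oo j i oo x = x" "q i oo j i oo x = Zero A (Dom A x) (cobj Y i)" if "x \<in> Arr A" "Cod A x = cobj X i" for x i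
    using that assoc_eq[OF DD(14)[of i], of x] assoc_eq[OF DD(17)[of i], of x] DD(2-13) XY by (simp_all add: id_comp zero_comp)
  have ids': "q i oo k i oo x = x" "p i oo k i oo x = Zero A (Dom A x) (cobj X i)" if "x \<in> Arr A" "Cod A x = cobj Y i" for x i
    using that assoc_eq[OF DD(15)[of i], of x] assoc_eq[OF DD(16)[of i], of x] DD(2-13) XY by (simp_all add: id_comp zero_comp)
  have cj: "chain_map A X D j"
  proof (rule chain_mapI)
    fix i show "j (i + 1) oo cdiff X i = cdiff D i oo j i"
    proof (rule twist_joint[OF D])
      show "p (i + 1) oo j (i + 1) oo cdiff X i = p (i + 1) oo cdiff D i oo j i"
        using chain_map_left[OF cp DD(1) X refl, of "j i" i] ids(1) DD(8-14) XY by (simp add: comp_id)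
      show "q (i + 1) oo j (i + 1) oo cdiff X i = q (i + 1) oo cdiff D i oo j i"
        using chain_map_left[OF cq DD(1) Y refl, of "j i" i] ids(2) DD(8-13,17) XY by (simp add: comp_zero)
    qed (use DD(8-13) XY DX in \<open>simp_all add: comp_arr\<close>)
  qed (simp_all add: DD)
  have ck: "chain_map A Y D k"
  proof (rule chain_mapI)
    fix i show "k (i + 1) oo cdiff Y i = cdiff D i oo k i"
    proof (rule twist_joint[OF D])
      show "p (i + 1) oo k (i + 1) oo cdiff Y i = p (i + 1) oo cdiff D i oo k i"
        using chain_map_left[OF cp DD(1) X refl, of "k i" i] ids'(2) DD(8-13,16) XY by (simp add: comp_zero)
      show "q (i + 1) oo k (i + 1) oo cdiff Y i = q (i + 1) oo cdiff D i oo k i"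
        using chain_map_left[OF cq DD(1) Y refl, of "k i" i] ids'(1) DD(8-13,15) XY by (simp add: comp_id)
    qed (use DD(8-13) XY DX in \<open>simp_all add: comp_arr\<close>)
  qed (simp_all add: DD)
  have "is_biproduct (Kb A) X Y D (hc X D j) (hc Y D k) (hc D X p) (hc D Y q)"
    unfolding is_biproduct_def
      Comp_Kb[OF cj cp X DD(1) X] Comp_Kb[OF ck cq Y DD(1) Y] Comp_Kb[OF ck cp Y DD(1) X] Comp_Kb[OF cj cq X DD(1) Y]
      Comp_Kb[OF cp cj DD(1) X DD(1)] Comp_Kb[OF cq ck DD(1) Y DD(1)]
      Plus_Kb[OF chain_map_comp[OF cp cj DD(1) X DD(1)] chain_map_comp[OF cq ck DD(1) Y DD(1)] DD(1) DD(1)]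
    using hc_Arr(1)[OF cj X DD(1)] hc_Arr(1)[OF ck Y DD(1)] hc_Arr(1)[OF cp DD(1) X] hc_Arr(1)[OF cq DD(1) Y]
    by (simp add: DD(14-18) Id_Kb Zero_Kb)
  then show ?thesis using that[OF D cp cq cj ck] by blast
qed

lemma sum_loc_bd:
  assumes D: "is_twist X Y g D p q j k" and "chain_map A X D j" "chain_map A Y D k"
    and b: "bounded_complex A X" "bounded_complex A Y"
    and z: "z \<in> Arr A" "Cod A z = cobj D i" "loc_bd X i (p i oo z)" "loc_bd Y i (q i oo z)"
  shows "loc_bd D i z"
proof -
  note DD = twistD[OF D]
  have "z = (j i oo p i \<boxplus> k i oo q i) oo z" unfolding DD(18) using z by (simp add: id_comp)
  also have "\<dots> = j i oo p i oo z \<boxplus> k i oo q i oo z" using z(1,2) DD(2-13) by (simp add: plus_comp comp_assoc comp_arr)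
  finally have e: "z = j i oo p i oo z \<boxplus> k i oo q i oo z" .
  have "loc_bd D i (j i oo p i oo z \<boxplus> k i oo q i oo z)"
    by (rule loc_bd_plus[OF loc_bd_map[OF z(3) _ _ assms(2) b(1) DD(1)] loc_bd_map[OF z(4) _ _ assms(3) b(2) DD(1)] _ _ _ _ _ DD(1)])
      (use z(1,2) DD(2-13) in \<open>simp_all add: comp_arr\<close>)
  then show ?thesis using e by simp
qed

lemma shift_simps: "cobj (shift_complex A X) i = cobj X (i + 1)" "cdiff (shift_complex A X) i = \<boxminus> cdiff X (i + 1)"
  by (simp_all add: shift_complex_def)

lemma shift_bounded: assumes "bounded_complex A X" shows "bounded_complex A (shift_complex A X)"
proof -
  obtain N where N: "\<And>i. \<bar>i\<bar> > N \<Longrightarrow> zero_obj A (cobj X i)" using bounded_complexE[OF assms] by metis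
  show ?thesis
    by (rule bounded_complexI[of _ "N + 1"])
      (auto simp: shift_simps complexD[OF assms] diff_diff[OF assms] neg_arr comp_neg neg_neg neg_zero
        zero_arr comp_arr intro!: N)
qed

lemma shift_cocycle: assumes "bounded_complex A X"
  shows "cocycle (shift_complex A X) i z \<longleftrightarrow> cocycle X (i + 1) z"
proof -
  have "\<boxminus> (cdiff X (i + 1) oo z) = Zero A (Dom A z) (cobj X (i + 1 + 1)) \<longleftrightarrow>
      cdiff X (i + 1) oo z = Zero A (Dom A z) (cobj X (i + 1 + 1))" if z: "z \<in> Arr A" "Cod A z = cobj X (i + 1)"
  proof
    assume "\<boxminus> (cdiff X (i + 1) oo z) = Zero A (Dom A z) (cobj X (i + 1 + 1))"
    then have "\<boxminus> (\<boxminus> (cdiff X (i + 1) oo z)) = Zero A (Dom A z) (cobj X (i + 1 + 1))"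
      using Dom_Obj[OF z(1)] complexD[OF assms] by (simp add: neg_zero)
    then show "cdiff X (i + 1) oo z = Zero A (Dom A z) (cobj X (i + 1 + 1))"
      using z complexD[OF assms] by (simp add: neg_neg comp_arr)
  qed (use Dom_Obj[OF z(1)] complexD[OF assms] in \<open>simp add: neg_zero\<close>)
  then show ?thesis using complexD[OF assms] by (auto simp: cocycle_def shift_simps comp_neg)
qed

lemma shift_loc_bd: assumes X: "bounded_complex A X"
  shows "loc_bd (shift_complex A X) i z \<longleftrightarrow> loc_bd X (i + 1) z"
proof
  assume "loc_bd (shift_complex A X) i z"
  then obtain e x where h: "epi_arr A e" "e \<in> Arr A" "Cod A e = Dom A z" "x \<in> Arr A" "Dom A x = Dom A e"
    "Cod A x = cobj (shift_complex A X) (i - 1)" "z oo e = cdiff (shift_complex A X) (i - 1) oo x" by (rule loc_bdE)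
  show "loc_bd X (i + 1) z"
    by (rule loc_bdI[of e _ "\<boxminus> x"]) (use h complexD[OF X] in \<open>simp_all add: shift_simps neg_arr comp_neg\<close>)
next
  assume "loc_bd X (i + 1) z"
  then obtain e x where h: "epi_arr A e" "e \<in> Arr A" "Cod A e = Dom A z" "x \<in> Arr A" "Dom A x = Dom A e"
    "Cod A x = cobj X (i + 1 - 1)" "z oo e = cdiff X (i + 1 - 1) oo x" by (rule loc_bdE)
  show "loc_bd (shift_complex A X) i z"
    by (rule loc_bdI[of e _ "\<boxminus> x"]) (use h complexD[OF X] in \<open>simp_all add: shift_simps neg_arr comp_neg neg_neg comp_arr\<close>)
qed

lemma shift_exact: "bounded_complex A X \<Longrightarrow> exact_at (shift_complex A X) i \<longleftrightarrow> exact_at X (i + 1)"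
  by (simp add: exact_at_def shift_cocycle shift_loc_bd)

text \<open>
  Let \<open>F\<close> be the homotopy fibre of the truncation \<open>\<iota>\<close> from \<open>T\<close> to \<open>X\<close>.  It is exact in degrees
  \<open>\<le> a + 1\<close> whereas \<open>T\<close> vanishes above \<open>a\<close>, so \<open>P\<close> from \<open>F\<close> to \<open>T\<close> is zero in the derived
  category: there are a quasi-isomorphism \<open>u\<close> from \<open>W\<close> to \<open>F\<close> and a null-homotopy \<open>h\<close> of
  \<open>P u\<close>.  Both \<open>Q u\<close> and \<open>\<iota> h\<close> are null-homotopies of \<open>\<iota> P u\<close>, so their difference is a
  chain map \<open>\<omega>\<close> from the shift \<open>V\<close> of \<open>W\<close> to \<open>X\<close>.  Together with \<open>\<iota>\<close> it is a
  quasi-isomorphism from the direct sum of \<open>V\<close> and \<open>T\<close> to \<open>X\<close>.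
\<close>

theorem truncation_splits:
  assumes her: "hereditary A" and X: "bounded_complex A X"
  obtains V T D p q j k \<mu> where "bounded_complex A V" "bounded_complex A T" "\<And>i. i > a \<Longrightarrow> zero_obj A (cobj T i)"
    "\<And>i. i \<le> a \<Longrightarrow> (\<And>i. exact_at T i) \<Longrightarrow> exact_at X i"
    "is_twist V T (\<lambda>i. Zero A (cobj V i) (cobj T (i + 1))) D p q j k"
    "chain_map A D V p" "chain_map A D T q" "chain_map A V D j" "chain_map A T D k"
    "is_biproduct (Kb A) V T D (hc V D j) (hc T D k) (hc D V p) (hc D T q)"
    "chain_map A D X \<mu>" "coh_inj D X \<mu>" "coh_surj D X \<mu>"
proof -
  obtain T \<iota> where T: "bounded_complex A T" "chain_map A T X \<iota>" "\<And>i. i > a \<Longrightarrow> zero_obj A (cobj T i)" "coh_inj T X \<iota>"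
    "\<And>i x. i \<le> a \<Longrightarrow> cocycle X i x \<Longrightarrow> \<exists>y. cocycle T i y \<and> Dom A y = Dom A x \<and> \<iota> i oo y = x"
    using truncation_ex[OF X, of a] by metis
  obtain F P Q where F: "is_fibre T X \<iota> F P Q" using fibre_ex[OF T(1) X T(2)] .
  note FD = fibreD[OF F] and FM = chain_mapD(1-3)[OF fibreD(2)[OF F]] is_htpyD[OF fibreD(3)[OF F]]
  note I = chain_mapD(1-3)[OF T(2)]
  have surj: "coh_surj_at T X \<iota> i" if i: "i \<le> a" for i
    unfolding coh_surj_at_def
  proof (intro allI impI)
    fix y assume y: "cocycle X i y"
    obtain x where x: "cocycle T i x" "Dom A x = Dom A y" "\<iota> i oo x = y" using T(5)[OF i y] by blast
    have Y: "y \<in> Arr A" "Cod A y = cobj X i" "Dom A y \<in> Obj A" using y Dom_Obj by (auto simp: cocycle_def)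
    have "\<iota> i oo x \<boxplus> \<boxminus> (y oo Id A (Dom A y)) = Zero A (Dom A y) (cobj X i)"
      unfolding x(3) using Y by (simp add: comp_id plus_neg)
    then show "\<exists>e x. epi_arr A e \<and> Cod A e = Dom A y \<and> cocycle T i x \<and> Dom A x = Dom A e \<and>
        loc_bd X i (\<iota> i oo x \<boxplus> \<boxminus> (y oo e))"
      by (intro exI[of _ "Id A (Dom A y)"] exI[of _ x]) (use x(1,2) Y loc_bd_zero[OF X] in \<open>simp add: epi_id id_arr\<close>)
  qed
  have exT: "exact_at X i" if i: "i \<le> a" and ex: "\<And>i. exact_at T i" for i
    unfolding exact_at_def
  proof (intro allI impI)
    fix y assume y: "cocycle X i y"
    obtain x where x: "cocycle T i x" "Dom A x = Dom A y" "\<iota> i oo x = y" using T(5)[OF i y] by blast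
    have "loc_bd X i (\<iota> i oo x)"
      by (rule loc_bd_map[OF _ _ _ T(2,1) X]) (use x(1) ex in \<open>auto simp: exact_at_def cocycle_def\<close>)
    then show "loc_bd X i y" unfolding x(3) .
  qed
  have exF: "exact_at F i" if "i \<le> a + 1" for i
    by (rule fibre_exact[OF F T(1) X T(2)]) (use T(4) surj that in \<open>auto simp: coh_inj_def\<close>)
  have "null_map F T P" by (rule vanishing[OF her FD(2,1) T(1) exF T(3)])
  then obtain W u where W: "bounded_complex A W" "chain_map A W F u" "coh_inj W F u" "coh_surj W F u"
    "homotopic A W T (\<lambda>i. P i oo u i) (zero_map W T)" unfolding null_map_def by blast
  obtain h where h: "is_htpy W T h" and e0: "\<And>i. P i oo u i = zero_map W T i \<boxplus> (cdiff T (i - 1) oo h i \<boxplus> h (i + 1) oo cdiff W i)"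
    using homotopicE[OF W(5)] by metis
  note H = is_htpyD[OF h] and U = chain_mapD(1-3)[OF W(2)]
    and XX = complexD[OF X] complexD[OF T(1)] complexD[OF W(1)] complexD[OF FD(1)]
  have e: "P i oo u i = cdiff T (i - 1) oo h i \<boxplus> h (i + 1) oo cdiff W i" for i
    unfolding e0 zero_map_def by (rule zero_plus) (simp_all add: H XX comp_arr plus_arr)
  \<comment> \<open>The difference of two null-homotopies of the same map.\<close>
  define w where "w i = Q i oo u i \<boxplus> \<boxminus> (\<iota> (i - 1) oo h i)" for i
  have wA: "w i \<in> Arr A" "Dom A (w i) = cobj W i" "Cod A (w i) = cobj X (i - 1)" for i
    unfolding w_def by (simp_all add: plus_arr neg_arr comp_arr FM U I H)
  have wd: "w (i + 1) oo cdiff W i = \<boxminus> (cdiff X (i - 1) oo w i)" for i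
  proof -
    have Id: "\<iota> i oo cdiff T (i - 1) oo h i = cdiff X (i - 1) oo \<iota> (i - 1) oo h i"
      by (rule chain_map_left[OF T(2,1) X]) (simp_all add: H)
    have ud: "u (i + 1) oo cdiff W i = cdiff F i oo u i" using chain_mapD(4)[OF W(2)] by simp
    have "w (i + 1) oo cdiff W i = Q (i + 1) oo (u (i + 1) oo cdiff W i) \<boxplus> \<boxminus> (\<iota> i oo h (i + 1) oo cdiff W i)"
      unfolding w_def by (simp add: plus_comp comp_neg comp_assoc comp_arr neg_arr FM U I H XX)
    also have "\<dots> = \<iota> i oo P i oo u i \<boxplus> \<boxminus> (cdiff X (i - 1) oo Q i oo u i) \<boxplus> \<boxminus> (\<iota> i oo h (i + 1) oo cdiff W i)"
      unfolding ud using fibre_diff(2)[OF F T(1) X T(2), of "u i" i] U by simp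
    also have "\<dots> = \<iota> i oo cdiff T (i - 1) oo h i \<boxplus> \<boxminus> (cdiff X (i - 1) oo Q i oo u i)"
      unfolding e by (rule eq_sgI) (simp add: lin_simps FM U I H XX)
    also have "\<dots> = \<boxminus> (cdiff X (i - 1) oo w i)"
      unfolding Id w_def by (rule eq_sgI) (simp add: lin_simps FM U I H XX)
    finally show ?thesis .
  qed
  define V where "V = shift_complex A W"
  have V: "bounded_complex A V" unfolding V_def by (rule shift_bounded[OF W(1)])
  define \<omega> where "\<omega> i = w (i + 1)" for i
  have Vs: "cobj V i = cobj W (i + 1)" "cdiff V i = \<boxminus> cdiff W (i + 1)" for i by (simp_all add: V_def shift_simps)
  have c\<omega>: "chain_map A V X \<omega>"
  proof (rule chain_mapI)
    fix i
    show "\<omega> (i + 1) oo cdiff V i = cdiff X i oo \<omega> i"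
      unfolding Vs \<omega>_def using wd[of "i + 1"] wA XX by (simp add: comp_neg neg_neg comp_arr)
  qed (simp_all add: \<omega>_def wA Vs)
  obtain D p q j k where D: "is_twist V T (\<lambda>i. Zero A (cobj V i) (cobj T (i + 1))) D p q j k"
    "chain_map A D V p" "chain_map A D T q" "chain_map A V D j" "chain_map A T D k"
    "is_biproduct (Kb A) V T D (hc V D j) (hc T D k) (hc D V p) (hc D T q)"
    using Kb_biproduct[OF V T(1)] .
  note DD = twistD[OF D(1)] and c\<omega>1 = chain_mapD(1-3)[OF c\<omega>]
  define \<mu> where "\<mu> i = \<omega> i oo p i \<boxplus> \<iota> i oo q i" for i
  have c\<mu>: "chain_map A D X \<mu>" unfolding \<mu>_def
    by (rule chain_map_plus[OF chain_map_comp[OF D(2) c\<omega> DD(1) V X] chain_map_comp[OF D(3) T(2) DD(1) T(1) X] DD(1) X])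
  have mz: "\<mu> i oo z = \<omega> i oo p i oo z \<boxplus> \<iota> i oo q i oo z" if "z \<in> Arr A" "Cod A z = cobj D i" for i z
    unfolding \<mu>_def using that DD(2-7) I c\<omega>1 by (simp add: plus_comp comp_assoc comp_arr)
  have wz: "\<omega> i oo x = Q (i + 1) oo u (i + 1) oo x \<boxplus> \<boxminus> (\<iota> i oo h (i + 1) oo x)"
    if "x \<in> Arr A" "Cod A x = cobj W (i + 1)" for i x
    unfolding \<omega>_def w_def using that by (simp add: plus_comp comp_neg comp_assoc comp_arr neg_arr FM U I H)
  have Pu0: "P n oo u n oo x = cdiff T (n - 1) oo h n oo x" if x: "cocycle W n x" for n x
  proof -
    have Xx: "x \<in> Arr A" "Cod A x = cobj W n" "cdiff W n oo x = Zero A (Dom A x) (cobj W (n + 1))" "Dom A x \<in> Obj A"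
      using x Dom_Obj by (auto simp: cocycle_def)
    have "P n oo u n oo x = (P n oo u n) oo x" using Xx(1,2) FM U by (simp add: comp_assoc)
    also have "\<dots> = cdiff T (n - 1) oo h n oo x"
      unfolding e using Xx H XX by (simp add: plus_comp comp_assoc comp_arr comp_zero plus_zero)
    finally show ?thesis .
  qed
  have Pu: "P (i + 1) oo u (i + 1) oo x = cdiff T i oo h (i + 1) oo x" if "cocycle W (i + 1) x" for i x
    using Pu0[OF that] by simp
  have "coh_inj D X \<mu>" unfolding coh_inj_def coh_inj_at_def
  proof (intro allI impI, elim conjE)
    fix i z assume z: "cocycle D i z" "loc_bd X i (\<mu> i oo z)"
    have Z: "z \<in> Arr A" "Cod A z = cobj D i" using z by (auto simp: cocycle_def)
    define \<alpha> where "\<alpha> = p i oo z"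
    define \<beta> where "\<beta> = q i oo z"
    have ca: "cocycle V i \<alpha>" "cocycle T i \<beta>" unfolding \<alpha>_def \<beta>_def
      by (rule cocycle_map[OF z(1) D(2) DD(1) V], rule cocycle_map[OF z(1) D(3) DD(1) T(1)])
    then have ca': "cocycle W (i + 1) \<alpha>" unfolding V_def shift_cocycle[OF W(1)] by simp
    have Aa: "\<alpha> \<in> Arr A" "Dom A \<alpha> = Dom A z" "Cod A \<alpha> = cobj W (i + 1)" "\<beta> \<in> Arr A" "Dom A \<beta> = Dom A z" "Cod A \<beta> = cobj T i"
      unfolding \<alpha>_def \<beta>_def using Z DD(2-7) Vs by (simp_all add: comp_arr)
    have db: "cdiff T i oo \<beta> = Zero A (Dom A z) (cobj T (i + 1))" using ca(2) Aa by (simp add: cocycle_def)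
    have eq: "\<mu> i oo z = \<omega> i oo \<alpha> \<boxplus> \<iota> i oo \<beta>" using mz[OF Z] by (simp add: \<alpha>_def \<beta>_def)
    obtain e1 x where x: "epi_arr A e1" "e1 \<in> Arr A" "Cod A e1 = Dom A (\<mu> i oo z)" "x \<in> Arr A" "Dom A x = Dom A e1"
      "Cod A x = cobj X (i - 1)" "(\<mu> i oo z) oo e1 = cdiff X (i - 1) oo x" using loc_bdE[OF z(2)] .
    have x3: "Cod A e1 = Dom A z" using x(3) Z chain_mapD(1-3)[OF c\<mu>] by (simp add: comp_arr)
    have x7: "\<omega> i oo \<alpha> oo e1 = cdiff X (i - 1) oo x \<boxplus> \<boxminus> (\<iota> i oo \<beta> oo e1)"
      unfolding x(7)[symmetric] eq by (rule eq_sgI) (use x(2) x3 Aa c\<omega>1 I Vs in \<open>simp add: lin_simps\<close>)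
    obtain v where v: "v \<in> Arr A" "Dom A v = Dom A (h (i + 1) oo \<alpha> oo e1 \<boxplus> \<boxminus> (\<beta> oo e1))" "Cod A v = cobj F i"
      "P i oo v = h (i + 1) oo \<alpha> oo e1 \<boxplus> \<boxminus> (\<beta> oo e1)" "Q i oo v = \<boxminus> x"
      by (rule fibre_pair[OF F, of "h (i + 1) oo \<alpha> oo e1 \<boxplus> \<boxminus> (\<beta> oo e1)" "\<boxminus> x" i])
        (use x(2,4-6) x3 Aa H in \<open>simp_all add: comp_arr plus_arr neg_arr\<close>)
    have vd: "Dom A v = Dom A e1" using v(2) x(2) x3 Aa H by (simp add: comp_arr plus_arr neg_arr)
    have "(u (i + 1) oo \<alpha>) oo e1 = cdiff F (i + 1 - 1) oo v"
    proof (rule fibre_diffI[OF F T(1) X T(2)])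
      have "P (i + 1) oo (u (i + 1) oo \<alpha>) oo e1 = (P (i + 1) oo u (i + 1) oo \<alpha>) oo e1"
        using x(2) x3 Aa FM U by (simp add: comp_assoc comp_arr)
      also have "\<dots> = cdiff T i oo h (i + 1) oo \<alpha> oo e1"
        unfolding Pu[OF ca'] using x(2) x3 Aa H XX by (simp add: comp_assoc comp_arr)
      also have "\<dots> = cdiff T i oo (h (i + 1) oo \<alpha> oo e1 \<boxplus> \<boxminus> (\<beta> oo e1))"
        using assoc_eq[OF db, of e1] x(2) x3 Aa H XX Dom_Obj[OF x(2)]
        by (simp add: comp_plus comp_neg comp_arr neg_arr zero_comp neg_zero plus_zero)
      finally show "P (i + 1) oo (u (i + 1) oo \<alpha>) oo e1 = cdiff T (i + 1 - 1) oo P (i + 1 - 1) oo v"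
        using v(4) by simp
      have "Q (i + 1) oo (u (i + 1) oo \<alpha>) oo e1 = \<omega> i oo \<alpha> oo e1 \<boxplus> \<iota> i oo h (i + 1) oo \<alpha> oo e1"
        unfolding \<omega>_def w_def by (rule eq_sgI) (use x(2) x3 Aa FM U I H in \<open>simp add: lin_simps\<close>)
      also have "\<dots> = \<iota> i oo (h (i + 1) oo \<alpha> oo e1 \<boxplus> \<boxminus> (\<beta> oo e1)) \<boxplus> \<boxminus> (cdiff X (i - 1) oo \<boxminus> x)"
        unfolding x7 by (rule eq_sgI) (use x(2,4-6) x3 Aa I H XX in \<open>simp add: lin_simps\<close>)
      finally show "Q (i + 1) oo (u (i + 1) oo \<alpha>) oo e1 = \<iota> (i + 1 - 1) oo P (i + 1 - 1) oo v \<boxplus>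
          \<boxminus> (cdiff X (i + 1 - 1 - 1) oo Q (i + 1 - 1) oo v)"
        using v(4,5) by simp
    qed (use x(2) x3 Aa U v(1,3) vd in \<open>simp_all add: comp_arr\<close>)
    then have "loc_bd F (i + 1) (u (i + 1) oo \<alpha>)"
      by (intro loc_bdI[of e1 _ v]) (use x(1,2) x3 Aa U v(1,3) vd in \<open>simp_all add: comp_arr\<close>)
    then have "loc_bd W (i + 1) \<alpha>" using W(3) ca' unfolding coh_inj_def coh_inj_at_def by blast
    then have la: "loc_bd V i \<alpha>" unfolding V_def shift_loc_bd[OF W(1)] .
    have lw: "loc_bd X i (\<omega> i oo \<alpha>)" by (rule loc_bd_map[OF la _ _ c\<omega> V X]) (use Aa Vs in simp_all)
    have "loc_bd X i (\<mu> i oo z \<boxplus> \<boxminus> (\<omega> i oo \<alpha>))"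
      by (rule loc_bd_plus[OF z(2) loc_bd_neg[OF lw _ X] _ _ _ _ _ X])
        (use Z Aa chain_mapD(1-3)[OF c\<mu>] c\<omega>1 Vs in \<open>simp_all add: comp_arr neg_arr\<close>)
    moreover have "\<mu> i oo z \<boxplus> \<boxminus> (\<omega> i oo \<alpha>) = \<iota> i oo \<beta>"
      unfolding eq by (rule eq_sgI) (use Aa c\<omega>1 I Vs in \<open>simp add: lin_simps\<close>)
    ultimately have "loc_bd T i \<beta>" using T(4) ca(2) unfolding coh_inj_def coh_inj_at_def by simp
    then show "loc_bd D i z"
      using sum_loc_bd[OF D(1,4,5) V T(1) Z] la unfolding \<alpha>_def \<beta>_def by blast
  qed
  moreover have "coh_surj D X \<mu>" unfolding coh_surj_def coh_surj_at_def
  proof (intro allI impI)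
    fix i x assume x: "cocycle X i x"
    have Xx: "x \<in> Arr A" "Cod A x = cobj X i" "cdiff X i oo x = Zero A (Dom A x) (cobj X (i + 1))" "Dom A x \<in> Obj A"
      using x Dom_Obj by (auto simp: cocycle_def)
    obtain y where y: "y \<in> Arr A" "Dom A y = Dom A (Zero A (Dom A x) (cobj T (i + 1)))" "Cod A y = cobj F (i + 1)"
       "P (i + 1) oo y = Zero A (Dom A x) (cobj T (i + 1))" "Q (i + 1) oo y = x"
      by (rule fibre_pair[OF F, of "Zero A (Dom A x) (cobj T (i + 1))" x "i + 1"]) (use Xx XX in \<open>simp_all add: zero_arr\<close>)
    have yd: "Dom A y = Dom A x" using y(2) Xx XX by (simp add: zero_arr)
    have cy: "cocycle F (i + 1) y"
      by (rule fibre_cocycleI[OF F T(1) X T(2) y(1,3)])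
        (use Xx XX I in \<open>simp_all add: y(4,5) cocycle_def zero_arr comp_zero\<close>)
    obtain e1 \<alpha> v where k: "epi_arr A e1" "e1 \<in> Arr A" "Cod A e1 = Dom A y" "cocycle W (i + 1) \<alpha>" "\<alpha> \<in> Arr A"
      "Cod A \<alpha> = cobj W (i + 1)" "Dom A \<alpha> = Dom A e1" "v \<in> Arr A" "Dom A v = Dom A e1"
      "Cod A v = cobj F (i + 1 - 1)" "u (i + 1) oo \<alpha> = y oo e1 \<boxplus> cdiff F (i + 1 - 1) oo v"
      using coh_surjE[OF W(4) cy W(2,1) FD(1)] .
    have k3: "Cod A e1 = Dom A x" using k(3) yd by simp
    have vF: "Cod A v = cobj F i" using k(10) by simp
    have k11: "u (i + 1) oo \<alpha> = y oo e1 \<boxplus> cdiff F i oo v" using k(11) by simp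
    have EO: "Dom A e1 \<in> Obj A" using Dom_Obj[OF k(2)] .
    note fd = fibre_diff(1,2)[OF F T(1) X T(2) k(8) vF]
    have "cdiff T i oo h (i + 1) oo \<alpha> = P (i + 1) oo u (i + 1) oo \<alpha>" by (rule Pu[OF k(4), symmetric])
    also have "\<dots> = (P (i + 1) oo y) oo e1 \<boxplus> P (i + 1) oo cdiff F i oo v"
      unfolding k11 using k(2,8,9) vF k(3) y(1,3) FM XX by (simp add: comp_plus comp_assoc comp_arr)
    also have "\<dots> = cdiff T i oo P i oo v"
      unfolding y(4) fd(1) using k(2,8,9) vF k3 Xx FM XX by (simp add: zero_comp zero_plus comp_arr)
    finally have dv: "cdiff T i oo h (i + 1) oo \<alpha> = cdiff T i oo P i oo v" .
    define \<beta> where "\<beta> = h (i + 1) oo \<alpha> \<boxplus> \<boxminus> (P i oo v)"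
    have B: "\<beta> \<in> Arr A" "Dom A \<beta> = Dom A e1" "Cod A \<beta> = cobj T i"
      unfolding \<beta>_def using k(5-9) vF H FM by (simp_all add: comp_arr plus_arr neg_arr)
    have cb: "cocycle T i \<beta>"
    proof -
      have "cdiff T i oo \<beta> = cdiff T i oo h (i + 1) oo \<alpha> \<boxplus> \<boxminus> (cdiff T i oo P i oo v)"
        unfolding \<beta>_def using k(5-9) vF H FM XX by (simp add: comp_plus comp_neg comp_arr neg_arr)
      also have "\<dots> = Zero A (Dom A e1) (cobj T (i + 1))"
        unfolding dv using k(8,9) vF FM XX by (simp add: plus_neg comp_arr)
      finally show ?thesis using B by (simp add: cocycle_def)
    qed
    have cV: "cocycle V i \<alpha>" unfolding V_def shift_cocycle[OF W(1)] by (rule k(4))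
    obtain z where z: "z \<in> Arr A" "Dom A z = Dom A \<alpha>" "Cod A z = cobj D i" "p i oo z = \<alpha>" "q i oo z = \<beta>"
      by (rule twist_pair[OF D(1), of \<alpha> i \<beta>]) (use k(5-7) B Vs in simp_all)
    have zd: "Dom A z = Dom A e1" using z(2) k(7) by simp
    have cz: "cocycle D i z"
    proof -
      have "cdiff D i oo z = Zero A (Dom A e1) (cobj D (i + 1))"
      proof (rule twist_joint[OF D(1)])
        have "p (i + 1) oo cdiff D i oo z = cdiff V i oo \<alpha>"
          using chain_map_left[OF D(2) DD(1) V refl z(1,3)] z(4) by simp
        also have "\<dots> = Zero A (Dom A e1) (cobj V (i + 1))" using cV k(7) by (simp add: cocycle_def)
        finally show "p (i + 1) oo cdiff D i oo z = p (i + 1) oo Zero A (Dom A e1) (cobj D (i + 1))"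
          using DD(2-7) EO by (simp add: comp_zero)
        have "q (i + 1) oo cdiff D i oo z = cdiff T i oo \<beta>"
          using chain_map_left[OF D(3) DD(1) T(1) refl z(1,3)] z(5) by simp
        also have "\<dots> = Zero A (Dom A e1) (cobj T (i + 1))" using cb B by (simp add: cocycle_def)
        finally show "q (i + 1) oo cdiff D i oo z = q (i + 1) oo Zero A (Dom A e1) (cobj D (i + 1))"
          using DD(2-7) EO by (simp add: comp_zero)
      qed (use z(1,3) zd EO complexD[OF DD(1)] in \<open>simp_all add: comp_arr zero_arr\<close>)
      then show ?thesis using z(1,3) zd by (simp add: cocycle_def)
    qed
    have Qu: "Q (i + 1) oo u (i + 1) oo \<alpha> = x oo e1 \<boxplus> (\<iota> i oo P i oo v \<boxplus> \<boxminus> (cdiff X (i - 1) oo Q i oo v))"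
    proof -
      have "Q (i + 1) oo u (i + 1) oo \<alpha> = (Q (i + 1) oo y) oo e1 \<boxplus> Q (i + 1) oo cdiff F i oo v"
        unfolding k11 using k(2,8,9) vF k(3) y(1,3) FM XX by (simp add: comp_plus comp_assoc comp_arr)
      then show ?thesis unfolding y(5) fd(2) .
    qed
    have "\<mu> i oo z \<boxplus> \<boxminus> (x oo e1) = \<omega> i oo \<alpha> \<boxplus> \<iota> i oo \<beta> \<boxplus> \<boxminus> (x oo e1)"
      unfolding mz[OF z(1,3)] z(4,5) ..
    also have "\<dots> = cdiff X (i - 1) oo \<boxminus> (Q i oo v)"
      unfolding wz[OF k(5,6)] Qu \<beta>_def
      by (rule eq_sgI) (use k(2,5-9) vF k3 Xx(1,2) FM U I H XX in \<open>simp add: lin_simps\<close>)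
    finally have "loc_bd X i (\<mu> i oo z \<boxplus> \<boxminus> (x oo e1))"
      using loc_bd_diff[OF X, of "\<boxminus> (Q i oo v)" i] k(8) vF FM by (simp add: comp_arr neg_arr)
    then show "\<exists>e z. epi_arr A e \<and> Cod A e = Dom A x \<and> cocycle D i z \<and> Dom A z = Dom A e \<and>
        loc_bd X i (\<mu> i oo z \<boxplus> \<boxminus> (x oo e))" using k(1) k3 cz zd by blast
  qed
  ultimately show ?thesis using that[OF V T(1,3) exT D c\<mu>] by blast
qed

definition concentrated :: "('o, 'm) complex \<Rightarrow> int \<Rightarrow> bool" where
  "concentrated X c \<longleftrightarrow> bounded_complex A X \<and> \<not> exact_at X c \<and> (\<forall>i. i \<noteq> c \<longrightarrow> exact_at X i)"

lemma exact_sum: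
  assumes D: "is_twist V T g D p q j k" "chain_map A D V p" "chain_map A D T q" "chain_map A V D j" "chain_map A T D k"
    and b: "bounded_complex A V" "bounded_complex A T" and "exact_at V i" "exact_at T i"
  shows "exact_at D i"
  unfolding exact_at_def
proof (intro allI impI)
  fix z assume z: "cocycle D i z"
  note DD = twistD[OF D(1)]
  have "cocycle V i (p i oo z)" "cocycle T i (q i oo z)"
    by (rule cocycle_map[OF z D(2) DD(1) b(1)], rule cocycle_map[OF z D(3) DD(1) b(2)])
  then show "loc_bd D i z"
    using sum_loc_bd[OF D(1,4,5) b, of z i] z assms(8,9) unfolding exact_at_def cocycle_def by blast
qed

lemma exact_coh_surj:
  assumes "coh_surj D X \<mu>" "chain_map A D X \<mu>" "bounded_complex A D" "bounded_complex A X" "exact_at D i"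
  shows "exact_at X i"
  unfolding exact_at_def
proof (intro allI impI)
  fix x assume x: "cocycle X i x"
  have Xx: "x \<in> Arr A" "Cod A x = cobj X i" using x by (auto simp: cocycle_def)
  obtain e y w where k: "epi_arr A e" "e \<in> Arr A" "Cod A e = Dom A x" "cocycle D i y" "y \<in> Arr A"
    "Cod A y = cobj D i" "Dom A y = Dom A e" "w \<in> Arr A" "Dom A w = Dom A e"
    "Cod A w = cobj X (i - 1)" "\<mu> i oo y = x oo e \<boxplus> cdiff X (i - 1) oo w"
    using coh_surjE[OF assms(1) x assms(2-4)] .
  note M = chain_mapD(1-3)[OF assms(2)]
  have 1: "loc_bd X i (\<mu> i oo y)"
    by (rule loc_bd_map[OF _ _ _ assms(2-4)]) (use k(4-6) assms(5) in \<open>auto simp: exact_at_def\<close>)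
  have "x oo e = \<mu> i oo y \<boxplus> cdiff X (i - 1) oo \<boxminus> w"
    unfolding k(11) by (rule eq_sgI) (use k(2,3,8-10) Xx complexD[OF assms(4)] in \<open>simp add: lin_simps\<close>)
  moreover have "loc_bd X i (\<mu> i oo y \<boxplus> cdiff X (i - 1) oo \<boxminus> w)"
    by (rule loc_bd_plus[OF 1 loc_bd_diff[OF assms(4)] _ _ _ _ _ assms(4)])
      (use k(5-10) M complexD[OF assms(4)] in \<open>simp_all add: comp_arr neg_arr\<close>)
  ultimately have "loc_bd X i (x oo e)" by simp
  then show "loc_bd X i x" by (rule loc_bd_epi[OF _ k(1) Xx(1) k(3)])
qed

text \<open>
  Splitting off the truncation at \<open>a\<close> shows that the cohomology of an indecomposable object lies
  entirely above \<open>a\<close> or entirely in degrees \<open>\<le> a\<close>.  Two neighbouring values of \<open>a\<close> around a degree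
  with cohomology isolate that degree.
\<close>

theorem indecomposable_concentrated:
  assumes her: "hereditary A" and ind: "indecomposable (Db_cat A) X"
  obtains c where "concentrated X c"
proof -
  have X: "bounded_complex A X" using ind by (simp add: indecomposable_def Obj_Db)
  have dich: "(\<forall>i\<le>a. exact_at X i) \<or> (\<forall>i>a. exact_at X i)" for a
  proof -
    obtain V T D p q j k \<mu> where h: "bounded_complex A V" "bounded_complex A T" "\<And>i. i > a \<Longrightarrow> zero_obj A (cobj T i)"
      "\<And>i. i \<le> a \<Longrightarrow> (\<And>i. exact_at T i) \<Longrightarrow> exact_at X i"
      "is_twist V T (\<lambda>i. Zero A (cobj V i) (cobj T (i + 1))) D p q j k"
      "chain_map A D V p" "chain_map A D T q" "chain_map A V D j" "chain_map A T D k"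
      "is_biproduct (Kb A) V T D (hc V D j) (hc T D k) (hc D V p) (hc D T q)"
      "chain_map A D X \<mu>" "coh_inj D X \<mu>" "coh_surj D X \<mu>"
      using truncation_splits[OF her X, of a] by blast
    have D: "bounded_complex A D" by (rule twistD(1)[OF h(5)])
    have m: "hc D X \<mu> \<in> qis A" using qis_iff[OF h(11) D X] h(12,13) by blast
    note mA = hc_Arr[OF h(11) D X]
    obtain n where n: "n \<in> Hom (Db_cat A) X D" "Comp (Db_cat A) n (Q.loc (hc D X \<mu>)) = Id (Db_cat A) D"
      "Comp (Db_cat A) (Q.loc (hc D X \<mu>)) n = Id (Db_cat A) X" using Q.loc_inverse[OF m] unfolding mA(3,4) by blast
    have "\<exists>i1 i2 p1 p2. is_biproduct (Db_cat A) V T X i1 i2 p1 p2"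
      using D.biproduct_iso[OF Q.loc_biproduct[OF h(10)] Q.loc_Hom[OF mA(1)] n] by blast
    then have "zero_obj (Db_cat A) V \<or> zero_obj (Db_cat A) T"
      using ind h(1,2) unfolding indecomposable_def Obj_Db by blast
    then show ?thesis
    proof
      assume "zero_obj (Db_cat A) T"
      then have "\<And>i. exact_at T i" using zero_obj_Db_iff[OF h(2)] by blast
      then show ?thesis using h(4) by blast
    next
      assume "zero_obj (Db_cat A) V"
      then have V: "\<And>i. exact_at V i" using zero_obj_Db_iff[OF h(1)] by blast
      have "exact_at X i" if "i > a" for i
      proof (rule exact_coh_surj[OF h(13,11) D X])
        have "exact_at T i" unfolding exact_at_def cocycle_def using loc_bd_into_zero[OF h(2) h(3)[OF that]] by blast
        then show "exact_at D i" by (rule exact_sum[OF h(5-9) h(1,2) V])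
      qed
      then show ?thesis by blast
    qed
  qed
  have "\<not> zero_obj (Db_cat A) X" using ind by (simp add: indecomposable_def)
  then obtain c where c: "\<not> exact_at X c" using zero_obj_Db_iff[OF X] by blast
  have "exact_at X i" if "i \<noteq> c" for i
    using dich[of c] dich[of "c - 1"] c that by (cases "i > c") (auto dest: spec[of _ i] spec[of _ c])
  then show ?thesis using that X c unfolding concentrated_def by blast
qed

text \<open>
  The object \<open>Y[1]\<close> has its cohomology in degree \<open>cy - 1\<close>, so it may be replaced by its truncation
  there.  If \<open>cy < cx\<close>, then the source is exact in degrees \<open>\<le> cy\<close> and the vanishing statement
  applies with \<open>b = cy - 1\<close>.
\<close>

theorem nonzero_Hom_degrees:
  assumes her: "hereditary A" and X: "concentrated X cx" and Y: "concentrated Y cy"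
    and \<phi>: "\<phi> \<in> Hom (Db_cat A) X (shift_complex A Y)" "\<phi> \<noteq> Zero (Db_cat A) X (shift_complex A Y)"
  shows "cx \<le> cy"
proof (rule ccontr)
  assume "\<not> cx \<le> cy"
  then have lt: "cy < cx" by simp
  define Z where "Z = shift_complex A Y"
  have bX: "bounded_complex A X" and bY: "bounded_complex A Y" using X Y by (auto simp: concentrated_def)
  have Z: "bounded_complex A Z" unfolding Z_def by (rule shift_bounded[OF bY])
  have exZ: "exact_at Z i" if "i > cy - 1" for i
    using Y that unfolding Z_def shift_exact[OF bY] concentrated_def by auto
  obtain s f where sf: "(s, f) \<in> roofs (Kb A) (qis A) X Z" "\<phi> = Q.cls X Z (s, f)" using Q.HomE[OF \<phi>(1)[folded Z_def]] .
  obtain X' s' f' where h: "bounded_complex A X" "bounded_complex A Z" "bounded_complex A X'"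
    "chain_map A X' X s'" "coh_inj X' X s'" "coh_surj X' X s'" "chain_map A X' Z f'"
    "s = hc X' X s'" "f = hc X' Z f'" using roofE[OF sf(1)] .
  have exX': "exact_at X' i" if "i < cx" for i
    by (rule coh_exact[OF h(5,4,3,1)]) (use X that in \<open>auto simp: concentrated_def\<close>)
  obtain T \<iota> where T: "bounded_complex A T" "chain_map A T Z \<iota>" "\<And>i. i > cy - 1 \<Longrightarrow> zero_obj A (cobj T i)" "coh_inj T Z \<iota>"
    "\<And>i x. i \<le> cy - 1 \<Longrightarrow> cocycle Z i x \<Longrightarrow> \<exists>y. cocycle T i y \<and> Dom A y = Dom A x \<and> \<iota> i oo y = x"
    using truncation_ex[OF Z, of "cy - 1"] by metis
  have "coh_surj T Z \<iota>" unfolding coh_surj_def coh_surj_at_def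
  proof (intro allI impI)
    fix i y assume y: "cocycle Z i y"
    have Y: "y \<in> Arr A" "Cod A y = cobj Z i" "Dom A y \<in> Obj A" using y Dom_Obj by (auto simp: cocycle_def)
    note ZZ = complexD[OF Z] complexD[OF T(1)] chain_mapD(1-3)[OF T(2)]
    show "\<exists>e x. epi_arr A e \<and> Cod A e = Dom A y \<and> cocycle T i x \<and> Dom A x = Dom A e \<and>
        loc_bd Z i (\<iota> i oo x \<boxplus> \<boxminus> (y oo e))"
    proof (cases "i \<le> cy - 1")
      case True
      obtain x where x: "cocycle T i x" "Dom A x = Dom A y" "\<iota> i oo x = y" using T(5)[OF True y] by blast
      have "\<iota> i oo x \<boxplus> \<boxminus> (y oo Id A (Dom A y)) = Zero A (Dom A y) (cobj Z i)"
        unfolding x(3) using Y by (simp add: comp_id plus_neg)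
      then show ?thesis
        by (intro exI[of _ "Id A (Dom A y)"] exI[of _ x]) (use x(1,2) Y loc_bd_zero[OF Z] in \<open>simp add: epi_id id_arr\<close>)
    next
      case False
      let ?x = "Zero A (Dom A y) (cobj T i)"
      have "\<iota> i oo ?x \<boxplus> \<boxminus> (y oo Id A (Dom A y)) = \<boxminus> y" using Y ZZ by (simp add: arr_simps)
      moreover have "loc_bd Z i (\<boxminus> y)" using loc_bd_neg[OF _ Y(1) Z] exZ[of i] False y unfolding exact_at_def by simp
      ultimately show ?thesis
        by (intro exI[of _ "Id A (Dom A y)"] exI[of _ ?x]) (use Y ZZ in \<open>simp add: epi_id arr_simps cocycle_def\<close>)
    qed
  qed
  then obtain F t g where F: "bounded_complex A F" "chain_map A F X' t" "chain_map A F T g" "coh_inj F X' t" "coh_surj F X' t"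
    "homotopic A F Z (\<lambda>i. f' i oo t i) (\<lambda>i. \<iota> i oo g i)"
    using ore[OF h(7) T(2,4) _ h(3) Z T(1)] by blast
  have "null_map F T g"
  proof (rule vanishing[OF her F(3,1) T(1)])
    fix i assume "i \<le> cy - 1 + 1"
    then show "exact_at F i" using coh_exact[OF F(4,2,1) h(3) exX'[of i]] lt by simp
  qed (rule T(3))
  then have "null_map F Z (\<lambda>i. \<iota> i oo g i)" by (rule null_map_comp[OF _ F(3) T(2) F(1) T(1) Z])
  then obtain W u where W: "bounded_complex A W" "chain_map A W F u" "coh_inj W F u" "coh_surj W F u"
    "homotopic A W Z (\<lambda>i. (\<iota> i oo g i) oo u i) (zero_map W Z)" unfolding null_map_def by blast
  have "homotopic A W Z (\<lambda>i. (f' i oo t i) oo u i) (\<lambda>i. (\<iota> i oo g i) oo u i)"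
    by (rule homotopic_comp_right[OF F(6) chain_map_comp[OF F(3) T(2) F(1) T(1) Z] W(2,1) F(1) Z])
  from homotopic_trans[OF this W(5) chain_map_zero_map[OF W(1) Z] W(1) Z]
  have "homotopic A W Z (\<lambda>i. f' i oo t i oo u i) (zero_map W Z)"
    using chain_mapD(1-3)[OF h(7)] chain_mapD(1-3)[OF F(2)] chain_mapD(1-3)[OF W(2)] by (simp add: comp_assoc)
  then have "null_map X' Z f'" unfolding null_map_def
    using W(1) chain_map_comp[OF W(2) F(2) W(1) F(1) h(3)] coh_inj_comp[OF W(3) F(4) W(2) F(2) W(1) F(1)]
      coh_surj_comp[OF W(4) F(5) W(2) F(2) W(1) F(1) h(3)] by blast
  then have "\<phi> = Zero (Db_cat A) X Z"
    unfolding sf(2) Q.cls_zero_iff[OF sf(1)] unfolding null_map_iff[OF h(7,3) Z] h(9) hc_Arr(3)[OF h(7,3) Z] .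
  then show False using \<phi>(2) by (simp add: Z_def)
qed

lemma concentrated_unique: "concentrated X c \<Longrightarrow> concentrated X c' \<Longrightarrow> c = c'"
  unfolding concentrated_def by metis

lemma concentrated_shift: "concentrated X c \<Longrightarrow> concentrated (shift_complex A X) (c - 1)"
  unfolding concentrated_def using shift_bounded shift_exact by auto

lemma concentrated_isomorphic:
  assumes "isomorphic (Db_cat A) X Y" "concentrated X c" shows "concentrated Y c"
proof -
  obtain f where f: "f \<in> Hom (Db_cat A) X Y" "iso_arr (Db_cat A) f" using assms(1) unfolding isomorphic_def by blast
  note F = HomD[OF f(1)]
  obtain g where g: "g \<in> Hom (Db_cat A) Y X" "Comp (Db_cat A) g f = Id (Db_cat A) X" "Comp (Db_cat A) f g = Id (Db_cat A) Y"
    using f(2) unfolding iso_arr_def F by blast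
  have "bounded_complex A Y" using D.Hom_Obj[OF f(1)] by (simp add: Obj_Db)
  moreover have "exact_at X i \<longleftrightarrow> exact_at Y i" for i
    using exact_retract[OF f(1) g(1,2)] exact_retract[OF g(1) f(1) g(3)] by blast
  ultimately show ?thesis using assms(2) unfolding concentrated_def by blast
qed

end

section \<open>Transport along a triangle equivalence\<close>

lemma isomorphic_Db: "isomorphic (Db A) X Y \<longleftrightarrow> isomorphic (Db_cat A) X Y"
  by (simp add: isomorphic_def iso_arr_def Hom_def Db_def cat.extend_def)

lemma zero_obj_Db: "zero_obj (Db A) X \<longleftrightarrow> zero_obj (Db_cat A) X"
  by (simp add: zero_obj_def Hom_def Db_def cat.extend_def)

lemma indecomposable_Db: "indecomposable (Db A) X \<longleftrightarrow> indecomposable (Db_cat A) X"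
  unfolding indecomposable_def zero_obj_Db
  by (simp add: is_biproduct_def Hom_def Db_def cat.extend_def)

lemma Db_preadditive:
  assumes "abelian_category A" shows "preadditive_category (Db A)"
proof -
  interpret ab_cat A by (rule ab_cat.intro[OF assms])
  have "preadditive_category (Db_cat A)" by (rule Q.localisation_preadditive)
  then show ?thesis
    unfolding preadditive_category_def category_def preadditive_category_axioms_def Hom_Db Db_simps .
qed

context preadditive_category
begin

lemma zero_obj_iso:
  assumes "zero_obj C X" "f \<in> Hom C X Y" "g \<in> Hom C Y X" "Comp C f g = Id C Y"
  shows "zero_obj C Y"
proof (rule zero_objI)
  note F = HomD[OF assms(2)] HomD[OF assms(3)]
  show Y: "Y \<in> Obj C" using Hom_Obj[OF assms(2)] by simp
  have "f = Zero C X Y" using zero_objD(4)[OF assms(1) F(1,2)] F by simp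
  then have "Comp C f g = Zero C Y Y" using F Y by (simp add: zero_comp)
  then show "Id C Y = Zero C Y Y" using assms(4) by simp
qed

lemma biproduct_iso_summands:
  assumes b: "is_biproduct C X Y P i1 i2 p1 p2"
    and a: "a \<in> Hom C X' X" "a' \<in> Hom C X X'" "Comp C a' a = Id C X'" "Comp C a a' = Id C X"
    and c: "c \<in> Hom C Y' Y" "c' \<in> Hom C Y Y'" "Comp C c' c = Id C Y'" "Comp C c c' = Id C Y"
  shows "is_biproduct C X' Y' P (Comp C i1 a) (Comp C i2 c) (Comp C a' p1) (Comp C c' p2)"
proof -
  note M = HomD[OF a(1)] HomD[OF a(2)] HomD[OF c(1)] HomD[OF c(2)]
  have B: "i1 \<in> Arr C" "Dom C i1 = X" "Cod C i1 = P" "i2 \<in> Arr C" "Dom C i2 = Y" "Cod C i2 = P"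
    "p1 \<in> Arr C" "Dom C p1 = P" "Cod C p1 = X" "p2 \<in> Arr C" "Dom C p2 = P" "Cod C p2 = Y"
    and E: "Comp C p1 i1 = Id C X" "Comp C p2 i2 = Id C Y" "Comp C p1 i2 = Zero C Y X"
      "Comp C p2 i1 = Zero C X Y" "Plus C (Comp C i1 p1) (Comp C i2 p2) = Id C P"
    using b unfolding is_biproduct_def Hom_def by auto
  have O: "X \<in> Obj C" "Y \<in> Obj C" "X' \<in> Obj C" "Y' \<in> Obj C" using Hom_Obj a c by blast+
  have 1: "Comp C (Comp C f' p) (Comp C i f) = Comp C f' (Comp C (Comp C p i) f)"
    if "f' \<in> Arr C" "p \<in> Arr C" "i \<in> Arr C" "f \<in> Arr C" "Dom C f' = Cod C p" "Dom C p = Cod C i" "Dom C i = Cod C f"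
    for f' p i f using that by (simp add: comp_assoc comp_arr)
  have 2: "Comp C (Comp C i f) (Comp C f' p) = Comp C i (Comp C (Comp C f f') p)"
    if "f' \<in> Arr C" "p \<in> Arr C" "i \<in> Arr C" "f \<in> Arr C" "Dom C f' = Cod C p" "Dom C f = Cod C f'" "Dom C i = Cod C f"
    for f' p i f using that by (simp add: comp_assoc comp_arr)
  show ?thesis unfolding is_biproduct_def
    using M B O by (simp add: 1 2 E a(3,4) c(3,4) id_comp zero_comp comp_zero) (simp add: Hom_def comp_arr)
qed

end

locale preadditive_triangle_equivalence = triangle_equivalence S T Fo Fm + S: preadditive_category S + T: preadditive_category T
  for S :: "('o, 'm) tricat" and T :: "('p, 'n) tricat" and Fo Fm
begin

lemma F_Zero: assumes "X \<in> Obj S" "Y \<in> Obj S" shows "Fm (Zero S X Y) = Zero T (Fo X) (Fo Y)"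
proof -
  have z: "Zero S X Y \<in> Hom S X Y" by (rule S.Zero_Hom[OF assms])
  have e: "Plus T (Fm (Zero S X Y)) (Fm (Zero S X Y)) = Fm (Zero S X Y)"
    using F_Plus[OF z z] S.Plus_Zero[OF z] by simp
  note F = HomD[OF F_Hom[OF z]]
  show ?thesis using T.plus_idem_zero[OF F(1) e] unfolding F(2,3) .
qed

lemma F_inj: "f \<in> Hom S X Y \<Longrightarrow> g \<in> Hom S X Y \<Longrightarrow> Fm f = Fm g \<Longrightarrow> f = g"
  using full_faithful[of X Y] S.Hom_Obj[of f X Y] unfolding bij_betw_def inj_on_def by blast

lemma F_surj: "X \<in> Obj S \<Longrightarrow> Y \<in> Obj S \<Longrightarrow> g \<in> Hom T (Fo X) (Fo Y) \<Longrightarrow> \<exists>f \<in> Hom S X Y. Fm f = g"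
  using full_faithful[of X Y] unfolding bij_betw_def by (metis imageE)

lemma F_zero_obj_iff: assumes "X \<in> Obj S" shows "zero_obj T (Fo X) \<longleftrightarrow> zero_obj S X"
proof
  assume "zero_obj T (Fo X)"
  then have "Fm (Id S X) = Fm (Zero S X X)"
    using T.zero_objD(2) F_Id[OF assms] F_Zero[OF assms assms] by simp
  then have "Id S X = Zero S X X" by (rule F_inj[OF S.Id_Hom[OF assms] S.Zero_Hom[OF assms assms]])
  then show "zero_obj S X" by (rule S.zero_objI[OF assms])
next
  assume "zero_obj S X"
  then have "Id T (Fo X) = Zero T (Fo X) (Fo X)"
    using S.zero_objD(2) F_Id[OF assms] F_Zero[OF assms assms] by metis
  then show "zero_obj T (Fo X)" by (rule T.zero_objI[OF F_Obj[OF assms]])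
qed

lemma F_nonzero:
  assumes "f \<in> Hom S X Y" "f \<noteq> Zero S X Y" shows "Fm f \<noteq> Zero T (Fo X) (Fo Y)"
  using assms F_inj[OF assms(1) S.Zero_Hom] F_Zero S.Hom_Obj[OF assms(1)] by metis

lemma F_isomorphic: assumes "isomorphic S X Y" shows "isomorphic T (Fo X) (Fo Y)"
proof -
  obtain f where f: "f \<in> Hom S X Y" "iso_arr S f" using assms unfolding isomorphic_def by blast
  note F = HomD[OF f(1)]
  obtain g where g: "g \<in> Hom S Y X" "Comp S g f = Id S X" "Comp S f g = Id S Y"
    using f(2) unfolding iso_arr_def F by blast
  note G = HomD[OF F_Hom[OF f(1)]] and O = S.Hom_Obj[OF f(1)]
  have "Comp T (Fm g) (Fm f) = Id T (Fo X)" "Comp T (Fm f) (Fm g) = Id T (Fo Y)"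
    using F_Comp[OF f(1) g(1)] F_Comp[OF g(1) f(1)] g(2,3) F_Id O by simp_all
  then show ?thesis unfolding isomorphic_def iso_arr_def
    using F_Hom[OF f(1)] F_Hom[OF g(1)] G by metis
qed

lemma ess_surjE:
  assumes "Z \<in> Obj T"
  obtains X a b where "X \<in> Obj S" "a \<in> Hom T (Fo X) Z" "b \<in> Hom T Z (Fo X)" "Comp T b a = Id T (Fo X)" "Comp T a b = Id T Z"
proof -
  obtain X where X: "X \<in> Obj S" "isomorphic T (Fo X) Z" using ess_surj[OF assms] by blast
  obtain a where a: "a \<in> Hom T (Fo X) Z" "iso_arr T a" using X(2) unfolding isomorphic_def by blast
  note A = HomD[OF a(1)]
  show ?thesis using a(2) that X(1) a(1) unfolding iso_arr_def A by blast
qed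

text \<open>
  A decomposition of the image is isomorphic to the image of a pair of objects by essential
  surjectivity, and its structure maps lift because the functor is full; their relations hold before
  applying the functor because it is faithful.
\<close>

lemma F_indecomposable:
  assumes ind: "indecomposable S X" shows "indecomposable T (Fo X)"
  unfolding indecomposable_def
proof (intro conjI ballI allI impI)
  have X: "X \<in> Obj S" using ind by (simp add: indecomposable_def)
  show "Fo X \<in> Obj T" by (rule F_Obj[OF X])
  show "\<not> zero_obj T (Fo X)" unfolding F_zero_obj_iff[OF X] using ind by (simp add: indecomposable_def)
  fix Y Z i1 i2 p1 p2
  assume YZ: "Y \<in> Obj T" "Z \<in> Obj T" and b: "is_biproduct T Y Z (Fo X) i1 i2 p1 p2"
  obtain Y' a a' where Y: "Y' \<in> Obj S" "a \<in> Hom T (Fo Y') Y" "a' \<in> Hom T Y (Fo Y')" "Comp T a' a = Id T (Fo Y')" "Comp T a a' = Id T Y"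
    using ess_surjE[OF YZ(1)] .
  obtain Z' c c' where Z: "Z' \<in> Obj S" "c \<in> Hom T (Fo Z') Z" "c' \<in> Hom T Z (Fo Z')" "Comp T c' c = Id T (Fo Z')" "Comp T c c' = Id T Z"
    using ess_surjE[OF YZ(2)] .
  note B = T.biproduct_iso_summands[OF b Y(2-5) Z(2-5), unfolded is_biproduct_def]
  obtain j1 where j1: "j1 \<in> Hom S Y' X" "Fm j1 = Comp T i1 a" using F_surj[OF Y(1) X, of "Comp T i1 a"] B by blast
  obtain j2 where j2: "j2 \<in> Hom S Z' X" "Fm j2 = Comp T i2 c" using F_surj[OF Z(1) X, of "Comp T i2 c"] B by blast
  obtain q1 where q1: "q1 \<in> Hom S X Y'" "Fm q1 = Comp T a' p1" using F_surj[OF X Y(1), of "Comp T a' p1"] B by blast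
  obtain q2 where q2: "q2 \<in> Hom S X Z'" "Fm q2 = Comp T c' p2" using F_surj[OF X Z(1), of "Comp T c' p2"] B by blast
  note cH = S.Comp_Hom[OF j1(1) q1(1)] S.Comp_Hom[OF j2(1) q2(1)] S.Comp_Hom[OF j2(1) q1(1)] S.Comp_Hom[OF j1(1) q2(1)]
    S.Comp_Hom[OF q1(1) j1(1)] S.Comp_Hom[OF q2(1) j2(1)]
  have "is_biproduct S Y' Z' X j1 j2 q1 q2"
    unfolding is_biproduct_def
  proof (intro conjI j1(1) j2(1) q1(1) q2(1))
    show "Comp S q1 j1 = Id S Y'"
      by (rule F_inj[OF cH(1) S.Id_Hom[OF Y(1)]]) (use F_Comp[OF j1(1) q1(1)] F_Id[OF Y(1)] j1 q1 B in simp)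
    show "Comp S q2 j2 = Id S Z'"
      by (rule F_inj[OF cH(2) S.Id_Hom[OF Z(1)]]) (use F_Comp[OF j2(1) q2(1)] F_Id[OF Z(1)] j2 q2 B in simp)
    show "Comp S q1 j2 = Zero S Z' Y'"
      by (rule F_inj[OF cH(3) S.Zero_Hom[OF Z(1) Y(1)]]) (use F_Comp[OF j2(1) q1(1)] F_Zero[OF Z(1) Y(1)] j2 q1 B in simp)
    show "Comp S q2 j1 = Zero S Y' Z'"
      by (rule F_inj[OF cH(4) S.Zero_Hom[OF Y(1) Z(1)]]) (use F_Comp[OF j1(1) q2(1)] F_Zero[OF Y(1) Z(1)] j1 q2 B in simp)
    show "Plus S (Comp S j1 q1) (Comp S j2 q2) = Id S X"
      by (rule F_inj[OF S.Plus_Hom[OF cH(5,6)] S.Id_Hom[OF X]])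
        (use F_Plus[OF cH(5,6)] F_Comp[OF q1(1) j1(1)] F_Comp[OF q2(1) j2(1)] F_Id[OF X] j1 j2 q1 q2 B in simp)
  qed
  then have "zero_obj S Y' \<or> zero_obj S Z'" using ind Y(1) Z(1) unfolding indecomposable_def by blast
  then show "zero_obj T Y \<or> zero_obj T Z"
    using T.zero_obj_iso[OF _ Y(2,3,5)] T.zero_obj_iso[OF _ Z(2,3,5)] F_zero_obj_iff Y(1) Z(1) by blast
qed

end

theorem no_periodic_object:
  assumes A: "abelian_category A" and H: "abelian_category H" "hereditary H"
    and eq: "triangle_equivalence (Db A) (Db H) Fo Fm"
    and X: "indecomposable (Db A) X" and Y: "(ar_translate (Db A) ^^ n) X Y"
    and iso: "isomorphic (Db A) Y ((ShObj (Db A) ^^ m) X)" and m: "m \<ge> 1"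
  shows False
proof -
  interpret A: ab_cat A by (rule ab_cat.intro[OF A])
  interpret H: ab_cat H by (rule ab_cat.intro[OF H(1)])
  interpret E: preadditive_triangle_equivalence "Db A" "Db H" Fo Fm
    by (intro preadditive_triangle_equivalence.intro eq Db_preadditive A H)
  have conc: "\<exists>c. H.concentrated (Fo Z) c" if "indecomposable (Db A) Z" for Z
    using H.indecomposable_concentrated[OF H(2)] E.F_indecomposable[OF that] unfolding indecomposable_Db by metis
  from E.triangulated obtain \<xi> where
    "\<forall>Z \<in> Obj (Db A). \<xi> Z \<in> Hom (Db H) (Fo (ShObj (Db A) Z)) (ShObj (Db H) (Fo Z)) \<and> iso_arr (Db H) (\<xi> Z)"
    by (elim exE conjE) (rule that)
  then have \<xi>: "\<xi> Z \<in> Hom (Db H) (Fo (ShObj (Db A) Z)) (ShObj (Db H) (Fo Z)) \<and> iso_arr (Db H) (\<xi> Z)"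
    if "Z \<in> Obj (Db A)" for Z using that by blast
  have ObA: "Z \<in> Obj (Db A) \<longleftrightarrow> bounded_complex A Z" for Z by (simp add: A.Db_simps A.Obj_Db)
  have sh: "isomorphic (Db_cat H) (Fo (shift_complex A Z)) (shift_complex H (Fo Z))" if "bounded_complex A Z" for Z
  proof -
    have "isomorphic (Db H) (Fo (shift_complex A Z)) (shift_complex H (Fo Z))"
      using \<xi>[of Z] that unfolding ObA isomorphic_def A.Db_simps(9) H.Db_simps(9) by blast
    then show ?thesis by (simp only: isomorphic_Db)
  qed
  have iso_sym: "isomorphic (Db_cat H) V U" if UV: "isomorphic (Db_cat H) U V" for U V
  proof -
    obtain f where f: "f \<in> Hom (Db_cat H) U V" "iso_arr (Db_cat H) f" using UV unfolding isomorphic_def by blast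
    note F = HomD[OF f(1)]
    obtain g where g: "g \<in> Hom (Db_cat H) V U" "Comp (Db_cat H) g f = Id (Db_cat H) U" "Comp (Db_cat H) f g = Id (Db_cat H) V"
      using f(2) unfolding iso_arr_def F by blast
    note G = HomD[OF g(1)]
    show ?thesis unfolding isomorphic_def iso_arr_def using f(1) g G by metis
  qed
  \<comment> \<open>The connecting morphism of the almost split triangle, transported to the hereditary side.\<close>
  have step: "cx \<le> cy" if t: "ar_translate (Db A) X Y" and c: "H.concentrated (Fo X) cx" "H.concentrated (Fo Y) cy" for X Y cx cy
  proof -
    obtain Z u v w where w0: "(Y, Z, X, u, v, w) \<in> Tri (Db A)" "w \<noteq> Zero (Db A) X (ShObj (Db A) Y)" "indecomposable (Db A) Y"
      using t unfolding ar_translate_def almost_split_def by auto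
    then have w: "w \<in> Hom (Db A) X (ShObj (Db A) Y)" "Y \<in> Obj (Db A)"
      unfolding A.Db_simps(9,10) A.Hom_Db Db_triangles_def indecomposable_def by auto
    have x: "\<xi> Y \<in> Hom (Db H) (Fo (ShObj (Db A) Y)) (ShObj (Db H) (Fo Y))" "iso_arr (Db H) (\<xi> Y)" using \<xi>[OF w(2)] by auto
    note XX = HomD[OF x(1)]
    obtain y where y: "y \<in> Hom (Db H) (ShObj (Db H) (Fo Y)) (Fo (ShObj (Db A) Y))" "Comp (Db H) y (\<xi> Y) = Id (Db H) (Fo (ShObj (Db A) Y))"
      using x(2) unfolding iso_arr_def XX by blast
    note YY = HomD[OF y(1)] and FW = HomD[OF E.F_Hom[OF w(1)]]
    define \<phi> where "\<phi> = Comp (Db H) (\<xi> Y) (Fm w)"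
    have \<phi>: "\<phi> \<in> Hom (Db H) (Fo X) (ShObj (Db H) (Fo Y))"
      unfolding \<phi>_def by (rule E.T.Comp_Hom[OF E.F_Hom[OF w(1)] x(1)])
    have "\<phi> \<noteq> Zero (Db H) (Fo X) (ShObj (Db H) (Fo Y))"
    proof
      assume z: "\<phi> = Zero (Db H) (Fo X) (ShObj (Db H) (Fo Y))"
      have "Fm w = Comp (Db H) y \<phi>"
        using E.T.comp_assoc[of "Fm w" "\<xi> Y" y] FW XX YY y(2) by (simp add: \<phi>_def E.T.id_comp)
      also have "\<dots> = Zero (Db H) (Fo X) (Fo (ShObj (Db A) Y))"
        unfolding z using YY E.T.Hom_Obj[OF \<phi>] by (simp add: E.T.comp_zero)
      finally show False using E.F_nonzero[OF w(1) w0(2)] by simp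
    qed
    with \<phi> show ?thesis using H.nonzero_Hom_degrees[OF H(2) c] unfolding H.Hom_Db H.Db_simps by blast
  qed
  have chain: "indecomposable (Db A) Y \<and> (\<forall>cx cy. H.concentrated (Fo X) cx \<longrightarrow> H.concentrated (Fo Y) cy \<longrightarrow> cx \<le> cy)"
    if "(ar_translate (Db A) ^^ n) X Y" "indecomposable (Db A) X" for X Y n
    using that
  proof (induction n arbitrary: Y)
    case 0
    then show ?case using H.concentrated_unique by auto
  next
    case (Suc n)
    then obtain Z where Z: "(ar_translate (Db A) ^^ n) X Z" "ar_translate (Db A) Z Y" by auto
    have IH: "indecomposable (Db A) Z" "\<And>cx cz. H.concentrated (Fo X) cx \<Longrightarrow> H.concentrated (Fo Z) cz \<Longrightarrow> cx \<le> cz"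
      using Suc.IH[OF Z(1) Suc.prems(2)] by auto
    obtain cz where cz: "H.concentrated (Fo Z) cz" using conc[OF IH(1)] by blast
    have "indecomposable (Db A) Y" using Z(2) unfolding ar_translate_def almost_split_def by auto
    then show ?case using IH(2)[OF _ cz] step[OF Z(2) cz] by (meson order_trans)
  qed
  obtain c where c: "H.concentrated (Fo X) c" using conc[OF X] by blast
  have bX: "bounded_complex A X" using X ObA unfolding indecomposable_def by blast
  have shm: "bounded_complex A ((shift_complex A ^^ k) X) \<and> H.concentrated (Fo ((shift_complex A ^^ k) X)) (c - int k)" for k
  proof (induction k)
    case 0 then show ?case using bX c by simp
  next
    case (Suc k)
    have "H.concentrated (shift_complex H (Fo ((shift_complex A ^^ k) X))) (c - int k - 1)"
      using H.concentrated_shift Suc.IH by blast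
    then have "H.concentrated (Fo (shift_complex A ((shift_complex A ^^ k) X))) (c - int k - 1)"
      using H.concentrated_isomorphic[OF iso_sym[OF sh]] Suc.IH by blast
    then show ?case using A.shift_bounded Suc.IH by (simp add: algebra_simps)
  qed
  have "isomorphic (Db_cat H) (Fo Y) (Fo ((shift_complex A ^^ m) X))"
    using E.F_isomorphic[OF iso] unfolding isomorphic_Db A.Db_simps .
  then have cY: "H.concentrated (Fo Y) (c - int m)" using H.concentrated_isomorphic[OF iso_sym] shm by blast
  have "c \<le> c - int m" using chain[OF Y X] c cY by blast
  then show False using m by simp
qed

section \<open>Modules over a left noetherian ring form an abelian category\<close>

subsection \<open>Submodules, images and products\<close>

definition submod :: "'r ring \<Rightarrow> ('r, 'v) module \<Rightarrow> 'v set \<Rightarrow> bool" where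
  "submod R M N \<longleftrightarrow> N \<subseteq> carrier M \<and> \<zero>\<^bsub>M\<^esub> \<in> N \<and> (\<forall>x \<in> N. \<forall>y \<in> N. x \<oplus>\<^bsub>M\<^esub> y \<in> N) \<and>
     (\<forall>r \<in> carrier R. \<forall>x \<in> N. r \<odot>\<^bsub>M\<^esub> x \<in> N)"

lemma submodD:
  assumes "submod R M N"
  shows "N \<subseteq> carrier M" "\<zero>\<^bsub>M\<^esub> \<in> N" "x \<in> N \<Longrightarrow> y \<in> N \<Longrightarrow> x \<oplus>\<^bsub>M\<^esub> y \<in> N"
    "r \<in> carrier R \<Longrightarrow> x \<in> N \<Longrightarrow> r \<odot>\<^bsub>M\<^esub> x \<in> N"
  using assms unfolding submod_def by auto

context left_module
begin

lemma smult_zero: assumes "r \<in> carrier R" shows "r \<odot>\<^bsub>M\<^esub> \<zero>\<^bsub>M\<^esub> = \<zero>\<^bsub>M\<^esub>"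
proof -
  have "r \<odot>\<^bsub>M\<^esub> \<zero>\<^bsub>M\<^esub> \<oplus>\<^bsub>M\<^esub> r \<odot>\<^bsub>M\<^esub> \<zero>\<^bsub>M\<^esub> = r \<odot>\<^bsub>M\<^esub> \<zero>\<^bsub>M\<^esub> \<oplus>\<^bsub>M\<^esub> \<zero>\<^bsub>M\<^esub>"
    using smult_r_distr[OF assms M.zero_closed M.zero_closed] smult_closed[OF assms M.zero_closed] by simp
  then show ?thesis using smult_closed[OF assms M.zero_closed] by (simp del: M.r_zero)
qed

lemma zero_smult: assumes "x \<in> carrier M" shows "\<zero>\<^bsub>R\<^esub> \<odot>\<^bsub>M\<^esub> x = \<zero>\<^bsub>M\<^esub>"
proof -
  have "\<zero>\<^bsub>R\<^esub> \<odot>\<^bsub>M\<^esub> x \<oplus>\<^bsub>M\<^esub> \<zero>\<^bsub>R\<^esub> \<odot>\<^bsub>M\<^esub> x = \<zero>\<^bsub>R\<^esub> \<odot>\<^bsub>M\<^esub> x \<oplus>\<^bsub>M\<^esub> \<zero>\<^bsub>M\<^esub>"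
    using smult_l_distr[OF R.zero_closed R.zero_closed assms] smult_closed[OF R.zero_closed assms] by simp
  then show ?thesis using smult_closed[OF R.zero_closed assms] by (simp del: M.r_zero)
qed

lemma minus_smult: assumes "x \<in> carrier M" shows "(\<ominus>\<^bsub>R\<^esub> \<one>\<^bsub>R\<^esub>) \<odot>\<^bsub>M\<^esub> x = \<ominus>\<^bsub>M\<^esub> x"
proof -
  have "x \<oplus>\<^bsub>M\<^esub> (\<ominus>\<^bsub>R\<^esub> \<one>\<^bsub>R\<^esub>) \<odot>\<^bsub>M\<^esub> x = (\<one>\<^bsub>R\<^esub> \<oplus>\<^bsub>R\<^esub> \<ominus>\<^bsub>R\<^esub> \<one>\<^bsub>R\<^esub>) \<odot>\<^bsub>M\<^esub> x"
    using assms by (simp add: smult_l_distr smult_one)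
  also have "\<dots> = \<zero>\<^bsub>M\<^esub>" using assms by (simp add: R.r_neg zero_smult)
  finally show ?thesis using assms smult_closed[of "\<ominus>\<^bsub>R\<^esub> \<one>\<^bsub>R\<^esub>" x]
    using M.minus_equality[of "(\<ominus>\<^bsub>R\<^esub> \<one>\<^bsub>R\<^esub>) \<odot>\<^bsub>M\<^esub> x" x] M.a_comm[of x "(\<ominus>\<^bsub>R\<^esub> \<one>\<^bsub>R\<^esub>) \<odot>\<^bsub>M\<^esub> x"] by simp
qed

lemma smult_minus: assumes "r \<in> carrier R" "x \<in> carrier M" shows "r \<odot>\<^bsub>M\<^esub> (\<ominus>\<^bsub>M\<^esub> x) = \<ominus>\<^bsub>M\<^esub> (r \<odot>\<^bsub>M\<^esub> x)"
  by (rule M.minus_equality[symmetric])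
    (use assms in \<open>simp_all add: smult_closed smult_r_distr[symmetric] M.l_neg smult_zero\<close>)

lemma submod_minus: "submod R M N \<Longrightarrow> x \<in> N \<Longrightarrow> \<ominus>\<^bsub>M\<^esub> x \<in> N"
  using submodD(1)[of R M N] submodD(4)[of R M N "\<ominus>\<^bsub>R\<^esub> \<one>\<^bsub>R\<^esub>" x] minus_smult[of x] by auto

lemma submod_carrier: "submod R M (carrier M)"
  by (simp add: submod_def smult_closed)

text \<open>
  Both direct products coded inside another type and quotients realised on representatives are
  images of modules under a map that respects the operations; this transfers the axioms to them.
\<close>

lemma image_module:
  assumes C: "carrier N = r ` carrier M" and z: "\<zero>\<^bsub>N\<^esub> = r \<zero>\<^bsub>M\<^esub>"
    and a: "\<And>x y. x \<in> carrier M \<Longrightarrow> y \<in> carrier M \<Longrightarrow> r x \<oplus>\<^bsub>N\<^esub> r y = r (x \<oplus>\<^bsub>M\<^esub> y)"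
    and s: "\<And>c x. c \<in> carrier R \<Longrightarrow> x \<in> carrier M \<Longrightarrow> c \<odot>\<^bsub>N\<^esub> r x = r (c \<odot>\<^bsub>M\<^esub> x)"
  shows "left_module R N"
proof (intro left_module.intro R.ring_axioms left_module_axioms.intro abelian_groupI)
  fix x assume "x \<in> carrier N"
  then obtain x' where x: "x' \<in> carrier M" "x = r x'" using C by auto
  show "\<exists>y\<in>carrier N. y \<oplus>\<^bsub>N\<^esub> x = \<zero>\<^bsub>N\<^esub>"
    by (rule bexI[of _ "r (\<ominus>\<^bsub>M\<^esub> x')"]) (use x C z a M.l_neg in auto)
qed (use C z a s smult_closed in \<open>auto simp: M.a_ac smult_l_distr smult_r_distr smult_assoc smult_one\<close>)

lemma submodule_module:
  assumes "submod R M N" shows "left_module R (M\<lparr>carrier := N\<rparr>)"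
proof (intro left_module.intro R.ring_axioms left_module_axioms.intro abelian_groupI)
  note D = submodD[OF assms]
  have N: "x \<in> N \<Longrightarrow> x \<in> carrier M" for x using D by auto
  show "\<exists>y\<in>carrier (M\<lparr>carrier := N\<rparr>). y \<oplus>\<^bsub>M\<lparr>carrier := N\<rparr>\<^esub> x = \<zero>\<^bsub>M\<lparr>carrier := N\<rparr>\<^esub>"
    if "x \<in> carrier (M\<lparr>carrier := N\<rparr>)" for x
    using submod_minus[OF assms, of x] that N M.l_neg[of x] by auto
qed (use submodD[OF assms] in \<open>auto simp: M.a_ac smult_l_distr smult_r_distr smult_assoc smult_one subset_iff\<close>)

lemma submod_finsum:
  assumes N: "submod R M N" and G: "finite G" "G \<subseteq> N" "c \<in> G \<rightarrow> carrier R"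
  shows "(\<Oplus>\<^bsub>M\<^esub>g\<in>G. c g \<odot>\<^bsub>M\<^esub> g) \<in> N"
  using G
proof (induction G rule: finite_induct)
  case empty then show ?case using submodD(2)[OF N] by simp
next
  case (insert g G)
  have "c g \<odot>\<^bsub>M\<^esub> g \<in> N" "c g \<odot>\<^bsub>M\<^esub> g \<in> carrier M" "(\<lambda>g. c g \<odot>\<^bsub>M\<^esub> g) \<in> G \<rightarrow> carrier M"
    using insert submodD[OF N] by (auto intro!: smult_closed)
  then show ?case using insert submodD(3)[OF N] by (simp add: M.finsum_insert)
qed

lemma smult_finsum:
  assumes "finite G" "a \<in> carrier R" "f \<in> G \<rightarrow> carrier M"
  shows "a \<odot>\<^bsub>M\<^esub> (\<Oplus>\<^bsub>M\<^esub>g\<in>G. f g) = (\<Oplus>\<^bsub>M\<^esub>g\<in>G. a \<odot>\<^bsub>M\<^esub> f g)"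
  using assms
proof (induction G rule: finite_induct)
  case empty then show ?case by (simp add: smult_zero)
next
  case (insert g G)
  have "f g \<in> carrier M" "f \<in> G \<rightarrow> carrier M" "(\<lambda>g. a \<odot>\<^bsub>M\<^esub> f g) \<in> G \<rightarrow> carrier M" "a \<odot>\<^bsub>M\<^esub> f g \<in> carrier M"
    using insert by (auto intro!: smult_closed)
  then show ?case using insert by (simp add: M.finsum_insert smult_r_distr)
qed

lemma span_submod:
  assumes "finite G" "G \<subseteq> carrier M"
  shows "submod R M {x. \<exists>c \<in> G \<rightarrow> carrier R. x = (\<Oplus>\<^bsub>M\<^esub>g\<in>G. c g \<odot>\<^bsub>M\<^esub> g)}" (is "submod R M ?N")
    and "G \<subseteq> {x. \<exists>c \<in> G \<rightarrow> carrier R. x = (\<Oplus>\<^bsub>M\<^esub>g\<in>G. c g \<odot>\<^bsub>M\<^esub> g)}"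
proof -
  have cl: "(\<lambda>g. c g \<odot>\<^bsub>M\<^esub> g) \<in> G \<rightarrow> carrier M" if "c \<in> G \<rightarrow> carrier R" for c
    using that assms by (auto intro!: smult_closed)
  have sub: "?N \<subseteq> carrier M" using cl M.finsum_closed by auto
  moreover have "\<zero>\<^bsub>M\<^esub> \<in> ?N"
  proof -
    have "(\<Oplus>\<^bsub>M\<^esub>g\<in>G. \<zero>\<^bsub>R\<^esub> \<odot>\<^bsub>M\<^esub> g) = (\<Oplus>\<^bsub>M\<^esub>g\<in>G. \<zero>\<^bsub>M\<^esub>)"
      using assms(2) by (intro M.finsum_cong') (auto simp: zero_smult)
    then show ?thesis by (intro CollectI bexI[of _ "\<lambda>g. \<zero>\<^bsub>R\<^esub>"]) auto
  qed
  moreover have "x \<oplus>\<^bsub>M\<^esub> y \<in> ?N" if "x \<in> ?N" "y \<in> ?N" for x y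
  proof -
    obtain c d where c: "c \<in> G \<rightarrow> carrier R" "x = (\<Oplus>\<^bsub>M\<^esub>g\<in>G. c g \<odot>\<^bsub>M\<^esub> g)"
      and d: "d \<in> G \<rightarrow> carrier R" "y = (\<Oplus>\<^bsub>M\<^esub>g\<in>G. d g \<odot>\<^bsub>M\<^esub> g)" using \<open>x \<in> ?N\<close> \<open>y \<in> ?N\<close> by blast
    have "x \<oplus>\<^bsub>M\<^esub> y = (\<Oplus>\<^bsub>M\<^esub>g\<in>G. c g \<odot>\<^bsub>M\<^esub> g \<oplus>\<^bsub>M\<^esub> d g \<odot>\<^bsub>M\<^esub> g)"
      unfolding c d using cl c d by (simp add: M.finsum_addf)
    also have "\<dots> = (\<Oplus>\<^bsub>M\<^esub>g\<in>G. (c g \<oplus>\<^bsub>R\<^esub> d g) \<odot>\<^bsub>M\<^esub> g)"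
      using c d assms(2) by (intro M.finsum_cong') (auto simp: smult_l_distr Pi_def subset_iff intro!: smult_closed)
    finally show ?thesis using c d by (intro CollectI bexI[of _ "\<lambda>g. c g \<oplus>\<^bsub>R\<^esub> d g"]) auto
  qed
  moreover have "a \<odot>\<^bsub>M\<^esub> x \<in> ?N" if "a \<in> carrier R" "x \<in> ?N" for a x
  proof -
    obtain c where c: "c \<in> G \<rightarrow> carrier R" "x = (\<Oplus>\<^bsub>M\<^esub>g\<in>G. c g \<odot>\<^bsub>M\<^esub> g)" using \<open>x \<in> ?N\<close> by blast
    have "a \<odot>\<^bsub>M\<^esub> x = (\<Oplus>\<^bsub>M\<^esub>g\<in>G. a \<odot>\<^bsub>M\<^esub> (c g \<odot>\<^bsub>M\<^esub> g))"
      unfolding c by (rule smult_finsum[OF assms(1) \<open>a \<in> carrier R\<close> cl[OF c(1)]])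
    also have "\<dots> = (\<Oplus>\<^bsub>M\<^esub>g\<in>G. (a \<otimes>\<^bsub>R\<^esub> c g) \<odot>\<^bsub>M\<^esub> g)"
      using c \<open>a \<in> carrier R\<close> assms(2) by (intro M.finsum_cong') (auto simp: smult_assoc Pi_def subset_iff intro!: smult_closed)
    finally show ?thesis using c \<open>a \<in> carrier R\<close> by (intro CollectI bexI[of _ "\<lambda>g. a \<otimes>\<^bsub>R\<^esub> c g"]) auto
  qed
  ultimately show "submod R M ?N" unfolding submod_def by blast
  show "G \<subseteq> ?N"
  proof
    fix g assume g: "g \<in> G"
    have "(\<Oplus>\<^bsub>M\<^esub>h\<in>G. (if g = h then \<one>\<^bsub>R\<^esub> else \<zero>\<^bsub>R\<^esub>) \<odot>\<^bsub>M\<^esub> h) = (\<Oplus>\<^bsub>M\<^esub>h\<in>G. if g = h then h else \<zero>\<^bsub>M\<^esub>)"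
      using assms(2) by (intro M.finsum_cong') (auto simp: smult_one zero_smult subset_iff)
    also have "\<dots> = g" using M.finsum_singleton[OF g assms(1), of "\<lambda>h. h"] assms(2) by auto
    finally show "g \<in> ?N" by (intro CollectI bexI[of _ "\<lambda>h. if g = h then \<one>\<^bsub>R\<^esub> else \<zero>\<^bsub>R\<^esub>"]) auto
  qed
qed

end

text \<open>
  Generation is expressed by leastness among submodules rather than by linear combinations, so that
  images, products and inclusions need no manipulation of sums; \<open>fg_module_iff\<close> relates the two.
\<close>

definition generates :: "'r ring \<Rightarrow> ('r, 'v) module \<Rightarrow> 'v set \<Rightarrow> 'v set \<Rightarrow> bool" where
  "generates R M G N \<longleftrightarrow> finite G \<and> G \<subseteq> N \<and> (\<forall>N'. submod R M N' \<and> G \<subseteq> N' \<longrightarrow> N \<subseteq> N')"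

lemma generatesD: "generates R M G N \<Longrightarrow> submod R M N' \<Longrightarrow> G \<subseteq> N' \<Longrightarrow> N \<subseteq> N'"
  by (simp add: generates_def)

lemma fg_module_iff: "fg_module R M \<longleftrightarrow> left_module R M \<and> (\<exists>G. generates R M G (carrier M))"
proof
  assume fg: "fg_module R M"
  then interpret left_module R M by (simp add: fg_module_def)
  obtain G where G: "finite G" "G \<subseteq> carrier M"
     "\<forall>x \<in> carrier M. \<exists>c \<in> G \<rightarrow> carrier R. x = (\<Oplus>\<^bsub>M\<^esub>g\<in>G. c g \<odot>\<^bsub>M\<^esub> g)"
    using fg unfolding fg_module_def by blast
  have "x \<in> N" if "submod R M N" "G \<subseteq> N" "x \<in> carrier M" for x N
    using G(3) submod_finsum[OF that(1) G(1) that(2)] that(3) by auto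
  then have "generates R M G (carrier M)" unfolding generates_def using G(1,2) by blast
  then show "left_module R M \<and> (\<exists>G. generates R M G (carrier M))" using left_module_axioms by blast
next
  assume h: "left_module R M \<and> (\<exists>G. generates R M G (carrier M))"
  then interpret left_module R M by blast
  obtain G where G: "generates R M G (carrier M)" using h by blast
  then have f: "finite G" "G \<subseteq> carrier M" by (auto simp: generates_def)
  have "carrier M \<subseteq> {x. \<exists>c \<in> G \<rightarrow> carrier R. x = (\<Oplus>\<^bsub>M\<^esub>g\<in>G. c g \<odot>\<^bsub>M\<^esub> g)}"
    using G span_submod[OF f] unfolding generates_def by blast
  then show "fg_module R M" unfolding fg_module_def using left_module_axioms f by blast
qed

subsection \<open>Homomorphisms\<close>

lemma module_homI:
  assumes "f \<in> carrier M \<rightarrow>\<^sub>E carrier N"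
    "\<And>x y. x \<in> carrier M \<Longrightarrow> y \<in> carrier M \<Longrightarrow> f (x \<oplus>\<^bsub>M\<^esub> y) = f x \<oplus>\<^bsub>N\<^esub> f y"
    "\<And>r x. r \<in> carrier R \<Longrightarrow> x \<in> carrier M \<Longrightarrow> f (r \<odot>\<^bsub>M\<^esub> x) = r \<odot>\<^bsub>N\<^esub> f x"
  shows "f \<in> module_hom R M N"
  using assms by (simp add: module_hom_def)

lemma module_homD:
  assumes "f \<in> module_hom R M N"
  shows "x \<in> carrier M \<Longrightarrow> f x \<in> carrier N" "x \<notin> carrier M \<Longrightarrow> f x = undefined"
    "x \<in> carrier M \<Longrightarrow> y \<in> carrier M \<Longrightarrow> f (x \<oplus>\<^bsub>M\<^esub> y) = f x \<oplus>\<^bsub>N\<^esub> f y"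
    "r \<in> carrier R \<Longrightarrow> x \<in> carrier M \<Longrightarrow> f (r \<odot>\<^bsub>M\<^esub> x) = r \<odot>\<^bsub>N\<^esub> f x"
  using assms by (auto simp: module_hom_def)

lemma module_hom_zero:
  assumes "f \<in> module_hom R M N" "left_module R M" "left_module R N"
  shows "f \<zero>\<^bsub>M\<^esub> = \<zero>\<^bsub>N\<^esub>"
proof -
  interpret M: left_module R M by fact
  interpret N: left_module R N by fact
  have "f (\<zero>\<^bsub>R\<^esub> \<odot>\<^bsub>M\<^esub> \<zero>\<^bsub>M\<^esub>) = \<zero>\<^bsub>R\<^esub> \<odot>\<^bsub>N\<^esub> f \<zero>\<^bsub>M\<^esub>" using module_homD(4)[OF assms(1)] by simp
  then show ?thesis using module_homD(1)[OF assms(1)] by (simp add: M.zero_smult N.zero_smult)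
qed

lemma module_hom_minus:
  assumes "f \<in> module_hom R M N" "left_module R M" "left_module R N" "x \<in> carrier M"
  shows "f (\<ominus>\<^bsub>M\<^esub> x) = \<ominus>\<^bsub>N\<^esub> f x"
proof -
  interpret M: left_module R M by fact
  interpret N: left_module R N by fact
  show ?thesis using module_homD(1,4)[OF assms(1)] assms(4)
    by (simp add: M.minus_smult[symmetric] N.minus_smult[symmetric])
qed

lemma module_hom_kernel_submod:
  assumes f: "f \<in> module_hom R M N" "left_module R M" "left_module R N"
  shows "submod R M {x \<in> carrier M. f x = \<zero>\<^bsub>N\<^esub>}"
proof -
  interpret M: left_module R M by fact
  interpret N: left_module R N by fact
  show ?thesis unfolding submod_def
    using module_homD[OF f(1)] module_hom_zero[OF f] M.smult_closed N.smult_zero by auto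
qed

lemma module_hom_image_submod:
  assumes f: "f \<in> module_hom R M N" "left_module R M" "left_module R N" and P: "submod R M P"
  shows "submod R N (f ` P)"
proof -
  interpret M: left_module R M by fact
  interpret N: left_module R N by fact
  note F = module_homD[OF f(1)] and D = submodD[OF P]
  have P: "x \<in> P \<Longrightarrow> x \<in> carrier M" for x using D(1) by blast
  show ?thesis unfolding submod_def
  proof (intro conjI ballI)
    show "f ` P \<subseteq> carrier N" using F(1) P by blast
    show "\<zero>\<^bsub>N\<^esub> \<in> f ` P" using D(2) module_hom_zero[OF f] by (metis image_eqI)
  next
    fix x y assume "x \<in> f ` P" "y \<in> f ` P"
    then obtain x' y' where "x' \<in> P" "y' \<in> P" "x = f x'" "y = f y'" by blast
    then show "x \<oplus>\<^bsub>N\<^esub> y \<in> f ` P" using F(3)[of x' y'] P D(3) by (metis image_eqI)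
  next
    fix r x assume r: "r \<in> carrier R" and "x \<in> f ` P"
    then obtain x' where "x' \<in> P" "x = f x'" by blast
    then show "r \<odot>\<^bsub>N\<^esub> x \<in> f ` P" using F(4)[OF r, of x'] P D(4)[OF r] by (metis image_eqI)
  qed
qed

lemma module_hom_vimage_submod:
  assumes f: "f \<in> module_hom R M N" "left_module R M" "left_module R N" and P: "submod R N P"
  shows "submod R M {x \<in> carrier M. f x \<in> P}"
proof -
  interpret M: left_module R M by fact
  interpret N: left_module R N by fact
  show ?thesis unfolding submod_def
    using module_homD[OF f(1)] module_hom_zero[OF f] M.smult_closed submodD[OF P] by auto
qed

lemma generates_image:
  assumes f: "f \<in> module_hom R M N" "left_module R M" "left_module R N"
    and G: "generates R M G (carrier M)"
  shows "generates R N (f ` G) (f ` carrier M)"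
  unfolding generates_def
proof (intro conjI allI impI)
  show "finite (f ` G)" "f ` G \<subseteq> f ` carrier M" using G by (auto simp: generates_def)
  fix N' assume h: "submod R N N' \<and> f ` G \<subseteq> N'"
  have "carrier M \<subseteq> {x \<in> carrier M. f x \<in> N'}"
    using G module_hom_vimage_submod[OF f, of N'] h unfolding generates_def by blast
  then show "f ` carrier M \<subseteq> N'" by blast
qed

text \<open>
  The objects of \<open>mod_cat R\<close> are modules on lists over \<open>R\<close>, so a direct product has to be carried by
  lists again.  Two distinct letters suffice to code a pair of lists injectively: \<open>a\<close> announces a
  further letter of the first list, and \<open>b\<close> announces that the rest is the second list.
\<close>

fun code_pair :: "'a \<Rightarrow> 'a \<Rightarrow> 'a list \<Rightarrow> 'a list \<Rightarrow> 'a list" where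
  "code_pair a b [] ys = b # ys"
| "code_pair a b (x # xs) ys = a # x # code_pair a b xs ys"

lemma code_pair_inj: "a \<noteq> b \<Longrightarrow> code_pair a b xs ys = code_pair a b xs' ys' \<Longrightarrow> xs = xs' \<and> ys = ys'"
proof (induction xs arbitrary: xs')
  case Nil then show ?case by (cases xs') auto
next
  case (Cons x xs) then show ?case by (cases xs') auto
qed

definition product_module :: "('r, 'v) module \<Rightarrow> ('r, 'w) module \<Rightarrow> ('r, 'v \<times> 'w) module" where
  "product_module M N = \<lparr>carrier = carrier M \<times> carrier N, mult = undefined, one = undefined,
     zero = (\<zero>\<^bsub>M\<^esub>, \<zero>\<^bsub>N\<^esub>), add = (\<lambda>(x, y) (x', y'). (x \<oplus>\<^bsub>M\<^esub> x', y \<oplus>\<^bsub>N\<^esub> y')),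
     smult = (\<lambda>r (x, y). (r \<odot>\<^bsub>M\<^esub> x, r \<odot>\<^bsub>N\<^esub> y))\<rparr>"

lemma product_module:
  assumes "left_module R M" "left_module R N"
  shows "left_module R (product_module M N)"
proof -
  interpret M: left_module R M by fact
  interpret N: left_module R N by fact
  show ?thesis
  proof (intro left_module.intro M.R.ring_axioms left_module_axioms.intro abelian_groupI)
    fix x assume "x \<in> carrier (product_module M N)"
    then show "\<exists>y\<in>carrier (product_module M N). y \<oplus>\<^bsub>product_module M N\<^esub> x = \<zero>\<^bsub>product_module M N\<^esub>"
      by (intro bexI[of _ "(\<ominus>\<^bsub>M\<^esub> fst x, \<ominus>\<^bsub>N\<^esub> snd x)"]) (auto simp: product_module_def M.M.l_neg N.M.l_neg)
  qed (auto simp: product_module_def M.M.a_ac N.M.a_ac M.smult_closed N.smult_closed M.smult_l_distr N.smult_l_distr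
      M.smult_r_distr N.smult_r_distr M.smult_assoc N.smult_assoc M.smult_one N.smult_one)
qed

definition transport_module :: "('v \<Rightarrow> 'w) \<Rightarrow> ('w \<Rightarrow> 'v) \<Rightarrow> ('r, 'v) module \<Rightarrow> ('r, 'w) module" where
  "transport_module r d M = \<lparr>carrier = r ` carrier M, mult = undefined, one = undefined,
     zero = r \<zero>\<^bsub>M\<^esub>, add = (\<lambda>u v. r (d u \<oplus>\<^bsub>M\<^esub> d v)), smult = (\<lambda>c u. r (c \<odot>\<^bsub>M\<^esub> d u))\<rparr>"

lemma transported_product:
  fixes M N :: "('r, 'r list) module"
  assumes M: "fg_module R M" and N: "fg_module R N" and ab: "(a :: 'r) \<noteq> b"
  obtains P :: "('r, 'r list) module" and e where
    "fg_module R P" "carrier P = (\<lambda>(x, y). e x y) ` (carrier M \<times> carrier N)"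
    "\<And>x y x' y'. e x y = e x' y' \<longleftrightarrow> x = x' \<and> y = y'"
    "\<And>x y x' y'. x \<in> carrier M \<Longrightarrow> y \<in> carrier N \<Longrightarrow> x' \<in> carrier M \<Longrightarrow> y' \<in> carrier N \<Longrightarrow>
       e x y \<oplus>\<^bsub>P\<^esub> e x' y' = e (x \<oplus>\<^bsub>M\<^esub> x') (y \<oplus>\<^bsub>N\<^esub> y')"
    "\<And>r x y. r \<in> carrier R \<Longrightarrow> x \<in> carrier M \<Longrightarrow> y \<in> carrier N \<Longrightarrow> r \<odot>\<^bsub>P\<^esub> e x y = e (r \<odot>\<^bsub>M\<^esub> x) (r \<odot>\<^bsub>N\<^esub> y)"
    "\<zero>\<^bsub>P\<^esub> = e \<zero>\<^bsub>M\<^esub> \<zero>\<^bsub>N\<^esub>"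
proof -
  have lM: "left_module R M" and lN: "left_module R N" using M N by (auto simp: fg_module_def)
  interpret M: left_module R M by fact
  interpret N: left_module R N by fact
  interpret MN: left_module R "product_module M N" by (rule product_module[OF lM lN])
  define e where "e = code_pair a b"
  have inj: "e x y = e x' y' \<longleftrightarrow> x = x' \<and> y = y'" for x y x' y' using code_pair_inj[OF ab] unfolding e_def by blast
  define r where "r = (\<lambda>(x, y). e x y)"
  have ir: "inj r" unfolding r_def by (auto simp: inj_def inj)
  define d where "d = inv_into UNIV r"
  have d: "d (e x y) = (x, y)" for x y using inv_f_f[OF ir, of "(x, y)"] by (simp add: d_def r_def)
  define P where "P = transport_module r d (product_module M N)"
  have add: "e x y \<oplus>\<^bsub>P\<^esub> e x' y' = e (x \<oplus>\<^bsub>M\<^esub> x') (y \<oplus>\<^bsub>N\<^esub> y')" for x y x' y'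
    by (simp add: P_def transport_module_def d product_module_def r_def)
  have smult: "c \<odot>\<^bsub>P\<^esub> e x y = e (c \<odot>\<^bsub>M\<^esub> x) (c \<odot>\<^bsub>N\<^esub> y)" for c x y
    by (simp add: P_def transport_module_def d product_module_def r_def)
  have C: "carrier P = r ` (carrier M \<times> carrier N)" and z: "\<zero>\<^bsub>P\<^esub> = e \<zero>\<^bsub>M\<^esub> \<zero>\<^bsub>N\<^esub>" by (simp_all add: P_def transport_module_def product_module_def r_def)
  have lP: "left_module R P"
    by (rule MN.image_module[of _ r]) (auto simp: C z add smult product_module_def r_def)
  have eC: "e x y \<in> carrier P \<longleftrightarrow> x \<in> carrier M \<and> y \<in> carrier N" for x y
    by (auto simp: C r_def inj)
  define j where "j = (\<lambda>x\<in>carrier M. e x \<zero>\<^bsub>N\<^esub>)"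
  define k where "k = (\<lambda>y\<in>carrier N. e \<zero>\<^bsub>M\<^esub> y)"
  have j: "j \<in> module_hom R M P"
    by (rule module_homI) (auto simp: j_def eC add smult N.smult_zero M.smult_closed)
  have k: "k \<in> module_hom R N P"
    by (rule module_homI) (auto simp: k_def eC add smult M.smult_zero N.smult_closed)
  obtain G H where G: "generates R M G (carrier M)" "generates R N H (carrier N)"
    using M N unfolding fg_module_iff by blast
  have "generates R P (j ` G \<union> k ` H) (carrier P)"
    unfolding generates_def
  proof (intro conjI allI impI)
    show "finite (j ` G \<union> k ` H)" using G by (auto simp: generates_def)
    show "j ` G \<union> k ` H \<subseteq> carrier P" using G module_homD(1)[OF j] module_homD(1)[OF k] unfolding generates_def by blast
    fix N' assume h: "submod R P N' \<and> j ` G \<union> k ` H \<subseteq> N'"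
    have 1: "j ` carrier M \<subseteq> N'" "k ` carrier N \<subseteq> N'"
      using generatesD[OF generates_image[OF j lM lP G(1)]] generatesD[OF generates_image[OF k lN lP G(2)]] h by auto
    show "carrier P \<subseteq> N'"
    proof
      fix u assume "u \<in> carrier P"
      then obtain x y where u: "u = e x y" "x \<in> carrier M" "y \<in> carrier N" by (auto simp: C r_def)
      have "u = j x \<oplus>\<^bsub>P\<^esub> k y" using u by (simp add: j_def k_def add)
      moreover have "j x \<in> N'" "k y \<in> N'" using 1 u by auto
      ultimately show "u \<in> N'" using submodD(3)[of R P N'] h by blast
    qed
  qed
  then have "fg_module R P" unfolding fg_module_iff using lP by blast
  then show ?thesis using that[of P e] C inj add smult z by (simp add: r_def)
qed

subsection \<open>The category of finitely generated modules\<close>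

text \<open>Being noetherian, tested on the modules that occur as objects of \<open>mod_cat R\<close>.\<close>

definition noetherian_on_lists :: "'r ring \<Rightarrow> bool" where
  "noetherian_on_lists R \<longleftrightarrow> (\<forall>M :: ('r, 'r list) module. fg_module R M \<longrightarrow>
     (\<forall>N. submod R M N \<longrightarrow> (\<exists>G. generates R M G N)))"

lemma fg_left_module: "fg_module R M \<Longrightarrow> left_module R M"
  by (simp add: fg_module_def)

lemma mod_cat_simps:
  "Obj (mod_cat R) = {M. fg_module R M}" "Dom (mod_cat R) (M, N, f) = M" "Cod (mod_cat R) (M, N, f) = N"
  "Id (mod_cat R) M = (M, M, \<lambda>x\<in>carrier M. x)"
  "Comp (mod_cat R) (N, K, g) (M, N', f) = (M, K, compose (carrier M) g f)"
  "Plus (mod_cat R) (M, N, f) (M', N', g) = (M, N, \<lambda>x\<in>carrier M. f x \<oplus>\<^bsub>N\<^esub> g x)"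
  "Zero (mod_cat R) M N = (M, N, \<lambda>x\<in>carrier M. \<zero>\<^bsub>N\<^esub>)"
  "(M, N, f) \<in> Arr (mod_cat R) \<longleftrightarrow> fg_module R M \<and> fg_module R N \<and> f \<in> module_hom R M N"
  by (simp_all add: mod_cat_def)

lemma Hom_mod_cat: "(M', N', f) \<in> Hom (mod_cat R) M N \<longleftrightarrow> M' = M \<and> N' = N \<and> fg_module R M \<and> fg_module R N \<and> f \<in> module_hom R M N"
  by (auto simp: Hom_def mod_cat_simps)

lemma Hom_mod_catE:
  assumes "F \<in> Hom (mod_cat R) M N"
  obtains f where "F = (M, N, f)" "fg_module R M" "fg_module R N" "f \<in> module_hom R M N"
proof -
  obtain M' N' f where F: "F = (M', N', f)" by (rule prod_cases3)
  show ?thesis using that[of f] assms unfolding F Hom_mod_cat by blast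
qed

lemma Arr_mod_catE:
  assumes "F \<in> Arr (mod_cat R)"
  obtains M N f where "F = (M, N, f)" "fg_module R M" "fg_module R N" "f \<in> module_hom R M N"
proof -
  obtain M' N' f where F: "F = (M', N', f)" by (rule prod_cases3)
  show ?thesis using that[of M' N' f] assms unfolding F mod_cat_simps by blast
qed

lemma module_homI':
  assumes "left_module R M" "\<And>x. x \<in> carrier M \<Longrightarrow> f x \<in> carrier N"
    "\<And>x y. x \<in> carrier M \<Longrightarrow> y \<in> carrier M \<Longrightarrow> f (x \<oplus>\<^bsub>M\<^esub> y) = f x \<oplus>\<^bsub>N\<^esub> f y"
    "\<And>r x. r \<in> carrier R \<Longrightarrow> x \<in> carrier M \<Longrightarrow> f (r \<odot>\<^bsub>M\<^esub> x) = r \<odot>\<^bsub>N\<^esub> f x"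
  shows "(\<lambda>x\<in>carrier M. f x) \<in> module_hom R M N"
proof -
  interpret left_module R M by fact
  show ?thesis by (rule module_homI) (use assms smult_closed in auto)
qed

lemma compose_hom:
  assumes "left_module R M" "f \<in> module_hom R M N" "g \<in> module_hom R N K"
  shows "compose (carrier M) g f \<in> module_hom R M K"
  unfolding compose_def
  by (rule module_homI'[OF assms(1)]) (use module_homD[OF assms(2)] module_homD[OF assms(3)] in auto)

lemma id_hom: "left_module R M \<Longrightarrow> (\<lambda>x\<in>carrier M. x) \<in> module_hom R M M"
  by (rule module_homI') auto

lemma zero_hom: assumes "left_module R M" "left_module R N"
  shows "(\<lambda>x\<in>carrier M. \<zero>\<^bsub>N\<^esub>) \<in> module_hom R M N"
proof -
  interpret N: left_module R N by fact
  show ?thesis by (rule module_homI'[OF assms(1)]) (auto simp: N.smult_zero)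
qed

lemma plus_hom: assumes "left_module R M" "left_module R N" "f \<in> module_hom R M N" "g \<in> module_hom R M N"
  shows "(\<lambda>x\<in>carrier M. f x \<oplus>\<^bsub>N\<^esub> g x) \<in> module_hom R M N"
proof -
  interpret N: left_module R N by fact
  show ?thesis by (rule module_homI'[OF assms(1)])
    (use module_homD[OF assms(3)] module_homD[OF assms(4)] in \<open>auto simp: N.smult_r_distr N.M.a_ac\<close>)
qed

lemma minus_hom: assumes "left_module R M" "left_module R N" "f \<in> module_hom R M N"
  shows "(\<lambda>x\<in>carrier M. \<ominus>\<^bsub>N\<^esub> f x) \<in> module_hom R M N"
proof -
  interpret N: left_module R N by fact
  show ?thesis by (rule module_homI'[OF assms(1)])
    (use module_homD[OF assms(3)] in \<open>auto simp: N.M.minus_add N.smult_minus\<close>)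
qed

lemma hom_ext:
  assumes "f \<in> module_hom R M N" "g \<in> module_hom R M N'" "\<And>x. x \<in> carrier M \<Longrightarrow> f x = g x"
  shows "f = g"
  by (rule ext) (use module_homD(2)[OF assms(1)] module_homD(2)[OF assms(2)] assms(3) in metis)

theorem mod_cat_preadditive: "preadditive_category (mod_cat R)"
proof
  show "Dom (mod_cat R) f \<in> Obj (mod_cat R)" "Cod (mod_cat R) f \<in> Obj (mod_cat R)" if hyp: "f \<in> Arr (mod_cat R)" for f
    using hyp by (auto elim!: Arr_mod_catE simp: mod_cat_simps)
  show "Id (mod_cat R) M \<in> Hom (mod_cat R) M M" if "M \<in> Obj (mod_cat R)" for M
    using that by (auto simp: mod_cat_simps Hom_mod_cat intro!: id_hom fg_left_module)
  show "Comp (mod_cat R) G F \<in> Hom (mod_cat R) M K" if hyp: "F \<in> Hom (mod_cat R) M N" "G \<in> Hom (mod_cat R) N K" for F G M N K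
  proof -
    obtain f where f: "F = (M, N, f)" "fg_module R M" "f \<in> module_hom R M N" using Hom_mod_catE[OF hyp(1)] .
    obtain g where g: "G = (N, K, g)" "fg_module R K" "g \<in> module_hom R N K" using Hom_mod_catE[OF hyp(2)] .
    show ?thesis using compose_hom[OF fg_left_module[OF f(2)] f(3) g(3)] f(1,2) g(1,2)
      by (simp add: mod_cat_simps Hom_mod_cat)
  qed
  show "Comp (mod_cat R) F (Id (mod_cat R) M) = F" "Comp (mod_cat R) (Id (mod_cat R) N) F = F"
    if hyp: "F \<in> Hom (mod_cat R) M N" for F M N
  proof -
    obtain f where f: "F = (M, N, f)" "fg_module R M" "fg_module R N" "f \<in> module_hom R M N" using Hom_mod_catE[OF hyp] .
    note l = fg_left_module[OF f(2)] fg_left_module[OF f(3)]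
    have "compose (carrier M) f (\<lambda>x\<in>carrier M. x) = f"
      by (rule hom_ext[OF compose_hom[OF l(1) id_hom[OF l(1)] f(4)] f(4)]) (simp add: compose_def)
    then show "Comp (mod_cat R) F (Id (mod_cat R) M) = F" by (simp add: f mod_cat_simps)
    have "compose (carrier M) (\<lambda>x\<in>carrier N. x) f = f"
      by (rule hom_ext[OF compose_hom[OF l(1) f(4) id_hom[OF l(2)]] f(4)]) (use module_homD(1)[OF f(4)] in \<open>simp add: compose_def\<close>)
    then show "Comp (mod_cat R) (Id (mod_cat R) N) F = F" by (simp add: f mod_cat_simps)
  qed
  show "Comp (mod_cat R) H (Comp (mod_cat R) G F) = Comp (mod_cat R) (Comp (mod_cat R) H G) F"
    if hyp: "F \<in> Hom (mod_cat R) W X" "G \<in> Hom (mod_cat R) X Y" "H \<in> Hom (mod_cat R) Y Z" for F G H W X Y Z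
  proof -
    obtain f where f: "F = (W, X, f)" "f \<in> module_hom R W X" using Hom_mod_catE[OF hyp(1)] .
    obtain g where g: "G = (X, Y, g)" using Hom_mod_catE[OF hyp(2)] .
    obtain h where h: "H = (Y, Z, h)" using Hom_mod_catE[OF hyp(3)] .
    have "compose (carrier W) h (compose (carrier W) g f) = compose (carrier W) (compose (carrier X) h g) f"
      using module_homD(1)[OF f(2)] by (auto simp: compose_def fun_eq_iff)
    then show ?thesis by (simp add: f g h mod_cat_simps)
  qed
  fix F G M N assume F: "F \<in> Hom (mod_cat R) M N" and G: "G \<in> Hom (mod_cat R) M N"
  obtain f where f: "F = (M, N, f)" "fg_module R M" "fg_module R N" "f \<in> module_hom R M N" using Hom_mod_catE[OF F] .
  obtain g where g: "G = (M, N, g)" "g \<in> module_hom R M N" using Hom_mod_catE[OF G] .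
  note l = fg_left_module[OF f(2)] fg_left_module[OF f(3)]
  interpret N: left_module R N by (rule l(2))
  note fD = module_homD(1)[OF f(4)] and gD = module_homD(1)[OF g(2)]
  show "Plus (mod_cat R) F G \<in> Hom (mod_cat R) M N"
    using f g plus_hom[OF l f(4) g(2)] by (simp add: mod_cat_simps Hom_mod_cat)
  show "Plus (mod_cat R) F G = Plus (mod_cat R) G F"
    using fD gD by (auto simp: f g mod_cat_simps fun_eq_iff restrict_def N.M.a_comm)
  show "Plus (mod_cat R) (Plus (mod_cat R) F G) H = Plus (mod_cat R) F (Plus (mod_cat R) G H)"
    if hyp: "H \<in> Hom (mod_cat R) M N" for H
  proof -
    obtain h where h: "H = (M, N, h)" "h \<in> module_hom R M N" using Hom_mod_catE[OF hyp] .
    show ?thesis using fD gD module_homD(1)[OF h(2)]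
      by (auto simp: f g h mod_cat_simps fun_eq_iff restrict_def N.M.a_assoc)
  qed
  show "Comp (mod_cat R) H (Plus (mod_cat R) F G) = Plus (mod_cat R) (Comp (mod_cat R) H F) (Comp (mod_cat R) H G)"
    if hyp: "H \<in> Hom (mod_cat R) N K" for H K
  proof -
    obtain h where h: "H = (N, K, h)" "h \<in> module_hom R N K" using Hom_mod_catE[OF hyp] .
    show ?thesis using fD gD module_homD(3)[OF h(2)]
      by (auto simp: f g h mod_cat_simps fun_eq_iff restrict_def compose_def)
  qed
  show "Comp (mod_cat R) (Plus (mod_cat R) F G) H = Plus (mod_cat R) (Comp (mod_cat R) F H) (Comp (mod_cat R) G H)"
    if hyp: "H \<in> Hom (mod_cat R) K M" for H K
  proof -
    obtain h where h: "H = (K, M, h)" "h \<in> module_hom R K M" using Hom_mod_catE[OF hyp] .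
    show ?thesis using module_homD(1)[OF h(2)]
      by (auto simp: f g h mod_cat_simps fun_eq_iff restrict_def compose_def)
  qed
  have z: "(\<lambda>x\<in>carrier M. f x \<oplus>\<^bsub>N\<^esub> (\<lambda>x\<in>carrier M. \<zero>\<^bsub>N\<^esub>) x) = f"
    by (rule hom_ext[OF plus_hom[OF l f(4) zero_hom[OF l]] f(4)]) (use fD in simp)
  show "Plus (mod_cat R) F (Zero (mod_cat R) M N) = F" unfolding f(1) mod_cat_simps z ..
  have n: "(\<lambda>x\<in>carrier M. f x \<oplus>\<^bsub>N\<^esub> (\<lambda>x\<in>carrier M. \<ominus>\<^bsub>N\<^esub> f x) x) = (\<lambda>x\<in>carrier M. \<zero>\<^bsub>N\<^esub>)"
    by (rule hom_ext[OF plus_hom[OF l f(4) minus_hom[OF l f(4)]] zero_hom[OF l]]) (use fD N.M.r_neg in simp)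
  show "\<exists>g\<in>Hom (mod_cat R) M N. Plus (mod_cat R) F g = Zero (mod_cat R) M N"
    by (rule bexI[of _ "(M, N, \<lambda>x\<in>carrier M. \<ominus>\<^bsub>N\<^esub> f x)"])
      (unfold f(1) mod_cat_simps Hom_mod_cat n, use f(2,3) minus_hom[OF l f(4)] in auto)
next
  show "Zero (mod_cat R) M N \<in> Hom (mod_cat R) M N" if "M \<in> Obj (mod_cat R)" "N \<in> Obj (mod_cat R)" for M N
    using that by (auto simp: mod_cat_simps Hom_mod_cat intro!: zero_hom fg_left_module)
qed

lemma submodule_inclusion:
  assumes M: "fg_module R M" and N: "submod R M N" "generates R M G N"
  shows "fg_module R (M\<lparr>carrier := N\<rparr>)" "(\<lambda>x\<in>N. x) \<in> module_hom R (M\<lparr>carrier := N\<rparr>) M"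
proof -
  interpret M: left_module R M by (rule fg_left_module[OF M])
  have l: "left_module R (M\<lparr>carrier := N\<rparr>)" by (rule M.submodule_module[OF N(1)])
  have "submod R M N'" if "submod R (M\<lparr>carrier := N\<rparr>) N'" for N'
    using that N(1) unfolding submod_def by auto
  then have "generates R (M\<lparr>carrier := N\<rparr>) G (carrier (M\<lparr>carrier := N\<rparr>))"
    using N(2) unfolding generates_def by simp
  then show "fg_module R (M\<lparr>carrier := N\<rparr>)" unfolding fg_module_iff using l by blast
  show "(\<lambda>x\<in>N. x) \<in> module_hom R (M\<lparr>carrier := N\<rparr>) M"
    using module_homI'[OF l, of "\<lambda>x. x" M] submodD(1)[OF N(1)] by auto
qed

lemma kernel_ex:
  assumes noeth: "noetherian_on_lists R" and f: "f \<in> module_hom R M N" and M: "fg_module R M" and N: "fg_module R N"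
  defines "K \<equiv> M\<lparr>carrier := {x \<in> carrier M. f x = \<zero>\<^bsub>N\<^esub>}\<rparr>"
  shows "is_kernel (mod_cat R) (M, N, f) (K, M, \<lambda>x\<in>carrier K. x)" "fg_module R K"
proof -
  note l = fg_left_module[OF M] fg_left_module[OF N]
  have s: "submod R M {x \<in> carrier M. f x = \<zero>\<^bsub>N\<^esub>}" by (rule module_hom_kernel_submod[OF f l])
  obtain G where G: "generates R M G {x \<in> carrier M. f x = \<zero>\<^bsub>N\<^esub>}" using noeth M s unfolding noetherian_on_lists_def by blast
  note I = submodule_inclusion[OF M s G]
  show K: "fg_module R K" unfolding K_def by (rule I(1))
  have i: "(\<lambda>x\<in>carrier K. x) \<in> module_hom R K M" using I(2) by (simp add: K_def)
  show "is_kernel (mod_cat R) (M, N, f) (K, M, \<lambda>x\<in>carrier K. x)"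
    unfolding is_kernel_def mod_cat_simps
  proof (intro conjI allI ballI impI)
    fix W g assume g: "g \<in> Hom (mod_cat R) W M" "Comp (mod_cat R) (M, N, f) g = (W, N, \<lambda>x\<in>carrier W. \<zero>\<^bsub>N\<^esub>)"
    obtain g' where g': "g = (W, M, g')" "fg_module R W" "g' \<in> module_hom R W M" using Hom_mod_catE[OF g(1)] .
    note G = module_homD[OF g'(3)] and W = fg_left_module[OF g'(2)]
    have z: "f (g' x) = \<zero>\<^bsub>N\<^esub>" if "x \<in> carrier W" for x
      using g(2) that unfolding g'(1) mod_cat_simps by (auto simp: compose_def fun_eq_iff split: if_splits)
    have h: "g' \<in> module_hom R W K"
      by (rule module_homI) (use G z in \<open>auto simp: K_def\<close>)
    have c: "compose (carrier W) (\<lambda>x\<in>carrier K. x) g' = g'"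
      by (rule hom_ext[OF compose_hom[OF W h i] h]) (use module_homD(1)[OF h] in \<open>simp add: compose_def\<close>)
    show "\<exists>!h. h \<in> Hom (mod_cat R) W K \<and> Comp (mod_cat R) (K, M, \<lambda>x\<in>carrier K. x) h = g"
    proof (rule ex1I[of _ "(W, K, g')"])
      show "(W, K, g') \<in> Hom (mod_cat R) W K \<and> Comp (mod_cat R) (K, M, \<lambda>x\<in>carrier K. x) (W, K, g') = g"
        using h g' K c by (simp add: Hom_mod_cat mod_cat_simps)
      fix h' assume h': "h' \<in> Hom (mod_cat R) W K \<and> Comp (mod_cat R) (K, M, \<lambda>x\<in>carrier K. x) h' = g"
      then obtain k where k: "h' = (W, K, k)" "k \<in> module_hom R W K" using Hom_mod_catE by blast
      have "compose (carrier W) (\<lambda>x\<in>carrier K. x) k = g'" using h' unfolding k g' mod_cat_simps by simp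
      moreover have "compose (carrier W) (\<lambda>x\<in>carrier K. x) k = k"
        by (rule hom_ext[OF compose_hom[OF W k(2) i] k(2)]) (use module_homD(1)[OF k(2)] in \<open>simp add: compose_def\<close>)
      ultimately show "h' = (W, K, g')" using k by simp
    qed
  next
    show "(K, N, compose (carrier K) f (\<lambda>x\<in>carrier K. x)) = (K, N, \<lambda>x\<in>carrier K. \<zero>\<^bsub>N\<^esub>)"
      by (auto simp: compose_def K_def fun_eq_iff)
  qed (use f M N K i in auto)
qed

text \<open>
  The quotient by a submodule is realised on a chosen set of representatives of the cosets, so that its
  elements have the same type as those of the module.
\<close>

lemma quotient_ex:
  fixes N :: "('r, 'v) module"
  assumes N: "fg_module R N" and P: "submod R N P"
  obtains C r where "fg_module R C" "(\<lambda>x\<in>carrier N. r x) \<in> module_hom R N C" "carrier C = r ` carrier N"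
    "\<And>x. x \<in> carrier N \<Longrightarrow> r x \<in> carrier N" "\<And>x y. x \<in> carrier N \<Longrightarrow> y \<in> carrier N \<Longrightarrow> r x = r y \<longleftrightarrow> x \<ominus>\<^bsub>N\<^esub> y \<in> P"
    "\<And>x. x \<in> carrier N \<Longrightarrow> x \<ominus>\<^bsub>N\<^esub> r x \<in> P"
proof -
  interpret N: left_module R N by (rule fg_left_module[OF N])
  note D = submodD[OF P]
  have PN: "x \<in> P \<Longrightarrow> x \<in> carrier N" for x using D(1) by blast
  define r where "r x = (SOME y. y \<in> carrier N \<and> x \<ominus>\<^bsub>N\<^esub> y \<in> P)" for x
  have r: "r x \<in> carrier N" "x \<ominus>\<^bsub>N\<^esub> r x \<in> P" if "x \<in> carrier N" for x
  proof -
    have "\<exists>y. y \<in> carrier N \<and> x \<ominus>\<^bsub>N\<^esub> y \<in> P"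
      by (rule exI[of _ x]) (use that D(2) in \<open>simp add: a_minus_def N.M.r_neg\<close>)
    from someI_ex[OF this] show "r x \<in> carrier N" "x \<ominus>\<^bsub>N\<^esub> r x \<in> P" unfolding r_def by auto
  qed
  have sym: "y \<ominus>\<^bsub>N\<^esub> x \<in> P" if "x \<ominus>\<^bsub>N\<^esub> y \<in> P" "x \<in> carrier N" "y \<in> carrier N" for x y
  proof -
    have "y \<ominus>\<^bsub>N\<^esub> x = \<ominus>\<^bsub>N\<^esub> (x \<ominus>\<^bsub>N\<^esub> y)" using that by (simp add: a_minus_def N.M.minus_add N.M.a_comm)
    then show ?thesis using N.submod_minus[OF P that(1)] by simp
  qed
  have tr: "x \<ominus>\<^bsub>N\<^esub> z \<in> P" if "x \<ominus>\<^bsub>N\<^esub> y \<in> P" "y \<ominus>\<^bsub>N\<^esub> z \<in> P" "x \<in> carrier N" "y \<in> carrier N" "z \<in> carrier N" for x y z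
  proof -
    have "x \<ominus>\<^bsub>N\<^esub> z = (x \<ominus>\<^bsub>N\<^esub> y) \<oplus>\<^bsub>N\<^esub> (y \<ominus>\<^bsub>N\<^esub> z)"
      using that(3-5) by (simp add: a_minus_def N.M.a_assoc N.M.r_neg1)
    then show ?thesis using D(3) that by simp
  qed
  have eq: "r x = r y \<longleftrightarrow> x \<ominus>\<^bsub>N\<^esub> y \<in> P" if xy: "x \<in> carrier N" "y \<in> carrier N" for x y
  proof
    assume "r x = r y"
    moreover have "r y \<ominus>\<^bsub>N\<^esub> y \<in> P" by (rule sym[OF r(2)[OF xy(2)] xy(2) r(1)[OF xy(2)]])
    ultimately show "x \<ominus>\<^bsub>N\<^esub> y \<in> P" using tr[OF r(2)[OF xy(1)], of y] r(1)[OF xy(1)] xy by simp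
  next
    assume p: "x \<ominus>\<^bsub>N\<^esub> y \<in> P"
    have "z \<in> carrier N \<and> x \<ominus>\<^bsub>N\<^esub> z \<in> P \<longleftrightarrow> z \<in> carrier N \<and> y \<ominus>\<^bsub>N\<^esub> z \<in> P" for z
      using tr[OF p _ xy] tr[OF sym[OF p xy] _ xy(2,1)] by blast
    then show "r x = r y" unfolding r_def by simp
  qed
  define C :: "('r, 'v) module" where "C = \<lparr>carrier = r ` carrier N, mult = undefined, one = undefined, zero = r \<zero>\<^bsub>N\<^esub>,
    add = (\<lambda>x y. r (x \<oplus>\<^bsub>N\<^esub> y)), smult = (\<lambda>c x. r (c \<odot>\<^bsub>N\<^esub> x))\<rparr>"
  have add: "r x \<oplus>\<^bsub>C\<^esub> r y = r (x \<oplus>\<^bsub>N\<^esub> y)" if xy: "x \<in> carrier N" "y \<in> carrier N" for x y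
  proof -
    have "(x \<oplus>\<^bsub>N\<^esub> y) \<ominus>\<^bsub>N\<^esub> (r x \<oplus>\<^bsub>N\<^esub> r y) = (x \<ominus>\<^bsub>N\<^esub> r x) \<oplus>\<^bsub>N\<^esub> (y \<ominus>\<^bsub>N\<^esub> r y)"
      using xy r by (simp add: a_minus_def N.M.minus_add N.M.a_ac)
    then have "r (x \<oplus>\<^bsub>N\<^esub> y) = r (r x \<oplus>\<^bsub>N\<^esub> r y)" using eq D(3) xy r by simp
    then show ?thesis by (simp add: C_def)
  qed
  have smult: "c \<odot>\<^bsub>C\<^esub> r x = r (c \<odot>\<^bsub>N\<^esub> x)" if cx: "c \<in> carrier R" "x \<in> carrier N" for c x
  proof -
    have "c \<odot>\<^bsub>N\<^esub> (x \<ominus>\<^bsub>N\<^esub> r x) = (c \<odot>\<^bsub>N\<^esub> x) \<ominus>\<^bsub>N\<^esub> (c \<odot>\<^bsub>N\<^esub> r x)"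
      using cx r by (simp add: a_minus_def N.smult_r_distr N.smult_minus)
    then have "r (c \<odot>\<^bsub>N\<^esub> x) = r (c \<odot>\<^bsub>N\<^esub> r x)" using eq D(4)[OF cx(1) r(2)[OF cx(2)]] cx r N.smult_closed by simp
    then show ?thesis by (simp add: C_def)
  qed
  have C: "carrier C = r ` carrier N" "\<zero>\<^bsub>C\<^esub> = r \<zero>\<^bsub>N\<^esub>" by (simp_all add: C_def)
  have lC: "left_module R C" by (rule N.image_module[of C r]) (simp_all add: C add smult)
  have h: "(\<lambda>x\<in>carrier N. r x) \<in> module_hom R N C"
    by (rule module_homI'[OF N.left_module_axioms]) (simp_all add: C add smult)
  obtain G where G: "generates R N G (carrier N)" using N unfolding fg_module_iff by blast
  have "(\<lambda>x\<in>carrier N. r x) ` carrier N = carrier C" by (auto simp: C)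
  then have "fg_module R C" unfolding fg_module_iff using generates_image[OF h N.left_module_axioms lC G] lC by metis
  then show ?thesis using that[of C r] h C(1) r eq by blast
qed

lemma cokernel_ex:
  assumes f: "f \<in> module_hom R M N" and M: "fg_module R M" and N: "fg_module R N"
  obtains C r where "is_cokernel (mod_cat R) (M, N, f) (N, C, \<lambda>x\<in>carrier N. r x)" "fg_module R C"
    "(\<lambda>x\<in>carrier N. r x) \<in> module_hom R N C" "\<And>y. y \<in> carrier N \<Longrightarrow> r y = \<zero>\<^bsub>C\<^esub> \<longleftrightarrow> y \<in> f ` carrier M"
proof -
  note l = fg_left_module[OF M] fg_left_module[OF N]
  interpret M: left_module R M by (rule l(1))
  interpret N: left_module R N by (rule l(2))
  note F = module_homD[OF f]
  have P: "submod R N (f ` carrier M)" by (rule module_hom_image_submod[OF f l M.submod_carrier])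
  obtain C r where C: "fg_module R C" "(\<lambda>x\<in>carrier N. r x) \<in> module_hom R N C" "carrier C = r ` carrier N"
    "\<And>x. x \<in> carrier N \<Longrightarrow> r x \<in> carrier N"
    "\<And>x y. x \<in> carrier N \<Longrightarrow> y \<in> carrier N \<Longrightarrow> r x = r y \<longleftrightarrow> x \<ominus>\<^bsub>N\<^esub> y \<in> f ` carrier M"
    "\<And>x. x \<in> carrier N \<Longrightarrow> x \<ominus>\<^bsub>N\<^esub> r x \<in> f ` carrier M"
    using quotient_ex[OF N P] by blast
  note lC = fg_left_module[OF C(1)]
  have r0: "r \<zero>\<^bsub>N\<^esub> = \<zero>\<^bsub>C\<^esub>" using module_hom_zero[OF C(2) l(2) lC] by simp
  have z: "r y = \<zero>\<^bsub>C\<^esub> \<longleftrightarrow> y \<in> f ` carrier M" if "y \<in> carrier N" for y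
  proof -
    have m: "\<ominus>\<^bsub>N\<^esub> \<zero>\<^bsub>N\<^esub> = \<zero>\<^bsub>N\<^esub>" by (rule N.M.minus_equality) simp_all
    have "y \<ominus>\<^bsub>N\<^esub> \<zero>\<^bsub>N\<^esub> = y" unfolding a_minus_def m using that by simp
    then show ?thesis using C(5)[OF that N.M.zero_closed] unfolding r0 by simp
  qed
  have rh: "r (x \<oplus>\<^bsub>N\<^esub> y) = r x \<oplus>\<^bsub>C\<^esub> r y" "c \<in> carrier R \<Longrightarrow> r (c \<odot>\<^bsub>N\<^esub> x) = c \<odot>\<^bsub>C\<^esub> r x"
    if "x \<in> carrier N" "y \<in> carrier N" for x y c
    using module_homD(3,4)[OF C(2)] that N.smult_closed by auto
  have "is_cokernel (mod_cat R) (M, N, f) (N, C, \<lambda>x\<in>carrier N. r x)"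
    unfolding is_cokernel_def mod_cat_simps
  proof (intro conjI allI ballI impI)
    show "(M, C, compose (carrier M) (\<lambda>x\<in>carrier N. r x) f) = (M, C, \<lambda>x\<in>carrier M. \<zero>\<^bsub>C\<^esub>)"
      using F(1) z by (auto simp: compose_def fun_eq_iff)
    fix W g assume g: "g \<in> Hom (mod_cat R) N W" "Comp (mod_cat R) g (M, N, f) = (M, W, \<lambda>x\<in>carrier M. \<zero>\<^bsub>W\<^esub>)"
    obtain g' where g': "g = (N, W, g')" "fg_module R W" "g' \<in> module_hom R N W" using Hom_mod_catE[OF g(1)] .
    note G = module_homD[OF g'(3)] and lW = fg_left_module[OF g'(2)]
    interpret W: left_module R W by (rule lW)
    have gf: "g' (f x) = \<zero>\<^bsub>W\<^esub>" if "x \<in> carrier M" for x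
      using g(2) that unfolding g'(1) mod_cat_simps by (auto simp: compose_def fun_eq_iff split: if_splits)
    have gr: "g' (r x) = g' x" if x: "x \<in> carrier N" for x
    proof -
      have "g' (x \<ominus>\<^bsub>N\<^esub> r x) = \<zero>\<^bsub>W\<^esub>" using C(6)[OF x] gf by auto
      then have "g' x \<oplus>\<^bsub>W\<^esub> \<ominus>\<^bsub>W\<^esub> g' (r x) = \<zero>\<^bsub>W\<^esub>"
        using x C(4)[OF x] G(3)[of x "\<ominus>\<^bsub>N\<^esub> r x"] module_hom_minus[OF g'(3) l(2) lW] by (simp add: a_minus_def)
      then show ?thesis using G(1) x C(4)[OF x] W.M.minus_equality[of "g' x" "\<ominus>\<^bsub>W\<^esub> g' (r x)"] by simp
    qed
    have ch: "compose (carrier N) (\<lambda>y\<in>carrier C. g' y) (\<lambda>x\<in>carrier N. r x) = g'"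
      by (rule ext) (use gr C(3) G(2) in \<open>auto simp: compose_def\<close>)
    have h: "(\<lambda>y\<in>carrier C. g' y) \<in> module_hom R C W"
      by (rule module_homI'[OF lC]) (use C(3,4) gr G rh N.smult_closed in \<open>auto simp: rh[symmetric]\<close>)
    show "\<exists>!h. h \<in> Hom (mod_cat R) C W \<and> Comp (mod_cat R) h (N, C, \<lambda>x\<in>carrier N. r x) = g"
    proof (rule ex1I[of _ "(C, W, \<lambda>y\<in>carrier C. g' y)"])
      show "(C, W, \<lambda>y\<in>carrier C. g' y) \<in> Hom (mod_cat R) C W \<and>
          Comp (mod_cat R) (C, W, \<lambda>y\<in>carrier C. g' y) (N, C, \<lambda>x\<in>carrier N. r x) = g"
        using h g' C(1) ch by (simp add: Hom_mod_cat mod_cat_simps)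
      fix h' assume h': "h' \<in> Hom (mod_cat R) C W \<and> Comp (mod_cat R) h' (N, C, \<lambda>x\<in>carrier N. r x) = g"
      then obtain k where k: "h' = (C, W, k)" "k \<in> module_hom R C W" using Hom_mod_catE by blast
      have e: "compose (carrier N) k (\<lambda>x\<in>carrier N. r x) = g'" using h' unfolding k g' mod_cat_simps by simp
      have "k (r x) = g' x" if "x \<in> carrier N" for x
        using fun_cong[OF e, of x] that by (simp add: compose_def)
      then have "k = (\<lambda>y\<in>carrier C. g' y)" by (intro hom_ext[OF k(2) h]) (auto simp: C(3) gr)
      then show "h' = (C, W, \<lambda>y\<in>carrier C. g' y)" using k by simp
    qed
  qed (use f M N C in auto)
  then show ?thesis using that C(1,2) z by blast
qed

lemma mono_injective:
  assumes noeth: "noetherian_on_lists R" and f: "f \<in> module_hom R M N" "fg_module R M" "fg_module R N"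
    and mono: "mono_arr (mod_cat R) (M, N, f)" and x: "x \<in> carrier M" "f x = \<zero>\<^bsub>N\<^esub>"
  shows "x = \<zero>\<^bsub>M\<^esub>"
proof -
  define K where "K = M\<lparr>carrier := {x \<in> carrier M. f x = \<zero>\<^bsub>N\<^esub>}\<rparr>"
  note k = kernel_ex[OF noeth f, folded K_def]
  note l = fg_left_module[OF f(2)] fg_left_module[OF f(3)] fg_left_module[OF k(2)]
  have h: "(K, M, \<lambda>x\<in>carrier K. x) \<in> Hom (mod_cat R) K M" "(K, M, \<lambda>x\<in>carrier K. \<zero>\<^bsub>M\<^esub>) \<in> Hom (mod_cat R) K M"
    using k f l zero_hom[OF l(3,1)] unfolding is_kernel_def mod_cat_simps Hom_mod_cat by auto
  have "Comp (mod_cat R) (M, N, f) (K, M, \<lambda>x\<in>carrier K. x) = Comp (mod_cat R) (M, N, f) (K, M, \<lambda>x\<in>carrier K. \<zero>\<^bsub>M\<^esub>)"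
    using module_hom_zero[OF f(1) l(1,2)] by (auto simp: mod_cat_simps compose_def fun_eq_iff K_def)
  from mono[unfolded mono_arr_def mod_cat_simps(2), THEN conjunct2, rule_format, OF h this]
  have "(\<lambda>x\<in>carrier K. x) = (\<lambda>x\<in>carrier K. \<zero>\<^bsub>M\<^esub>)" by simp
  from fun_cong[OF this, of x] x show ?thesis by (simp add: K_def)
qed

lemma epi_surjective:
  assumes f: "f \<in> module_hom R M N" "fg_module R M" "fg_module R N"
    and epi: "epi_arr (mod_cat R) (M, N, f)" and y: "y \<in> carrier N"
  shows "y \<in> f ` carrier M"
proof -
  obtain C r where c: "is_cokernel (mod_cat R) (M, N, f) (N, C, \<lambda>x\<in>carrier N. r x)" "fg_module R C"
    "(\<lambda>x\<in>carrier N. r x) \<in> module_hom R N C" "\<And>y. y \<in> carrier N \<Longrightarrow> r y = \<zero>\<^bsub>C\<^esub> \<longleftrightarrow> y \<in> f ` carrier M"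
    using cokernel_ex[OF f] by blast
  note l = fg_left_module[OF f(2)] fg_left_module[OF f(3)] fg_left_module[OF c(2)]
  have h: "(N, C, \<lambda>x\<in>carrier N. r x) \<in> Hom (mod_cat R) N C" "(N, C, \<lambda>x\<in>carrier N. \<zero>\<^bsub>C\<^esub>) \<in> Hom (mod_cat R) N C"
    using c f zero_hom[OF l(2,3)] by (auto simp: Hom_mod_cat)
  have "Comp (mod_cat R) (N, C, \<lambda>x\<in>carrier N. r x) (M, N, f) = Comp (mod_cat R) (N, C, \<lambda>x\<in>carrier N. \<zero>\<^bsub>C\<^esub>) (M, N, f)"
    using module_homD(1)[OF f(1)] c(4) by (auto simp: mod_cat_simps compose_def fun_eq_iff)
  from epi[unfolded epi_arr_def mod_cat_simps(3), THEN conjunct2, rule_format, OF h this]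
  have "(\<lambda>x\<in>carrier N. r x) = (\<lambda>x\<in>carrier N. \<zero>\<^bsub>C\<^esub>)" by simp
  from fun_cong[OF this, of y] y c(4) show ?thesis by simp
qed

lemma mod_cat_mono_is_kernel:
  assumes noeth: "noetherian_on_lists R" and mono: "mono_arr (mod_cat R) F"
  shows "\<exists>G. is_kernel (mod_cat R) G F"
proof -
  have "F \<in> Arr (mod_cat R)" using mono by (simp add: mono_arr_def)
  then obtain M N f where f: "F = (M, N, f)" "fg_module R M" "fg_module R N" "f \<in> module_hom R M N" by (rule Arr_mod_catE)
  obtain C r where c: "is_cokernel (mod_cat R) (M, N, f) (N, C, \<lambda>x\<in>carrier N. r x)" "fg_module R C"
    "(\<lambda>x\<in>carrier N. r x) \<in> module_hom R N C" "\<And>y. y \<in> carrier N \<Longrightarrow> r y = \<zero>\<^bsub>C\<^esub> \<longleftrightarrow> y \<in> f ` carrier M"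
    using cokernel_ex[OF f(4,2,3)] by blast
  note l = fg_left_module[OF f(2)] fg_left_module[OF f(3)] fg_left_module[OF c(2)] and F = module_homD[OF f(4)]
  interpret M: left_module R M by (rule l(1))
  interpret N: left_module R N by (rule l(2))
  have inj: "x = y" if "f x = f y" "x \<in> carrier M" "y \<in> carrier M" for x y
  proof -
    have "f (x \<oplus>\<^bsub>M\<^esub> \<ominus>\<^bsub>M\<^esub> y) = \<zero>\<^bsub>N\<^esub>"
      using that F(1)[OF that(3)] F(3)[of x "\<ominus>\<^bsub>M\<^esub> y"] module_hom_minus[OF f(4) l(1,2)] by (simp add: N.M.r_neg)
    then have "x \<oplus>\<^bsub>M\<^esub> \<ominus>\<^bsub>M\<^esub> y = \<zero>\<^bsub>M\<^esub>" using mono_injective[OF noeth f(4,2,3) mono[unfolded f(1)]] that by simp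
    then show ?thesis using that M.M.minus_equality[of x "\<ominus>\<^bsub>M\<^esub> y"] by simp
  qed
  have "is_kernel (mod_cat R) (N, C, \<lambda>x\<in>carrier N. r x) (M, N, f)"
    unfolding is_kernel_def mod_cat_simps
  proof (intro conjI allI ballI impI)
    show "(M, C, compose (carrier M) (\<lambda>x\<in>carrier N. r x) f) = (M, C, \<lambda>x\<in>carrier M. \<zero>\<^bsub>C\<^esub>)"
      using c(1) unfolding is_cokernel_def mod_cat_simps by blast
    fix W g assume g: "g \<in> Hom (mod_cat R) W N" "Comp (mod_cat R) (N, C, \<lambda>x\<in>carrier N. r x) g = (W, C, \<lambda>x\<in>carrier W. \<zero>\<^bsub>C\<^esub>)"
    obtain g' where g': "g = (W, N, g')" "fg_module R W" "g' \<in> module_hom R W N" using Hom_mod_catE[OF g(1)] .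
    note G = module_homD[OF g'(3)] and lW = fg_left_module[OF g'(2)]
    interpret W: left_module R W by (rule lW)
    have im: "g' w \<in> f ` carrier M" if w: "w \<in> carrier W" for w
    proof -
      have "compose (carrier W) (\<lambda>x\<in>carrier N. r x) g' = (\<lambda>x\<in>carrier W. \<zero>\<^bsub>C\<^esub>)"
        using g(2) unfolding g'(1) mod_cat_simps by simp
      from fun_cong[OF this, of w] w G(1)[OF w] c(4) show ?thesis by (simp add: compose_def)
    qed
    define h where "h w = (THE x. x \<in> carrier M \<and> f x = g' w)" for w
    have h: "h w \<in> carrier M \<and> f (h w) = g' w" if w: "w \<in> carrier W" for w
      unfolding h_def by (rule theI') (use im[OF w] inj in \<open>auto intro!: ex_ex1I\<close>)
    have hh: "(\<lambda>w\<in>carrier W. h w) \<in> module_hom R W M"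
    proof (rule module_homI'[OF lW])
      show "h w \<in> carrier M" if "w \<in> carrier W" for w using h that by blast
      show "h (v \<oplus>\<^bsub>W\<^esub> w) = h v \<oplus>\<^bsub>M\<^esub> h w" if "v \<in> carrier W" "w \<in> carrier W" for v w
        by (rule inj) (use that h G(3) F(3) in auto)
      show "h (a \<odot>\<^bsub>W\<^esub> w) = a \<odot>\<^bsub>M\<^esub> h w" if "a \<in> carrier R" "w \<in> carrier W" for a w
        by (rule inj) (use that h G(4) F(4) W.smult_closed M.smult_closed in auto)
    qed
    have ch: "compose (carrier W) f (\<lambda>w\<in>carrier W. h w) = g'"
      by (rule ext) (use h G(2) in \<open>auto simp: compose_def\<close>)
    show "\<exists>!h. h \<in> Hom (mod_cat R) W M \<and> Comp (mod_cat R) (M, N, f) h = g"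
    proof (rule ex1I[of _ "(W, M, \<lambda>w\<in>carrier W. h w)"])
      show "(W, M, \<lambda>w\<in>carrier W. h w) \<in> Hom (mod_cat R) W M \<and> Comp (mod_cat R) (M, N, f) (W, M, \<lambda>w\<in>carrier W. h w) = g"
        using hh g' f ch by (simp add: Hom_mod_cat mod_cat_simps)
      fix h' assume h': "h' \<in> Hom (mod_cat R) W M \<and> Comp (mod_cat R) (M, N, f) h' = g"
      then obtain k where k: "h' = (W, M, k)" "k \<in> module_hom R W M" using Hom_mod_catE by blast
      have e: "compose (carrier W) f k = g'" using h' unfolding k g' mod_cat_simps by simp
      have "k = (\<lambda>w\<in>carrier W. h w)"
      proof (rule hom_ext[OF k(2) hh])
        fix w assume w: "w \<in> carrier W"
        have "f (k w) = g' w" using fun_cong[OF e, of w] w by (simp add: compose_def)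
        then show "k w = (\<lambda>w\<in>carrier W. h w) w" using inj[of "k w" "h w"] h[OF w] module_homD(1)[OF k(2) w] w by simp
      qed
      then show "h' = (W, M, \<lambda>w\<in>carrier W. h w)" using k by simp
    qed
  qed (use f c in auto)
  then show ?thesis using f(1) by blast
qed

lemma mod_cat_epi_is_cokernel:
  assumes noeth: "noetherian_on_lists R" and epi: "epi_arr (mod_cat R) F"
  shows "\<exists>G. is_cokernel (mod_cat R) G F"
proof -
  have "F \<in> Arr (mod_cat R)" using epi by (simp add: epi_arr_def)
  then obtain M N f where f: "F = (M, N, f)" "fg_module R M" "fg_module R N" "f \<in> module_hom R M N" by (rule Arr_mod_catE)
  define K where "K = M\<lparr>carrier := {x \<in> carrier M. f x = \<zero>\<^bsub>N\<^esub>}\<rparr>"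
  note k = kernel_ex[OF noeth f(4,2,3), folded K_def]
  have K: "(\<lambda>x\<in>carrier K. x) \<in> module_hom R K M" "fg_module R K"
    using k unfolding is_kernel_def mod_cat_simps by auto
  note l = fg_left_module[OF f(2)] fg_left_module[OF f(3)] and F = module_homD[OF f(4)]
  interpret M: left_module R M by (rule l(1))
  interpret N: left_module R N by (rule l(2))
  have surj: "y \<in> f ` carrier M" if "y \<in> carrier N" for y by (rule epi_surjective[OF f(4,2,3) epi[unfolded f(1)] that])
  have "is_cokernel (mod_cat R) (K, M, \<lambda>x\<in>carrier K. x) (M, N, f)"
    unfolding is_cokernel_def mod_cat_simps
  proof (intro conjI allI ballI impI)
    show "(K, N, compose (carrier K) f (\<lambda>x\<in>carrier K. x)) = (K, N, \<lambda>x\<in>carrier K. \<zero>\<^bsub>N\<^esub>)"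
      using k(1) unfolding is_kernel_def mod_cat_simps by blast
    fix W g assume g: "g \<in> Hom (mod_cat R) M W" "Comp (mod_cat R) g (K, M, \<lambda>x\<in>carrier K. x) = (K, W, \<lambda>x\<in>carrier K. \<zero>\<^bsub>W\<^esub>)"
    obtain g' where g': "g = (M, W, g')" "fg_module R W" "g' \<in> module_hom R M W" using Hom_mod_catE[OF g(1)] .
    note G = module_homD[OF g'(3)] and lW = fg_left_module[OF g'(2)]
    interpret W: left_module R W by (rule lW)
    have z: "g' x = \<zero>\<^bsub>W\<^esub>" if "x \<in> carrier M" "f x = \<zero>\<^bsub>N\<^esub>" for x
    proof -
      have "compose (carrier K) g' (\<lambda>x\<in>carrier K. x) = (\<lambda>x\<in>carrier K. \<zero>\<^bsub>W\<^esub>)"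
        using g(2) unfolding g'(1) mod_cat_simps by simp
      from fun_cong[OF this, of x] that show ?thesis by (simp add: compose_def K_def)
    qed
    have gg: "g' x = g' y" if "x \<in> carrier M" "y \<in> carrier M" "f x = f y" for x y
    proof -
      have "f (x \<oplus>\<^bsub>M\<^esub> \<ominus>\<^bsub>M\<^esub> y) = \<zero>\<^bsub>N\<^esub>"
        using that F(1)[OF that(2)] F(3)[of x "\<ominus>\<^bsub>M\<^esub> y"] module_hom_minus[OF f(4) l(1,2)] by (simp add: N.M.r_neg)
      then have "g' (x \<oplus>\<^bsub>M\<^esub> \<ominus>\<^bsub>M\<^esub> y) = \<zero>\<^bsub>W\<^esub>" using z that by simp
      then have "g' x \<oplus>\<^bsub>W\<^esub> \<ominus>\<^bsub>W\<^esub> g' y = \<zero>\<^bsub>W\<^esub>" using that G(3)[of x "\<ominus>\<^bsub>M\<^esub> y"] module_hom_minus[OF g'(3) l(1) lW] by simp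
      then show ?thesis using G(1) that W.M.minus_equality[of "g' x" "\<ominus>\<^bsub>W\<^esub> g' y"] by simp
    qed
    define s where "s y = (SOME x. x \<in> carrier M \<and> f x = y)" for y
    have s: "s y \<in> carrier M" "f (s y) = y" if "y \<in> carrier N" for y
    proof -
      have "\<exists>x. x \<in> carrier M \<and> f x = y" using surj[OF that] by blast
      from someI_ex[OF this] show "s y \<in> carrier M" "f (s y) = y" unfolding s_def by auto
    qed
    define h where "h y = g' (s y)" for y
    have hf: "h (f x) = g' x" if "x \<in> carrier M" for x
      unfolding h_def by (rule gg) (use that s F(1) in auto)
    have hh: "(\<lambda>y\<in>carrier N. h y) \<in> module_hom R N W"
    proof (rule module_homI'[OF l(2)])
      show "h y \<in> carrier W" if "y \<in> carrier N" for y using s G(1) that by (simp add: h_def)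
      show "h (v \<oplus>\<^bsub>N\<^esub> w) = h v \<oplus>\<^bsub>W\<^esub> h w" if "v \<in> carrier N" "w \<in> carrier N" for v w
        using hf[of "s v \<oplus>\<^bsub>M\<^esub> s w"] s that F(3) G(3) by (simp add: h_def)
      show "h (a \<odot>\<^bsub>N\<^esub> w) = a \<odot>\<^bsub>W\<^esub> h w" if "a \<in> carrier R" "w \<in> carrier N" for a w
        using hf[of "a \<odot>\<^bsub>M\<^esub> s w"] s that F(4) G(4) M.smult_closed by (simp add: h_def)
    qed
    have ch: "compose (carrier M) (\<lambda>y\<in>carrier N. h y) f = g'"
      by (rule ext) (use hf F(1) G(2) in \<open>auto simp: compose_def\<close>)
    show "\<exists>!h. h \<in> Hom (mod_cat R) N W \<and> Comp (mod_cat R) h (M, N, f) = g"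
    proof (rule ex1I[of _ "(N, W, \<lambda>y\<in>carrier N. h y)"])
      show "(N, W, \<lambda>y\<in>carrier N. h y) \<in> Hom (mod_cat R) N W \<and> Comp (mod_cat R) (N, W, \<lambda>y\<in>carrier N. h y) (M, N, f) = g"
        using hh g' f ch by (simp add: Hom_mod_cat mod_cat_simps)
      fix h' assume h': "h' \<in> Hom (mod_cat R) N W \<and> Comp (mod_cat R) h' (M, N, f) = g"
      then obtain k where k: "h' = (N, W, k)" "k \<in> module_hom R N W" using Hom_mod_catE by blast
      have e: "compose (carrier M) k f = g'" using h' unfolding k g' mod_cat_simps by simp
      have "k = (\<lambda>y\<in>carrier N. h y)"
      proof (rule hom_ext[OF k(2) hh])
        fix y assume y: "y \<in> carrier N"
        then show "k y = (\<lambda>y\<in>carrier N. h y) y" using fun_cong[OF e, of "s y"] s by (simp add: compose_def h_def)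
      qed
      then show "h' = (N, W, \<lambda>y\<in>carrier N. h y)" using k by simp
    qed
  qed (use f K in auto)
  then show ?thesis using f(1) by blast
qed

lemma zero_module_ex:
  fixes R :: "'a ring"
  assumes "ring R" shows "\<exists>Z. zero_obj (mod_cat R) Z"
proof -
  define Z :: "('a, 'a list) module" where "Z = \<lparr>carrier = {[]}, mult = undefined, one = undefined, zero = [], add = (\<lambda>x y. []), smult = (\<lambda>r x. [])\<rparr>"
  have l: "left_module R Z"
    by (intro left_module.intro assms left_module_axioms.intro abelian_groupI) (auto simp: Z_def)
  have "generates R Z {} (carrier Z)" by (auto simp: generates_def submod_def Z_def)
  then have Z: "fg_module R Z" unfolding fg_module_iff using l by blast
  have 1: "\<exists>!f. f \<in> Hom (mod_cat R) Z M" if M: "fg_module R M" for M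
  proof (rule ex1I[of _ "(Z, M, \<lambda>x\<in>carrier Z. \<zero>\<^bsub>M\<^esub>)"])
    show "(Z, M, \<lambda>x\<in>carrier Z. \<zero>\<^bsub>M\<^esub>) \<in> Hom (mod_cat R) Z M"
      using Z M zero_hom[OF l fg_left_module[OF M]] by (simp add: Hom_mod_cat)
    fix f assume "f \<in> Hom (mod_cat R) Z M"
    then obtain f' where f: "f = (Z, M, f')" "f' \<in> module_hom R Z M" by (rule Hom_mod_catE)
    have "f' = (\<lambda>x\<in>carrier Z. \<zero>\<^bsub>M\<^esub>)"
      by (rule hom_ext[OF f(2) zero_hom[OF l fg_left_module[OF M]]])
        (use module_hom_zero[OF f(2) l fg_left_module[OF M]] in \<open>simp add: Z_def\<close>)
    then show "f = (Z, M, \<lambda>x\<in>carrier Z. \<zero>\<^bsub>M\<^esub>)" using f by simp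
  qed
  have 2: "\<exists>!f. f \<in> Hom (mod_cat R) M Z" if M: "fg_module R M" for M
  proof (rule ex1I[of _ "(M, Z, \<lambda>x\<in>carrier M. \<zero>\<^bsub>Z\<^esub>)"])
    show "(M, Z, \<lambda>x\<in>carrier M. \<zero>\<^bsub>Z\<^esub>) \<in> Hom (mod_cat R) M Z"
      using Z M zero_hom[OF fg_left_module[OF M] l] by (simp add: Hom_mod_cat)
    fix f assume "f \<in> Hom (mod_cat R) M Z"
    then obtain f' where f: "f = (M, Z, f')" "f' \<in> module_hom R M Z" by (rule Hom_mod_catE)
    have "f' = (\<lambda>x\<in>carrier M. \<zero>\<^bsub>Z\<^esub>)"
      by (rule hom_ext[OF f(2) zero_hom[OF fg_left_module[OF M] l]])
        (use module_homD(1)[OF f(2)] in \<open>simp add: Z_def\<close>)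
    then show "f = (M, Z, \<lambda>x\<in>carrier M. \<zero>\<^bsub>Z\<^esub>)" using f by simp
  qed
  show ?thesis unfolding zero_obj_def mod_cat_simps using Z 1 2 by blast
qed

lemma biproduct_module_ex:
  fixes M N :: "('r, 'r list) module"
  assumes M: "fg_module R M" and N: "fg_module R N" and ab: "(a :: 'r) \<noteq> b"
  shows "\<exists>P i1 i2 p1 p2. is_biproduct (mod_cat R) M N P i1 i2 p1 p2"
proof -
  obtain P :: "('r, 'r list) module" and e where P: "fg_module R P" "carrier P = (\<lambda>(x, y). e x y) ` (carrier M \<times> carrier N)"
    and inj: "\<And>x y x' y'. e x y = e x' y' \<longleftrightarrow> x = x' \<and> y = y'"
    and add: "\<And>x y x' y'. x \<in> carrier M \<Longrightarrow> y \<in> carrier N \<Longrightarrow> x' \<in> carrier M \<Longrightarrow> y' \<in> carrier N \<Longrightarrow>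
       e x y \<oplus>\<^bsub>P\<^esub> e x' y' = e (x \<oplus>\<^bsub>M\<^esub> x') (y \<oplus>\<^bsub>N\<^esub> y')"
    and smult: "\<And>r x y. r \<in> carrier R \<Longrightarrow> x \<in> carrier M \<Longrightarrow> y \<in> carrier N \<Longrightarrow> r \<odot>\<^bsub>P\<^esub> e x y = e (r \<odot>\<^bsub>M\<^esub> x) (r \<odot>\<^bsub>N\<^esub> y)"
    and z: "\<zero>\<^bsub>P\<^esub> = e \<zero>\<^bsub>M\<^esub> \<zero>\<^bsub>N\<^esub>"
    using transported_product[OF M N ab] by metis
  note l = fg_left_module[OF M] fg_left_module[OF N] fg_left_module[OF P(1)]
  interpret M: left_module R M by (rule l(1))
  interpret N: left_module R N by (rule l(2))
  define d1 where "d1 u = (THE x. \<exists>y. u = e x y)" for u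
  define d2 where "d2 u = (THE y. \<exists>x. u = e x y)" for u
  have d: "d1 (e x y) = x" "d2 (e x y) = y" for x y by (auto simp: d1_def d2_def inj)
  have eP: "e x y \<in> carrier P \<longleftrightarrow> x \<in> carrier M \<and> y \<in> carrier N" for x y by (auto simp: P(2) inj)
  have elt: "\<exists>x y. u = e x y \<and> x \<in> carrier M \<and> y \<in> carrier N" if "u \<in> carrier P" for u using that by (auto simp: P(2))
  have h: "(\<lambda>x\<in>carrier M. e x \<zero>\<^bsub>N\<^esub>) \<in> module_hom R M P" "(\<lambda>y\<in>carrier N. e \<zero>\<^bsub>M\<^esub> y) \<in> module_hom R N P"
    by (rule module_homI'[OF l(1)], auto simp: eP add smult N.smult_zero)
      (rule module_homI'[OF l(2)], auto simp: eP add smult M.smult_zero)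
  have h': "(\<lambda>u\<in>carrier P. d1 u) \<in> module_hom R P M" "(\<lambda>u\<in>carrier P. d2 u) \<in> module_hom R P N"
    by (rule module_homI'[OF l(3)], auto dest!: elt simp: d add smult)
      (rule module_homI'[OF l(3)], auto dest!: elt simp: d add smult)
  have "is_biproduct (mod_cat R) M N P (M, P, \<lambda>x\<in>carrier M. e x \<zero>\<^bsub>N\<^esub>) (N, P, \<lambda>y\<in>carrier N. e \<zero>\<^bsub>M\<^esub> y)
      (P, M, \<lambda>u\<in>carrier P. d1 u) (P, N, \<lambda>u\<in>carrier P. d2 u)"
    unfolding is_biproduct_def mod_cat_simps Hom_mod_cat
    using M N P(1) h h' by (auto simp: compose_def fun_eq_iff eP d add dest!: elt)
  then show ?thesis by blast
qed

text \<open>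
  Two distinct elements of the ring, available in the application as elements of the type, serve to code
  direct products.
\<close>

theorem mod_cat_abelian:
  fixes R :: "'r ring"
  assumes R: "ring R" and noeth: "noetherian_on_lists R" and ab: "(a :: 'r) \<noteq> b"
  shows "abelian_category (mod_cat R)"
proof (intro abelian_category.intro mod_cat_preadditive abelian_category_axioms.intro)
  show "\<exists>X. zero_obj (mod_cat R) X" by (rule zero_module_ex[OF R])
  show "\<exists>P i1 i2 p1 p2. is_biproduct (mod_cat R) X Y P i1 i2 p1 p2"
    if "X \<in> Obj (mod_cat R)" "Y \<in> Obj (mod_cat R)" for X Y
    using that biproduct_module_ex[OF _ _ ab] by (simp add: mod_cat_simps)
  show "\<exists>k. is_kernel (mod_cat R) f k" if "f \<in> Arr (mod_cat R)" for f
    using that by (rule Arr_mod_catE) (use kernel_ex(1)[OF noeth] in blast)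
  show "\<exists>c. is_cokernel (mod_cat R) f c" if "f \<in> Arr (mod_cat R)" for f
    using that by (rule Arr_mod_catE) (use cokernel_ex in blast)
  show "\<exists>g. is_kernel (mod_cat R) g f" if "mono_arr (mod_cat R) f" for f by (rule mod_cat_mono_is_kernel[OF noeth that])
  show "\<exists>g. is_cokernel (mod_cat R) g f" if "epi_arr (mod_cat R) f" for f by (rule mod_cat_epi_is_cokernel[OF noeth that])
qed

section \<open>Nakayama algebras are noetherian\<close>

text \<open>
  A field inside the ring makes every module a vector space, although no field acts on the module as
  part of its structure; \<open>\<kappa>\<close> is the embedding of the scalars.
\<close>

locale scalar_module = left_module R M for R :: "'r ring" and M :: "('r, 'v) module" +
  fixes \<kappa> :: "'k::field \<Rightarrow> 'r"
  assumes \<kappa>_closed: "\<kappa> c \<in> carrier R" and \<kappa>_mult: "\<kappa> c \<otimes>\<^bsub>R\<^esub> \<kappa> d = \<kappa> (c * d)"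
    and \<kappa>_add: "\<kappa> c \<oplus>\<^bsub>R\<^esub> \<kappa> d = \<kappa> (c + d)" and \<kappa>_one: "\<kappa> 1 = \<one>\<^bsub>R\<^esub>"
begin

definition subspace :: "'v set \<Rightarrow> bool" where
  "subspace N \<longleftrightarrow> N \<subseteq> carrier M \<and> \<zero>\<^bsub>M\<^esub> \<in> N \<and> (\<forall>x \<in> N. \<forall>y \<in> N. x \<oplus>\<^bsub>M\<^esub> y \<in> N) \<and>
     (\<forall>c. \<forall>x \<in> N. \<kappa> c \<odot>\<^bsub>M\<^esub> x \<in> N)"

definition span :: "'v set \<Rightarrow> 'v set" where
  "span F = \<Inter> {N. subspace N \<and> F \<subseteq> N}"

lemma subspaceD:
  assumes "subspace N"
  shows "N \<subseteq> carrier M" "\<zero>\<^bsub>M\<^esub> \<in> N" "x \<in> N \<Longrightarrow> y \<in> N \<Longrightarrow> x \<oplus>\<^bsub>M\<^esub> y \<in> N" "x \<in> N \<Longrightarrow> \<kappa> c \<odot>\<^bsub>M\<^esub> x \<in> N"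
  using assms unfolding subspace_def by auto

lemma submod_subspace: "submod R M N \<Longrightarrow> subspace N"
  unfolding submod_def subspace_def using \<kappa>_closed by blast

lemma subspace_span: assumes "F \<subseteq> carrier M" shows "subspace (span F)" "F \<subseteq> span F"
proof -
  have "subspace (carrier M)" by (rule submod_subspace[OF submod_carrier])
  then have c: "span F \<subseteq> carrier M" using assms unfolding span_def by blast
  show "subspace (span F)" unfolding subspace_def
    by (intro conjI c ballI allI) (auto simp: span_def subspaceD)
  show "F \<subseteq> span F" unfolding span_def by blast
qed

lemma span_least: "subspace N \<Longrightarrow> F \<subseteq> N \<Longrightarrow> span F \<subseteq> N"
  unfolding span_def by blast

lemma \<kappa>_zero: "\<kappa> 0 = \<zero>\<^bsub>R\<^esub>"
proof -
  have "\<kappa> 0 = \<ominus>\<^bsub>R\<^esub> \<kappa> 0 \<oplus>\<^bsub>R\<^esub> (\<kappa> 0 \<oplus>\<^bsub>R\<^esub> \<kappa> 0)" using \<kappa>_closed by (simp add: R.r_neg1)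
  also have "\<dots> = \<zero>\<^bsub>R\<^esub>" using \<kappa>_closed by (simp add: \<kappa>_add R.l_neg)
  finally show ?thesis .
qed

lemma \<kappa>_smult:
  assumes "x \<in> carrier M"
  shows "\<kappa> c \<odot>\<^bsub>M\<^esub> x \<in> carrier M" "\<kappa> c \<odot>\<^bsub>M\<^esub> (\<kappa> d \<odot>\<^bsub>M\<^esub> x) = \<kappa> (c * d) \<odot>\<^bsub>M\<^esub> x"
    "\<kappa> c \<odot>\<^bsub>M\<^esub> x \<oplus>\<^bsub>M\<^esub> \<kappa> d \<odot>\<^bsub>M\<^esub> x = \<kappa> (c + d) \<odot>\<^bsub>M\<^esub> x" "\<kappa> 0 \<odot>\<^bsub>M\<^esub> x = \<zero>\<^bsub>M\<^esub>" "\<kappa> 1 \<odot>\<^bsub>M\<^esub> x = x"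
  using assms \<kappa>_closed
  by (simp_all add: smult_closed smult_assoc[symmetric] \<kappa>_mult smult_l_distr[symmetric] \<kappa>_add \<kappa>_zero zero_smult
    \<kappa>_one smult_one)

lemma span_insert:
  assumes g: "g \<in> carrier M" and F: "F \<subseteq> carrier M" and x: "x \<in> span (insert g F)"
  obtains a y where "y \<in> span F" "x = \<kappa> a \<odot>\<^bsub>M\<^esub> g \<oplus>\<^bsub>M\<^esub> y"
proof -
  note D = subspaceD[OF subspace_span(1)[OF F]] and s = subspace_span(2)[OF F]
  have sc: "y \<in> span F \<Longrightarrow> y \<in> carrier M" for y using D(1) by blast
  let ?N = "{\<kappa> a \<odot>\<^bsub>M\<^esub> g \<oplus>\<^bsub>M\<^esub> y | a y. y \<in> span F}"
  have "subspace ?N" unfolding subspace_def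
  proof (intro conjI ballI allI)
    show "?N \<subseteq> carrier M" using g sc \<kappa>_smult(1) by auto
    show "\<zero>\<^bsub>M\<^esub> \<in> ?N" by (rule CollectI, intro exI[of _ 0] exI[of _ "\<zero>\<^bsub>M\<^esub>"]) (use g D(2) in \<open>simp add: \<kappa>_smult\<close>)
  next
    fix u v assume "u \<in> ?N" "v \<in> ?N"
    then obtain a y b z where u: "u = \<kappa> a \<odot>\<^bsub>M\<^esub> g \<oplus>\<^bsub>M\<^esub> y" "y \<in> span F" and v: "v = \<kappa> b \<odot>\<^bsub>M\<^esub> g \<oplus>\<^bsub>M\<^esub> z" "z \<in> span F" by blast
    have "u \<oplus>\<^bsub>M\<^esub> v = (\<kappa> a \<odot>\<^bsub>M\<^esub> g \<oplus>\<^bsub>M\<^esub> \<kappa> b \<odot>\<^bsub>M\<^esub> g) \<oplus>\<^bsub>M\<^esub> (y \<oplus>\<^bsub>M\<^esub> z)"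
      unfolding u v using g sc[OF u(2)] sc[OF v(2)] \<kappa>_smult(1)[OF g] by (simp add: M.a_ac)
    then show "u \<oplus>\<^bsub>M\<^esub> v \<in> ?N" unfolding \<kappa>_smult(3)[OF g] using D(3)[OF u(2) v(2)] by blast
  next
    fix c u assume "u \<in> ?N"
    then obtain a y where u: "u = \<kappa> a \<odot>\<^bsub>M\<^esub> g \<oplus>\<^bsub>M\<^esub> y" "y \<in> span F" by blast
    have "\<kappa> c \<odot>\<^bsub>M\<^esub> u = \<kappa> (c * a) \<odot>\<^bsub>M\<^esub> g \<oplus>\<^bsub>M\<^esub> \<kappa> c \<odot>\<^bsub>M\<^esub> y"
      unfolding u using smult_r_distr[OF \<kappa>_closed \<kappa>_smult(1)[OF g] sc[OF u(2)]] by (simp add: \<kappa>_smult(2)[OF g])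
    then show "\<kappa> c \<odot>\<^bsub>M\<^esub> u \<in> ?N" using D(4)[OF u(2)] by blast
  qed
  moreover have "g \<in> ?N" by (rule CollectI, intro exI[of _ 1] exI[of _ "\<zero>\<^bsub>M\<^esub>"]) (use g D(2) in \<open>simp add: \<kappa>_smult\<close>)
  moreover have "F \<subseteq> ?N"
  proof
    fix y assume y: "y \<in> F"
    show "y \<in> ?N" by (rule CollectI, intro exI[of _ 0] exI[of _ y]) (use g y s F in \<open>auto simp: \<kappa>_smult\<close>)
  qed
  ultimately have "span (insert g F) \<subseteq> ?N" by (intro span_least) auto
  then show ?thesis using x that by blast
qed

text \<open>
  By induction on a spanning set of the whole space.  If
  the subspace is not already contained in the span of \<open>F\<close>, it has an element \<open>x0\<close> whose coefficient
  at \<open>g\<close> is nonzero, and subtracting multiples of \<open>x0\<close> moves all others into the span of \<open>F\<close>.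
\<close>

lemma subspace_finite:
  assumes "finite F" "F \<subseteq> carrier M" "subspace N" "N \<subseteq> span F"
  shows "\<exists>G. finite G \<and> G \<subseteq> N \<and> (\<forall>N'. subspace N' \<and> G \<subseteq> N' \<longrightarrow> N \<subseteq> N')"
  using assms
proof (induction F arbitrary: N rule: finite_induct)
  case empty
  have "subspace {\<zero>\<^bsub>M\<^esub>}" unfolding subspace_def using smult_zero \<kappa>_closed by auto
  then have "span {} \<subseteq> {\<zero>\<^bsub>M\<^esub>}" by (intro span_least) auto
  then show ?case using empty by (intro exI[of _ "{}"]) (auto dest: subspaceD(2))
next
  case (insert g F)
  have g: "g \<in> carrier M" and F: "F \<subseteq> carrier M" using insert by auto
  note sF = subspace_span[OF F] and N = subspaceD[OF insert.prems(2)]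
  have Nc: "x \<in> N \<Longrightarrow> x \<in> carrier M" for x using N(1) by blast
  have sc: "y \<in> span F \<Longrightarrow> y \<in> carrier M" for y using subspaceD(1)[OF sF(1)] by blast
  show ?case
  proof (cases "N \<subseteq> span F")
    case True
    then show ?thesis using insert.IH[OF F insert.prems(2)] by blast
  next
    case False
    then obtain x0 where x0: "x0 \<in> N" "x0 \<notin> span F" by blast
    obtain a0 y0 where e0: "y0 \<in> span F" "x0 = \<kappa> a0 \<odot>\<^bsub>M\<^esub> g \<oplus>\<^bsub>M\<^esub> y0"
      using span_insert[OF g F] x0(1) insert.prems(3) by blast
    have a0: "a0 \<noteq> 0"
    proof
      assume "a0 = 0"
      then have "x0 = y0" using e0 sc[OF e0(1)] by (simp add: \<kappa>_smult(4)[OF g])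
      then show False using x0 e0 by simp
    qed
    have "subspace (N \<inter> span F)" using N subspaceD[OF sF(1)] unfolding subspace_def by auto
    then obtain G where G: "finite G" "G \<subseteq> N \<inter> span F" "\<forall>N'. subspace N' \<and> G \<subseteq> N' \<longrightarrow> N \<inter> span F \<subseteq> N'"
      using insert.IH[OF F, of "N \<inter> span F"] by blast
    show ?thesis
    proof (intro exI[of _ "insert x0 G"] conjI allI impI)
      show "finite (insert x0 G)" "insert x0 G \<subseteq> N" using G x0 by auto
      fix N' assume h: "subspace N' \<and> insert x0 G \<subseteq> N'"
      then have N': "subspace N'" "x0 \<in> N'" "N \<inter> span F \<subseteq> N'" using G by auto
      show "N \<subseteq> N'"
      proof
        fix x assume x: "x \<in> N"
        obtain a y where e: "y \<in> span F" "x = \<kappa> a \<odot>\<^bsub>M\<^esub> g \<oplus>\<^bsub>M\<^esub> y"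
          using span_insert[OF g F] x insert.prems(3) by blast
        \<comment> \<open>This multiple of x0 cancels the coefficient of g in x.\<close>
        define b where "b = - (a / a0)"
        define z where "z = \<kappa> b \<odot>\<^bsub>M\<^esub> x0 \<oplus>\<^bsub>M\<^esub> x"
        have zN: "z \<in> N" unfolding z_def by (rule N(3)[OF N(4)[OF x0(1)] x])
        have "\<kappa> b \<odot>\<^bsub>M\<^esub> x0 = \<kappa> (b * a0) \<odot>\<^bsub>M\<^esub> g \<oplus>\<^bsub>M\<^esub> \<kappa> b \<odot>\<^bsub>M\<^esub> y0"
          unfolding e0(2) using smult_r_distr[OF \<kappa>_closed \<kappa>_smult(1)[OF g] sc[OF e0(1)]] by (simp add: \<kappa>_smult(2)[OF g])
        then have "z = (\<kappa> (b * a0) \<odot>\<^bsub>M\<^esub> g \<oplus>\<^bsub>M\<^esub> \<kappa> a \<odot>\<^bsub>M\<^esub> g) \<oplus>\<^bsub>M\<^esub> (\<kappa> b \<odot>\<^bsub>M\<^esub> y0 \<oplus>\<^bsub>M\<^esub> y)"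
          unfolding z_def e(2) using \<kappa>_smult(1)[OF g] \<kappa>_smult(1)[OF sc[OF e0(1)]] sc[OF e(1)] by (simp add: M.a_ac)
        also have "\<dots> = \<kappa> b \<odot>\<^bsub>M\<^esub> y0 \<oplus>\<^bsub>M\<^esub> y"
          unfolding \<kappa>_smult(3)[OF g] using a0 \<kappa>_smult(1)[OF sc[OF e0(1)]] sc[OF e(1)]
          by (simp add: b_def \<kappa>_smult(4)[OF g])
        also have "\<dots> \<in> span F" using subspaceD(3,4)[OF sF(1)] e0(1) e(1) by blast
        finally have zN': "z \<in> N'" using zN N'(3) by blast
        have "\<kappa> (- b) \<odot>\<^bsub>M\<^esub> x0 \<oplus>\<^bsub>M\<^esub> z = (\<kappa> (- b) \<odot>\<^bsub>M\<^esub> x0 \<oplus>\<^bsub>M\<^esub> \<kappa> b \<odot>\<^bsub>M\<^esub> x0) \<oplus>\<^bsub>M\<^esub> x"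
          unfolding z_def using \<kappa>_smult(1)[OF Nc[OF x0(1)]] Nc[OF x] by (simp add: M.a_assoc)
        also have "\<dots> = x" unfolding \<kappa>_smult(3)[OF Nc[OF x0(1)]] using Nc[OF x] by (simp add: \<kappa>_smult(4)[OF Nc[OF x0(1)]])
        finally show "x \<in> N'" using subspaceD(3)[OF N'(1) subspaceD(4)[OF N'(1,2)] zN'] by metis
      qed
    qed
  qed
qed

end

text \<open>
  The products of a finite spanning set \<open>B\<close> of the ring with finite generators of a module span the
  module over the scalars.  The hypothesis \<open>gen\<close> is spanning in the form of an induction rule.
\<close>

lemma finite_dimensional_noetherian:
  fixes R :: "'r ring" and \<kappa> :: "'k::field \<Rightarrow> 'r"
  assumes \<kappa>: "\<And>c. \<kappa> c \<in> carrier R" "\<And>c d. \<kappa> c \<otimes>\<^bsub>R\<^esub> \<kappa> d = \<kappa> (c * d)" "\<And>c d. \<kappa> c \<oplus>\<^bsub>R\<^esub> \<kappa> d = \<kappa> (c + d)"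
      "\<kappa> 1 = \<one>\<^bsub>R\<^esub>"
    and B: "finite B" "B \<subseteq> carrier R"
    and gen: "\<And>S. \<zero>\<^bsub>R\<^esub> \<in> S \<Longrightarrow> (\<And>x y. x \<in> S \<Longrightarrow> y \<in> S \<Longrightarrow> x \<in> carrier R \<Longrightarrow> y \<in> carrier R \<Longrightarrow> x \<oplus>\<^bsub>R\<^esub> y \<in> S) \<Longrightarrow>
      (\<And>c x. x \<in> S \<Longrightarrow> x \<in> carrier R \<Longrightarrow> \<kappa> c \<otimes>\<^bsub>R\<^esub> x \<in> S) \<Longrightarrow> B \<subseteq> S \<Longrightarrow> carrier R \<subseteq> S"
  shows "noetherian_on_lists R"
  unfolding noetherian_on_lists_def
proof (intro allI impI)
  fix M :: "('r, 'r list) module" and N assume M: "fg_module R M" and N: "submod R M N"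
  interpret left_module R M by (rule fg_left_module[OF M])
  interpret scalar_module R M \<kappa> by unfold_locales (fact \<kappa>)+
  obtain G where G: "generates R M G (carrier M)" using M unfolding fg_module_iff by blast
  have Gc: "finite G" "G \<subseteq> carrier M" using G by (auto simp: generates_def)
  define F where "F = (\<lambda>(b, g). b \<odot>\<^bsub>M\<^esub> g) ` (B \<times> G)"
  have F: "finite F" "F \<subseteq> carrier M" using B Gc smult_closed by (auto simp: F_def)
  note sF = subspace_span[OF F(2)] and D = subspaceD[OF subspace_span(1)[OF F(2)]]
  define U where "U = {x \<in> carrier M. \<forall>r \<in> carrier R. r \<odot>\<^bsub>M\<^esub> x \<in> span F}"
  have "submod R M U" unfolding submod_def
  proof (intro conjI ballI)
    show "U \<subseteq> carrier M" "\<zero>\<^bsub>M\<^esub> \<in> U" using D(2) by (auto simp: U_def smult_zero)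
    show "x \<oplus>\<^bsub>M\<^esub> y \<in> U" if "x \<in> U" "y \<in> U" for x y using that D(3) by (auto simp: U_def smult_r_distr)
    show "r \<odot>\<^bsub>M\<^esub> x \<in> U" if "r \<in> carrier R" "x \<in> U" for r x
      using that by (auto simp: U_def smult_closed smult_assoc[symmetric])
  qed
  moreover have "G \<subseteq> U"
  proof
    fix g assume g: "g \<in> G"
    then have gc: "g \<in> carrier M" using Gc by blast
    have "carrier R \<subseteq> {r \<in> carrier R. r \<odot>\<^bsub>M\<^esub> g \<in> span F}"
    proof (rule gen)
      show "B \<subseteq> {r \<in> carrier R. r \<odot>\<^bsub>M\<^esub> g \<in> span F}" using B(2) sF(2) g by (auto simp: F_def)
    qed (use gc D(2,3,4) \<kappa>_closed in \<open>auto simp: zero_smult smult_l_distr smult_assoc\<close>)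
    then show "g \<in> U" using gc by (auto simp: U_def)
  qed
  ultimately have "carrier M \<subseteq> U" using generatesD[OF G] by blast
  then have "carrier M \<subseteq> span F" using smult_one by (force simp: U_def)
  then have "N \<subseteq> span F" using submodD(1)[OF N] by blast
  from subspace_finite[OF F submod_subspace[OF N] this]
  obtain H where "finite H" "H \<subseteq> N" "\<forall>N'. subspace N' \<and> H \<subseteq> N' \<longrightarrow> N \<subseteq> N'" by blast
  then show "\<exists>G. generates R M G N" unfolding generates_def using submod_subspace by blast
qed

lemma path_end_in_verts: "is_path Q v es \<Longrightarrow> path_end Q v es \<in> verts Q"
  by (induction es arbitrary: v) auto

lemma path_algebra_simps:
  "x \<oplus>\<^bsub>path_algebra Q\<^esub> y = (\<lambda>p. x p + y p)" "\<zero>\<^bsub>path_algebra Q\<^esub> = (\<lambda>p. 0)"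
  "\<one>\<^bsub>path_algebra Q\<^esub> = (\<lambda>(v, es). if v \<in> verts Q \<and> es = [] then 1 else 0)"
  "x \<in> carrier (path_algebra Q) \<longleftrightarrow> finite {p. x p \<noteq> 0} \<and> (\<forall>v es. x (v, es) \<noteq> 0 \<longrightarrow> is_path Q v es)"
  by (simp_all add: path_algebra_def)

text \<open>The multiple \<open>c \<cdot> 1\<close> of the unit, which is the sum of the trivial paths.\<close>

definition scalar :: "('v, 'e) quiver \<Rightarrow> 'k::field \<Rightarrow> ('v, 'e) path \<Rightarrow> 'k" where
  "scalar Q c = (\<lambda>(v, es). if v \<in> verts Q \<and> es = [] then c else 0)"

lemma scalar_closed: assumes "finite (verts Q)" shows "scalar Q c \<in> carrier (path_algebra Q)"
proof -
  have "{p. scalar Q c p \<noteq> 0} \<subseteq> verts Q \<times> {[]}" by (auto simp: scalar_def split: if_splits)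
  then have "finite {p. scalar Q c p \<noteq> 0}" by (rule finite_subset) (simp add: assms)
  then show ?thesis by (auto simp: path_algebra_simps scalar_def split: if_splits)
qed

lemma scalar_mult:
  fixes x :: "('v, 'e) path \<Rightarrow> 'k::field"
  assumes "x \<in> carrier (path_algebra Q)"
  shows "scalar Q c \<otimes>\<^bsub>path_algebra Q\<^esub> x = (\<lambda>p. c * x p)"
proof
  fix p :: "('v, 'e) path"
  obtain v es where p: "p = (v, es)" by (cases p)
  have "(scalar Q c \<otimes>\<^bsub>path_algebra Q\<^esub> x) p =
      (\<Sum>i\<le>length es. scalar Q c (path_end Q v (take i es), drop i es) * x (v, take i es))"
    by (simp add: p path_algebra_def)
  also have "\<dots> = (\<Sum>i\<in>{length es}. scalar Q c (path_end Q v (take i es), drop i es) * x (v, take i es))"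
    by (rule sum.mono_neutral_right) (auto simp: scalar_def)
  also have "\<dots> = c * x p"
  proof (cases "x (v, es) = 0")
    case False
    then have "is_path Q v es" using assms by (auto simp: path_algebra_simps)
    from path_end_in_verts[OF this]
    show ?thesis by (simp add: p scalar_def)
  qed (simp add: p)
  finally show "(scalar Q c \<otimes>\<^bsub>path_algebra Q\<^esub> x) p = c * x p" .
qed

text \<open>The classes of the paths span the algebra over the scalars.\<close>

lemma path_algebra_quotient_noetherian:
  fixes J :: "(('v, 'e) path \<Rightarrow> 'k::field) set"
  assumes J: "ideal J (path_algebra Q)" and V: "finite (verts Q)" and P: "finite {(v, es). is_path Q v es}"
  shows "noetherian_on_lists (path_algebra Q Quot J)"
proof -
  interpret J: ideal J "path_algebra Q" by fact
  let ?A = "path_algebra Q :: (('v, 'e) path \<Rightarrow> 'k) ring"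
  let ?q = "\<lambda>x. J +>\<^bsub>?A\<^esub> x"
  have h: "?q \<in> ring_hom ?A (?A Quot J)" by (rule J.rcos_ring_hom)
  have qc: "?q x \<in> carrier (?A Quot J)" if "x \<in> carrier ?A" for x using ring_hom_closed[OF h that] .
  have qm: "?q (x \<otimes>\<^bsub>?A\<^esub> y) = ?q x \<otimes>\<^bsub>?A Quot J\<^esub> ?q y" if "x \<in> carrier ?A" "y \<in> carrier ?A" for x y
    using ring_hom_mult[OF h that] .
  have qa: "?q (x \<oplus>\<^bsub>?A\<^esub> y) = ?q x \<oplus>\<^bsub>?A Quot J\<^esub> ?q y" if "x \<in> carrier ?A" "y \<in> carrier ?A" for x y
    using ring_hom_add[OF h that] .
  have q1: "?q \<one>\<^bsub>?A\<^esub> = \<one>\<^bsub>?A Quot J\<^esub>" by (rule ring_hom_one[OF h])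
  interpret R: ring "?A Quot J" by (rule J.quotient_is_ring)
  have q0: "?q \<zero>\<^bsub>?A\<^esub> = \<zero>\<^bsub>?A Quot J\<^esub>" by (rule ring_hom_zero[OF h J.ring_axioms R.ring_axioms])
  note sc = scalar_closed[OF V]
  have s1: "scalar Q 1 = \<one>\<^bsub>?A\<^esub>" by (auto simp: scalar_def path_algebra_simps)
  have sm: "scalar Q c \<otimes>\<^bsub>?A\<^esub> scalar Q d = scalar Q (c * d)" for c d
    unfolding scalar_mult[OF sc] by (auto simp: scalar_def)
  have sa: "scalar Q c \<oplus>\<^bsub>?A\<^esub> scalar Q d = scalar Q (c + d)" for c d
    by (auto simp: scalar_def path_algebra_simps)
  have pe: "path_elem p \<in> carrier ?A" if "is_path Q (fst p) (snd p)" for p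
    using that by (auto simp: path_algebra_simps path_elem_def split: if_splits)
  define B where "B = (\<lambda>p. ?q (path_elem p)) ` {(v, es). is_path Q v es}"
  show ?thesis
  proof (rule finite_dimensional_noetherian[of "\<lambda>c. ?q (scalar Q c)" _ B])
    show "?q (scalar Q c) \<in> carrier (?A Quot J)" for c by (rule qc[OF sc])
    show "?q (scalar Q c) \<otimes>\<^bsub>?A Quot J\<^esub> ?q (scalar Q d) = ?q (scalar Q (c * d))" for c d
      unfolding qm[OF sc sc, symmetric] sm ..
    show "?q (scalar Q c) \<oplus>\<^bsub>?A Quot J\<^esub> ?q (scalar Q d) = ?q (scalar Q (c + d))" for c d
      unfolding qa[OF sc sc, symmetric] sa ..
    show "?q (scalar Q 1) = \<one>\<^bsub>?A Quot J\<^esub>" unfolding s1 q1 ..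
    show "finite B" unfolding B_def using P by simp
    show "B \<subseteq> carrier (?A Quot J)" unfolding B_def using qc[OF pe] by auto
    fix S assume S0: "\<zero>\<^bsub>?A Quot J\<^esub> \<in> S"
      and Sa: "\<And>x y. x \<in> S \<Longrightarrow> y \<in> S \<Longrightarrow> x \<in> carrier (?A Quot J) \<Longrightarrow> y \<in> carrier (?A Quot J) \<Longrightarrow> x \<oplus>\<^bsub>?A Quot J\<^esub> y \<in> S"
      and Sm: "\<And>c x. x \<in> S \<Longrightarrow> x \<in> carrier (?A Quot J) \<Longrightarrow> ?q (scalar Q c) \<otimes>\<^bsub>?A Quot J\<^esub> x \<in> S"
      and SB: "B \<subseteq> S"
    have main: "?q x \<in> S" if "finite X" "x \<in> carrier ?A" "{p. x p \<noteq> 0} \<subseteq> X" for X x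
      using that
    proof (induction X arbitrary: x rule: finite_induct)
      case empty
      then have "x = \<zero>\<^bsub>?A\<^esub>" by (auto simp: path_algebra_simps)
      then show ?case using q0 S0 by simp
    next
      case (insert p X)
      show ?case
      proof (cases "x p = 0")
        case True
        then show ?thesis using insert by auto
      next
        case False
        obtain v es where p: "p = (v, es)" by (cases p)
        have ip: "is_path Q v es" using False insert.prems(1) p by (auto simp: path_algebra_simps)
        have pc: "path_elem p \<in> carrier ?A" using pe ip p by simp
        define y where "y = x(p := 0)"
        have "{p. y p \<noteq> 0} \<subseteq> {p. x p \<noteq> 0}" by (auto simp: y_def)
        then have yc: "y \<in> carrier ?A"
          using insert.prems(1) finite_subset[of "{p. y p \<noteq> 0}" "{p. x p \<noteq> 0}"]
          by (auto simp: path_algebra_simps y_def split: if_splits)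
        have yS: "?q y \<in> S" using insert.prems(2) by (intro insert.IH yc) (auto simp: y_def)
        have "x = y \<oplus>\<^bsub>?A\<^esub> (scalar Q (x p) \<otimes>\<^bsub>?A\<^esub> path_elem p)"
          unfolding scalar_mult[OF pc] by (auto simp: path_algebra_simps y_def path_elem_def fun_eq_iff)
        then have "?q x = ?q y \<oplus>\<^bsub>?A Quot J\<^esub> (?q (scalar Q (x p)) \<otimes>\<^bsub>?A Quot J\<^esub> ?q (path_elem p))"
          using qa[OF yc J.m_closed[OF sc pc]] qm[OF sc pc] by metis
        moreover have "?q (path_elem p) \<in> S" using SB ip p by (auto simp: B_def)
        ultimately show ?thesis using Sa[OF yS Sm _ R.m_closed[OF qc[OF sc] qc[OF pc]]] qc[OF pc] qc[OF yc] by simp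
      qed
    qed
    show "carrier (?A Quot J) \<subseteq> S"
    proof
      fix r assume "r \<in> carrier (?A Quot J)"
      then obtain x where x: "x \<in> carrier ?A" "r = ?q x" by (auto simp: FactRing_def A_RCOSETS_def')
      then show "r \<in> S" using main[of "{p. x p \<noteq> 0}" x] by (simp add: path_algebra_simps)
    qed
  qed
qed

lemma linear_quiver_path:
  "is_path (linear_quiver n) v es \<Longrightarrow> v + length es \<le> n \<and> set es \<subseteq> {..n}"
proof (induction es arbitrary: v)
  case (Cons e es)
  then have "e = v" "v \<le> n" "is_path (linear_quiver n) (Suc e) es" by (auto simp: linear_quiver_def)
  then show ?case using Cons.IH[of "Suc e"] by simp
qed (simp add: linear_quiver_def)

lemma linear_quiver_finite_paths: "finite {(v, es). is_path (linear_quiver n) v es}"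
proof (rule finite_subset)
  show "{(v, es). is_path (linear_quiver n) v es} \<subseteq> {..n} \<times> {es. set es \<subseteq> {..n} \<and> length es \<le> n}"
  proof
    fix p assume "p \<in> {(v, es). is_path (linear_quiver n) v es}"
    then obtain v es where p: "p = (v, es)" "is_path (linear_quiver n) v es" by blast
    show "p \<in> {..n} \<times> {es. set es \<subseteq> {..n} \<and> length es \<le> n}"
      using linear_quiver_path[OF p(2)] by (simp add: p(1))
  qed
qed (simp add: finite_lists_length_le)

theorem nakayama_abelian:
  fixes \<Lambda> :: "((nat, nat) path \<Rightarrow> 'k::field) set ring"
  assumes "nakayama_algebra \<Lambda>" shows "abelian_category (mod_cat \<Lambda>)"
proof -
  obtain n J where n: "admissible_ideal (linear_quiver n) J" "\<Lambda> = path_algebra (linear_quiver n) Quot J"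
    using assms unfolding nakayama_algebra_def by blast
  have J: "ideal J (path_algebra (linear_quiver n))" using n(1) by (simp add: admissible_ideal_def)
  have ne: "({} :: ((nat, nat) path \<Rightarrow> 'k) set) \<noteq> UNIV" by simp
  show ?thesis unfolding n(2)
    by (rule mod_cat_abelian[OF ideal.quotient_is_ring[OF J] path_algebra_quotient_noetherian[OF J _ linear_quiver_finite_paths] ne])
      (simp add: linear_quiver_def)
qed

theorem lemma3p11:
  fixes \<Lambda> :: "((nat, nat) path \<Rightarrow> 'k::field) set ring"
    and n m :: nat
  assumes "nakayama_algebra \<Lambda>"
    and "n \<ge> 1" and "m \<ge> 1"
    and "indecomposable (Db (mod_cat \<Lambda>)) X"
    and "\<exists>Y. (ar_translate (Db (mod_cat \<Lambda>)) ^^ n) X Y \<and>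
           isomorphic (Db (mod_cat \<Lambda>)) Y ((ShObj (Db (mod_cat \<Lambda>)) ^^ m) X)"
  shows "\<not> piecewise_hereditary TYPE('o) TYPE('m) \<Lambda>"
proof
  assume "piecewise_hereditary TYPE('o) TYPE('m) \<Lambda>"
  then obtain H :: "('o, 'm) cat" and Fo Fm where H: "abelian_category H" "hereditary H"
      "triangle_equivalence (Db (mod_cat \<Lambda>)) (Db H) Fo Fm"
    unfolding piecewise_hereditary_def triangle_equivalent_def by blast
  obtain Y where Y: "(ar_translate (Db (mod_cat \<Lambda>)) ^^ n) X Y"
      "isomorphic (Db (mod_cat \<Lambda>)) Y ((ShObj (Db (mod_cat \<Lambda>)) ^^ m) X)"
    using assms(5) by blast
  show False by (rule no_periodic_object[OF nakayama_abelian[OF assms(1)] H assms(4) Y assms(3)])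
qed

end
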